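(* For each $\lambda\in(0,1)$, consider a $\lambda$-FFP $(\eta^\lambda_t)_{t\ge0}$, and let $C^\lambda_t(0)$ denote the occupied cluster of the site $0$ at time $t$. (i) There are constants $0<c<C$ such that for all $t\ge5/2$ and all $0\le a<b<1$, the limit below exists and $$c(b-a)\le\lim_{\lambda\to0}\mathbb{P}\big(\#(C^\lambda_{t\log(1/\lambda)}(0))\in[\lambda^{-a},\lambda^{-b}]\big)\le C(b-a).$$ (ii) There are constants $0<c<C$ and $0<\kappa_1<\kappa_2$ such that for all $t\ge3/2$ and all $B>0$, the limit below exists and $$c\,e^{-\kappa_2B}\le\lim_{\lambda\to0}\mathbb{P}\big(\#(C^\lambda_{t\log(1/\lambda)}(0))\ge B/(\lambda\log(1/\lambda))\big)\le C\,e^{-\kappa_1B}.$$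
   Context: $\#(I)$ is the number of elements of a set $I$; $[\![a,b]\!]=\{a,\ldots,b\}\subset\mathbb{Z}$ for integers $a\le b$. $\lambda$-FFP (forest fire process). Let $N=(N_t(i))_{t\ge0,i\in\mathbb{Z}}$ and $M^\lambda=(M^\lambda_t(i))_{t\ge0,i\in\mathbb{Z}}$ be two independent families of independent Poisson processes with respective rates $1$ and $\lambda>0$, and $\mathcal{F}^{N,M^\lambda}_t=\sigma(N_s(i),M^\lambda_s(i),s\le t,i\in\mathbb{Z})$. The $\lambda$-FFP is the (a.s. unique) $(\mathcal{F}^{N,M^\lambda}_t)$-adapted $\{0,1\}^{\mathbb{Z}}$-valued process $(\eta^\lambda_t)_{t\ge0}$ such that each $t\mapsto\eta^\lambda_t(i)$ is a.s. càdlàg and a.s., for all $t\ge0$, $i\in\mathbb{Z}$, $$\eta^\lambda_t(i)=\int_0^t\mathbf{1}_{\{\eta^\lambda_{s-}(i)=0\}}\,dN_s(i)-\sum_{k\in\mathbb{Z}}\int_0^t\mathbf{1}_{\{k\in C^\lambda_{s-}(i)\}}\,dM^\lambda_s(k),$$ where $C^\lambda_s(i)=\varnothing$ if $\eta^\lambda_s(i)=0$, and $C^\lambda_s(i)=[\![l^\lambda_s(i),r^\lambda_s(i)]\!]$ if $\eta^\lambda_s(i)=1$, with $l^\lambda_s(i)=\sup\{k<i:\eta^\lambda_s(k)=0\}+1$ and $r^\lambda_s(i)=\inf\{k>i:\eta^\lambda_s(k)=0\}-1$. *)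

theory Defs
  imports "HOL-Probability.Probability"
begin

section \<open>Poisson processes\<close>

text \<open>Processes are functions of a real time; only times \<open>t \<ge> 0\<close> are ever constrained or used.\<close>

definition cadlag :: "(real \<Rightarrow> 'b::t2_space) \<Rightarrow> bool" where
  "cadlag f \<longleftrightarrow> (\<forall>t\<ge>0. continuous (at_right t) f) \<and> (\<forall>t>0. \<exists>l. (f \<longlongrightarrow> l) (at_left t))"

text \<open>Since the paths are almost surely nondecreasing, the truncated subtraction of natural
  numbers below is almost surely the true increment.\<close>

definition poisson_process :: "'a measure \<Rightarrow> real \<Rightarrow> (real \<Rightarrow> 'a \<Rightarrow> nat) \<Rightarrow> bool" where
  "poisson_process P rate X \<longleftrightarrow>
     prob_space P \<and> 0 < rate \<and>
     (\<forall>t\<ge>0. X t \<in> P \<rightarrow>\<^sub>M count_space UNIV) \<and>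
     (AE \<omega> in P. X 0 \<omega> = 0) \<and>
     (AE \<omega> in P. cadlag (\<lambda>t. X t \<omega>) \<and> mono_on {0..} (\<lambda>t. X t \<omega>)) \<and>
     (\<forall>s t. 0 \<le> s \<and> s < t \<longrightarrow>
        distr P (count_space UNIV) (\<lambda>\<omega>. X t \<omega> - X s \<omega>)
          = measure_pmf (poisson_pmf (rate * (t - s)))) \<and>
     (\<forall>(n::nat) u. 0 \<le> u 0 \<and> mono u \<longrightarrow>
        prob_space.indep_vars P (\<lambda>_. count_space UNIV)
          (\<lambda>k \<omega>. X (u (Suc k)) \<omega> - X (u k) \<omega>) {..<n})"

definition indep_poisson_family :: "'a measure \<Rightarrow> real \<Rightarrow> (real \<Rightarrow> int \<Rightarrow> 'a \<Rightarrow> nat) \<Rightarrow> bool" where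
  "indep_poisson_family P rate X \<longleftrightarrow>
     (\<forall>i. poisson_process P rate (\<lambda>t. X t i)) \<and>
     prob_space.indep_vars P (\<lambda>_. PiM {0..} (\<lambda>_. count_space UNIV))
       (\<lambda>i \<omega>. \<lambda>t\<in>{0..}. X t i \<omega>) UNIV"

definition indep_families ::
    "'a measure \<Rightarrow> (real \<Rightarrow> int \<Rightarrow> 'a \<Rightarrow> nat) \<Rightarrow> (real \<Rightarrow> int \<Rightarrow> 'a \<Rightarrow> nat) \<Rightarrow> bool" where
  "indep_families P X Y \<longleftrightarrow>
     prob_space.indep_var P
       (PiM ({0..} \<times> UNIV) (\<lambda>_. count_space UNIV)) (\<lambda>\<omega>. \<lambda>(t, i)\<in>{0..} \<times> UNIV. X t i \<omega>)
       (PiM ({0..} \<times> UNIV) (\<lambda>_. count_space UNIV)) (\<lambda>\<omega>. \<lambda>(t, i)\<in>{0..} \<times> UNIV. Y t i \<omega>)"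

definition generated_filtration ::
    "'a measure \<Rightarrow> (real \<Rightarrow> int \<Rightarrow> 'a \<Rightarrow> nat) \<Rightarrow> (real \<Rightarrow> int \<Rightarrow> 'a \<Rightarrow> nat) \<Rightarrow> real \<Rightarrow> 'a measure" where
  "generated_filtration P X Y t = sigma (space P)
     ({X s i -` A \<inter> space P | s i A. 0 \<le> s \<and> s \<le> t} \<union>
      {Y s i -` A \<inter> space P | s i A. 0 \<le> s \<and> s \<le> t})"


section \<open>Occupied clusters\<close>

text \<open>The endpoints live in the extended reals, so that they are infinite when there is no vacant
  site on the corresponding side.\<close>

definition cluster_left :: "(int \<Rightarrow> nat) \<Rightarrow> int \<Rightarrow> ereal" where
  "cluster_left e i = (SUP k\<in>{k. k < i \<and> e k = 0}. ereal (real_of_int k)) + 1"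

definition cluster_right :: "(int \<Rightarrow> nat) \<Rightarrow> int \<Rightarrow> ereal" where
  "cluster_right e i = (INF k\<in>{k. i < k \<and> e k = 0}. ereal (real_of_int k)) - 1"

definition cluster :: "(int \<Rightarrow> nat) \<Rightarrow> int \<Rightarrow> int set" where
  "cluster e i = (if e i = 0 then {}
     else {k. cluster_left e i \<le> ereal (real_of_int k) \<and> ereal (real_of_int k) \<le> cluster_right e i})"

text \<open>Counting measure rather than \<^const>\<open>card\<close>: an infinite set has infinitely many elements.\<close>

definition numel :: "'b set \<Rightarrow> ennreal" where
  "numel A = emeasure (count_space UNIV) A"


section \<open>The forest fire process\<close>

definition left_limit :: "(real \<Rightarrow> int \<Rightarrow> nat) \<Rightarrow> real \<Rightarrow> int \<Rightarrow> nat" where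
  "left_limit e s i = Lim (at_left s) (\<lambda>u. e u i)"

text \<open>The pathwise Stieltjes integral of the indicator of \<open>Q\<close> over \<open>(0, t]\<close> against the counting
  path \<open>F\<close>, which is extended by its value at 0 to negative times.\<close>

definition path_integral :: "(real \<Rightarrow> bool) \<Rightarrow> (real \<Rightarrow> nat) \<Rightarrow> real \<Rightarrow> real" where
  "path_integral Q F t =
     (LINT s:{0<..t}|interval_measure (\<lambda>s. real (F (max 0 s))). indicator {s. Q s} s)"

text \<open>The series is explicitly required to converge, because \<^const>\<open>infsum\<close> is 0 otherwise.\<close>

definition ffp_equation ::
    "(real \<Rightarrow> int \<Rightarrow> nat) \<Rightarrow> (real \<Rightarrow> int \<Rightarrow> nat) \<Rightarrow> (real \<Rightarrow> int \<Rightarrow> nat) \<Rightarrow> bool" where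
  "ffp_equation n m e \<longleftrightarrow> (\<forall>t\<ge>0. \<forall>i.
     (\<lambda>k. path_integral (\<lambda>s. k \<in> cluster (left_limit e s) i) (\<lambda>s. m s k) t) summable_on UNIV \<and>
     real (e t i) = path_integral (\<lambda>s. left_limit e s i = 0) (\<lambda>s. n s i) t
       - (\<Sum>\<^sub>\<infinity>k. path_integral (\<lambda>s. k \<in> cluster (left_limit e s) i) (\<lambda>s. m s k) t))"

definition forest_fire_process ::
    "real \<Rightarrow> 'a measure \<Rightarrow> (real \<Rightarrow> int \<Rightarrow> 'a \<Rightarrow> nat) \<Rightarrow> (real \<Rightarrow> int \<Rightarrow> 'a \<Rightarrow> nat)
      \<Rightarrow> (real \<Rightarrow> int \<Rightarrow> 'a \<Rightarrow> nat) \<Rightarrow> bool" where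
  "forest_fire_process lam P N M \<eta> \<longleftrightarrow>
     prob_space P \<and>
     indep_poisson_family P 1 N \<and> indep_poisson_family P lam M \<and> indep_families P N M \<and>
     (\<forall>t\<ge>0. \<forall>i. \<forall>\<omega>\<in>space P. \<eta> t i \<omega> \<in> {0, 1}) \<and>
     (\<forall>t\<ge>0. \<forall>i. \<eta> t i \<in> generated_filtration P N M t \<rightarrow>\<^sub>M count_space UNIV) \<and>
     (\<forall>i. AE \<omega> in P. cadlag (\<lambda>t. \<eta> t i \<omega>)) \<and>
     (AE \<omega> in P. ffp_equation (\<lambda>t i. N t i \<omega>) (\<lambda>t i. M t i \<omega>) (\<lambda>t i. \<eta> t i \<omega>))"

end

theory Submission
  imports Defs "HOL-Real_Asymp.Real_Asymp"
begin

text \<open>In units of \<open>ln (1/\<lambda>)\<close>, divide time into rows of length \<open>1/N\<close>, and divide space into columns of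
  \<open>1/(N \<lambda> ln (1/\<lambda>))\<close> sites. As \<open>\<lambda> \<rightarrow> 0\<close>, the cells in which a fire starts become independent, each
  with probability \<open>1 - exp (- 1/N\<^sup>2)\<close>. A region that burnt \<open>z < 1\<close> ago consists of clusters of size
  about \<open>\<lambda>\<close> to the power \<open>- z\<close>, which are microscopic; after time 1 it is filled. A fire in a
  microscopic cluster of age \<open>z\<close> only makes a hole that blocks other fires for a time about \<open>z\<close>.
  So, unless there are near ties between rows or columns of fires, the marked cells determine by
  recursion which gaps between fires each fire burns. Both events then agree, up to a probability
  that vanishes with the grid, with events of the marked cells, whose probabilities converge; hence
  the probabilities of the events are Cauchy as \<open>\<lambda> \<rightarrow> 0\<close>. The recursion is localized by chains of
  fires whose shielding periods cover all rows, and explicit chains around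
  the origin also give the lower bounds. The cluster is large only if one side of the origin has
  seen no recent fire, and of intermediate size only if a fire in the right rows has no shielding
  fire between itself and the origin; this gives the upper bounds.\<close>

section \<open>Paths of the forest fire process\<close>

text \<open>The grid stays fixed while \<lambda> tends to 0 and is refined only afterwards. With
  finitely many cells the joint law of the marks converges by a finite computation, and no limiting
  continuum process has to be constructed. The price is that times and places are known only up to a
  cell, so each comparison in the recursion must hold with room to spare; this is the origin of
  constants such as 8 rows or 3 columns. The second obstacle is that a fire may arrive from
  arbitrarily far away. It is stopped because every fire leaves a vacancy close by for almost half a
  time unit, whatever it burns. If it hits a cluster of age z, its own hole lasts for a time z; if
  the cluster is small because the place burnt a time z before, vacancies of that earlier burning
  survive for a time 1 - z after the fire. The larger of the two is at least 1/2. Hence a time unit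
  has an even number of rows, and it is cut into eighths where chains of fires relay the shielding:
  a link every quarter unit, located up to an eighth, stays well inside its half unit.\<close>

definition jump :: "(real \<Rightarrow> nat) \<Rightarrow> real \<Rightarrow> bool" where
  "jump f s \<longleftrightarrow> 0 < s \<and> (\<forall>u. 0 \<le> u \<and> u < s \<longrightarrow> f u < f s)"

text \<open>Connectivity replaces the extended-real endpoints of a cluster: it is symmetric, can be
  cut and concatenated, and treats infinite clusters without a case distinction.\<close>

definition conn :: "(int \<Rightarrow> nat) \<Rightarrow> int \<Rightarrow> int \<Rightarrow> bool" where
  "conn E x y \<longleftrightarrow> (\<forall>z. min x y \<le> z \<and> z \<le> max x y \<longrightarrow> E z \<noteq> 0)"

lemma conn_sym: "conn E x y \<longleftrightarrow> conn E y x"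
  unfolding conn_def by (simp add: min.commute max.commute)

lemma mem_cluster_iff: "k \<in> cluster E i \<longleftrightarrow> conn E i k"
proof (cases "E i = 0")
  case True
  then show ?thesis
    by (auto simp: cluster_def conn_def intro!: exI[of _ i])
next
  case False
  have L: "cluster_left E i \<le> ereal (real_of_int k) \<longleftrightarrow> (\<forall>z. z < i \<and> E z = 0 \<longrightarrow> z < k)" for k
  proof -
    have "cluster_left E i \<le> ereal (real_of_int k) \<longleftrightarrow>
        (SUP z\<in>{z. z < i \<and> E z = 0}. ereal (real_of_int z)) \<le> ereal (real_of_int (k - 1))"
      unfolding cluster_left_def
      by (cases "(SUP z\<in>{z. z < i \<and> E z = 0}. ereal (real_of_int z))")
         (auto simp: one_ereal_def algebra_simps)
    also have "\<dots> \<longleftrightarrow> (\<forall>z. z < i \<and> E z = 0 \<longrightarrow> z \<le> k - 1)"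
      by (auto simp: SUP_le_iff)
    finally show ?thesis by (auto; force)
  qed
  have R: "ereal (real_of_int k) \<le> cluster_right E i \<longleftrightarrow> (\<forall>z. i < z \<and> E z = 0 \<longrightarrow> k < z)" for k
  proof -
    have "ereal (real_of_int k) \<le> cluster_right E i \<longleftrightarrow>
        ereal (real_of_int (k + 1)) \<le> (INF z\<in>{z. i < z \<and> E z = 0}. ereal (real_of_int z))"
      unfolding cluster_right_def
      by (cases "(INF z\<in>{z. i < z \<and> E z = 0}. ereal (real_of_int z))")
         (auto simp: one_ereal_def algebra_simps)
    also have "\<dots> \<longleftrightarrow> (\<forall>z. i < z \<and> E z = 0 \<longrightarrow> k + 1 \<le> z)"
      by (auto simp: le_INF_iff)
    finally show ?thesis by (auto; force)
  qed
  show ?thesis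
  proof
    assume "k \<in> cluster E i"
    then have "\<forall>z. z < i \<and> E z = 0 \<longrightarrow> z < k" "\<forall>z. i < z \<and> E z = 0 \<longrightarrow> k < z"
      using False L R by (auto simp: cluster_def)
    then show "conn E i k"
      unfolding conn_def using False by (smt (verit))
  next
    assume *: "conn E i k"
    have "\<forall>z. z < i \<and> E z = 0 \<longrightarrow> z < k" "\<forall>z. i < z \<and> E z = 0 \<longrightarrow> k < z"
      using * unfolding conn_def by (smt (verit))+
    then show "k \<in> cluster E i"
      using False L R by (auto simp: cluster_def)
  qed
qed

text \<open>The pathwise consequences of the equation through which the geometry sees the process. A
  fire acts at its jump time on the cluster seen just before, so a state and its left limit have to
  be kept apart.\<close>

locale ffp_dynamics =
  fixes n m e :: "real \<Rightarrow> int \<Rightarrow> nat"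
  assumes vacant_init: "e 0 i = 0"
    and vacant_persists: "0 \<le> s \<Longrightarrow> s \<le> u \<Longrightarrow> e s i = 0 \<Longrightarrow> n s i = n u i \<Longrightarrow> e u i = 0"
    and occupied_after: "0 \<le> s \<Longrightarrow> s < u \<Longrightarrow> n s i < n u i \<Longrightarrow>
      (\<And>w k. s < w \<Longrightarrow> w \<le> u \<Longrightarrow> jump (\<lambda>t. m t k) w \<Longrightarrow> \<not> conn (left_limit e w) i k) \<Longrightarrow> e u i \<noteq> 0"
    and burn: "jump (\<lambda>t. m t k) s \<Longrightarrow> conn (left_limit e s) k y \<Longrightarrow> e s y = 0"
    and left_nbhd: "0 < s \<Longrightarrow> \<exists>u. 0 \<le> u \<and> u < s \<and> (\<forall>w. u \<le> w \<and> w < s \<longrightarrow> e w i = left_limit e s i)"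
    and n_mono: "0 \<le> s \<Longrightarrow> s \<le> u \<Longrightarrow> n s i \<le> n u i"

section \<open>Counting paths and their Stieltjes integrals\<close>

lemma cadlag_right:
  fixes f :: "real \<Rightarrow> nat"
  assumes "cadlag f" "0 \<le> t"
  shows "\<exists>d>0. \<forall>s. t \<le> s \<and> s < t + d \<longrightarrow> f s = f t"
proof -
  have "(f \<longlongrightarrow> f t) (at_right t)"
    using assms by (auto simp: cadlag_def continuous_within)
  then have "eventually (\<lambda>s. f s = f t) (at_right t)"
    by (simp add: tendsto_discrete)
  then obtain b where b: "b > t" "\<And>y. t < y \<Longrightarrow> y < b \<Longrightarrow> f y = f t"
    unfolding eventually_at_right_field by auto
  show ?thesis
    by (rule exI[of _ "b - t"]) (use b in \<open>auto simp: le_less\<close>)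
qed

text \<open>The naturals are discrete, so a left limit is attained on a whole interval before
  \<open>t\<close>; this turns left limits into statements about actual earlier times.\<close>

lemma cadlag_left:
  fixes f :: "real \<Rightarrow> nat"
  assumes "cadlag f" "0 < t"
  shows "\<exists>u. 0 \<le> u \<and> u < t \<and> (\<forall>w. u \<le> w \<and> w < t \<longrightarrow> f w = Lim (at_left t) f)"
proof -
  obtain l where l: "(f \<longlongrightarrow> l) (at_left t)"
    using assms by (auto simp: cadlag_def)
  have "eventually (\<lambda>s. f s = l) (at_left t)"
    using l by (simp add: tendsto_discrete)
  then obtain b where b: "b < t" "\<And>y. b < y \<Longrightarrow> y < t \<Longrightarrow> f y = l"
    unfolding eventually_at_left_field by auto
  have "Lim (at_left t) f = l"
    by (rule tendsto_Lim[OF _ l]) simp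
  moreover obtain u where "max 0 b < u" "u < t"
    using b assms dense[of "max 0 b" t] by auto
  ultimately show ?thesis
    using b(2) by (intro exI[of _ u]) auto
qed

abbreviation jump_measure :: "(real \<Rightarrow> nat) \<Rightarrow> real measure" where
  "jump_measure f \<equiv> interval_measure (\<lambda>s. real (f (max 0 s)))"

locale counting_path =
  fixes f :: "real \<Rightarrow> nat"
  assumes cadlag: "cadlag f" and mono: "mono_on {0..} f"
begin

lemma mono_le: "0 \<le> s \<Longrightarrow> s \<le> u \<Longrightarrow> f s \<le> f u"
  using mono by (auto simp: mono_on_def)

lemma emeasure_Ioc: "0 \<le> s \<Longrightarrow> s \<le> u \<Longrightarrow> emeasure (jump_measure f) {s<..u} = ennreal (real (f u) - real (f s))"
  apply (subst emeasure_interval_measure_Ioc)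
proof -
  fix a :: real
  show "continuous (at_right a) (\<lambda>s. real (f (max 0 s)))"
  proof (cases "0 \<le> a")
    case True
    from cadlag_right[OF cadlag this] obtain d where d: "d > 0"
      "\<And>s. a \<le> s \<Longrightarrow> s < a + d \<Longrightarrow> f s = f a" by blast
    have "((\<lambda>s. real (f (max 0 s))) \<longlongrightarrow> real (f a)) (at_right a)"
    proof (rule tendsto_eventually)
      show "\<forall>\<^sub>F x in at_right a. real (f (max 0 x)) = real (f a)"
        unfolding eventually_at_right_field
      proof (intro exI[of _ "a + d"] conjI allI impI)
        fix y assume "a < y" "y < a + d"
        then show "real (f (max 0 y)) = real (f a)" using d(2)[of y] True by simp
      qed (use d in simp)
    qed
    then show ?thesis using True by (simp add: continuous_within)
  next
    case False
    have "((\<lambda>s. real (f (max 0 s))) \<longlongrightarrow> real (f 0)) (at_right a)"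
    proof (rule tendsto_eventually)
      show "\<forall>\<^sub>F x in at_right a. real (f (max 0 x)) = real (f 0)"
        unfolding eventually_at_right_field
        by (rule exI[of _ "0"]) (use False in auto)
    qed
    then show ?thesis using False by (simp add: continuous_within)
  qed
qed (auto simp: mono_le)

lemma measure_Ioc: "0 \<le> s \<Longrightarrow> s \<le> u \<Longrightarrow> measure (jump_measure f) {s<..u} = real (f u) - real (f s)"
  using emeasure_Ioc[of s u] mono_le[of s u] by (simp add: measure_def)

lemma finite_emeasure: "A \<in> sets borel \<Longrightarrow> A \<subseteq> {0<..u} \<Longrightarrow> emeasure (jump_measure f) A < \<infinity>"
proof -
  assume A: "A \<in> sets borel" "A \<subseteq> {0<..u}"
  show ?thesis
  proof (cases "0 \<le> u")
    case True
    have "emeasure (jump_measure f) A \<le> emeasure (jump_measure f) {0<..u}"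
      by (rule emeasure_mono) (use A in auto)
    also have "\<dots> < \<infinity>" using emeasure_Ioc[of 0 u] True by simp
    finally show ?thesis .
  next
    case False
    then have "A = {}" using A by auto
    then show ?thesis by simp
  qed
qed

text \<open>A time that is no jump lies in an interval with rational ends over which the path does
  not increase. There are countably many such intervals, and each is a null set.\<close>

lemma jump_null:
  assumes A: "A \<in> sets borel" "A \<subseteq> {s<..u}" "0 \<le> s" and nj: "\<And>w. w \<in> A \<Longrightarrow> \<not> jump f w"
  shows "measure (jump_measure f) A = 0"
proof -
  let ?I = "{(a, b). a \<in> \<rat> \<and> b \<in> \<rat> \<and> 0 \<le> a \<and> a \<le> b \<and> f a = f b}"
  have cnt: "countable ?I"
    by (rule countable_subset[of _ "\<rat> \<times> \<rat>"]) (auto simp: countable_rat)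
  have null: "(\<Union>p\<in>?I. {fst p<..snd p}) \<in> null_sets (jump_measure f)"
  proof (rule null_sets_UN'[OF cnt])
    fix p assume "p \<in> ?I"
    then show "{fst p<..snd p} \<in> null_sets (jump_measure f)"
      using emeasure_Ioc[of "fst p" "snd p"] by (auto simp: null_sets_def split: prod.splits)
  qed
  have "A \<subseteq> (\<Union>p\<in>?I. {fst p<..snd p})"
  proof
    fix w assume w: "w \<in> A"
    then have w0: "0 < w" using A(2,3) by auto
    obtain v where v: "0 \<le> v" "v < w" "\<not> f v < f w"
      using nj[OF w] w0 by (auto simp: jump_def)
    have fv: "f v = f w" using mono_le[of v w] v by auto
    obtain a where a: "a \<in> \<rat>" "v < a" "a < w" using Rats_dense_in_real[OF v(2)] by blast
    obtain d where d: "d > 0" "\<And>s. w \<le> s \<Longrightarrow> s < w + d \<Longrightarrow> f s = f w"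
      using cadlag_right[OF cadlag, of w] w0 by auto
    obtain b where b: "b \<in> \<rat>" "w < b" "b < w + d" using Rats_dense_in_real[of w "w + d"] d by auto
    have "f a = f w" using mono_le[of v a] mono_le[of a w] v a fv by auto
    moreover have "f b = f w" using d(2)[of b] b by auto
    ultimately have "(a, b) \<in> ?I" "w \<in> {fst (a, b)<..snd (a, b)}" using a b v by auto
    then show "w \<in> (\<Union>p\<in>?I. {fst p<..snd p})" by (rule UN_I)
  qed
  then have "A \<in> null_sets (jump_measure f)"
    using null_sets_subset[OF null] A(1) by simp
  then show ?thesis by (simp add: measure_def null_setsD1)
qed

lemma path_integral_eq:
  assumes "{s \<in> {0<..t}. Q s} \<in> sets borel"
  shows "path_integral Q f t = measure (jump_measure f) {s \<in> {0<..t}. Q s}"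
proof -
  have "path_integral Q f t = (LINT s|jump_measure f. indicator {s \<in> {0<..t}. Q s} s)"
    unfolding path_integral_def set_lebesgue_integral_def
    by (rule arg_cong[where f="integral\<^sup>L _"]) (auto simp: indicator_def)
  also have "\<dots> = measure (jump_measure f) {s \<in> {0<..t}. Q s}"
    using finite_emeasure[OF assms, of t] assms by (subst Bochner_Integration.integral_indicator) auto
  finally show ?thesis .
qed

lemma path_integral_diff:
  assumes "{s \<in> {0<..t}. Q s} \<in> sets borel" "{s \<in> {0<..u}. Q s} \<in> sets borel" "0 \<le> u" "u \<le> t"
  shows "path_integral Q f t - path_integral Q f u = measure (jump_measure f) {s \<in> {u<..t}. Q s}"
    "{s \<in> {u<..t}. Q s} \<in> sets borel"
proof -
  have eq: "{s \<in> {u<..t}. Q s} = {s \<in> {0<..t}. Q s} - {s \<in> {0<..u}. Q s}"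
    using assms by auto
  show b: "{s \<in> {u<..t}. Q s} \<in> sets borel"
    unfolding eq using assms by auto
  have "emeasure (jump_measure f) {s \<in> {0<..t}. Q s} < \<infinity>"
    by (rule finite_emeasure[OF assms(1)]) auto
  then have "measure (jump_measure f) ({s \<in> {0<..t}. Q s} - {s \<in> {0<..u}. Q s}) =
      measure (jump_measure f) {s \<in> {0<..t}. Q s} - measure (jump_measure f) {s \<in> {0<..u}. Q s}"
    using assms by (intro measure_Diff) auto
  then show "path_integral Q f t - path_integral Q f u = measure (jump_measure f) {s \<in> {u<..t}. Q s}"
    unfolding eq path_integral_eq[OF assms(1)] path_integral_eq[OF assms(2)] by simp
qed

lemma measure_mono_Ioc:
  assumes "A \<in> sets borel" "B \<in> sets borel" "A \<subseteq> B" "B \<subseteq> {s<..u}" "0 \<le> s"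
  shows "measure (jump_measure f) A \<le> measure (jump_measure f) B"
proof -
  have "B \<subseteq> {0<..u}" using assms(4,5) by force
  from finite_emeasure[OF assms(2) this] show ?thesis
    by (intro measure_mono_fmeasurable) (use assms in \<open>auto simp: fmeasurable_def\<close>)
qed

end

text \<open>The left limit at \<open>s\<close> is \<open>c\<close> exactly if the path equals
  \<open>c\<close> at all rationals of some (a, s) with \<open>a\<close> rational; for fixed
  \<open>a\<close> these \<open>s\<close> form the intersection of an open and a closed
  half-line.\<close>

lemma left_limit_borel:
  fixes f :: "real \<Rightarrow> nat"
  assumes "cadlag f"
  shows "{s \<in> {0<..t}. Lim (at_left s) f = c} \<in> sets borel"
proof -
  define W where "W a = {w \<in> \<rat>. a < w \<and> f w \<noteq> c}" for a :: real
  have cW: "countable (W a)" for a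
    by (rule countable_subset[OF _ countable_rat]) (auto simp: W_def)
  have "{s \<in> {0<..t}. Lim (at_left s) f = c} =
      {0<..t} \<inter> (\<Union>a\<in>\<rat> \<inter> {0..}. {s. a < s \<and> (\<forall>w\<in>W a. s \<le> w)})" (is "?L = ?R")
  proof (intro set_eqI iffI)
    fix s assume s: "s \<in> ?L"
    then obtain u where u: "0 \<le> u" "u < s" "\<forall>w. u \<le> w \<and> w < s \<longrightarrow> f w = Lim (at_left s) f"
      using cadlag_left[OF assms, of s] by auto
    obtain a where "a \<in> \<rat>" "u < a" "a < s" using Rats_dense_in_real[OF u(2)] by blast
    moreover have "s \<le> w" if "w \<in> W a" for w
      using that u s \<open>u < a\<close> by (auto simp: W_def) (metis less_eq_real_def less_trans not_le)
    ultimately show "s \<in> ?R" using s u by auto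
  next
    fix s assume s: "s \<in> ?R"
    then obtain a where a: "a \<in> \<rat>" "0 \<le> a" "a < s" "\<forall>w\<in>W a. s \<le> w" by auto
    obtain u where u: "0 \<le> u" "u < s" "\<forall>w. u \<le> w \<and> w < s \<longrightarrow> f w = Lim (at_left s) f"
      using cadlag_left[OF assms, of s] s by auto
    obtain w where "w \<in> \<rat>" "max a u < w" "w < s" using Rats_dense_in_real[of "max a u" s] a u by auto
    moreover have "w \<notin> W a" using a \<open>w < s\<close> by auto
    ultimately show "s \<in> ?L" using u s by (auto simp: W_def)
  qed
  moreover have "{s. a < s \<and> (\<forall>w\<in>W a. s \<le> w)} \<in> sets borel" for a
  proof -
    have "{s. a < s \<and> (\<forall>w\<in>W a. s \<le> w)} = {a<..} \<inter> (\<Inter>w\<in>W a. {..w})" by auto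
    moreover have "closed (\<Inter>w\<in>W a. {..w})" by (intro closed_INT) auto
    ultimately show ?thesis by auto
  qed
  moreover have "countable (\<rat> \<inter> {0::real..})" by (simp add: countable_rat)
  ultimately show ?thesis by (auto intro!: sets.countable_UN')
qed

text \<open>Only increments of the equation are used. Without burning jumps the occupation is
  nondecreasing and each seed on a vacant site counts; a burning jump contributes mass at least 1 to
  the series, which forces an occupation of at most 1 down to 0.\<close>

lemma ffp_dynamicsI:
  assumes n: "\<And>i. counting_path (\<lambda>t. n t i)" and m: "\<And>i. counting_path (\<lambda>t. m t i)"
    and e: "\<And>t i. 0 \<le> t \<Longrightarrow> e t i \<in> {0, 1}" and cad: "\<And>i. cadlag (\<lambda>t. e t i)"
    and eq: "ffp_equation n m e"
  shows "ffp_dynamics n m e"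
proof -
  define Q where "Q i = {s. left_limit e s i = 0}" for i
  define C where "C k i = {s. k \<in> cluster (left_limit e s) i}" for k i
  have left: "\<exists>u. 0 \<le> u \<and> u < s \<and> (\<forall>w. u \<le> w \<and> w < s \<longrightarrow> e w i = left_limit e s i)" if "0 < s" for s i
    unfolding left_limit_def using cadlag_left[OF cad that] by simp
  have Qb: "{s \<in> {0<..t}. left_limit e s i = 0} \<in> sets borel" for i t
    unfolding left_limit_def by (rule left_limit_borel[OF cad])
  have Cb: "{s \<in> {0<..t}. k \<in> cluster (left_limit e s) i} \<in> sets borel" for i k t
  proof -
    have "{s \<in> {0<..t}. k \<in> cluster (left_limit e s) i} =
       {0<..t} \<inter> (\<Inter>z\<in>{min i k..max i k}. {0<..t} - {s \<in> {0<..t}. left_limit e s z = 0})"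
      by (auto simp: mem_cluster_iff conn_def)
    also have "\<dots> \<in> sets borel"
      by (intro sets.Int sets.finite_INT sets.Diff Qb) auto
    finally show ?thesis .
  qed
  have nd: "path_integral (\<lambda>s. left_limit e s i = 0) (\<lambda>s. n s i) t - path_integral (\<lambda>s. left_limit e s i = 0) (\<lambda>s. n s i) u =
      measure (jump_measure (\<lambda>t. n t i)) {s \<in> {u<..t}. left_limit e s i = 0}"
    if "0 \<le> u" "u \<le> t" for i t u
    by (rule counting_path.path_integral_diff[OF n Qb Qb that])
  have md: "path_integral (\<lambda>s. k \<in> cluster (left_limit e s) i) (\<lambda>s. m s k) t - path_integral (\<lambda>s. k \<in> cluster (left_limit e s) i) (\<lambda>s. m s k) u =
      measure (jump_measure (\<lambda>t. m t k)) {s \<in> {u<..t}. k \<in> cluster (left_limit e s) i}"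
    if "0 \<le> u" "u \<le> t" for i t u k
    by (rule counting_path.path_integral_diff[OF m Cb Cb that])
  \<comment> \<open>The mass that the fire clock \<open>k\<close> removes at \<open>i\<close> during
    (u, t].\<close>
  define D where "D i u t k = measure (jump_measure (\<lambda>t. m t k)) {s \<in> {u<..t}. k \<in> cluster (left_limit e s) i}" for i u t k
  have incr: "real (e t i) - real (e u i) =
      measure (jump_measure (\<lambda>t. n t i)) {s \<in> {u<..t}. left_limit e s i = 0} - (\<Sum>\<^sub>\<infinity>k. D i u t k)"
    and Dsum: "D i u t summable_on UNIV"
    if ut: "0 \<le> u" "u \<le> t" for i t u
  proof -
    let ?p = "\<lambda>t k. path_integral (\<lambda>s. k \<in> cluster (left_limit e s) i) (\<lambda>s. m s k) t"
    have s1: "?p t summable_on UNIV" "?p u summable_on UNIV"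
      using eq ut by (auto simp: ffp_equation_def)
    have D: "D i u t = (\<lambda>k. ?p t k + - ?p u k)"
      using md[OF ut] by (auto simp: D_def)
    show "D i u t summable_on UNIV"
      unfolding D by (intro summable_on_add s1 summable_on_uminus[THEN iffD2])
    have "(\<Sum>\<^sub>\<infinity>k. D i u t k) = (\<Sum>\<^sub>\<infinity>k. ?p t k) - (\<Sum>\<^sub>\<infinity>k. ?p u k)"
      unfolding D using infsum_add[OF s1(1) summable_on_uminus[THEN iffD2, OF s1(2)]] by (simp add: infsum_uminus)
    moreover have "real (e t i) = path_integral (\<lambda>s. left_limit e s i = 0) (\<lambda>s. n s i) t - (\<Sum>\<^sub>\<infinity>k. ?p t k)"
      "real (e u i) = path_integral (\<lambda>s. left_limit e s i = 0) (\<lambda>s. n s i) u - (\<Sum>\<^sub>\<infinity>k. ?p u k)"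
      using eq ut by (auto simp: ffp_equation_def)
    ultimately show "real (e t i) - real (e u i) =
      measure (jump_measure (\<lambda>t. n t i)) {s \<in> {u<..t}. left_limit e s i = 0} - (\<Sum>\<^sub>\<infinity>k. D i u t k)"
      using nd[OF ut, of i] by simp
  qed
  have Dn: "0 \<le> D i u t k" for i u t k by (simp add: D_def)
  have D0: "0 \<le> (\<Sum>\<^sub>\<infinity>k. D i u t k)" for i u t
    by (intro infsum_nonneg Dn)
  have Dk: "D i u t k \<le> (\<Sum>\<^sub>\<infinity>k. D i u t k)" if "0 \<le> u" "u \<le> t" for i u t k
    using infsum_mono_neutral[of "D i u t" "{k}" "D i u t" UNIV] Dsum[OF that, of i] Dn by simp
  have Iocb: "{s \<in> {u<..t}. left_limit e s i = 0} \<in> sets borel" "{s \<in> {u<..t}. k \<in> cluster (left_limit e s) i} \<in> sets borel"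
     if "0 \<le> u" "u \<le> t" for i t u k
    using counting_path.path_integral_diff(2)[OF n Qb Qb that] counting_path.path_integral_diff(2)[OF m Cb Cb that] by auto
  show ?thesis
  proof
    fix i show "e 0 i = 0"
    proof -
      have "{s. 0 < s \<and> s \<le> 0 \<and> P s} = {}" for P :: "real \<Rightarrow> bool" by auto
      then have "path_integral q g 0 = 0" for q g
        by (simp add: path_integral_def set_lebesgue_integral_def)
      then show ?thesis using eq unfolding ffp_equation_def
        by (metis (no_types, lifting) infsum_0 diff_zero of_nat_eq_0_iff order_refl)
    qed
  next
    fix s u i assume su: "0 \<le> s" "s \<le> u" "e s i = 0" "n s i = n u i"
    have "measure (jump_measure (\<lambda>t. n t i)) {w \<in> {s<..u}. left_limit e w i = 0} \<le> measure (jump_measure (\<lambda>t. n t i)) {s<..u}"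
      by (rule counting_path.measure_mono_Ioc[OF n Iocb(1)[OF su(1,2)]]) (use su in auto)
    also have "\<dots> = 0" using counting_path.measure_Ioc[OF n su(1,2), of i] su by simp
    finally show "e u i = 0" using incr[OF su(1,2), of i] D0[of i s u] su by simp
  next
    fix s u i
    assume su: "0 \<le> s" "s < u" "n s i < n u i"
      and nb: "\<And>w k. s < w \<Longrightarrow> w \<le> u \<Longrightarrow> jump (\<lambda>t. m t k) w \<Longrightarrow> \<not> conn (left_limit e w) i k"
    have Dz: "D i a b k = 0" if "s \<le> a" "a \<le> b" "b \<le> u" for a b k
      unfolding D_def
      by (rule counting_path.jump_null[OF m, of _ a b])
         (use Iocb(2)[of a b] that su nb in \<open>force simp: mem_cluster_iff\<close>)+
    have mon: "e a i \<le> e b i" if "s \<le> a" "a \<le> b" "b \<le> u" for a b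
      using incr[of a b i] that su Dz[OF that]
        measure_nonneg[of "jump_measure (\<lambda>t. n t i)" "{w \<in> {a<..b}. left_limit e w i = 0}"]
      by (simp del: measure_nonneg)
    show "e u i \<noteq> 0"
    proof
      assume 0: "e u i = 0"
      \<comment> \<open>Occupation is nondecreasing here, so vacancy at the end means vacancy
        throughout, and then the seed in between would have been counted.\<close>
      have ll: "left_limit e w i = 0" if w: "s < w" "w \<le> u" for w
      proof -
        have "0 < w" using w su by simp
        from left[OF this, of i] obtain v where v: "0 \<le> v" "v < w" "\<forall>x. v \<le> x \<and> x < w \<longrightarrow> e x i = left_limit e w i" by blast
        have "e (max s v) i \<le> e u i" using mon[of "max s v" u] w v su by auto
        then show ?thesis using v(3)[rule_format, of "max s v"] v w 0 by auto
      qed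
      have "{w \<in> {s<..u}. left_limit e w i = 0} = {s<..u}" using ll by auto
      then have "real (e u i) - real (e s i) = real (n u i) - real (n s i)"
        using incr[of s u i] su Dz[of s u] counting_path.measure_Ioc[OF n, of s u i] by simp
      then show False using 0 su by simp
    qed
  next
    fix k s y assume j: "jump (\<lambda>t. m t k) s" and c: "conn (left_limit e s) k y"
    have s0: "0 < s" using j by (simp add: jump_def)
    have "\<forall>z\<in>{min k y..max k y}. \<exists>u. 0 \<le> u \<and> u < s \<and> (\<forall>w. u \<le> w \<and> w < s \<longrightarrow> e w z = left_limit e s z)"
      using left[OF s0] by blast
    then obtain U where U: "\<And>z. z \<in> {min k y..max k y} \<Longrightarrow> 0 \<le> U z \<and> U z < s \<and> (\<forall>w. U z \<le> w \<and> w < s \<longrightarrow> e w z = left_limit e s z)"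
      by metis
    \<comment> \<open>Only finitely many sites lie between \<open>k\<close> and \<open>y\<close>, so
      from a common time \<open>a\<close> before \<open>s\<close> they all keep their left
      limits.\<close>
    define a where "a = Max (U ` {min k y..max k y})"
    have fin: "finite (U ` {min k y..max k y})" "U ` {min k y..max k y} \<noteq> {}" by auto
    have as: "a < s" unfolding a_def using fin U by (subst Max_less_iff) auto
    have aU: "U z \<le> a" if "z \<in> {min k y..max k y}" for z
      unfolding a_def using fin that by (intro Max_ge) auto
    have a0: "0 \<le> a" using aU[of k] U[of k] by auto
    have const: "e w z = left_limit e s z" if "z \<in> {min k y..max k y}" "a \<le> w" "w < s" for w z
      using U[OF that(1)] aU[OF that(1)] that by auto
    have llw: "left_limit e w z = left_limit e s z" if z: "z \<in> {min k y..max k y}" and w: "a < w" "w \<le> s" for w z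
    proof -
      have "0 < w" using w a0 by simp
      from left[OF this, of z] obtain v where v: "0 \<le> v" "v < w" "\<forall>x. v \<le> x \<and> x < w \<longrightarrow> e x z = left_limit e w z" by blast
      have "e (max a v) z = left_limit e s z" using const[OF z, of "max a v"] w v by auto
      then show ?thesis using v(3)[rule_format, of "max a v"] v w by auto
    qed
    have occ: "left_limit e s z \<noteq> 0" if "z \<in> {min k y..max k y}" for z
      using c that by (auto simp: conn_def)
    have "conn (left_limit e w) y k" if "a < w" "w \<le> s" for w
      unfolding conn_def
    proof (intro allI impI)
      fix z assume "min y k \<le> z \<and> z \<le> max y k"
      then have z: "z \<in> {min k y..max k y}" by auto
      show "left_limit e w z \<noteq> 0" using llw[OF z that] occ[OF z] by simp
    qed
    then have "{w \<in> {a<..s}. k \<in> cluster (left_limit e w) y} = {a<..s}"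
      by (auto simp: mem_cluster_iff)
    then have "D y a s k = real (m s k) - real (m a k)"
      unfolding D_def using counting_path.measure_Ioc[OF m, of a s k] a0 as by simp
    moreover have "m a k < m s k" using j a0 as by (auto simp: jump_def)
    ultimately have "1 \<le> D y a s k" by simp
    then have "1 \<le> (\<Sum>\<^sub>\<infinity>k. D y a s k)" using Dk[of a s y k] a0 as by simp
    moreover have "{w \<in> {a<..s}. left_limit e w y = 0} = {}"
    proof -
      have "left_limit e w y \<noteq> 0" if "a < w" "w \<le> s" for w
        using llw[of y w] occ[of y] that by simp
      then show ?thesis by auto
    qed
    ultimately have "real (e s y) - real (e a y) \<le> -1"
      using incr[OF a0 less_imp_le[OF as], of y] by (simp only: measure_empty)
    moreover have "e a y \<le> 1" using e[of a y] a0 by auto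
    ultimately show "e s y = 0" by simp
  next
    fix s :: real and i assume "0 < s"
    then show "\<exists>u. 0 \<le> u \<and> u < s \<and> (\<forall>w. u \<le> w \<and> w < s \<longrightarrow> e w i = left_limit e s i)" by (rule left)
  next
    fix s u :: real and i assume "0 \<le> s" "s \<le> u"
    then show "n s i \<le> n u i" using counting_path.mono_le[OF n] by simp
  qed
qed

section \<open>Tracking the fires on a time grid\<close>

locale grid_events =
  fixes n :: "real \<Rightarrow> int \<Rightarrow> nat" and \<iota> :: real
begin

definition ev :: "int \<Rightarrow> nat \<Rightarrow> nat \<Rightarrow> bool" where
  "ev y p q \<longleftrightarrow> n (real p * \<iota>) y < n (real q * \<iota>) y"

text \<open>The reciprocal of the probability that a site receives no seed during \<open>q\<close>
  rows, hence the typical size of a cluster of age \<open>q\<close>.\<close>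

definition R :: "nat \<Rightarrow> real" where "R q = exp (real q * \<iota>)"

text \<open>Typical seeding around \<open>x\<close>. One row of slack on either side of the typical
  size makes the exceptional probabilities small: the age \<open>q - p\<close> gives full balls of
  radius \<open>R (q - p - 1)\<close> but leaves a hole in every slot of width
  \<open>R (q - p + 1)\<close>. Slots of many indices are offered because each row will use a slot
  of its own.\<close>

definition good :: "nat \<Rightarrow> int \<Rightarrow> bool" where
  "good H x \<longleftrightarrow> (\<forall>p q. p < q \<and> q \<le> H \<longrightarrow>
     (\<forall>y. of_int \<bar>y - x\<bar> \<le> R (q - p - 1) \<longrightarrow> ev y p q) \<and>
     (\<forall>i. \<bar>i\<bar> \<le> int H \<longrightarrow> (\<exists>y. of_int x + of_int i * R (q - p + 1) < of_int y \<and>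
        of_int y < of_int x + (of_int i + 1) * R (q - p + 1) \<and> \<not> ev y p q)))"

end

locale ffp_grid = ffp_dynamics n m e + grid_events n \<iota> for n m e :: "real \<Rightarrow> int \<Rightarrow> nat" and \<iota> :: real +
  fixes N hN :: nat
  assumes \<iota>_pos: "1 \<le> \<iota>" and N_eq: "N \<le> 2 * hN" "2 * hN \<le> N" and hN_ge: "20 \<le> hN"
begin

text \<open>The largest length treated as microscopic: one row short of \<open>R N\<close>, which
  becomes 1 / \<lambda>.\<close>

definition K :: real where "K = R (N - 1)"

definition burned :: "int \<Rightarrow> real \<Rightarrow> bool" where
  "burned y w \<longleftrightarrow> (\<exists>x. jump (\<lambda>t. m t x) w \<and> conn (left_limit e w) x y)"

lemma R_pos: "0 < R q" "1 \<le> R q"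
  using \<iota>_pos by (simp_all add: R_def)

lemma R_mono: "p \<le> q \<Longrightarrow> R p \<le> R q"
  using \<iota>_pos by (simp add: R_def)

lemma K_pos: "0 < K" "1 \<le> K"
  using R_pos by (simp_all add: K_def)

lemma left_limit_vacant:
  assumes "a < w" "\<And>u. a \<le> u \<Longrightarrow> u < w \<Longrightarrow> e u y = 0" "0 < w"
  shows "left_limit e w y = 0"
proof -
  from left_nbhd[OF assms(3), of y] obtain u where u: "0 \<le> u" "u < w"
    "\<forall>v. u \<le> v \<and> v < w \<longrightarrow> e v y = left_limit e w y" by blast
  then show ?thesis using assms(2)[of "max a u"] assms(1) u(3)[rule_format, of "max a u"] by auto
qed

lemma stays_vacant:
  assumes "e s y = 0" "\<not> ev y p q" "real p * \<iota> \<le> s" "s \<le> u" "u \<le> real q * \<iota>"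
  shows "e u y = 0"
proof -
  have 0: "0 \<le> real p * \<iota>" using \<iota>_pos by simp
  have "n (real p * \<iota>) y \<le> n s y" "n s y \<le> n u y" "n u y \<le> n (real q * \<iota>) y"
    using assms 0 by (auto intro!: n_mono)
  then have "n s y = n u y" using assms(2) by (simp add: ev_def)
  then show ?thesis using vacant_persists[of s u y] assms 0 by auto
qed

lemma burned_vacant: "burned y w \<Longrightarrow> e w y = 0"
  using burn by (auto simp: burned_def)

lemma occupied:
  assumes "ev y p q" "real q * \<iota> \<le> u" "\<And>w. real p * \<iota> < w \<Longrightarrow> w \<le> u \<Longrightarrow> \<not> burned y w" "p < q"
  shows "e u y \<noteq> 0"
proof (rule occupied_after[of "real p * \<iota>" u y])
  have pq: "real p * \<iota> < real q * \<iota>" using \<iota>_pos assms(4) by simp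
  show "0 \<le> real p * \<iota>" using \<iota>_pos by simp
  show "real p * \<iota> < u" using pq assms(2) by simp
  have "n (real q * \<iota>) y \<le> n u y" using n_mono[of "real q * \<iota>" u y] assms(2) \<iota>_pos by simp
  then show "n (real p * \<iota>) y < n u y" using assms(1) by (simp add: ev_def)
  show "\<not> conn (left_limit e w) y k" if "real p * \<iota> < w" "w \<le> u" "jump (\<lambda>t. m t k) w" for w k
    using assms(3)[OF that(1,2)] that(3) by (auto simp: burned_def conn_sym)
qed

lemma left_occupied:
  assumes "ev y p q" "real q * \<iota> < w" "\<And>v. real p * \<iota> < v \<Longrightarrow> v < w \<Longrightarrow> \<not> burned y v" "p < q"
  shows "left_limit e w y \<noteq> 0"
proof -
  have w0: "0 < w" using assms(2) \<iota>_pos by (meson le_less_trans mult_nonneg_nonneg of_nat_0_le_iff order_trans zero_le_one)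
  from left_nbhd[OF this, of y] obtain u where u: "0 \<le> u" "u < w"
    "\<forall>v. u \<le> v \<and> v < w \<longrightarrow> e v y = left_limit e w y" by blast
  have "e (max u (real q * \<iota>)) y \<noteq> 0"
    by (rule occupied[OF assms(1)]) (use assms u in auto)
  then show ?thesis using u(3)[rule_format, of "max u (real q * \<iota>)"] assms(2) u by auto
qed

lemma conn_mem:
  assumes "conn E x y" "min x y \<le> z" "z \<le> max x y"
  shows "E z \<noteq> 0 \<and> conn E x z"
proof -
  have "min x y \<le> min x z" "max x z \<le> max x y" using assms by auto
  then show ?thesis using assms unfolding conn_def by (meson order_trans)
qed

lemma conn_trans: "conn E x y \<Longrightarrow> conn E y z \<Longrightarrow> conn E x z"
  unfolding conn_def by (smt (verit, best))

lemma burned_between: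
  assumes "jump (\<lambda>t. m t x) w" "conn (left_limit e w) x y" "min x y \<le> z" "z \<le> max x y"
  shows "burned z w"
  using assms conn_mem[OF assms(2-4)] by (auto simp: burned_def)

lemma good_ev: "good H x \<Longrightarrow> p < q \<Longrightarrow> q \<le> H \<Longrightarrow> of_int \<bar>y - x\<bar> \<le> R (q - p - 1) \<Longrightarrow> ev y p q"
  unfolding good_def by blast

lemma good_slot: "good H x \<Longrightarrow> p < q \<Longrightarrow> q \<le> H \<Longrightarrow> \<bar>i\<bar> \<le> int H \<Longrightarrow>
   \<exists>y. of_int x + of_int i * R (q - p + 1) < of_int y \<and>
        of_int y < of_int x + (of_int i + 1) * R (q - p + 1) \<and> \<not> ev y p q"
  unfolding good_def by blast

text \<open>All sites start vacant, so for the first \<open>N - 2\<close> rows an unseeded site in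
  each slot of width \<open>R (N - 1) = K\<close> acts like a vacancy left by a fire.\<close>

lemma early_vacancy:
  assumes "good H x" "\<bar>i\<bar> \<le> int H" "N \<le> H"
  shows "\<exists>z. of_int x + of_int i * K < of_int z \<and> of_int z < of_int x + (of_int i + 1) * K \<and>
    (\<forall>u. 0 \<le> u \<and> u \<le> real (N - 2) * \<iota> \<longrightarrow> e u z = 0)"
proof -
  have *: "N - 2 - 0 + 1 = N - 1" "0 < N - 2" "N - 2 \<le> H" using N_eq hN_ge assms(3) by auto
  obtain z where z: "of_int x + of_int i * K < of_int z"
     "of_int z < of_int x + (of_int i + 1) * K" "\<not> ev z 0 (N - 2)"
    using good_slot[OF assms(1) *(2,3) assms(2)] unfolding *(1) K_def[symmetric] by blast
  then show ?thesis using stays_vacant[OF vacant_init z(3)] by auto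
qed

text \<open>If the fire finds a large cluster, it leaves a hole that needs half a time unit to fill. Otherwise
  a vacancy next to the fire must have been left by a recent fire from far away, which has
  therefore burnt one whole side of the neighbourhood.\<close>

lemma separator:
  assumes j: "jump (\<lambda>t. m t x) w" and w: "real s * \<iota> < w" "w \<le> (real s + 1) * \<iota>"
    and iso: "\<And>x' w'. jump (\<lambda>t. m t x') w' \<Longrightarrow> of_int \<bar>x' - x\<bar> \<le> 2 * K \<Longrightarrow> w' \<le> (real s + 1) * \<iota> \<Longrightarrow> x' = x \<and> w' = w"
    and g: "good H x" and H: "s + 1 + N \<le> H"
  shows "\<exists>z. of_int \<bar>z - x\<bar> \<le> 2 * K \<and> (\<forall>u. w \<le> u \<and> u \<le> real (s + hN - 3) * \<iota> \<longrightarrow> e u z = 0)"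
proof (cases "\<forall>y. x \<le> y \<and> of_int y \<le> of_int x + R hN \<longrightarrow> left_limit e w y \<noteq> 0")
  case True
  have *: "s + hN - 1 - s + 1 = hN" "s < s + hN - 1" "s + hN - 1 \<le> H" using hN_ge H N_eq by auto
  from good_slot[OF g *(2,3), of 0] obtain z where z: "real_of_int x < real_of_int z"
      "of_int z < of_int x + R hN" "\<not> ev z s (s + hN - 1)"
    unfolding *(1) by auto
  have "conn (left_limit e w) x z" unfolding conn_def using True z by auto
  then have "e w z = 0" using j burn by auto
  then have "e u z = 0" if "w \<le> u" "u \<le> real (s + hN - 3) * \<iota>" for u
  proof (rule stays_vacant[OF _ z(3)])
    show "u \<le> real (s + hN - 1) * \<iota>"
      by (rule order_trans[OF that(2)], rule mult_right_mono) (use hN_ge \<iota>_pos in auto)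
  qed (use w that in auto)
  moreover have "R hN \<le> K" unfolding K_def by (rule R_mono) (use N_eq hN_ge in auto)
  ultimately show ?thesis using z K_pos by (intro exI[of _ z]) auto
next
  case False
  then obtain y where y: "x \<le> y" "of_int y \<le> of_int x + R hN" "left_limit e w y = 0" by auto
  have RK: "R hN \<le> K" unfolding K_def by (rule R_mono) (use N_eq hN_ge in auto)
  show ?thesis
  proof (cases "hN + 1 \<le> s")
    case s: True
    \<comment> \<open>From row \<open>p\<close> to row \<open>s\<close> the seeds fill the ball of
      radius \<open>R hN\<close>, so a site this close that is still vacant must have burnt after
      row \<open>p\<close>.\<close>
    define p where "p = s - hN - 1"
    have ps: "p < s" "s - p - 1 = hN" "s \<le> H" using s H hN_ge by (auto simp: p_def)
    have "ev y p s" by (rule good_ev[OF g ps(1,3)]) (use y ps in auto)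
    then obtain w' where w': "real p * \<iota> < w'" "w' < w" "burned y w'"
      using left_occupied[of y p s w] w y ps by auto
    then obtain x' where x': "jump (\<lambda>t. m t x') w'" "conn (left_limit e w') x' y" by (auto simp: burned_def)
    have far: "2 * K < of_int \<bar>x' - x\<bar>" using iso[OF x'(1)] w' w by force
    \<comment> \<open>Here \<open>2 * hN = N\<close> enters: a slot of width exactly
      \<open>K\<close> still has an unseeded site from row \<open>p\<close> up to row
      \<open>s + hN - 3\<close>.\<close>
    have q: "s + hN - 3 - p + 1 = N - 1" "p < s + hN - 3" "s + hN - 3 \<le> H"
      using s hN_ge N_eq H by (auto simp: p_def)
    \<comment> \<open>The slot between \<open>y\<close> and the distant source \<open>x'\<close>;
      the fire that came from \<open>x'\<close> to \<open>y\<close> burnt it.\<close>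
    define i :: int where "i = (if x < x' then 1 else -2)"
    have iH: "\<bar>i\<bar> \<le> int H" using H hN_ge N_eq by (simp add: i_def)
    obtain z where z: "of_int x + of_int i * K < of_int z"
      "of_int z < of_int x + (of_int i + 1) * K" "\<not> ev z p (s + hN - 3)"
      using good_slot[OF g q(2,3) iH] unfolding q(1) K_def[symmetric] by blast
    have "min x' y \<le> z \<and> z \<le> max x' y"
    proof (cases "x < x'")
      case True
      then have "real_of_int y < real_of_int z" "real_of_int z < real_of_int x'" using z y RK far by (auto simp: i_def)
      then show ?thesis by auto
    next
      case False
      then have "real_of_int z < real_of_int y" "real_of_int x' < real_of_int z" using z y K_pos far by (auto simp: i_def)
      then show ?thesis by auto
    qed
    then have "burned z w'" using burned_between[OF x'] by auto
    then have "e u z = 0" if "w \<le> u" "u \<le> real (s + hN - 3) * \<iota>" for u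
      using stays_vacant[OF burned_vacant z(3)] w' that by auto
    moreover have "of_int \<bar>z - x\<bar> \<le> 2 * K"
      using z K_pos by (auto simp: i_def split: if_splits)
    ultimately show ?thesis by blast
  next
    case s: False
    obtain z where z: "of_int x + of_int 0 * K < of_int z" "of_int z < of_int x + (of_int 0 + 1) * K"
      "\<forall>u. 0 \<le> u \<and> u \<le> real (N - 2) * \<iota> \<longrightarrow> e u z = 0"
      using early_vacancy[OF g, of 0] H by force
    have "real (s + hN - 3) * \<iota> \<le> real (N - 2) * \<iota>"
      by (rule mult_right_mono) (use s hN_ge N_eq \<iota>_pos in auto)
    moreover have "0 \<le> w" using j by (simp add: jump_def)
    ultimately show ?thesis using z K_pos by (intro exI[of _ z]) auto
  qed
qed

end

text \<open>The combinatorial dynamics: \<open>M + 1\<close> positions in spatial order, position \<open>k\<close> carrying a fire in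
  row \<open>S k\<close> of the time grid, except that position \<open>v\<close> is the observed site and \<open>S v\<close> the final row.
  Gap \<open>g\<close> lies between the positions \<open>g\<close> and \<open>g + 1\<close>, and \<open>b k g\<close> means that fire \<open>k\<close> burns gap \<open>g\<close>.
  The pair \<open>lf, rg\<close> bounds in each row the window that is shielded from the outside.\<close>

locale schedule =
  fixes N M v :: nat and S lf rg :: "nat \<Rightarrow> nat"
begin

definition active :: "nat \<Rightarrow> bool" where
  "active k \<longleftrightarrow> k \<le> M \<and> lf (S k) < k \<and> k < rg (S k)"

text \<open>The default 0 stands for the initial state, which acts like a fire at time 0 that burnt
  everything.\<close>

definition last_burn :: "(nat \<Rightarrow> nat \<Rightarrow> bool) \<Rightarrow> nat \<Rightarrow> nat \<Rightarrow> nat" where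
  "last_burn b s g = Max (insert 0 (S ` {l. active l \<and> l \<noteq> v \<and> S l < s \<and> b l g}))"

definition full :: "(nat \<Rightarrow> nat \<Rightarrow> bool) \<Rightarrow> nat \<Rightarrow> nat \<Rightarrow> bool" where
  "full b s g \<longleftrightarrow> last_burn b s g + N \<le> s"

text \<open>A fire at \<open>j\<close> in a place last burnt in row \<open>L\<close>, less than
  \<open>N\<close> rows before, burns only a cluster of age \<open>S j - L\<close>. The hole takes
  equally long to heal, so it blocks until row \<open>2 * S j - L\<close>.\<close>

definition passable :: "(nat \<Rightarrow> nat \<Rightarrow> bool) \<Rightarrow> nat \<Rightarrow> nat \<Rightarrow> bool" where
  "passable b s j \<longleftrightarrow> \<not> (S j < s \<and> S j < last_burn b (S j) j + N \<and> s + last_burn b (S j) j < 2 * S j)"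

text \<open>Fire \<open>k\<close> sits between the gaps \<open>k - 1\<close> and \<open>k\<close>.
  The two ranges are the gaps from the fire up to and including \<open>g\<close>, and the positions
  strictly between the fire and \<open>g\<close>, written so as to cover both directions at
  once.\<close>

definition reaches :: "(nat \<Rightarrow> nat \<Rightarrow> bool) \<Rightarrow> nat \<Rightarrow> nat \<Rightarrow> bool" where
  "reaches b k g \<longleftrightarrow> (\<forall>g'\<in>{min g k..max g (k - 1)}. full b (S k) g') \<and>
     (\<forall>j\<in>{min g k + 1..max g (k - 1)}. passable b (S k) j)"

definition burns :: "(nat \<Rightarrow> nat \<Rightarrow> bool) \<Rightarrow> bool" where
  "burns b \<longleftrightarrow> (\<forall>k g. active k \<and> lf (S k) \<le> g \<and> g < rg (S k) \<longrightarrow> (b k g \<longleftrightarrow> reaches b k g))"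

lemma finite_active: "finite {l. active l \<and> P l}"
  by (rule finite_subset[of _ "{..M}"]) (auto simp: active_def)

lemma last_burn_ge: "active l \<Longrightarrow> l \<noteq> v \<Longrightarrow> S l < s \<Longrightarrow> b l g \<Longrightarrow> S l \<le> last_burn b s g"
  unfolding last_burn_def by (rule Max_ge) (auto intro!: finite_imageI finite_active)

lemma last_burn_cases: "last_burn b s g = 0 \<or> (\<exists>l. active l \<and> l \<noteq> v \<and> S l < s \<and> b l g \<and> last_burn b s g = S l)"
proof -
  have "last_burn b s g \<in> insert 0 (S ` {l. active l \<and> l \<noteq> v \<and> S l < s \<and> b l g})"
    unfolding last_burn_def by (rule Max_in) (auto intro!: finite_imageI finite_active)
  then show ?thesis by auto
qed

lemma last_burn_cong:
  assumes "\<And>l. active l \<Longrightarrow> l \<noteq> v \<Longrightarrow> S l < s \<Longrightarrow> b l g = b' l g'"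
  shows "last_burn b s g = last_burn b' s g'"
proof -
  have "{l. active l \<and> l \<noteq> v \<and> S l < s \<and> b l g} = {l. active l \<and> l \<noteq> v \<and> S l < s \<and> b' l g'}"
    using assms by auto
  then show ?thesis by (simp add: last_burn_def)
qed

end


text \<open>Comparisons of rows decide comparisons of times only up to a bounded error; the last three
  assumptions exclude all near ties.\<close>

locale tie_free_schedule = schedule +
  fixes P :: nat
  assumes lf_mono: "s \<le> s' \<Longrightarrow> s' \<le> P \<Longrightarrow> lf s \<le> lf s'"
    and rg_mono: "s \<le> s' \<Longrightarrow> s' \<le> P \<Longrightarrow> rg s' \<le> rg s"
    and rg_le: "s \<le> P \<Longrightarrow> rg s \<le> M"
    and v_window: "v \<le> M" "lf P < v" "v < rg P"
    and S_v: "S v = P"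
    and S_le: "k \<le> M \<Longrightarrow> S k \<le> P"
    and S_inj: "j \<le> M \<Longrightarrow> k \<le> M \<Longrightarrow> S j = S k \<Longrightarrow> j = k"
    and tie_start: "L \<in> insert 0 (S ` {..M}) \<Longrightarrow> k \<le> M \<Longrightarrow> L < S k \<Longrightarrow> L + 8 \<le> S k"
    and tie_full: "L \<in> insert 0 (S ` {..M}) \<Longrightarrow> k \<le> M \<Longrightarrow> L < S k \<Longrightarrow> S k + 8 \<le> L + N \<or> L + N + 8 \<le> S k"
    and tie_passable: "L \<in> insert 0 (S ` {..M}) \<Longrightarrow> j \<le> M \<Longrightarrow> k \<le> M \<Longrightarrow> L < S j \<Longrightarrow> S j < S k \<Longrightarrow>
      S k + L + 8 \<le> 2 * S j \<or> 2 * S j + 8 \<le> S k + L"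
begin

lemma active_le: "active k \<Longrightarrow> k \<le> M" "active k \<Longrightarrow> S k \<le> P" "active k \<Longrightarrow> rg (S k) \<le> M"
    "active k \<Longrightarrow> lf (S k) < k \<and> k < rg (S k)"
  using S_le rg_le by (auto simp: active_def)

lemma active_v: "active v"
  using v_window by (simp add: active_def S_v)

lemma window_mono:
  "active k \<Longrightarrow> s \<le> S k \<Longrightarrow> lf s \<le> lf (S k) \<and> rg (S k) \<le> rg s"
  using lf_mono[of s "S k"] rg_mono[of s "S k"] active_le by auto

lemma active_inside:
  assumes "active k" "S j \<le> S k" "lf (S k) < j" "j < rg (S k)" shows "active j"
  using window_mono[OF assms(1,2)] assms active_le[OF assms(1)] by (auto simp: active_def)

lemma last_burn_mem: "last_burn b s g \<in> insert 0 (S ` {..M})"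
  using last_burn_cases[of b s g] active_le by auto

lemma last_burn_less: "active k \<Longrightarrow> last_burn b (S k) g < S k \<or> S k = 0"
  using last_burn_cases[of b "S k" g] by auto

lemma S_active_pos: "active k \<Longrightarrow> S k \<noteq> 0 \<Longrightarrow> last_burn b (S k) g + 8 \<le> S k"
  using last_burn_less[of k b g] tie_start[OF last_burn_mem] active_le by auto

lemma full_iff:
  "active k \<Longrightarrow> S k \<noteq> 0 \<Longrightarrow> (full b (S k) g \<and> last_burn b (S k) g + N + 8 \<le> S k) \<or>
    (\<not> full b (S k) g \<and> S k + 8 \<le> last_burn b (S k) g + N)"
  using last_burn_less[of k b g] tie_full[OF last_burn_mem, of k b "S k" g] active_le by (auto simp: full_def)

text \<open>The equation determines \<open>b k\<close> from fires of strictly earlier rows, so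
  induction on the row applies; since the windows shrink with time, all gaps consulted lie in the
  windows of those earlier fires.\<close>

lemma burns_unique:
  assumes b: "burns b" "burns b'" and k: "active k" "lf (S k) \<le> g" "g < rg (S k)"
  shows "b k g = b' k g"
  using k
proof (induction "S k" arbitrary: k g rule: less_induct)
  case (less k)
  have lb: "last_burn b (S j) h = last_burn b' (S j) h"
    if "S j \<le> S k" "lf (S k) \<le> h" "h < rg (S k)" for j h
  proof (rule last_burn_cong)
    fix l assume l: "active l" "l \<noteq> v" "S l < S j"
    then show "b l h = b' l h"
      using less.hyps[of l h] window_mono[OF less.prems(1), of "S l"] that by auto
  qed
  have lk: "lf (S k) < k" "k < rg (S k)" using active_le(4)[OF less.prems(1)] by auto
  have "full b (S k) h = full b' (S k) h" if "h \<in> {min g k..max g (k - 1)}" for h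
  proof -
    have "lf (S k) \<le> h" "h < rg (S k)" using that lk less.prems by auto
    then show ?thesis using lb[of k h] by (simp add: full_def)
  qed
  moreover have "passable b (S k) j = passable b' (S k) j" if "j \<in> {min g k + 1..max g (k - 1)}" for j
  proof (cases "S j < S k")
    case True
    have "lf (S k) \<le> j" "j < rg (S k)" using that lk less.prems by auto
    then show ?thesis using lb[of j j] True by (simp add: passable_def)
  qed (simp add: passable_def)
  ultimately have "reaches b k g = reaches b' k g" by (auto simp: reaches_def)
  then show ?case using b less.prems by (auto simp: burns_def)
qed

text \<open>As long as position \<open>j\<close> has not ignited it is no obstacle: every earlier
  fire burns both gaps next to it or neither.\<close>

lemma last_burn_both_sides:
  assumes b: "\<And>l g. active l \<Longrightarrow> S l < S k \<Longrightarrow> lf (S l) \<le> g \<Longrightarrow> g < rg (S l) \<Longrightarrow> b l g = reaches b l g"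
    and k: "active k" "S k \<le> S j" "lf (S k) < j" "j < rg (S k)"
  shows "last_burn b (S k) (j - 1) = last_burn b (S k) j"
proof -
  have "b l (j - 1) = b l j" if "active l" "S l < S k" for l
    using that
  proof (induction "S l" arbitrary: l rule: less_induct)
    case (less l)
    have win: "lf (S l) \<le> lf (S k)" "rg (S k) \<le> rg (S l)" using window_mono[OF k(1), of "S l"] less.prems by auto
    have "last_burn b (S l) (j - 1) = last_burn b (S l) j"
    proof (rule last_burn_cong)
      fix l' assume "active l'" "l' \<noteq> v" "S l' < S l"
      then show "b l' (j - 1) = b l' j" using less.hyps[of l'] less.prems by auto
    qed
    then have f: "full b (S l) (j - 1) = full b (S l) j" by (simp add: full_def)
    have p: "passable b (S l) j" using less.prems k by (simp add: passable_def)
    have lj: "l \<noteq> j" using less.prems k by auto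
    have j1: "0 < j" using k by auto
    have "reaches b l (j - 1) = reaches b l j"
    proof (cases "l < j")
      case True
      then have "{min j l..max j (l - 1)} = insert j {min (j - 1) l..max (j - 1) (l - 1)}"
         "{min j l + 1..max j (l - 1)} = insert j {min (j - 1) l + 1..max (j - 1) (l - 1)}"
         "j - 1 \<in> {min (j - 1) l..max (j - 1) (l - 1)}"
        by auto
      then show ?thesis unfolding reaches_def using f p by auto
    next
      case False
      then have "j < l" using lj by auto
      then have "{min (j - 1) l..max (j - 1) (l - 1)} = insert (j - 1) {min j l..max j (l - 1)}"
         "{min (j - 1) l + 1..max (j - 1) (l - 1)} = insert j {min j l + 1..max j (l - 1)}"
         "j \<in> {min j l..max j (l - 1)}"
        using j1 by auto
      then show ?thesis unfolding reaches_def using f p by auto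
    qed
    then show ?case using b[of l "j - 1"] b[of l j] less.prems win k by auto
  qed
  then show ?thesis by (intro last_burn_cong) auto
qed

end

section \<open>Matching the fires of a path with a schedule\<close>

lemma row_unique:
  assumes "0 < (\<iota>::real)" "real a * \<iota> < w" "w \<le> (real b + 1) * \<iota>" shows "a \<le> b"
proof -
  have "real a * \<iota> < (real b + 1) * \<iota>" using assms by linarith
  then have "real a < real b + 1" using mult_less_cancel_right_pos[OF assms(1)] by blast
  then show ?thesis by linarith
qed

lemma row_exists:
  assumes "0 < (\<iota>::real)" "0 < w" obtains s :: nat where "real s * \<iota> < w" "w \<le> (real s + 1) * \<iota>"
proof -
  define s where "s = nat (\<lceil>w / \<iota>\<rceil> - 1)"
  have "0 < \<lceil>w / \<iota>\<rceil>" using assms by simp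
  then have s: "real s = of_int \<lceil>w / \<iota>\<rceil> - 1" by (simp add: s_def)
  have "real s < w / \<iota>" "w / \<iota> \<le> real s + 1" unfolding s by linarith+
  then show ?thesis using that[of s] assms by (simp add: field_simps)
qed

text \<open>\<open>spacing\<close> makes the gaps long compared with all margins, and
  \<open>long_ev\<close> seeds the whole box within \<open>N + 1\<close> rows. By
  \<open>window_valid\<close> the ends of the window are fires that still shield in row
  \<open>s\<close>, unless the row is so early that unseeded sites of the initial state do.\<close>

locale ffp_track = ffp_grid n m e \<iota> N hN + tie_free_schedule N M v S lf rg P
  for n m e :: "real \<Rightarrow> int \<Rightarrow> nat" and \<iota> :: real and N hN M v :: nat and S lf rg :: "nat \<Rightarrow> nat" and P :: nat +
  fixes H :: nat and X :: "nat \<Rightarrow> int" and tm :: "nat \<Rightarrow> real" and box :: real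
  assumes H_ge: "P + 1 + N \<le> H"
    and P_ge: "N \<le> P"
    and tm_row: "l \<le> M \<Longrightarrow> real (S l) * \<iota> < tm l \<and> tm l \<le> (real (S l) + 1) * \<iota>"
    and fire: "l \<le> M \<Longrightarrow> l \<noteq> v \<Longrightarrow> jump (\<lambda>t. m t (X l)) (tm l)"
    and all_fires: "jump (\<lambda>t. m t x) w \<Longrightarrow> of_int \<bar>x\<bar> \<le> box \<Longrightarrow> w \<le> (real P + 1) * \<iota> \<Longrightarrow>
      \<exists>l\<le>M. l \<noteq> v \<and> x = X l \<and> w = tm l"
    and in_box: "l \<le> M \<Longrightarrow> of_int \<bar>X l\<bar> + 2 * K \<le> box"
    and spacing: "l < M \<Longrightarrow> real_of_int (X l) + 3 * ((real P + 3) * K) < real_of_int (X (Suc l))"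
    and all_good: "l \<le> M \<Longrightarrow> good H (X l)"
    and long_ev: "of_int \<bar>x\<bar> \<le> box \<Longrightarrow> p + N < q \<Longrightarrow> q \<le> H \<Longrightarrow> ev x p q"
    and window_valid: "s \<le> P \<Longrightarrow> j \<in> {lf s, rg s} \<Longrightarrow> j \<noteq> v \<and> (s + 3 \<le> N \<or> S j < s \<and> s + 4 \<le> S j + hN)"
    and S_ge: "k \<le> M \<Longrightarrow> 8 \<le> S k"
begin

definition xr :: "nat \<Rightarrow> real" where "xr l = of_int (X l)"

text \<open>Bounds all margins \<open>s * K\<close> for \<open>s\<close> up to \<open>P + 2\<close>,
  with one \<open>K\<close> to spare.\<close>

definition Z :: real where "Z = (real P + 3) * K"

text \<open>A fire acts on the state just before its time, whereas the cluster of the observed site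
  is wanted at the time itself.\<close>

definition obs :: "nat \<Rightarrow> int \<Rightarrow> nat" where
  "obs k = (if k = v then e (tm v) else left_limit e (tm k))"

definition B :: "nat \<Rightarrow> int set" where "B k = {y. conn (obs k) (X k) y}"

text \<open>The margin grows by \<open>K\<close> per row. So each row has a fresh slot of width
  \<open>K\<close> at either end of a gap, inside the core of row \<open>s\<close> and outside that
  of row \<open>s + 1\<close>, where a vacancy can be found that protects the latter.\<close>

definition core :: "nat \<Rightarrow> nat \<Rightarrow> int \<Rightarrow> bool" where
  "core s g y \<longleftrightarrow> xr g + real s * K < of_int y \<and> of_int y < xr (Suc g) - real s * K"

text \<open>A single burnt site suffices for the definition; the invariant \<open>tracked\<close>
  upgrades it to the whole core.\<close>

definition b :: "nat \<Rightarrow> nat \<Rightarrow> bool" where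
  "b k g \<longleftrightarrow> (\<exists>y. core (S k + 1) g y \<and> y \<in> B k)"

definition mid :: "nat \<Rightarrow> int" where "mid g = (X g + X (Suc g)) div 2"

lemma \<iota>_nonneg: "0 \<le> \<iota>" "0 < \<iota>"
  using \<iota>_pos by simp_all

lemma Z_ge: "3 * K \<le> Z" "1 \<le> Z" "0 < Z"
proof -
  show "3 * K \<le> Z" using K_pos mult_right_mono[of 3 "real P + 3" K] by (simp add: Z_def)
  then show "1 \<le> Z" "0 < Z" using K_pos by linarith+
qed

lemma sK_le: "s \<le> P + 2 \<Longrightarrow> real s * K \<le> Z - K" "0 \<le> real s * K"
proof -
  have "real s * K \<le> (real P + 2) * K" if "s \<le> P + 2" using K_pos that by (intro mult_right_mono) auto
  then show "s \<le> P + 2 \<Longrightarrow> real s * K \<le> Z - K" by (auto simp: Z_def algebra_simps)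
  show "0 \<le> real s * K" using K_pos by simp
qed

lemma xr_Suc: "l < M \<Longrightarrow> xr l + 3 * Z < xr (Suc l)"
  using spacing by (simp add: xr_def Z_def)

lemma xr_less: "j < k \<Longrightarrow> k \<le> M \<Longrightarrow> xr j + 3 * Z < xr k"
proof (induction k)
  case (Suc k)
  show ?case
  proof (cases "j = k")
    case True then show ?thesis using xr_Suc[of k] Suc.prems by simp
  next
    case False
    then have "xr j + 3 * Z < xr k" using Suc by simp
    then show ?thesis using xr_Suc[of k] Suc.prems Z_ge by simp
  qed
qed simp

lemma xr_le: "j \<le> k \<Longrightarrow> k \<le> M \<Longrightarrow> xr j \<le> xr k"
  using xr_less[of j k] Z_ge by (cases "j = k") auto

lemma xr_mono_iff: "j \<le> M \<Longrightarrow> k \<le> M \<Longrightarrow> xr j < xr k \<longleftrightarrow> j < k"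
  using xr_le[of k j] xr_less[of j k] Z_ge by (cases "j < k") auto

lemma mid: assumes "g < M" shows "xr g + Z \<le> of_int (mid g)" "of_int (mid g) \<le> xr (Suc g) - Z"
proof -
  have "X g + X (Suc g) - 1 \<le> 2 * mid g" "2 * mid g \<le> X g + X (Suc g)" unfolding mid_def by linarith+
  then have "xr g + xr (Suc g) - 1 \<le> 2 * of_int (mid g)" "2 * of_int (mid g) \<le> xr g + xr (Suc g)"
    unfolding xr_def by linarith+
  then show "xr g + Z \<le> of_int (mid g)" "of_int (mid g) \<le> xr (Suc g) - Z" using xr_Suc[OF assms] Z_ge by auto
qed

lemma core_mid: "g < M \<Longrightarrow> s \<le> P + 2 \<Longrightarrow> core s g (mid g)"
  using mid[of g] sK_le[of s] K_pos by (auto simp: core_def)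

lemma core_mono: "core s' g y \<Longrightarrow> s \<le> s' \<Longrightarrow> core s g y"
proof -
  assume a: "core s' g y" "s \<le> s'"
  have "real s * K \<le> real s' * K" using K_pos a by (intro mult_right_mono) auto
  then show ?thesis using a by (auto simp: core_def)
qed

lemma early_row:
  assumes "s + 3 \<le> N" "u \<le> (real s + 1) * \<iota>" shows "u \<le> real (N - 2) * \<iota>"
  by (rule order_trans[OF assms(2)], rule mult_right_mono) (use assms(1) \<iota>_nonneg in auto)

lemma row_start_nonneg: "0 \<le> real s * \<iota>"
  using \<iota>_nonneg by simp

lemma left_limit_vacant_row:
  assumes "\<And>u. real s * \<iota> \<le> u \<Longrightarrow> u \<le> (real s + 1) * \<iota> \<Longrightarrow> e u z = 0"
    "real s * \<iota> < w" "w \<le> (real s + 1) * \<iota>"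
  shows "left_limit e w z = 0"
proof -
  have "0 < w" using assms(2) row_start_nonneg[of s] by linarith
  then show ?thesis by (intro left_limit_vacant[OF assms(2)] assms(1)) (use assms in auto)
qed

text \<open>The spacing isolates every fire, so \<open>separator\<close> applies; its vacancy lasts
  through the whole of row \<open>s\<close>, since \<open>s + 1\<close> is at most
  \<open>S j + hN - 3\<close>.\<close>

lemma fire_vacancy:
  assumes j: "j \<le> M" "j \<noteq> v" and sj: "S j < s" "s + 4 \<le> S j + hN"
  shows "\<exists>z. \<bar>of_int z - xr j\<bar> \<le> 2 * K \<and> (\<forall>u. real s * \<iota> \<le> u \<and> u \<le> (real s + 1) * \<iota> \<longrightarrow> e u z = 0)"
proof -
  have iso: "x' = X j \<and> w' = tm j" if x': "jump (\<lambda>t. m t x') w'" "real_of_int \<bar>x' - X j\<bar> \<le> 2 * K"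
      "w' \<le> (real (S j) + 1) * \<iota>" for x' w'
  proof -
    have "of_int \<bar>x'\<bar> \<le> box" using x'(2) in_box[OF j(1)] by linarith
    moreover have "(real (S j) + 1) * \<iota> \<le> (real P + 1) * \<iota>" by (rule mult_right_mono) (use S_le[OF j(1)] \<iota>_nonneg in auto)
    ultimately obtain l where l: "l \<le> M" "l \<noteq> v" "x' = X l" "w' = tm l" using all_fires[OF x'(1)] x'(3) by auto
    have "l = j"
    proof (rule ccontr)
      assume "l \<noteq> j"
      then have "3 * Z < \<bar>xr l - xr j\<bar>" using xr_less[of l j] xr_less[of j l] l j by (cases "l < j") auto
      moreover have "of_int \<bar>x' - X j\<bar> = \<bar>xr l - xr j\<bar>" using l by (simp add: xr_def)
      ultimately show False using x' Z_ge K_pos by linarith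
    qed
    then show ?thesis using l by simp
  qed
  have "S j + 1 + N \<le> H" using H_ge S_le[OF j(1)] by auto
  from separator[OF fire[OF j] conjunct1[OF tm_row[OF j(1)]] conjunct2[OF tm_row[OF j(1)]] iso all_good[OF j(1)] this]
  obtain z where z: "real_of_int \<bar>z - X j\<bar> \<le> 2 * K"
    "\<forall>u. tm j \<le> u \<and> u \<le> real (S j + hN - 3) * \<iota> \<longrightarrow> e u z = 0" by blast
  have c: "(real (S j) + 1) * \<iota> \<le> real s * \<iota>" "(real s + 1) * \<iota> \<le> real (S j + hN - 3) * \<iota>"
    by (rule mult_right_mono; use sj \<iota>_nonneg in auto)+
  have "e u z = 0" if "real s * \<iota> \<le> u" "u \<le> (real s + 1) * \<iota>" for u
    by (rule z(2)[rule_format]) (use that c tm_row[OF j(1)] in linarith)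
  then show ?thesis using z by (intro exI[of _ z]) (auto simp: xr_def)
qed

lemma window_vacancy_row:
  assumes s: "s \<le> P" and j: "j \<in> {lf s, rg s}" "j \<le> M"
  shows "\<exists>z. \<bar>of_int z - xr j\<bar> \<le> 2 * K \<and> (\<forall>u. real s * \<iota> \<le> u \<and> u \<le> (real s + 1) * \<iota> \<longrightarrow> e u z = 0)"
proof (cases "s + 3 \<le> N")
  case True
  have iH: "\<bar>0::int\<bar> \<le> int H" "N \<le> H" using H_ge by auto
  obtain z where z: "xr j + of_int 0 * K < of_int z" "of_int z < xr j + (of_int 0 + 1) * K"
    "\<forall>u. 0 \<le> u \<and> u \<le> real (N - 2) * \<iota> \<longrightarrow> e u z = 0"
    using early_vacancy[OF all_good[OF j(2)] iH] by (auto simp: xr_def)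
  have "e u z = 0" if "real s * \<iota> \<le> u" "u \<le> (real s + 1) * \<iota>" for u
    by (rule z(3)[rule_format]) (use that early_row[OF True that(2)] row_start_nonneg[of s] in linarith)
  then show ?thesis using z K_pos by (intro exI[of _ z]) auto
next
  case False
  then show ?thesis using window_valid[OF s j(1)] fire_vacancy[OF j(2)] by auto
qed

text \<open>The last two claims concern an end position that ignites in row \<open>s\<close> itself.
  By \<open>window_valid\<close> such a row is early, and then a vacancy can be found on either
  prescribed side.\<close>

lemma window_vacancy:
  assumes s: "s \<le> P" and j: "j \<in> {lf s, rg s}" "j \<le> M" and w: "real s * \<iota> < w" "w \<le> (real s + 1) * \<iota>"
  shows "\<exists>z. \<bar>of_int z - xr j\<bar> \<le> 2 * K \<and> left_limit e w z = 0"
    and "S j = s \<Longrightarrow> \<exists>z. xr j < of_int z \<and> of_int z < xr j + K \<and> left_limit e w z = 0"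
    and "S j = s \<Longrightarrow> \<exists>z. xr j - K < of_int z \<and> of_int z < xr j \<and> left_limit e w z = 0"
proof -
  have val: "s + 3 \<le> N \<or> S j < s \<and> s + 4 \<le> S j + hN" using window_valid[OF s j(1)] by auto
  have early: "\<exists>z. xr j + of_int i * K < of_int z \<and> of_int z < xr j + (of_int i + 1) * K \<and> left_limit e w z = 0"
    if "s + 3 \<le> N" "\<bar>i\<bar> \<le> 1" for i
  proof -
    have iH: "\<bar>i\<bar> \<le> int H" "N \<le> H" using H_ge that by auto
    obtain z where z: "xr j + of_int i * K < of_int z" "of_int z < xr j + (of_int i + 1) * K"
      "\<forall>u. 0 \<le> u \<and> u \<le> real (N - 2) * \<iota> \<longrightarrow> e u z = 0"
      using early_vacancy[OF all_good[OF j(2)] iH] by (auto simp: xr_def)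
    have "e u z = 0" if "real s * \<iota> \<le> u" "u \<le> (real s + 1) * \<iota>" for u
      by (rule z(3)[rule_format]) (use that early_row[OF \<open>s + 3 \<le> N\<close> that(2)] row_start_nonneg[of s] in linarith)
    then show ?thesis using z left_limit_vacant_row[OF _ w] by blast
  qed
  show "S j = s \<Longrightarrow> \<exists>z. xr j < of_int z \<and> of_int z < xr j + K \<and> left_limit e w z = 0"
    using early[of 0] val by auto
  show "S j = s \<Longrightarrow> \<exists>z. xr j - K < of_int z \<and> of_int z < xr j \<and> left_limit e w z = 0"
    using early[of "-1"] val by auto
  show "\<exists>z. \<bar>of_int z - xr j\<bar> \<le> 2 * K \<and> left_limit e w z = 0"
    using window_vacancy_row[OF s j] left_limit_vacant_row[OF _ w] by blast
qed

text \<open>A fire from outside would have to cross the vacancy near an end of the window, so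
  whatever burns a site inside started at an active position.\<close>

lemma window_fire:
  assumes s: "s \<le> P" and x: "jump (\<lambda>t. m t x) w" "conn (left_limit e w) x y" and w: "real s * \<iota> < w" "w \<le> (real s + 1) * \<iota>"
    and y: "xr (lf s) + 2 * K < of_int y" "of_int y < xr (rg s) - 2 * K"
    and lr: "lf s \<le> M" "rg s \<le> M"
  shows "\<exists>l. active l \<and> l \<noteq> v \<and> S l = s \<and> x = X l \<and> w = tm l"
proof -
  have wP: "w \<le> (real P + 1) * \<iota>"
    by (rule order_trans[OF w(2)], rule mult_right_mono) (use s \<iota>_pos in auto)
  \<comment> \<open>The spacing exceeds \<open>2 * K\<close>, so a fire this close to a listed
    position is the one listed there.\<close>
  have near: "x = X j \<and> S j = s" if "real_of_int \<bar>x - X j\<bar> \<le> 2 * K" "j \<le> M" for j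
  proof -
    have "of_int \<bar>x\<bar> \<le> box" using that in_box[OF that(2)] by linarith
    then obtain l where l: "l \<le> M" "l \<noteq> v" "x = X l" "w = tm l" using all_fires[OF x(1)] wP by auto
    have "l = j"
    proof (rule ccontr)
      assume "l \<noteq> j"
      then have "3 * Z < \<bar>xr l - xr j\<bar>" using xr_less[of l j] xr_less[of j l] l that by (cases "l < j") auto
      moreover have "of_int \<bar>x - X j\<bar> = \<bar>xr l - xr j\<bar>" using l by (simp add: xr_def)
      ultimately show False using that Z_ge K_pos by linarith
    qed
    moreover have "S l \<le> s" "s \<le> S l"
      using row_unique[of \<iota> "S l" w s] row_unique[of \<iota> s w "S l"] tm_row[OF l(1)] w l \<iota>_pos by auto
    ultimately show ?thesis using l by auto
  qed
  have blocked: False if "min (real_of_int x) (real_of_int y) \<le> real_of_int z" "real_of_int z \<le> max (real_of_int x) (real_of_int y)"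
     "left_limit e w z = 0" for z
    using conn_mem[OF x(2), of z] that by linarith
  have "X (lf s) < x"
  proof (rule ccontr)
    assume a: "\<not> X (lf s) < x"
    show False
    proof (cases "real_of_int \<bar>x - X (lf s)\<bar> \<le> 2 * K")
      case True
      from near[OF this lr(1)] have xl: "x = X (lf s)" "S (lf s) = s" by auto
      from window_vacancy(2)[OF s _ lr(1) w xl(2)] obtain z where "xr (lf s) < of_int z" "of_int z < xr (lf s) + K" "left_limit e w z = 0" by auto
      then show False using blocked[of z] xl y K_pos by (auto simp: xr_def)
    next
      case False
      from window_vacancy(1)[OF s _ lr(1) w] obtain z where z: "\<bar>of_int z - xr (lf s)\<bar> \<le> 2 * K" "left_limit e w z = 0" by auto
      have "of_int x < xr (lf s) - 2 * K" using False a unfolding xr_def by linarith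
      then show False using blocked[of z] z y by linarith
    qed
  qed
  moreover have "x < X (rg s)"
  proof (rule ccontr)
    assume a: "\<not> x < X (rg s)"
    show False
    proof (cases "real_of_int \<bar>x - X (rg s)\<bar> \<le> 2 * K")
      case True
      from near[OF this lr(2)] have xl: "x = X (rg s)" "S (rg s) = s" by auto
      from window_vacancy(3)[OF s _ lr(2) w xl(2)] obtain z where "xr (rg s) - K < of_int z" "of_int z < xr (rg s)" "left_limit e w z = 0" by auto
      then show False using blocked[of z] xl y K_pos by (auto simp: xr_def)
    next
      case False
      from window_vacancy(1)[OF s _ lr(2) w] obtain z where z: "\<bar>of_int z - xr (rg s)\<bar> \<le> 2 * K" "left_limit e w z = 0" by auto
      have "xr (rg s) + 2 * K < of_int x" using False a unfolding xr_def by linarith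
      then show False using blocked[of z] z y by linarith
    qed
  qed
  ultimately have xx: "xr (lf s) < of_int x" "of_int x < xr (rg s)" by (auto simp: xr_def)
  then have "of_int \<bar>x\<bar> \<le> box" using in_box[OF lr(1)] in_box[OF lr(2)] K_pos by (auto simp: xr_def)
  then obtain l where l: "l \<le> M" "l \<noteq> v" "x = X l" "w = tm l" using all_fires[OF x(1)] wP by auto
  have "S l \<le> s" "s \<le> S l"
    using row_unique[of \<iota> "S l" w s] row_unique[of \<iota> s w "S l"] tm_row[OF l(1)] w l \<iota>_pos by auto
  moreover have "lf s < l" "l < rg s" using xx l lr xr_mono_iff[of "lf s" l] xr_mono_iff[of l "rg s"] by (auto simp: xr_def)
  ultimately show ?thesis using l by (auto simp: active_def)
qed

text \<open>A seeded site can be vacant only if it burnt after row \<open>p\<close>, and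
  \<open>window_fire\<close> attributes this burning to an active fire.\<close>

lemma obs_occupied:
  assumes k: "active k" and y: "xr (lf (S k)) + 2 * K < of_int y" "of_int y < xr (rg (S k)) - 2 * K"
    and ev: "ev y p q" "p < q" "q \<le> S k"
    and nb: "\<And>l. active l \<Longrightarrow> l \<noteq> v \<Longrightarrow> p \<le> S l \<Longrightarrow> S l < S k \<Longrightarrow> y \<notin> B l"
  shows "obs k y \<noteq> 0"
proof -
  have no: "\<not> burned y w" if w: "real p * \<iota> < w" "w < tm k \<or> k = v \<and> w \<le> tm k" for w
  proof
    assume "burned y w"
    then obtain x where x: "jump (\<lambda>t. m t x) w" "conn (left_limit e w) x y" by (auto simp: burned_def)
    have i0: "0 < \<iota>" using \<iota>_pos by simp
    have "0 < w" using x by (simp add: jump_def)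
    then obtain s where s: "real s * \<iota> < w" "w \<le> (real s + 1) * \<iota>" using row_exists[OF i0] by blast
    have "p \<le> s" using row_unique[OF i0 w(1) s(2)] .
    have "s \<le> S k" by (rule row_unique[OF i0 s(1)]) (use w tm_row[OF active_le(1)[OF k]] in auto)
    have win: "lf s \<le> lf (S k)" "rg (S k) \<le> rg s" using window_mono[OF k \<open>s \<le> S k\<close>] by auto
    have sP: "s \<le> P" using \<open>s \<le> S k\<close> active_le[OF k] by auto
    have rgs: "rg s \<le> M" using rg_le[OF sP] .
    have "lf (S k) \<le> M" "rg (S k) \<le> M" using active_le[OF k] by auto
    then have y': "xr (lf s) + 2 * K < of_int y" "of_int y < xr (rg s) - 2 * K" "lf s \<le> M"
      using y xr_le[OF win(1)] xr_le[OF win(2) rgs] win by auto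
    from window_fire[OF sP x s y'(1,2,3) rgs] obtain l where
      l: "active l" "l \<noteq> v" "S l = s" "x = X l" "w = tm l" by blast
    have "y \<in> B l" using x l by (simp add: B_def obs_def)
    have "S l \<noteq> S k"
    proof
      assume "S l = S k"
      then have "l = k" using S_inj[of l k] active_le l k by auto
      then show False using w l by auto
    qed
    then show False using nb[OF l(1,2)] \<open>y \<in> B l\<close> \<open>p \<le> s\<close> \<open>s \<le> S k\<close> l by auto
  qed
  have q: "real q * \<iota> < tm k"
    using tm_row[OF active_le(1)[OF k]] mult_right_mono[OF _ \<iota>_nonneg(1), of "real q" "real (S k)"] ev by auto
  show ?thesis
  proof (cases "k = v")
    case True
    then show ?thesis using occupied[OF ev(1) _ _ ev(2), of "tm v"] no q by (auto simp: obs_def)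
  next
    case False
    then show ?thesis using left_occupied[OF ev(1) q _ ev(2)] no by (auto simp: obs_def)
  qed
qed

lemma obs_vacantI:
  assumes k: "k \<le> M" "S k + 1 \<le> q" and a: "e a y = 0" "\<not> ev y p q" "real p * \<iota> \<le> a" "a < tm k"
  shows "obs k y = 0"
proof -
  have "(real (S k) + 1) * \<iota> \<le> real q * \<iota>" by (rule mult_right_mono) (use k \<iota>_pos in auto)
  then have v: "e u y = 0" if "a \<le> u" "u \<le> tm k" for u
    using stays_vacant[OF a(1,2,3) that(1)] tm_row[OF k(1)] that by auto
  have "0 < tm k" using tm_row[OF k(1)] mult_nonneg_nonneg[of "real (S k)" \<iota>] \<iota>_pos by linarith
  then show ?thesis using v a left_limit_vacant[OF a(4)] by (auto simp: obs_def)
qed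

lemma obs_vacant:
  assumes "y \<in> B l" "l \<le> M" "l \<noteq> v" "S l < S k" "k \<le> M" "\<not> ev y p q" "p \<le> S l" "S k + 1 \<le> q"
  shows "obs k y = 0"
proof (rule obs_vacantI[OF assms(5,8) _ assms(6)])
  show "e (tm l) y = 0" using burn[OF fire[OF assms(2,3)]] assms by (auto simp: B_def obs_def)
  show "real p * \<iota> \<le> tm l"
    using tm_row[OF assms(2)] mult_right_mono[OF _ \<iota>_nonneg(1), of "real p" "real (S l)"] assms by auto
  show "tm l < tm k"
    using tm_row[OF assms(2)] tm_row[OF assms(5)] mult_right_mono[OF _ \<iota>_nonneg(1), of "real (S l) + 1" "real (S k)"] assms by auto
qed

lemma obs_vacant_init:
  assumes "k \<le> M" "\<not> ev y 0 q" "S k + 1 \<le> q"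
  shows "obs k y = 0"
proof (rule obs_vacantI[OF assms(1,3) vacant_init assms(2)])
  show "0 < tm k" using tm_row[OF assms(1)] mult_nonneg_nonneg[of "real (S k)" \<iota>] \<iota>_pos by linarith
qed simp


lemma B_mem: "y \<in> B k \<Longrightarrow> min (X k) y \<le> z \<Longrightarrow> z \<le> max (X k) y \<Longrightarrow> z \<in> B k \<and> obs k z \<noteq> 0"
  unfolding B_def using conn_mem by blast

lemma B_memI: "(\<And>z. min (X k) y \<le> z \<Longrightarrow> z \<le> max (X k) y \<Longrightarrow> obs k z \<noteq> 0) \<Longrightarrow> y \<in> B k"
  by (auto simp: B_def conn_def)

lemma B_extend: "y \<in> B k \<Longrightarrow> (\<And>x. min y z \<le> x \<Longrightarrow> x \<le> max y z \<Longrightarrow> obs k x \<noteq> 0) \<Longrightarrow> z \<in> B k"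
  unfolding B_def using conn_trans[of "obs k" "X k" y z] by (simp add: conn_def)

lemma S_pos: "active k \<Longrightarrow> S k \<noteq> 0"
  using S_ge active_le(1) by force

lemma last_burn_8: "active k \<Longrightarrow> last_burn b (S k) g + 8 \<le> S k"
  using S_active_pos S_pos by blast

lemma b_whole_core: "b k g \<Longrightarrow> g < M \<Longrightarrow> active k \<Longrightarrow>
   (\<And>y. core (S k) g y \<Longrightarrow> obs k y \<noteq> 0) \<Longrightarrow> core (S k + 1) g y \<Longrightarrow> y \<in> B k"
proof -
  assume a: "b k g" "g < M" "active k" "\<And>y. core (S k) g y \<Longrightarrow> obs k y \<noteq> 0" "core (S k + 1) g y"
  then obtain y' where y': "core (S k + 1) g y'" "y' \<in> B k" by (auto simp: b_def)
  show "y \<in> B k"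
  proof (rule B_extend[OF y'(2)])
    fix x assume "min y' y \<le> x" "x \<le> max y' y"
    then have "core (S k + 1) g x" using a(5) y'(1) unfolding core_def by linarith
    then show "obs k x \<noteq> 0" using a(4) core_mono[of "S k + 1" g x "S k"] by auto
  qed
qed

text \<open>What a fire burns is an interval containing the fire; if it comes near another position,
  it has passed the middle of an adjacent gap.\<close>

lemma b_near:
  assumes l: "active l" "j \<le> M" "l \<noteq> j" and y: "y \<in> B l" "\<bar>of_int y - xr j\<bar> \<le> Z"
    and lj: "lf (S l) < j" "j < rg (S l)"
  shows "b l (j - 1) \<or> b l j"
proof (cases "l < j")
  case True
  have j1: "j - 1 < M" "Suc (j - 1) = j" "l \<le> j - 1" using l True by auto
  have m: "xr (j - 1) + Z \<le> of_int (mid (j - 1))" "of_int (mid (j - 1)) \<le> xr j - Z"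
    using mid[OF j1(1)] j1 by auto
  have "xr l \<le> xr (j - 1)" using xr_le[OF j1(3)] j1 by simp
  then have "X l \<le> mid (j - 1)" "mid (j - 1) \<le> y" using m y(2) Z_ge unfolding xr_def by linarith+
  then have "mid (j - 1) \<in> B l" using B_mem[OF y(1), of "mid (j - 1)"] by auto
  moreover have "core (S l + 1) (j - 1) (mid (j - 1))"
    using core_mid[OF j1(1)] active_le(2)[OF l(1)] by auto
  ultimately show ?thesis unfolding b_def by auto
next
  case False
  have j1: "j < M" "Suc j \<le> l" using l False active_le(1)[OF l(1)] by auto
  have m: "xr j + Z \<le> of_int (mid j)" "of_int (mid j) \<le> xr (Suc j) - Z"
    using mid[OF j1(1)] j1 by auto
  have "xr (Suc j) \<le> xr l" using xr_le[OF j1(2)] active_le(1)[OF l(1)] by simp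
  then have "mid j \<le> X l" "y \<le> mid j" using m y(2) Z_ge unfolding xr_def by linarith+
  then have "mid j \<in> B l" using B_mem[OF y(1), of "mid j"] by auto
  moreover have "core (S l + 1) j (mid j)"
    using core_mid[OF j1(1)] active_le(2)[OF l(1)] by auto
  ultimately show ?thesis unfolding b_def by auto
qed

lemma in_window:
  assumes "active k" "lf (S k) \<le> g" "g < rg (S k)" "core 2 g y"
  shows "xr (lf (S k)) + 2 * K < of_int y" "of_int y < xr (rg (S k)) - 2 * K" "g < M"
  using xr_le[of "lf (S k)" g] xr_le[of "Suc g" "rg (S k)"] assms active_le[OF assms(1)]
  by (auto simp: core_def)

lemma near_in_window:
  assumes "active k" "lf (S k) < j" "j < rg (S k)" "\<bar>of_int y - xr j\<bar> \<le> Z"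
  shows "xr (lf (S k)) + 2 * K < of_int y" "of_int y < xr (rg (S k)) - 2 * K" "j < M" "0 < j"
proof -
  have "xr (lf (S k)) + 3 * Z < xr j" "xr j + 3 * Z < xr (rg (S k))"
    using xr_less[of "lf (S k)" j] xr_less[of j "rg (S k)"] assms active_le[OF assms(1)] by auto
  then show "xr (lf (S k)) + 2 * K < of_int y" "of_int y < xr (rg (S k)) - 2 * K"
    using assms(4) Z_ge K_pos by (auto simp: abs_le_iff)
qed (use assms active_le[OF assms(1)] in auto)

lemma box_of_window:
  assumes "active k" "xr (lf (S k)) < of_int y" "of_int y < xr (rg (S k))"
  shows "of_int \<bar>y\<bar> \<le> box"
  using in_box[of "lf (S k)"] in_box[of "rg (S k)"] assms active_le[OF assms(1)] K_pos by (auto simp: xr_def)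

text \<open>The last fire in the gap is at least \<open>N + 8\<close> rows old, and the seeds of the
  last \<open>N + 1\<close> rows cover the box. A later fire touching the core would have counted as
  burning the gap.\<close>

lemma full_core_occupied:
  assumes k: "active k" "lf (S k) \<le> g" "g < rg (S k)" and f: "full b (S k) g" and y: "core (S k) g y"
  shows "obs k y \<noteq> 0"
proof -
  have L: "last_burn b (S k) g + N + 8 \<le> S k" using full_iff[OF k(1) S_pos[OF k(1)]] f by auto
  have "core 2 g y" using core_mono[OF y, of 2] S_ge active_le(1)[OF k(1)] by force
  note w = in_window[OF k this]
  have "of_int \<bar>y\<bar> \<le> box" using box_of_window[OF k(1)] w K_pos by auto
  then have ev: "ev y (S k - N - 1) (S k)"
    by (rule long_ev) (use L H_ge active_le[OF k(1)] in auto)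
  show ?thesis
  proof (rule obs_occupied[OF k(1) w(1,2) ev])
    fix l assume l: "active l" "l \<noteq> v" "S k - N - 1 \<le> S l" "S l < S k"
    show "y \<notin> B l"
    proof
      assume "y \<in> B l"
      moreover have "core (S l + 1) g y" using core_mono[OF y] l by auto
      ultimately have "b l g" by (auto simp: b_def)
      then show False using last_burn_ge[of l "S k" b g] l L by auto
    qed
  qed (use L in auto)
qed

text \<open>The invariant of the induction over the rows.\<close>

definition tracked :: "nat \<Rightarrow> bool" where
  "tracked k \<longleftrightarrow> (\<forall>g. lf (S k) \<le> g \<and> g < rg (S k) \<longrightarrow>
     (b k g \<longleftrightarrow> reaches b k g) \<and> (b k g \<longrightarrow> (\<forall>y. core (S k + 1) g y \<longrightarrow> y \<in> B k)))"

text \<open>Less than \<open>N\<close> rows after the last burning, each slot of width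
  \<open>K\<close> still has an unseeded site. The slot between the cores of rows \<open>S k\<close>
  and \<open>S k + 1\<close> is taken: it lies in the part that the last fire certainly burnt, and
  in the way of anything entering \<open>core (S k + 1)\<close>.\<close>

lemma unfilled_slot_vacancy:
  assumes k: "active k" "lf (S k) \<le> g" "g < rg (S k)" and f: "\<not> full b (S k) g"
    and tr: "\<And>l. active l \<Longrightarrow> S l < S k \<Longrightarrow> tracked l"
  shows "\<exists>z. xr g + real (S k) * K < of_int z \<and> of_int z < xr g + (real (S k) + 1) * K \<and> obs k z = 0"
    and "\<exists>z. xr (Suc g) - (real (S k) + 1) * K < of_int z \<and> of_int z < xr (Suc g) - real (S k) * K \<and> obs k z = 0"
proof -
  define L where "L = last_burn b (S k) g"
  have gM: "g < M" using k active_le[OF k(1)] by auto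
  have L: "S k + 8 \<le> L + N" "L < S k" using full_iff[OF k(1) S_pos[OF k(1)]] f last_burn_8[OF k(1)] by (auto simp: L_def intro: less_le_trans[of _ "L + 8"])
  have kP: "S k \<le> P" "k \<le> M" using active_le[OF k(1)] by auto
  \<comment> \<open>The end row \<open>L + N - 2\<close>, later than \<open>S k\<close>, is chosen
    to make the slot width equal to \<open>R (N - 1) = K\<close>.\<close>
  have q: "L < L + N - 2" "L + N - 2 \<le> H" "L + N - 2 - L + 1 = N - 1" using L H_ge kP hN_ge N_eq by auto
  have vac: "obs k z = 0" if z: "core (S k) g z" "\<not> ev z L (L + N - 2)" for z
  proof -
    consider "L = 0" | l where "active l" "l \<noteq> v" "S l < S k" "b l g" "L = S l"
      using last_burn_cases[of b "S k" g] by (auto simp: L_def)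
    then show ?thesis
    proof cases
      case 1
      then show ?thesis using obs_vacant_init[OF kP(2), of z "L + N - 2"] z L by auto
    next
      case 2
      have "lf (S l) \<le> g" "g < rg (S l)" using window_mono[OF k(1), of "S l"] 2 k by auto
      moreover have "core (S l + 1) g z" using core_mono[OF z(1)] 2 by auto
      ultimately have "z \<in> B l" using tr[OF 2(1,3)] 2 by (auto simp: tracked_def)
      then show ?thesis
        using obs_vacant[OF _ active_le(1)[OF 2(1)] 2(2,3) kP(2) z(2)] 2 L by auto
    qed
  qed
  have sp: "xr g + 3 * Z < xr (Suc g)" using xr_Suc[OF gM] .
  have sk: "real (S k) * K + K \<le> Z" using sK_le(1)[of "S k"] kP by auto
  show "\<exists>z. xr g + real (S k) * K < of_int z \<and> of_int z < xr g + (real (S k) + 1) * K \<and> obs k z = 0"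
  proof -
    obtain z where z: "xr g + real (S k) * K < of_int z" "of_int z < xr g + (real (S k) + 1) * K" "\<not> ev z L (L + N - 2)"
      using good_slot[OF all_good q(1,2), of g "int (S k)"] gM kP H_ge unfolding q(3) K_def[symmetric] by (auto simp: xr_def)
    moreover have "core (S k) g z" using z sp sk Z_ge K_pos by (auto simp: core_def algebra_simps)
    ultimately show ?thesis using vac by blast
  qed
  show "\<exists>z. xr (Suc g) - (real (S k) + 1) * K < of_int z \<and> of_int z < xr (Suc g) - real (S k) * K \<and> obs k z = 0"
  proof -
    obtain z where z: "xr (Suc g) - (real (S k) + 1) * K < of_int z" "of_int z < xr (Suc g) - real (S k) * K" "\<not> ev z L (L + N - 2)"
      using good_slot[OF all_good q(1,2), of "Suc g" "- int (S k) - 1"] gM kP H_ge unfolding q(3) K_def[symmetric] by (auto simp: xr_def algebra_simps)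
    moreover have "core (S k) g z" using z sp sk Z_ge K_pos by (auto simp: core_def algebra_simps)
    ultimately show ?thesis using vac by blast
  qed
qed

lemma unfilled_not_b:
  assumes k: "active k" "lf (S k) \<le> g" "g < rg (S k)" and f: "\<not> full b (S k) g"
    and tr: "\<And>l. active l \<Longrightarrow> S l < S k \<Longrightarrow> tracked l"
  shows "\<not> b k g"
proof
  assume "b k g"
  then obtain y where y: "core (S k + 1) g y" "y \<in> B k" by (auto simp: b_def)
  show False
  proof (cases "k \<le> g")
    case True
    obtain z where z: "xr g + real (S k) * K < of_int z" "of_int z < xr g + (real (S k) + 1) * K" "obs k z = 0"
      using unfilled_slot_vacancy(1)[OF assms] by blast
    have "xr k \<le> xr g" using xr_le[OF True] k active_le[OF k(1)] by auto
    moreover have "xr g + (real (S k) + 1) * K < of_int y" using y by (simp add: core_def algebra_simps)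
    ultimately have "X k \<le> z" "z \<le> y" using z sK_le(2)[of "S k"] unfolding xr_def by linarith+
    then show False using B_mem[OF y(2), of z] z by auto
  next
    case False
    obtain z where z: "xr (Suc g) - (real (S k) + 1) * K < of_int z" "of_int z < xr (Suc g) - real (S k) * K" "obs k z = 0"
      using unfilled_slot_vacancy(2)[OF assms] by blast
    have "xr (Suc g) \<le> xr k" using xr_le[of "Suc g" k] False active_le[OF k(1)] by auto
    moreover have "of_int y < xr (Suc g) - (real (S k) + 1) * K" using y by (simp add: core_def algebra_simps)
    ultimately have "z \<le> X k" "y \<le> z" using z sK_le(2)[of "S k"] unfolding xr_def by linarith+
    then show False using B_mem[OF y(2), of z] z by auto
  qed
qed


text \<open>The burnt interval contains the middles of both adjacent gaps and therefore everything
  between them.\<close>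

lemma burnt_near_unfired:
  assumes k: "active k" and tr: "\<And>l. active l \<Longrightarrow> S l < S k \<Longrightarrow> tracked l"
    and l: "active l" "S l < S k" "b l (k - 1)" "b l k" and z: "\<bar>of_int z - xr k\<bar> \<le> Z"
  shows "z \<in> B l"
proof -
  have lk: "lf (S k) < k" "k < rg (S k)" "k \<le> M" "rg (S k) \<le> M" using active_le[OF k] by auto
  have win: "lf (S l) \<le> lf (S k)" "rg (S k) \<le> rg (S l)" using window_mono[OF k, of "S l"] l by auto
  have lP: "S l + 1 \<le> P + 2" using active_le[OF l(1)] by auto
  have "core (S l + 1) (k - 1) (mid (k - 1))" "core (S l + 1) k (mid k)"
    by (rule core_mid; use lk lP in auto)+
  moreover have "lf (S l) \<le> k - 1" "k - 1 < rg (S l)" "lf (S l) \<le> k" "k < rg (S l)" using win lk by auto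
  ultimately have m: "mid (k - 1) \<in> B l" "mid k \<in> B l" using tr[OF l(1,2)] l(3,4) unfolding tracked_def by blast+
  have "of_int (mid (k - 1)) \<le> xr k - Z" "xr k + Z \<le> of_int (mid k)"
    using mid(2)[of "k - 1"] mid(1)[of k] lk by auto
  then have "mid (k - 1) \<le> z" "z \<le> mid k" using z by linarith+
  then show ?thesis using B_mem[OF m(1), of z] B_mem[OF m(2), of z] by (cases "z \<le> X l") auto
qed

lemma last_burn_sides:
  assumes k: "active k" and tr: "\<And>l. active l \<Longrightarrow> S l < S k \<Longrightarrow> tracked l"
    and j: "S k \<le> S j" "lf (S k) < j" "j < rg (S k)"
  shows "last_burn b (S k) (j - 1) = last_burn b (S k) j"
  by (rule last_burn_both_sides[OF _ k j]) (use tr in \<open>auto simp: tracked_def\<close>)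

lemma R_le_K: "q + 1 \<le> N \<Longrightarrow> R q \<le> K"
  unfolding K_def by (rule R_mono) auto

text \<open>Since the last burning in row \<open>L\<close>, an unseeded site remains close to the
  fire on either side. Of the two extra rows in the radius, one comes from waiting until the end of
  row \<open>S k\<close> and one from the slack in \<open>good\<close>.\<close>

lemma micro_upper:
  assumes k: "active k" and f: "\<not> full b (S k) k" and tr: "\<And>l. active l \<Longrightarrow> S l < S k \<Longrightarrow> tracked l"
  shows "\<exists>z. xr k < of_int z \<and> of_int z < xr k + R (S k - last_burn b (S k) k + 2) \<and> obs k z = 0"
    and "\<exists>z. xr k - R (S k - last_burn b (S k) k + 2) < of_int z \<and> of_int z < xr k \<and> obs k z = 0"
    and "y \<in> B k \<Longrightarrow> \<bar>of_int y - xr k\<bar> < R (S k - last_burn b (S k) k + 2)"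
proof -
  define L where "L = last_burn b (S k) k"
  have lk: "lf (S k) < k" "k < rg (S k)" "k \<le> M" "rg (S k) \<le> M" "S k \<le> P" using active_le[OF k] by auto
  have L: "S k + 8 \<le> L + N" "L + 8 \<le> S k" using full_iff[OF k S_pos[OF k]] f last_burn_8[OF k] by (auto simp: L_def)
  have q: "L < S k + 1" "S k + 1 \<le> H" "S k + 1 - L + 1 = S k - L + 2" using L H_ge lk by auto
  have RK: "R (S k - L + 2) \<le> K" by (rule R_le_K) (use L in auto)
  \<comment> \<open>Fire \<open>k\<close> has not ignited yet, so both gaps next to it were last
    burnt in the same row and, rows being distinct, by the same fire.\<close>
  have same: "last_burn b (S k) (k - 1) = L" using last_burn_sides[OF k tr, of k] lk by (simp add: L_def)
  have vac: "obs k z = 0" if z: "\<bar>of_int z - xr k\<bar> \<le> Z" "\<not> ev z L (S k + 1)" for z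
  proof -
    consider "L = 0" | l where "active l" "l \<noteq> v" "S l < S k" "b l k" "L = S l"
      using last_burn_cases[of b "S k" k] by (auto simp: L_def)
    then show ?thesis
    proof cases
      case 1
      then show ?thesis using obs_vacant_init[OF lk(3), of z "S k + 1"] z by auto
    next
      case 2
      obtain l' where l': "active l'" "l' \<noteq> v" "S l' < S k" "b l' (k - 1)" "L = S l'"
        using last_burn_cases[of b "S k" "k - 1"] 2 L unfolding same using S_ge active_le(1) by fastforce
      then have "l' = l" using S_inj active_le(1) 2 by auto
      then have "z \<in> B l" using burnt_near_unfired[OF k tr 2(1,3) _ 2(4) z(1)] l' by auto
      then show ?thesis
        using obs_vacant[OF _ active_le(1)[OF 2(1)] 2(2,3) lk(3) z(2)] 2 L by auto
    qed
  qed
  show 1: "\<exists>z. xr k < of_int z \<and> of_int z < xr k + R (S k - last_burn b (S k) k + 2) \<and> obs k z = 0"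
  proof -
    obtain z where z: "xr k < of_int z" "of_int z < xr k + R (S k - L + 2)" "\<not> ev z L (S k + 1)"
      using good_slot[OF all_good[OF lk(3)] q(1,2), of 0] unfolding q(3) by (auto simp: xr_def)
    moreover have "obs k z = 0" by (rule vac) (use z RK Z_ge K_pos in auto)
    ultimately show ?thesis by (auto simp: L_def)
  qed
  show 2: "\<exists>z. xr k - R (S k - last_burn b (S k) k + 2) < of_int z \<and> of_int z < xr k \<and> obs k z = 0"
  proof -
    obtain z where z: "xr k - R (S k - L + 2) < of_int z" "of_int z < xr k" "\<not> ev z L (S k + 1)"
      using good_slot[OF all_good[OF lk(3)] q(1,2), of "-1"] H_ge hN_ge N_eq unfolding q(3) by (auto simp: xr_def)
    moreover have "obs k z = 0" by (rule vac) (use z RK Z_ge K_pos in auto)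
    ultimately show ?thesis by (auto simp: L_def)
  qed
  assume y: "y \<in> B k"
  obtain z1 z2 where z: "xr k < of_int z1" "of_int z1 < xr k + R (S k - last_burn b (S k) k + 2)" "obs k z1 = 0"
    "xr k - R (S k - last_burn b (S k) k + 2) < of_int z2" "of_int z2 < xr k" "obs k z2 = 0"
    using 1 2 by blast
  have "y < z1" using B_mem[OF y, of z1] z by (force simp: xr_def)
  moreover have "z2 < y" using B_mem[OF y, of z2] z by (force simp: xr_def)
  ultimately show "\<bar>of_int y - xr k\<bar> < R (S k - last_burn b (S k) k + 2)" using z by linarith
qed

text \<open>Dually, the seeds from row \<open>L + 1\<close> on fill the ball of radius
  \<open>R (S k - L - 2)\<close>, and a fire entering it after row \<open>L\<close> would have burnt
  an adjacent gap.\<close>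

lemma micro_lower:
  assumes k: "active k" and f: "\<not> full b (S k) k" and tr: "\<And>l. active l \<Longrightarrow> S l < S k \<Longrightarrow> tracked l"
    and y: "\<bar>of_int y - xr k\<bar> \<le> R (S k - last_burn b (S k) k - 2)"
  shows "obs k y \<noteq> 0" "y \<in> B k"
proof -
  define L where "L = last_burn b (S k) k"
  have lk: "lf (S k) < k" "k < rg (S k)" "k \<le> M" "rg (S k) \<le> M" "S k \<le> P" using active_le[OF k] by auto
  have L: "S k + 8 \<le> L + N" "L + 8 \<le> S k" using full_iff[OF k S_pos[OF k]] f last_burn_8[OF k] by (auto simp: L_def)
  have same: "last_burn b (S k) (k - 1) = L" using last_burn_sides[OF k tr, of k] lk by (simp add: L_def)
  have RK: "R (S k - L - 2) \<le> K" by (rule R_le_K) (use L in auto)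
  have main: "obs k z \<noteq> 0" if z: "\<bar>of_int z - xr k\<bar> \<le> R (S k - L - 2)" for z
  proof -
    have zZ: "\<bar>of_int z - xr k\<bar> \<le> Z" using z RK Z_ge K_pos by linarith
    note w = near_in_window[OF k lk(1,2) zZ]
    have ev: "ev z (L + 1) (S k)"
      by (rule good_ev[OF all_good[OF lk(3)]]) (use L lk H_ge z in \<open>auto simp: xr_def\<close>)
    show ?thesis
    proof (rule obs_occupied[OF k w(1,2) ev])
      fix l assume l: "active l" "l \<noteq> v" "L + 1 \<le> S l" "S l < S k"
      show "z \<notin> B l"
      proof
        assume "z \<in> B l"
        then have "b l (k - 1) \<or> b l k"
          using b_near[OF l(1) lk(3) _ _ zZ] l window_mono[OF k, of "S l"] lk by auto
        then show False using last_burn_ge[of l "S k" b k] last_burn_ge[of l "S k" b "k - 1"] l same by (auto simp: L_def)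
      qed
    qed (use L in auto)
  qed
  show "obs k y \<noteq> 0" using main y by (simp add: L_def)
  show "y \<in> B k"
  proof (rule B_memI)
    fix z assume "min (X k) y \<le> z" "z \<le> max (X k) y"
    then have "\<bar>of_int z - xr k\<bar> \<le> \<bar>of_int y - xr k\<bar>" unfolding xr_def by linarith
    then show "obs k z \<noteq> 0" using main y by (simp add: L_def)
  qed
qed

lemma b_self: "tracked j \<Longrightarrow> active j \<Longrightarrow> b j j \<longleftrightarrow> full b (S j) j"
  using active_le(4)[of j] by (auto simp: tracked_def reaches_def)

text \<open>The margins around \<open>X j\<close> belong to no core and need an argument of their
  own. A vacancy there can only be due to fire \<open>j\<close>, since any other recent fire would
  have burnt an adjacent gap. Fire \<open>j\<close> found a small cluster, and by
  \<open>passable\<close> its hole has had time to refill.\<close>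

lemma passable_zone:
  assumes k: "active k" and tr: "\<And>l. active l \<Longrightarrow> S l < S k \<Longrightarrow> tracked l"
    and j: "lf (S k) < j" "j < rg (S k)" and p: "passable b (S k) j"
    and f: "full b (S k) (j - 1)" "full b (S k) j"
    and y: "\<bar>of_int y - xr j\<bar> \<le> real (S k) * K"
  shows "obs k y \<noteq> 0"
proof (rule ccontr)
  assume vac: "\<not> obs k y \<noteq> 0"
  have kP: "S k \<le> P" "k \<le> M" using active_le[OF k] by auto
  have L: "last_burn b (S k) (j - 1) + N + 8 \<le> S k" "last_burn b (S k) j + N + 8 \<le> S k"
    using full_iff[OF k S_pos[OF k]] f by auto
  have yZ: "\<bar>of_int y - xr j\<bar> \<le> Z" using y sK_le(1)[of "S k"] kP K_pos by linarith
  note w = near_in_window[OF k j yZ]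
  have box: "of_int \<bar>y\<bar> \<le> box" using box_of_window[OF k] w K_pos by auto
  have other: "l = j" if l: "active l" "l \<noteq> v" "S k - N - 1 \<le> S l" "S l < S k" "y \<in> B l" for l
  proof (rule ccontr)
    assume "l \<noteq> j"
    then have "b l (j - 1) \<or> b l j"
      using b_near[OF l(1) _ _ l(5) yZ] w window_mono[OF k, of "S l"] l j by auto
    then show False using last_burn_ge[of l "S k" b j] last_burn_ge[of l "S k" b "j - 1"] l L by auto
  qed
  have "ev y (S k - N - 1) (S k)"
    by (rule long_ev[OF box]) (use L H_ge kP in auto)
  then obtain l where l: "active l" "l \<noteq> v" "S k - N - 1 \<le> S l" "S l < S k" "y \<in> B l"
    using obs_occupied[OF k w(1,2), of "S k - N - 1" "S k"] vac L by auto
  then have "l = j" using other by blast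
  then have jj: "active j" "j \<noteq> v" "S k - N - 1 \<le> S j" "S j < S k" "y \<in> B j" using l by auto
  define Lj where "Lj = last_burn b (S j) j"
  \<comment> \<open>Fire \<open>j\<close> is at most \<open>N + 1\<close> rows old and gap
    \<open>j\<close> is nevertheless full, so \<open>j\<close> cannot have burnt it.\<close>
  have "\<not> b j j" using last_burn_ge[of j "S k" b j] jj L by auto
  then have nf: "\<not> full b (S j) j" using b_self[OF tr[OF jj(1,4)] jj(1)] by simp
  have Lj: "S j + 8 \<le> Lj + N" "Lj + 8 \<le> S j"
    using full_iff[OF jj(1) S_pos[OF jj(1)]] nf last_burn_8[OF jj(1)] by (auto simp: Lj_def)
  have trj: "\<And>l. active l \<Longrightarrow> S l < S j \<Longrightarrow> tracked l" using tr jj by auto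
  have close: "\<bar>of_int y - xr j\<bar> < R (S j - Lj + 2)"
    using micro_upper(3)[OF jj(1) nf trj jj(5)] by (simp add: Lj_def)
  have "2 * S j \<le> S k + Lj" using p jj Lj by (auto simp: passable_def Lj_def)
  then have long: "2 * S j + 8 \<le> S k + Lj"
    using tie_passable[OF last_burn_mem active_le(1)[OF jj(1)] kP(2), of b "S j" j] jj Lj by (auto simp: Lj_def)
  have "R (S j - Lj + 2) \<le> R (S k - (S j + 1) - 1)" by (rule R_mono) (use long jj Lj in auto)
  then have ev: "ev y (S j + 1) (S k)"
    by (intro good_ev[OF all_good[OF active_le(1)[OF jj(1)]]]) (use long Lj kP H_ge close in \<open>auto simp: xr_def\<close>)
  have "obs k y \<noteq> 0"
  proof (rule obs_occupied[OF k w(1,2) ev])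
    fix l assume "active l" "l \<noteq> v" "S j + 1 \<le> S l" "S l < S k"
    then show "y \<notin> B l" using other[of l] jj by auto
  qed (use long Lj in auto)
  then show False using vac by simp
qed

text \<open>Fire \<open>j\<close> burnt at least the ball of radius \<open>R (S j - L - 2)\<close>.
  Less time has passed since than the age of that cluster, so some site of the ball is still
  unseeded.\<close>

lemma blocked_zone:
  assumes k: "active k" and tr: "\<And>l. active l \<Longrightarrow> S l < S k \<Longrightarrow> tracked l"
    and j: "lf (S k) < j" "j < rg (S k)" and p: "\<not> passable b (S k) j" and jv: "j \<noteq> v"
  shows "\<exists>z. xr j < of_int z \<and> of_int z < xr j + K \<and> obs k z = 0"
proof -
  have kP: "S k \<le> P" "k \<le> M" using active_le[OF k] by auto
  define L where "L = last_burn b (S j) j"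
  have pp: "S j < S k" "S j < L + N" "S k + L < 2 * S j" using p by (auto simp: passable_def L_def)
  have aj: "active j" by (rule active_inside[OF k _ j]) (use pp in auto)
  have jM: "j \<le> M" using active_le[OF aj] by auto
  have trj: "\<And>l. active l \<Longrightarrow> S l < S j \<Longrightarrow> tracked l" using tr pp by auto
  have nf: "\<not> full b (S j) j" using pp by (simp add: full_def L_def)
  have L: "S j + 8 \<le> L + N" "L + 8 \<le> S j"
    using full_iff[OF aj S_pos[OF aj]] nf last_burn_8[OF aj] by (auto simp: L_def)
  have short: "S k + L + 8 \<le> 2 * S j"
    using tie_passable[OF last_burn_mem jM kP(2), of b "S j" j] pp L by (auto simp: L_def)
  have q: "S j < S k + 1" "S k + 1 \<le> H" "S k + 1 - S j + 1 = S k - S j + 2" using pp H_ge kP by auto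
  obtain z where z: "xr j < of_int z" "of_int z < xr j + R (S k - S j + 2)" "\<not> ev z (S j) (S k + 1)"
    using good_slot[OF all_good[OF jM] q(1,2), of 0] unfolding q(3) by (auto simp: xr_def)
  have R: "R (S k - S j + 2) \<le> R (S j - L - 2)" "R (S k - S j + 2) \<le> K"
    by (rule R_mono, use short pp L in auto) (rule R_le_K, use short pp L in auto)
  have "z \<in> B j" by (rule micro_lower(2)[OF aj nf trj]) (use z R in \<open>auto simp: L_def\<close>)
  then have "obs k z = 0"
    by (rule obs_vacant[OF _ jM jv pp(1) kP(2) z(3)]) auto
  then show ?thesis using z R by (intro exI[of _ z]) auto
qed


lemma locate_gap:
  "i \<le> j \<Longrightarrow> xr i \<le> y \<Longrightarrow> y \<le> xr (Suc j) \<Longrightarrow> \<exists>g. i \<le> g \<and> g \<le> j \<and> xr g \<le> y \<and> y \<le> xr (Suc g)"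
proof (induction j)
  case (Suc j)
  show ?case
  proof (cases "i \<le> j \<and> y \<le> xr (Suc j)")
    case True
    then show ?thesis using Suc le_Suc_eq by blast
  next
    case False
    then have "i = Suc j \<or> xr (Suc j) \<le> y" using Suc.prems by auto
    then show ?thesis using Suc.prems by (intro exI[of _ "Suc j"]) auto
  qed
qed auto

text \<open>Each site on the way lies in the core of a full gap or in the margin of a passable
  position. The position of the fire itself counts as passable, as the definition concerns earlier
  fires only.\<close>

lemma reaches_occupied:
  assumes k: "active k" "lf (S k) \<le> g" "g < rg (S k)" and tr: "\<And>l. active l \<Longrightarrow> S l < S k \<Longrightarrow> tracked l"
    and r: "reaches b k g"
    and y: "(k \<le> g \<and> xr k \<le> of_int y \<and> of_int y < xr (Suc g) - real (S k) * K) \<or>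
      (g < k \<and> xr g + real (S k) * K < of_int y \<and> of_int y \<le> xr k)"
  shows "obs k y \<noteq> 0"
proof -
  let ?G = "{min g k..max g (k - 1)}"
  have lk: "lf (S k) < k" "k < rg (S k)" "k \<le> M" "rg (S k) \<le> M" "S k \<le> P" using active_le[OF k(1)] by auto
  have sk: "0 \<le> real (S k) * K" "real (S k) * K \<le> Z" using sK_le[of "S k"] lk K_pos by auto
  have full: "full b (S k) h" if "h \<in> ?G" for h using r that by (auto simp: reaches_def)
  have zone: "obs k y \<noteq> 0" if p: "p = k \<or> p \<in> {min g k + 1..max g (k - 1)}" and yp: "\<bar>of_int y - xr p\<bar> \<le> real (S k) * K" for p
  proof -
    have pw: "lf (S k) < p" "p < rg (S k)" using p k lk by auto
    have "full b (S k) (p - 1) \<and> full b (S k) p \<and> passable b (S k) p"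
    proof (cases "p = k")
      case True
      have "k \<in> ?G \<or> k - 1 \<in> ?G" using lk by auto
      then have "full b (S k) k \<or> full b (S k) (k - 1)" using full by blast
      moreover have "last_burn b (S k) (k - 1) = last_burn b (S k) k" using last_burn_sides[OF k(1) tr, of k] lk by auto
      ultimately show ?thesis using True by (auto simp: full_def passable_def)
    next
      case False
      then have "p - 1 \<in> ?G" "p \<in> ?G" using p by auto
      then show ?thesis using full r p False by (auto simp: reaches_def)
    qed
    then show ?thesis using passable_zone[OF k(1) tr pw _ _ _ yp] by blast
  qed
  have "\<exists>h. min g k \<le> h \<and> h \<le> max g (k - 1) \<and> xr h \<le> of_int y \<and> of_int y \<le> xr (Suc h)"
  proof (cases "k \<le> g")
    case True
    then show ?thesis using locate_gap[of k g "real_of_int y"] y sk by (auto simp: min_def max_def)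
  next
    case False
    then have "g \<le> k - 1" "Suc (k - 1) = k" by auto
    then show ?thesis using locate_gap[of g "k - 1" "real_of_int y"] y sk False by (auto simp: min_def max_def)
  qed
  then obtain h where h: "h \<in> ?G" "xr h \<le> of_int y" "of_int y \<le> xr (Suc h)" by auto
  have hM: "h < M" using h lk k by auto
  consider "of_int y \<le> xr h + real (S k) * K" | "xr (Suc h) - real (S k) * K \<le> of_int y" | "core (S k) h y"
    unfolding core_def by (metis not_le)
  then show ?thesis
  proof cases
    case 1
    have "h = k \<or> h \<in> {min g k + 1..max g (k - 1)}" using h(1) y 1 by (cases "h = g") auto
    then show ?thesis by (rule zone) (use 1 h in auto)
  next
    case 2
    have "Suc h = k \<or> Suc h \<in> {min g k + 1..max g (k - 1)}" using h(1) y 2 by (cases "h = g") auto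
    then show ?thesis by (rule zone) (use 2 h in auto)
  next
    case 3
    show ?thesis by (rule full_core_occupied[OF k(1) _ _ full[OF h(1)] 3]) (use h k lk in auto)
  qed
qed

text \<open>Induction on the row. A fire that enters a core has passed all gaps and positions on its
  way, and an unfilled gap or a blocked position would have put a vacancy there; conversely
  \<open>reaches\<close> leaves no vacancy up to the middle of the gap.\<close>

lemma tracked: "active k \<Longrightarrow> tracked k"
proof (induction "S k" arbitrary: k rule: less_induct)
  case (less k)
  note k = less.prems
  have tr: "\<And>l. active l \<Longrightarrow> S l < S k \<Longrightarrow> tracked l" using less.hyps by blast
  have lk: "lf (S k) < k" "k < rg (S k)" "k \<le> M" "rg (S k) \<le> M" "S k \<le> P" using active_le[OF k(1)] by auto
  have sk: "0 \<le> real (S k) * K" "real (S k) * K + K \<le> Z" using sK_le[of "S k"] lk K_pos by auto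
  show ?case unfolding tracked_def
  proof (intro allI impI)
    fix g assume "lf (S k) \<le> g \<and> g < rg (S k)"
    then have g: "lf (S k) \<le> g" "g < rg (S k)" by auto
    then have gM: "g < M" using lk by auto
    have bf: "full b (S k) h" if "b k h" "lf (S k) \<le> h" "h < rg (S k)" for h
      using unfilled_not_b[OF k that(2,3) _ tr] that(1) by blast
    have whole: "\<forall>y. core (S k + 1) g y \<longrightarrow> y \<in> B k" if "b k g"
      using b_whole_core[OF that gM k] full_core_occupied[OF k g bf[OF that g]] by blast
    have "b k g = reaches b k g"
    proof
      assume bk: "b k g"
      then obtain y where y: "core (S k + 1) g y" "y \<in> B k" by (auto simp: b_def)
      have yl: "xr g + (real (S k) * K + K) < of_int y" "of_int y < xr (Suc g) - (real (S k) * K + K)"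
        using y(1) by (simp_all add: core_def algebra_simps)
      show "reaches b k g" unfolding reaches_def
      proof (intro conjI ballI)
        fix h assume h: "h \<in> {min g k..max g (k - 1)}"
        have hw: "lf (S k) \<le> h" "h < rg (S k)" using h g lk by auto
        then have hM: "h < M" using lk by auto
        have "b k h"
        proof (cases "h = g")
          case False
          note m = mid[OF hM]
          have "mid h \<in> B k"
          proof (cases "k \<le> g")
            case True
            then have "k \<le> h" "Suc h \<le> g" using h False by auto
            then have "xr k \<le> xr h" "xr (Suc h) \<le> xr g" using xr_le[of k h] xr_le[of "Suc h" g] gM hM by auto
            then have "X k \<le> mid h" "mid h \<le> y" using m yl Z_ge sk K_pos unfolding xr_def by linarith+
            then show ?thesis using B_mem[OF y(2)] by auto
          next
            case f: False
            then have "Suc h \<le> k" "Suc g \<le> h" using h False by auto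
            then have "xr (Suc h) \<le> xr k" "xr (Suc g) \<le> xr h" using xr_le[of "Suc h" k] xr_le[of "Suc g" h] lk hM by auto
            then have "mid h \<le> X k" "y \<le> mid h" using m yl Z_ge sk K_pos unfolding xr_def by linarith+
            then show ?thesis using B_mem[OF y(2)] by auto
          qed
          then show ?thesis using core_mid[OF hM, of "S k + 1"] lk by (auto simp: b_def)
        qed (simp add: bk)
        then show "full b (S k) h" using bf hw by blast
      next
        fix j assume j: "j \<in> {min g k + 1..max g (k - 1)}"
        have jw: "lf (S k) < j" "j < rg (S k)" using j g lk by auto
        show "passable b (S k) j"
        proof (rule ccontr)
          assume np: "\<not> passable b (S k) j"
          \<comment> \<open>The observed site carries the last row and can therefore never be an
            obstacle.\<close>
          have "j \<noteq> v" using np S_v lk by (auto simp: passable_def)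
          from blocked_zone[OF k tr jw np this] obtain z where
            z: "xr j < of_int z" "of_int z < xr j + K" "obs k z = 0" by blast
          show False
          proof (cases "k \<le> g")
            case True
            then have "k \<le> j" "j \<le> g" using j by auto
            then have "xr k \<le> xr j" "xr j \<le> xr g" using xr_le[of k j] xr_le[of j g] gM by auto
            then have "X k \<le> z" "z \<le> y" using z yl sk unfolding xr_def by linarith+
            then show False using B_mem[OF y(2), of z] z by auto
          next
            case False
            then have "j < k" "Suc g \<le> j" using j by auto
            then have "xr j + 3 * Z < xr k" "xr (Suc g) \<le> xr j" using xr_less[of j k] xr_le[of "Suc g" j] lk by auto
            then have "z \<le> X k" "y \<le> z" using z yl sk Z_ge K_pos unfolding xr_def by linarith+
            then show False using B_mem[OF y(2), of z] z by auto
          qed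
        qed
      qed
    next
      assume r: "reaches b k g"
      note occ = reaches_occupied[OF k g tr r]
      note m = mid[OF gM]
      have "mid g \<in> B k"
      proof (rule B_memI, rule occ)
        fix z assume z: "min (X k) (mid g) \<le> z" "z \<le> max (X k) (mid g)"
        show "(k \<le> g \<and> xr k \<le> of_int z \<and> of_int z < xr (Suc g) - real (S k) * K) \<or>
          (g < k \<and> xr g + real (S k) * K < of_int z \<and> of_int z \<le> xr k)"
        proof (cases "k \<le> g")
          case True
          then have "xr k \<le> xr g" using xr_le[of k g] gM by auto
          then have "X k \<le> mid g" using m Z_ge unfolding xr_def by linarith
          then have "X k \<le> z" "z \<le> mid g" using z by auto
          then show ?thesis using True m sk K_pos unfolding xr_def by linarith
        next
          case False
          then have "xr (Suc g) \<le> xr k" using xr_le[of "Suc g" k] lk by auto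
          then have "mid g \<le> X k" using m Z_ge unfolding xr_def by linarith
          then have "mid g \<le> z" "z \<le> X k" using z by auto
          then show ?thesis using False m sk K_pos unfolding xr_def by linarith
        qed
      qed
      then show "b k g" using core_mid[OF gM, of "S k + 1"] lk by (auto simp: b_def)
    qed
    then show "b k g = reaches b k g \<and> (b k g \<longrightarrow> (\<forall>y. core (S k + 1) g y \<longrightarrow> y \<in> B k))" using whole by blast
  qed
qed

section \<open>Shielding, and the state of the observed site\<close>

lemma tracked_reaches: "active k \<Longrightarrow> lf (S k) \<le> g \<Longrightarrow> g < rg (S k) \<Longrightarrow> b k g \<longleftrightarrow> reaches b k g"
  using tracked unfolding tracked_def by blast

lemma tracked_core:
  "active k \<Longrightarrow> lf (S k) \<le> g \<Longrightarrow> g < rg (S k) \<Longrightarrow> b k g \<Longrightarrow> core (S k + 1) g y \<Longrightarrow> y \<in> B k"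
  using tracked unfolding tracked_def by blast

lemma burns_b: "burns b"
  unfolding burns_def using tracked_reaches by blast

text \<open>The vacancy that fire \<open>j\<close> leaves for half a time unit lies between fire
  \<open>l\<close> and gap \<open>g\<close>, and the set burnt by \<open>l\<close> is
  connected.\<close>

lemma shielded:
  assumes l: "active l" and j: "j \<le> M" "j \<noteq> v" "S j < S l" "S l + 4 \<le> S j + hN" and g: "g < M"
    and sep: "(l < j \<and> j \<le> g) \<or> (g < j \<and> j < l)"
  shows "\<not> b l g"
proof
  assume "b l g"
  then obtain y where y: "core (S l + 1) g y" "y \<in> B l" by (auto simp: b_def)
  have lM: "l \<le> M" "S l \<le> P" using active_le[OF l] by auto
  have y': "xr g < of_int y" "of_int y < xr (Suc g)"
    using y(1) sK_le(2)[of "S l + 1"] unfolding core_def by linarith+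
  obtain z where z: "\<bar>of_int z - xr j\<bar> \<le> 2 * K" "\<forall>u. real (S l) * \<iota> \<le> u \<and> u \<le> (real (S l) + 1) * \<iota> \<longrightarrow> e u z = 0"
    using fire_vacancy[OF j] by blast
  note row = conjunct1[OF tm_row[OF lM(1)]] conjunct2[OF tm_row[OF lM(1)]]
  have "obs l z = 0"
    using left_limit_vacant_row[OF _ row, of z] z row unfolding obs_def by auto
  \<comment> \<open>The vacancy may be \<open>2 * K\<close> away from \<open>X j\<close>; it must
    still lie outside the core of \<open>g\<close> if \<open>j\<close> borders that gap.\<close>
  have zs: "(real (S l) + 1) * K \<ge> 2 * K" using K_pos S_ge[OF lM(1)] by (intro mult_right_mono) auto
  have "min (X l) y \<le> z \<and> z \<le> max (X l) y"
    using sep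
  proof
    assume a: "l < j \<and> j \<le> g"
    then have "xr l + 3 * Z < xr j" "xr j \<le> xr g" using xr_less[of l j] xr_le[of j g] j g by auto
    moreover have "xr g + (real (S l) + 1) * K < of_int y" using y(1) by (simp add: core_def algebra_simps)
    ultimately have "X l \<le> z" "z \<le> y" using z Z_ge zs K_pos unfolding xr_def by linarith+
    then show ?thesis by auto
  next
    assume a: "g < j \<and> j < l"
    then have "xr j + 3 * Z < xr l" "xr (Suc g) \<le> xr j" using xr_less[of j l] xr_le[of "Suc g" j] j lM by auto
    moreover have "of_int y < xr (Suc g) - (real (S l) + 1) * K" using y(1) by (simp add: core_def algebra_simps)
    ultimately have "z \<le> X l" "y \<le> z" using z Z_ge zs K_pos unfolding xr_def by linarith+
    then show ?thesis by auto
  qed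
  then show False using B_mem[OF y(2), of z] \<open>obs l z = 0\<close> by auto
qed

text \<open>Every recent fire is shielded from the span, so the span has had time to fill. The
  shielder lies between the fire and the span, which a fire strictly inside the span could not have;
  hence no recent hole is left inside and all its positions are passable.\<close>

lemma quiet_span:
  assumes k: "active k" "lf (S k) \<le> i" "j \<le> rg (S k)" "N + 8 \<le> S k"
    and sh: "\<And>l. active l \<Longrightarrow> l \<noteq> v \<Longrightarrow> S k < S l + N + 8 \<Longrightarrow> S l < S k \<Longrightarrow>
      \<exists>p\<le>M. p \<noteq> v \<and> S p < S l \<and> S l + 4 \<le> S p + hN \<and> ((l < p \<and> p \<le> i) \<or> (j \<le> p \<and> p < l))"
    and g: "i \<le> g" "g < j"
  shows "full b (S k) g" and "i < k \<Longrightarrow> k < j \<Longrightarrow> b k g"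
proof -
  have full: "full b (S k) g" if g: "i \<le> g" "g < j" for g
  proof -
    have gM: "g < M" using g k active_le[OF k(1)] by auto
    show ?thesis
    proof (cases "last_burn b (S k) g = 0")
      case True
      then show ?thesis using k by (simp add: full_def)
    next
      case False
      then obtain l where l: "active l" "l \<noteq> v" "S l < S k" "b l g" "last_burn b (S k) g = S l"
        using last_burn_cases[of b "S k" g] by metis
      show ?thesis
      proof (rule ccontr)
        assume "\<not> full b (S k) g"
        then have "S k < S l + N + 8" using l by (simp add: full_def)
        then obtain p where p: "p \<le> M" "p \<noteq> v" "S p < S l" "S l + 4 \<le> S p + hN" "(l < p \<and> p \<le> i) \<or> (j \<le> p \<and> p < l)"
          using sh[OF l(1,2)] l by blast
        have "(l < p \<and> p \<le> g) \<or> (g < p \<and> p < l)" using p(5) g by auto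
        then show False using shielded[OF l(1) p(1-4) gM] l by blast
      qed
    qed
  qed
  show "full b (S k) g" using full g .
  assume ikj: "i < k" "k < j"
  have "passable b (S k) q" if q: "i < q" "q < j" for q
  proof (rule ccontr)
    assume np: "\<not> passable b (S k) q"
    then have "S q < S k" "S k < S q + N + 8" by (auto simp: passable_def)
    moreover have "active q" using active_inside[OF k(1), of q] q k calculation by auto
    moreover have "q \<noteq> v" using \<open>S q < S k\<close> S_v active_le(2)[OF k(1)] by auto
    ultimately show False using sh[of q] q by auto
  qed
  then have "reaches b k g" unfolding reaches_def using full g ikj by auto
  then show "b k g" using tracked_reaches[OF k(1)] g k by auto
qed

text \<open>The fire that last burnt the gap of the observed site cannot have met a shielding fire
  on its way.\<close>

lemma last_burn_by_connected:
  assumes "\<not> full b P v"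
  shows "\<exists>l. active l \<and> l \<noteq> v \<and> S l < P \<and> last_burn b P v = S l \<and>
    (\<forall>j\<le>M. j \<noteq> v \<longrightarrow> (l < j \<and> j < v) \<or> (v < j \<and> j < l) \<longrightarrow> \<not> (S j < S l \<and> S l + 4 \<le> S j + hN))"
proof -
  have "last_burn b P v \<noteq> 0" using assms P_ge by (auto simp: full_def)
  then obtain l where l: "active l" "l \<noteq> v" "S l < P" "b l v" "last_burn b P v = S l"
    using last_burn_cases[of b P v] by metis
  have vM: "v < M" using v_window rg_le[of P] by auto
  show ?thesis
  proof (intro exI[of _ l] conjI allI impI notI)
    fix j assume j: "j \<le> M" "j \<noteq> v" "(l < j \<and> j < v) \<or> (v < j \<and> j < l)" "S j < S l \<and> S l + 4 \<le> S j + hN"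
    then have "(l < j \<and> j \<le> v) \<or> (v < j \<and> j < l)" by auto
    then show False using shielded[OF l(1) j(1,2) _ _ vM] j(4) l(4) by blast
  qed (use l in auto)
qed

lemma final_micro:
  assumes f: "\<not> full b P v"
  shows "\<exists>z. 0 < z - X v \<and> real_of_int (z - X v) < R (P - last_burn b P v + 2) \<and> e (tm v) z = 0"
    "\<exists>z. 0 < X v - z \<and> real_of_int (X v - z) < R (P - last_burn b P v + 2) \<and> e (tm v) z = 0"
    "\<And>y. real_of_int \<bar>y - X v\<bar> \<le> R (P - last_burn b P v - 2) \<Longrightarrow> e (tm v) y \<noteq> 0"
    "P - last_burn b P v + 8 \<le> N" "last_burn b P v + 8 \<le> P"
proof -
  have f': "\<not> full b (S v) v" using f S_v by simp
  have o: "obs v = e (tm v)" by (simp add: obs_def)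
  note mu = micro_upper(1,2)[OF active_v f' tracked, unfolded S_v o xr_def]
  show "\<exists>z. 0 < z - X v \<and> real_of_int (z - X v) < R (P - last_burn b P v + 2) \<and> e (tm v) z = 0"
    using mu(1) by force
  show "\<exists>z. 0 < X v - z \<and> real_of_int (X v - z) < R (P - last_burn b P v + 2) \<and> e (tm v) z = 0"
    using mu(2) by force
  show "e (tm v) y \<noteq> 0" if "real_of_int \<bar>y - X v\<bar> \<le> R (P - last_burn b P v - 2)" for y
    using micro_lower(1)[OF active_v f' tracked, of y] that by (simp add: S_v o xr_def)
  show "P - last_burn b P v + 8 \<le> N" using full_iff[OF active_v S_pos[OF active_v], of b v] f last_burn_8[OF active_v, of v] by (simp add: S_v)
  show "last_burn b P v + 8 \<le> P" using last_burn_8[OF active_v, of v] by (simp add: S_v)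
qed

lemma final_b: "b v v \<longleftrightarrow> full b P v"
  using b_self[OF tracked[OF active_v] active_v] by (simp add: S_v)

text \<open>The burnt cores omit the margins around the positions; these are filled in because the
  cluster is an interval.\<close>

lemma final_lower:
  assumes "lf P \<le> i" "i < j" "j \<le> rg P" "\<And>g. i \<le> g \<Longrightarrow> g < j \<Longrightarrow> b v g"
    and y: "xr i + Z \<le> of_int y" "of_int y \<le> xr j - Z"
  shows "y \<in> B v"
proof -
  have jM: "j \<le> M" using assms(3) rg_le[of P] by auto
  have core: "core (P + 1) g x \<Longrightarrow> x \<in> B v" if "i \<le> g" "g < j" for g x
    by (rule tracked_core[OF active_v, unfolded S_v, of g]) (use assms(1,3) that assms(4)[of g] in auto)
  have PZ: "real (P + 1) * K < Z" using sK_le(1)[of "P + 1"] K_pos by auto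
  note mi = mid[of i] and mj = mid[of "j - 1"]
  consider "y \<le> mid i" | "mid (j - 1) \<le> y" | "mid i \<le> y \<and> y \<le> mid (j - 1)" by linarith
  then show ?thesis
  proof cases
    case 1
    then have "core (P + 1) i y" using mi jM assms(2) y PZ Z_ge unfolding core_def by auto
    then show ?thesis using core assms(2) by auto
  next
    case 2
    then have "real_of_int (mid (j - 1)) \<le> real_of_int y" by simp
    moreover have "j - 1 < M" "Suc (j - 1) = j" using jM assms(2) by auto
    ultimately have "core (P + 1) (j - 1) y" using mj y PZ Z_ge unfolding core_def by auto
    then show ?thesis using core[of "j - 1"] assms(2) by auto
  next
    case 3
    have "mid i \<in> B v" "mid (j - 1) \<in> B v"
      by (rule core[OF _ _ core_mid]; use assms(2) jM in auto)+
    then show ?thesis using B_mem[of "mid i" v y] B_mem[of "mid (j - 1)" v y] 3 by (cases "y \<le> X v") auto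
  qed
qed

text \<open>An unburnt gap \<open>j\<close> contains no cluster site in its core, which stops the
  cluster within the margin; at the end of the window a shielding vacancy stops it.\<close>

lemma final_right_bound:
  assumes "v < j" "j \<le> rg P" "\<not> b v j \<or> j = rg P" "y \<in> B v"
  shows "of_int y \<le> xr j + Z"
proof (rule ccontr)
  assume a: "\<not> of_int y \<le> xr j + Z"
  have jM: "j \<le> M" using assms(2) rg_le[of P] by auto
  have vj: "xr v + 3 * Z < xr j" using xr_less[OF assms(1) jM] .
  show False
  proof (cases "j = rg P")
    case True
    obtain z where z: "\<bar>of_int z - xr j\<bar> \<le> 2 * K" "\<forall>u. real P * \<iota> \<le> u \<and> u \<le> (real P + 1) * \<iota> \<longrightarrow> e u z = 0"
      using window_vacancy_row[of P j] True jM by auto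
    have "e (tm v) z = 0" using z(2) tm_row[OF v_window(1)] by (auto simp: S_v)
    moreover have "X v \<le> z" "z \<le> y" using z a vj Z_ge K_pos unfolding xr_def by linarith+
    ultimately show False using B_mem[OF assms(4), of z] by (auto simp: obs_def)
  next
    case False
    then have nb: "\<not> b v j" using assms by auto
    have jM': "j < M" using False assms(2) rg_le[of P] by auto
    \<comment> \<open>\<open>Z\<close> exceeds the margin of row \<open>P + 1\<close> by more than
      one site, so this site lies in the core of gap \<open>j\<close>.\<close>
    define z where "z = \<lfloor>xr j + Z\<rfloor>"
    have z: "xr j + Z - 1 < of_int z" "of_int z \<le> xr j + Z" unfolding z_def by linarith+
    have "real (P + 1) * K + K + 1 \<le> Z" using sK_le(1)[of "P + 2"] K_pos by (auto simp: algebra_simps Z_def)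
    then have "core (P + 1) j z" using z xr_Suc[OF jM'] K_pos Z_ge unfolding core_def by linarith
    moreover have "X v \<le> z" "z \<le> y" using z a vj Z_ge unfolding xr_def by linarith+
    then have "z \<in> B v" using B_mem[OF assms(4), of z] by auto
    ultimately show False using nb by (auto simp: b_def S_v)
  qed
qed

lemma final_left_bound:
  assumes "i < v" "lf P \<le> i" "i = lf P \<or> \<not> b v (i - 1)" "y \<in> B v"
  shows "xr i - Z \<le> of_int y"
proof (rule ccontr)
  assume a: "\<not> xr i - Z \<le> of_int y"
  have iM: "i \<le> M" using assms(1) v_window by auto
  have vj: "xr i + 3 * Z < xr v" using xr_less[OF assms(1) v_window(1)] .
  show False
  proof (cases "i = lf P")
    case True
    obtain z where z: "\<bar>of_int z - xr i\<bar> \<le> 2 * K" "\<forall>u. real P * \<iota> \<le> u \<and> u \<le> (real P + 1) * \<iota> \<longrightarrow> e u z = 0"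
      using window_vacancy_row[of P i] True iM by auto
    have "e (tm v) z = 0" using z(2) tm_row[OF v_window(1)] by (auto simp: S_v)
    moreover have "z \<le> X v" "y \<le> z" using z a vj Z_ge K_pos unfolding xr_def by linarith+
    ultimately show False using B_mem[OF assms(4), of z] by (auto simp: obs_def)
  next
    case False
    then have nb: "\<not> b v (i - 1)" and i1: "Suc (i - 1) = i" "i - 1 < M" using assms iM by auto
    define z where "z = \<lceil>xr i - Z\<rceil>"
    have z: "of_int z < xr i - Z + 1" "xr i - Z \<le> of_int z" unfolding z_def by linarith+
    have "real (P + 1) * K + K + 1 \<le> Z" using sK_le(1)[of "P + 2"] K_pos by (auto simp: algebra_simps Z_def)
    then have "core (P + 1) (i - 1) z" using z xr_Suc[OF i1(2)] i1 K_pos Z_ge unfolding core_def i1(1) by linarith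
    moreover have "z \<le> X v" "y \<le> z" using z a vj Z_ge unfolding xr_def by linarith+
    then have "z \<in> B v" using B_mem[OF assms(4), of z] by auto
    ultimately show False using nb by (auto simp: b_def S_v)
  qed
qed

lemma final_fire_bound:
  assumes j: "j \<le> M" "j \<noteq> v" "S j < P" "P + 4 \<le> S j + hN" and y: "y \<in> B v"
  shows "v < j \<Longrightarrow> of_int y \<le> xr j + Z" "j < v \<Longrightarrow> xr j - Z \<le> of_int y"
proof -
  obtain z where z: "\<bar>of_int z - xr j\<bar> \<le> 2 * K" "\<forall>u. real P * \<iota> \<le> u \<and> u \<le> (real P + 1) * \<iota> \<longrightarrow> e u z = 0"
    using fire_vacancy[OF j] by blast
  have vac: "obs v z = 0" using z(2) tm_row[OF v_window(1)] by (auto simp: S_v obs_def)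
  show "of_int y \<le> xr j + Z" if "v < j"
  proof (rule ccontr)
    assume "\<not> of_int y \<le> xr j + Z"
    then have "X v \<le> z" "z \<le> y" using xr_less[OF that j(1)] z Z_ge K_pos unfolding xr_def by linarith+
    then show False using B_mem[OF y, of z] vac by auto
  qed
  show "xr j - Z \<le> of_int y" if "j < v"
  proof (rule ccontr)
    assume "\<not> xr j - Z \<le> of_int y"
    then have "z \<le> X v" "y \<le> z" using xr_less[OF that v_window(1)] z Z_ge K_pos unfolding xr_def by linarith+
    then show False using B_mem[OF y, of z] vac by auto
  qed
qed

text \<open>The run of burnt gaps around the observed site is extended on both sides until an
  unburnt gap or the end of the window.\<close>

lemma final_extent:
  assumes f: "full b P v"
  shows "\<exists>i j. lf P \<le> i \<and> i < v \<and> v < j \<and> j \<le> rg P \<and> (\<forall>g. i \<le> g \<and> g < j \<longrightarrow> b v g) \<and>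
    (\<forall>y\<in>B v. xr i - Z \<le> of_int y \<and> of_int y \<le> xr j + Z)"
proof -
  have bv: "b v v" using f final_b by simp
  \<comment> \<open>The observed site separates nothing, so the gap on its left is in the same state
    as the one on its right.\<close>
  have "last_burn b (S v) (v - 1) = last_burn b (S v) v"
    by (rule last_burn_sides[OF active_v tracked]) (use v_window in \<open>auto simp: S_v\<close>)
  then have "full b P (v - 1)" using f by (simp add: full_def S_v)
  moreover have "b v (v - 1) = reaches b v (v - 1)"
    by (rule tracked_reaches[OF active_v]) (use v_window in \<open>auto simp: S_v\<close>)
  moreover have "{min (v - 1) v..max (v - 1) (v - 1)} = {v - 1}" "{min (v - 1) v + 1..max (v - 1) (v - 1)} = {}"
    using v_window by auto
  ultimately have bv1: "b v (v - 1)" by (simp add: reaches_def S_v)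
  define j where "j = (LEAST j. v < j \<and> (j = rg P \<or> \<not> b v j))"
  have jP: "v < rg P \<and> (rg P = rg P \<or> \<not> b v (rg P))" using v_window by simp
  have j: "v < j" "j = rg P \<or> \<not> b v j" "j \<le> rg P"
    using LeastI[of "\<lambda>j. v < j \<and> (j = rg P \<or> \<not> b v j)", OF jP] Least_le[of "\<lambda>j. v < j \<and> (j = rg P \<or> \<not> b v j)", OF jP]
    unfolding j_def[symmetric] by auto
  have jb: "b v g" if "v \<le> g" "g < j" for g
    using not_less_Least[of g "\<lambda>j. v < j \<and> (j = rg P \<or> \<not> b v j)"] that bv unfolding j_def[symmetric]
    by (cases "g = v") auto
  define i where "i = (GREATEST i. i < v \<and> (i = lf P \<or> \<not> b v (i - 1)))"
  have iP: "lf P < v \<and> (lf P = lf P \<or> \<not> b v (lf P - 1))" using v_window by simp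
  have i: "i < v" "i = lf P \<or> \<not> b v (i - 1)" "lf P \<le> i"
    using GreatestI_nat[of "\<lambda>i. i < v \<and> (i = lf P \<or> \<not> b v (i - 1))", OF iP, of v]
      Greatest_le_nat[of "\<lambda>i. i < v \<and> (i = lf P \<or> \<not> b v (i - 1))", OF iP, of v]
    unfolding i_def[symmetric] by auto
  have ib: "b v g" if "i \<le> g" "g < v" for g
  proof (cases "g = v - 1")
    case False
    then have "Suc g < v" "i < Suc g" using that by auto
    then show ?thesis
      using Greatest_le_nat[of "\<lambda>i. i < v \<and> (i = lf P \<or> \<not> b v (i - 1))" "Suc g" v] unfolding i_def[symmetric] by auto
  qed (use bv1 in auto)
  have "\<forall>g. i \<le> g \<and> g < j \<longrightarrow> b v g" using ib jb by (metis not_le)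
  moreover have "\<forall>y\<in>B v. xr i - Z \<le> of_int y \<and> of_int y \<le> xr j + Z"
    using final_left_bound[OF i(1,3,2)] final_right_bound[OF j(1,3)] j(2) by blast
  ultimately show ?thesis using i j by blast
qed

end

section \<open>From the grid of cells to the tracked fires\<close>

text \<open>The infimum of the times at which the path exceeds \<open>f a\<close> is attained by
  right continuity, and it is a jump.\<close>

lemma (in counting_path) jump_exists:
  assumes "0 \<le> a" "a \<le> c" "f a < f c"
  shows "\<exists>w. a < w \<and> w \<le> c \<and> jump f w"
proof -
  define A where "A = {w. a \<le> w \<and> f a < f w}"
  have cA: "c \<in> A" using assms by (simp add: A_def)
  have bdd: "bdd_below A" by (rule bdd_belowI[of _ a]) (simp add: A_def)
  define w where "w = Inf A"
  have wc: "w \<le> c" unfolding w_def by (rule cInf_lower[OF cA bdd])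
  have aw: "a \<le> w" unfolding w_def by (rule cInf_greatest) (use cA in \<open>auto simp: A_def\<close>)
  have below: "f u = f a" if "a \<le> u" "u < w" for u
  proof -
    have "u \<notin> A" using cInf_lower[OF _ bdd, of u] that by (auto simp: w_def)
    then show ?thesis using mono_le[of a u] that assms by (auto simp: A_def)
  qed
  obtain dd where dd: "dd > 0" "\<And>s. w \<le> s \<Longrightarrow> s < w + dd \<Longrightarrow> f s = f w"
    using cadlag_right[OF cadlag, of w] aw assms by auto
  have fw: "f a < f w"
  proof (rule ccontr)
    assume n: "\<not> f a < f w"
    have "w + dd \<le> x" if "x \<in> A" for x
    proof (rule ccontr)
      assume "\<not> w + dd \<le> x"
      moreover have "w \<le> x" unfolding w_def by (rule cInf_lower[OF that bdd])
      ultimately have "f x = f w" using dd(2)[of x] by auto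
      then show False using that n by (simp add: A_def)
    qed
    then have "w + dd \<le> w" unfolding w_def using cA by (intro cInf_greatest) auto
    then show False using dd by simp
  qed
  then have "a \<noteq> w" by auto
  then have aw': "a < w" using aw by simp
  have "jump f w" unfolding jump_def
  proof (intro conjI allI impI)
    show "0 < w" using aw' assms by simp
    fix u assume u: "0 \<le> u \<and> u < w"
    have "f u \<le> f (max a u)" using mono_le[of u "max a u"] u by simp
    also have "\<dots> = f a" using below[of "max a u"] u aw' by simp
    finally show "f u < f w" using fw by simp
  qed
  then show ?thesis using aw' wc by blast
qed

text \<open>\<open>d\<close> is the width of a site measured in columns.\<close>

definition column_of :: "real \<Rightarrow> int \<Rightarrow> int" where
  "column_of d x = \<lfloor>real_of_int x * d\<rfloor>"

type_synonym config = "int \<times> nat \<Rightarrow> bool"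

definition cells :: "nat \<Rightarrow> nat \<Rightarrow> (int \<times> nat) set" where
  "cells Q P = {- int Q..<int Q} \<times> {..P}"

definition marks :: "real \<Rightarrow> real \<Rightarrow> (real \<Rightarrow> int \<Rightarrow> nat) \<Rightarrow> int \<times> nat \<Rightarrow> bool" where
  "marks d \<iota> m = (\<lambda>(c, s). \<exists>x. column_of d x = c \<and> m (real s * \<iota>) x < m ((real s + 1) * \<iota>) x)"

text \<open>A labelling of the marked cells by positions in spatial order. Excluding the outermost
  columns keeps the neighbourhoods of all positions inside the box.\<close>

definition admissible ::
  "nat \<Rightarrow> nat \<Rightarrow> nat \<Rightarrow> nat \<Rightarrow> config \<Rightarrow> nat \<Rightarrow> (nat \<Rightarrow> int) \<Rightarrow> nat \<Rightarrow> (nat \<Rightarrow> nat) \<Rightarrow> (nat \<Rightarrow> nat) \<Rightarrow> (nat \<Rightarrow> nat) \<Rightarrow> bool" where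
  "admissible N hN Q P f M cc v S lf rg \<longleftrightarrow>
     (\<forall>i j. i < j \<and> j \<le> M \<longrightarrow> cc i < cc j) \<and> cc v = 0 \<and>
     (\<forall>l\<le>M. l \<noteq> v \<longrightarrow> (cc l, S l) \<in> cells Q P \<and> f (cc l, S l)) \<and>
     (\<forall>c s. (c, s) \<in> cells Q P \<and> f (c, s) \<longrightarrow> (\<exists>l\<le>M. l \<noteq> v \<and> cc l = c \<and> S l = s)) \<and>
     (\<forall>l\<le>M. - int Q < cc l \<and> cc l < int Q - 1) \<and>
     tie_free_schedule N M v S lf rg P \<and>
     (\<forall>s j. s \<le> P \<and> j \<in> {lf s, rg s} \<longrightarrow> j \<noteq> v \<and> (s + 3 \<le> N \<or> S j < s \<and> s + 4 \<le> S j + hN)) \<and>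
     (\<forall>k\<le>M. 8 \<le> S k)"

lemma column_of_mono: "0 < d \<Longrightarrow> column_of d x < column_of d y \<Longrightarrow> x < y"
  unfolding column_of_def by (smt (verit) floor_mono mult_right_mono of_int_le_iff)

lemma column_of_bounds:
  assumes "0 < d" shows "real_of_int (column_of d x) \<le> real_of_int x * d" "real_of_int x * d < real_of_int (column_of d x) + 1"
  unfolding column_of_def by linarith+

text \<open>What holds off the exceptional set: at most one fire per site and per cell, fires far
  apart on the microscopic scale, and typical seeding around the origin and around each
  fire.\<close>

locale realization = ffp_grid n m e \<iota> N hN
  for n m e :: "real \<Rightarrow> int \<Rightarrow> nat" and \<iota> :: real and N hN :: nat +
  fixes P Q :: nat and d t :: real
  assumes m_path: "counting_path (\<lambda>t. m t i)" and m0: "m 0 i = 0"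
    and d_pos: "0 < d"
    and t: "real P * \<iota> < t" "t \<le> (real P + 1) * \<iota>"
    and d_small: "(6 * ((real P + 3) * K) + 1) * d \<le> 1 / 2"
    and Q_small: "real Q / d \<le> R N"
    and NP: "N \<le> P"
    and single: "\<bar>real_of_int x\<bar> * d \<le> real Q \<Longrightarrow> m ((real P + 1) * \<iota>) x \<le> 1"
    and sep: "\<bar>real_of_int x\<bar> * d \<le> real Q \<Longrightarrow> \<bar>real_of_int x'\<bar> * d \<le> real Q \<Longrightarrow> x \<noteq> x' \<Longrightarrow>
      0 < m ((real P + 1) * \<iota>) x \<Longrightarrow> 0 < m ((real P + 1) * \<iota>) x' \<Longrightarrow> 3 * ((real P + 3) * K) < \<bar>real_of_int x - real_of_int x'\<bar>"
    and sep0: "\<bar>real_of_int x\<bar> \<le> 3 * ((real P + 3) * K) \<Longrightarrow> m ((real P + 1) * \<iota>) x = 0"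
    and one_per_cell: "x \<noteq> x' \<Longrightarrow> column_of d x = column_of d x' \<Longrightarrow> (column_of d x, s) \<in> cells Q P \<Longrightarrow>
      m (real s * \<iota>) x < m ((real s + 1) * \<iota>) x \<Longrightarrow> m (real s * \<iota>) x' < m ((real s + 1) * \<iota>) x' \<Longrightarrow> False"
    and good_fires: "\<bar>real_of_int x\<bar> * d \<le> real Q \<Longrightarrow> 0 < m ((real P + 1) * \<iota>) x \<Longrightarrow> good (P + 1 + N) x"
    and good_0: "good (P + 1 + N) 0"
begin

lemma m_mono: "0 \<le> a \<Longrightarrow> a \<le> c \<Longrightarrow> m a x \<le> m c x"
  using counting_path.mono_le[OF m_path] by blast

lemma track:
  assumes ad: "admissible N hN Q P (marks d \<iota> m) M cc v S lf rg"
  shows "\<exists>X tm box. ffp_track n m e \<iota> N hN M v S lf rg P (P + 1 + N) X tm box \<and> X v = 0 \<and> tm v = t \<and>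
    (\<forall>l\<le>M. column_of d (X l) = cc l)"
proof -
  interpret tie_free_schedule N M v S lf rg P using ad by (simp add: admissible_def)
  have cc: "\<And>i j. i < j \<Longrightarrow> j \<le> M \<Longrightarrow> cc i < cc j" "cc v = 0"
    and mk: "\<And>l. l \<le> M \<Longrightarrow> l \<noteq> v \<Longrightarrow> (cc l, S l) \<in> cells Q P \<and> marks d \<iota> m (cc l, S l)"
    and all: "\<And>c s. (c, s) \<in> cells Q P \<Longrightarrow> marks d \<iota> m (c, s) \<Longrightarrow> \<exists>l\<le>M. l \<noteq> v \<and> cc l = c \<and> S l = s"
    and edge: "\<And>l. l \<le> M \<Longrightarrow> - int Q < cc l \<and> cc l < int Q - 1"
    and valid: "\<And>s j. s \<le> P \<Longrightarrow> j \<in> {lf s, rg s} \<Longrightarrow> j \<noteq> v \<and> (s + 3 \<le> N \<or> S j < s \<and> s + 4 \<le> S j + hN)"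
    and S8: "\<And>k. k \<le> M \<Longrightarrow> 8 \<le> S k"
    using ad unfolding admissible_def by blast+
  have i0: "0 \<le> \<iota>" "0 < \<iota>" using \<iota>_pos by auto
  define ZZ where "ZZ = (real P + 3) * K"
  have ZZ: "3 * K \<le> ZZ" using K_pos mult_right_mono[of 3 "real P + 3" K] by (simp add: ZZ_def)
  have inc_jump: "\<exists>w. real s * \<iota> < w \<and> w \<le> (real s + 1) * \<iota> \<and> jump (\<lambda>t. m t x) w"
    if "m (real s * \<iota>) x < m ((real s + 1) * \<iota>) x" for s x
    using counting_path.jump_exists[OF m_path _ _ that] i0 by (auto simp: algebra_simps)
  have "\<forall>l. \<exists>x w. l \<le> M \<and> l \<noteq> v \<longrightarrow> column_of d x = cc l \<and> m (real (S l) * \<iota>) x < m ((real (S l) + 1) * \<iota>) x \<and>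
      real (S l) * \<iota> < w \<and> w \<le> (real (S l) + 1) * \<iota> \<and> jump (\<lambda>t. m t x) w"
  proof
    fix l
    show "\<exists>x w. l \<le> M \<and> l \<noteq> v \<longrightarrow> column_of d x = cc l \<and> m (real (S l) * \<iota>) x < m ((real (S l) + 1) * \<iota>) x \<and>
      real (S l) * \<iota> < w \<and> w \<le> (real (S l) + 1) * \<iota> \<and> jump (\<lambda>t. m t x) w"
    proof (cases "l \<le> M \<and> l \<noteq> v")
      case True
      then obtain x where "column_of d x = cc l" "m (real (S l) * \<iota>) x < m ((real (S l) + 1) * \<iota>) x"
        using mk[of l] by (auto simp: marks_def)
      then show ?thesis using inc_jump[of "S l" x] by blast
    qed blast
  qed
  then obtain X' tm' where XT: "\<And>l. l \<le> M \<Longrightarrow> l \<noteq> v \<Longrightarrow> column_of d (X' l) = cc l \<and> m (real (S l) * \<iota>) (X' l) < m ((real (S l) + 1) * \<iota>) (X' l) \<and>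
      real (S l) * \<iota> < tm' l \<and> tm' l \<le> (real (S l) + 1) * \<iota> \<and> jump (\<lambda>t. m t (X' l)) (tm' l)"
    by metis
  define X where "X l = (if l = v then 0 else X' l)" for l
  define tm where "tm l = (if l = v then t else tm' l)" for l
  \<comment> \<open>The sites of the columns allowed for positions, enlarged by
    \<open>2 * K\<close>; this enlargement is at most half a column, so the box stays within the
    \<open>Q\<close> columns on either side.\<close>
  define box where "box = (real Q - 1) / d + 2 * K"
  have Kd: "2 * K * d \<le> 1 / 2"
  proof -
    have "2 * K \<le> 6 * ZZ + 1" using ZZ K_pos by linarith
    then have "2 * K * d \<le> (6 * ZZ + 1) * d" using d_pos by (intro mult_right_mono) auto
    then show ?thesis using d_small by (simp add: ZZ_def)
  qed
  have boxd: "box * d = real Q - 1 + 2 * K * d" unfolding box_def distrib_right using d_pos by simp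
  have colX: "column_of d (X l) = cc l" if "l \<le> M" for l
    using XT[OF that] cc(2) by (auto simp: X_def column_of_def)
  have inbox: "real_of_int \<bar>X l\<bar> * d \<le> real Q - 1" if l: "l \<le> M" for l
  proof -
    have "real_of_int (cc l) \<le> real_of_int (X l) * d" "real_of_int (X l) * d < real_of_int (cc l) + 1"
      using column_of_bounds[OF d_pos, of "X l"] colX[OF l] by auto
    moreover have "- real Q + 1 \<le> real_of_int (cc l)" "real_of_int (cc l) + 1 \<le> real Q - 1"
      using edge[OF l] by linarith+
    ultimately have "- (real Q - 1) \<le> real_of_int (X l) * d" "real_of_int (X l) * d \<le> real Q - 1" by auto
    then show ?thesis using d_pos by (cases "0 \<le> X l") auto
  qed
  have jumppos: "0 < m ((real P + 1) * \<iota>) (X l)" if "l \<le> M" "l \<noteq> v" for l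
  proof -
    have "m ((real (S l) + 1) * \<iota>) (X l) \<le> m ((real P + 1) * \<iota>) (X l)"
      using S_le[OF that(1)] i0 by (intro m_mono mult_right_mono) auto
    then show ?thesis using XT[OF that] that by (auto simp: X_def)
  qed
  have bQ: "\<bar>real_of_int x\<bar> * d \<le> real Q" if "of_int \<bar>x\<bar> \<le> box" for x
  proof -
    have "\<bar>of_int x\<bar> * d \<le> box * d" using that d_pos by (intro mult_right_mono) auto
    then show ?thesis using boxd Kd by simp
  qed
  have XQ: "\<bar>real_of_int (X l)\<bar> * d \<le> real Q" if "l \<le> M" for l using inbox[OF that] by simp
  have Qd: "real Q / d \<le> R N" by (rule Q_small)
  have "ffp_track n m e \<iota> N hN M v S lf rg P (P + 1 + N) X tm box"
  proof
    show "P + 1 + N \<le> P + 1 + N" "N \<le> P" using NP by auto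
    fix l assume l: "l \<le> M"
    show "real (S l) * \<iota> < tm l \<and> tm l \<le> (real (S l) + 1) * \<iota>"
      using XT[OF l] t S_v by (auto simp: tm_def)
    show "jump (\<lambda>t. m t (X l)) (tm l)" if "l \<noteq> v" using XT[OF l that] that by (simp add: tm_def X_def)
    show "of_int \<bar>X l\<bar> + 2 * K \<le> box"
      using pos_le_divide_eq[OF d_pos, THEN iffD2, OF inbox[OF l]] unfolding box_def by linarith
    show "good (P + 1 + N) (X l)"
    proof (cases "l = v")
      case True then show ?thesis using good_0 by (simp add: X_def)
    next
      case False show ?thesis by (rule good_fires[OF XQ[OF l] jumppos[OF l False]])
    qed
  next
    fix x w assume x: "jump (\<lambda>t. m t x) w" "of_int \<bar>x\<bar> \<le> box" "w \<le> (real P + 1) * \<iota>"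
    have w0: "0 < w" using x(1) by (simp add: jump_def)
    obtain s where s: "real s * \<iota> < w" "w \<le> (real s + 1) * \<iota>" using row_exists[OF i0(2) w0] by blast
    have sP: "s \<le> P" by (rule row_unique[OF i0(2) s(1) x(3)])
    have s0: "0 \<le> real s * \<iota>" using i0 by simp
    have "m (real s * \<iota>) x < m w x" using x(1) s s0 by (simp add: jump_def)
    also have "m w x \<le> m ((real s + 1) * \<iota>) x" using s w0 by (intro m_mono) auto
    finally have inc: "m (real s * \<iota>) x < m ((real s + 1) * \<iota>) x" .
    have xd: "\<bar>real_of_int x\<bar> * d < real Q"
    proof -
      have "\<bar>of_int x\<bar> * d \<le> box * d" using x(2) d_pos by (intro mult_right_mono) auto
      then show ?thesis using boxd Kd by simp
    qed
    have "- real Q \<le> real_of_int x * d" "real_of_int x * d < real Q"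
      using xd abs_mult[of "real_of_int x" d] d_pos by linarith+
    then have cell: "(column_of d x, s) \<in> cells Q P" using sP by (auto simp: cells_def column_of_def le_floor_iff floor_less_iff)
    have "marks d \<iota> m (column_of d x, s)" using inc by (auto simp: marks_def)
    from all[OF cell this] obtain l where l: "l \<le> M" "l \<noteq> v" "cc l = column_of d x" "S l = s" by blast
    have xX: "x = X l"
    proof (rule ccontr)
      assume "x \<noteq> X l"
      then have "x \<noteq> X' l" using l by (simp add: X_def)
      then show False
        using one_per_cell[of x "X' l" s] XT[OF l(1,2)] l(3,4) cell inc by simp
    qed
    moreover have "w = tm l"
    proof (rule ccontr)
      assume ne: "w \<noteq> tm l"
      have j2: "jump (\<lambda>t. m t x) (tm l)" "tm l \<le> (real P + 1) * \<iota>"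
      proof -
        show "jump (\<lambda>t. m t x) (tm l)" using XT[OF l(1,2)] l xX by (simp add: X_def tm_def)
        have "(real (S l) + 1) * \<iota> \<le> (real P + 1) * \<iota>" using S_le[OF l(1)] i0 by (intro mult_right_mono) auto
        then show "tm l \<le> (real P + 1) * \<iota>" using XT[OF l(1,2)] l by (auto simp: tm_def)
      qed
      \<comment> \<open>Two different jumps at one site would push its count to 2.\<close>
      define a c where "a = min w (tm l)" and "c = max w (tm l)"
      have ja: "jump (\<lambda>t. m t x) a" "jump (\<lambda>t. m t x) c" "a < c" "c \<le> (real P + 1) * \<iota>"
        using x j2 ne by (auto simp: a_def c_def min_def max_def)
      have "m 0 x < m a x" "m a x < m c x" using ja(1,2,3) by (auto simp: jump_def)
      moreover have "m c x \<le> m ((real P + 1) * \<iota>) x" using ja by (intro m_mono) (auto simp: jump_def)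
      ultimately show False using single[OF bQ[OF x(2)]] by simp
    qed
    ultimately show "\<exists>l\<le>M. l \<noteq> v \<and> x = X l \<and> w = tm l" using l by blast
  next
    fix l assume l: "l < M"
    have "column_of d (X l) < column_of d (X (Suc l))" using colX[of l] colX[of "Suc l"] cc(1)[of l "Suc l"] l by simp
    then have lt: "X l < X (Suc l)" by (rule column_of_mono[OF d_pos])
    have "3 * ((real P + 3) * K) < \<bar>real_of_int (X l) - real_of_int (X (Suc l))\<bar>"
    proof -
      consider "l = v" | "Suc l = v" | "l \<noteq> v" "Suc l \<noteq> v" by blast
      then show ?thesis
      proof cases
        case 1
        then have "0 < m ((real P + 1) * \<iota>) (X (Suc l))" using jumppos[of "Suc l"] l by auto
        then have "\<not> \<bar>real_of_int (X (Suc l))\<bar> \<le> 3 * ((real P + 3) * K)" using sep0[of "X (Suc l)"] by auto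
        then show ?thesis using 1 by (simp add: X_def)
      next
        case 2
        then have "0 < m ((real P + 1) * \<iota>) (X l)" using jumppos[of l] l by auto
        then have "\<not> \<bar>real_of_int (X l)\<bar> \<le> 3 * ((real P + 3) * K)" using sep0[of "X l"] by auto
        then show ?thesis using 2 by (simp add: X_def)
      next
        case 3
        show ?thesis by (rule sep) (use XQ jumppos 3 l lt in auto)
      qed
    qed
    then show "real_of_int (X l) + 3 * ((real P + 3) * K) < real_of_int (X (Suc l))" using lt by simp
  next
    fix x p q assume x: "of_int \<bar>x\<bar> \<le> box" and pq: "p + N < q" "q \<le> P + 1 + N"
    \<comment> \<open>The box has radius at most \<open>R N\<close>, so good seeding around the
      origin alone covers all of it.\<close>
    have "\<bar>real_of_int x\<bar> * d \<le> real Q" using bQ[OF x] .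
    then have "\<bar>real_of_int x\<bar> \<le> real Q / d" using d_pos by (simp add: field_simps)
    also have "\<dots> \<le> R N" by (rule Qd)
    also have "\<dots> \<le> R (q - p - 1)" by (rule R_mono) (use pq in auto)
    finally show "ev x p q" by (intro good_ev[OF good_0]) (use pq in auto)
  qed (use valid S8 in auto)
  then show ?thesis using colX by (intro exI[of _ X] exI[of _ tm] exI[of _ box]) (auto simp: X_def tm_def)
qed


abbreviation cl :: "int set" where "cl \<equiv> cluster (e t) 0"

lemma track_cluster:
  assumes "ffp_track n m e \<iota> N hN M v S lf rg P H X tm bx" "X v = 0" "tm v = t"
  shows "cl = ffp_track.B e v X tm v"
proof -
  interpret ffp_track n m e \<iota> N hN M v S lf rg P H X tm bx by (rule assms(1))
  show ?thesis unfolding B_def obs_def using assms by (auto simp: mem_cluster_iff)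
qed

end

section \<open>Cluster sizes read off from the burnt gaps\<close>

definition fin_macro :: "nat \<Rightarrow> real \<Rightarrow> nat \<Rightarrow> (nat \<Rightarrow> int) \<Rightarrow> nat \<Rightarrow> (nat \<Rightarrow> nat) \<Rightarrow> (nat \<Rightarrow> nat) \<Rightarrow> (nat \<Rightarrow> nat \<Rightarrow> bool) \<Rightarrow> bool" where
  "fin_macro N \<theta> P cc v lf rg b \<longleftrightarrow> (\<exists>i j. lf P \<le> i \<and> i < v \<and> v < j \<and> j \<le> rg P \<and> (\<forall>g. i \<le> g \<and> g < j \<longrightarrow> b v g) \<and>
     \<theta> * real N \<le> real_of_int (cc j - cc i))"

text \<open>The exponent of a small cluster is its age in units of \<open>N\<close> rows.\<close>

definition fin_micro :: "nat \<Rightarrow> real \<Rightarrow> real \<Rightarrow> nat \<Rightarrow> nat \<Rightarrow> nat \<Rightarrow> (nat \<Rightarrow> nat) \<Rightarrow> (nat \<Rightarrow> nat) \<Rightarrow> (nat \<Rightarrow> nat) \<Rightarrow> (nat \<Rightarrow> nat \<Rightarrow> bool) \<Rightarrow> bool" where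
  "fin_micro N \<alpha> \<beta> P M v S lf rg b \<longleftrightarrow> \<not> schedule.full N M v S lf rg b P v \<and>
     \<alpha> * real N \<le> real P - real (schedule.last_burn M v S lf rg b P v) \<and>
     real P - real (schedule.last_burn M v S lf rg b P v) \<le> \<beta> * real N"

lemma numel_le:
  assumes "\<And>y. y \<in> A \<Longrightarrow> a \<le> real_of_int y \<and> real_of_int y \<le> c" "a \<le> c + 1"
  shows "numel A \<le> ennreal (c - a + 1)"
proof -
  have "A \<subseteq> {\<lceil>a\<rceil>..\<lfloor>c\<rfloor>}" using assms(1) by (auto simp: ceiling_le_iff le_floor_iff)
  then have "numel A \<le> numel {\<lceil>a\<rceil>..\<lfloor>c\<rfloor>}" unfolding numel_def by (intro emeasure_mono) auto
  also have "\<dots> = ennreal (real (nat (\<lfloor>c\<rfloor> - \<lceil>a\<rceil> + 1)))"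
    unfolding numel_def by (subst emeasure_count_space_finite) (auto simp: ennreal_of_nat_eq_real_of_nat)
  also have "\<dots> \<le> ennreal (c - a + 1)" by (rule ennreal_leI) (use assms(2) in linarith)
  finally show ?thesis .
qed

lemma numel_ge:
  assumes "\<And>y. a \<le> real_of_int y \<Longrightarrow> real_of_int y \<le> c \<Longrightarrow> y \<in> A"
  shows "ennreal (c - a - 1) \<le> numel A"
proof -
  have "ennreal (c - a - 1) \<le> ennreal (real (nat (\<lfloor>c\<rfloor> - \<lceil>a\<rceil> + 1)))" by (rule ennreal_leI) linarith
  also have "\<dots> = numel {\<lceil>a\<rceil>..\<lfloor>c\<rfloor>}"
    unfolding numel_def by (subst emeasure_count_space_finite) (auto simp: ennreal_of_nat_eq_real_of_nat)
  also have "\<dots> \<le> numel A" unfolding numel_def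
  proof (rule emeasure_mono)
    show "{\<lceil>a\<rceil>..\<lfloor>c\<rfloor>} \<subseteq> A" using assms by (auto simp: ceiling_le_iff le_floor_iff)
  qed auto
  finally show ?thesis .
qed

locale tracked_realization = realization n m e \<iota> N hN P Q d t + ffp_track n m e \<iota> N hN M v S lf rg P "P + 1 + N" X tm bx
  for n m e :: "real \<Rightarrow> int \<Rightarrow> nat" and \<iota> :: real and N hN P Q :: nat and d t :: real
    and M v :: nat and S lf rg :: "nat \<Rightarrow> nat" and X :: "nat \<Rightarrow> int" and tm :: "nat \<Rightarrow> real" and bx :: real +
  fixes cc :: "nat \<Rightarrow> int"
  assumes adm: "admissible N hN Q P (marks d \<iota> m) M cc v S lf rg"
    and Xv: "X v = 0" and tmv: "tm v = t" and col: "l \<le> M \<Longrightarrow> column_of d (X l) = cc l"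
begin

abbreviation "f \<equiv> marks d \<iota> m"

lemma cl_eq: "cl = B v"
  by (rule track_cluster[OF ffp_track_axioms Xv tmv])

lemma cc_less: "i < j \<Longrightarrow> j \<le> M \<Longrightarrow> cc i < cc j" and cc_v: "cc v = 0"
  and marked: "l \<le> M \<Longrightarrow> l \<noteq> v \<Longrightarrow> (cc l, S l) \<in> cells Q P \<and> f (cc l, S l)"
  and all_marked: "(c, s) \<in> cells Q P \<Longrightarrow> f (c, s) \<Longrightarrow> \<exists>l\<le>M. l \<noteq> v \<and> cc l = c \<and> S l = s"
  using adm unfolding admissible_def by blast+

lemma cc_iff: "i \<le> M \<Longrightarrow> j \<le> M \<Longrightarrow> cc i < cc j \<longleftrightarrow> i < j"
  using cc_less[of i j] cc_less[of j i] by (cases i j rule: linorder_cases) auto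

lemma Zd: "(6 * Z + 1) * d \<le> 1 / 2" "0 \<le> Z * d" "d \<le> 1 / 2" "Z * d \<le> 1 / 12"
proof -
  show a: "(6 * Z + 1) * d \<le> 1 / 2" using d_small by (simp add: Z_def)
  show b: "0 \<le> Z * d" using Z_ge d_pos by simp
  from a b d_pos show "d \<le> 1 / 2" "Z * d \<le> 1 / 12" by (simp_all add: algebra_simps)
qed

lemma xrd: "l \<le> M \<Longrightarrow> of_int (cc l) \<le> xr l * d \<and> xr l * d < of_int (cc l) + 1"
  using column_of_bounds[OF d_pos, of "X l"] col[of l] by (simp add: xr_def)

lemma lfP: "lf P \<le> M" "rg P \<le> M" using v_window rg_le[of P] by auto

lemma size_le:
  assumes "i \<le> M" "j \<le> M" "i < j" "\<And>y. y \<in> cl \<Longrightarrow> xr i - Z \<le> of_int y \<and> of_int y \<le> xr j + Z"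
  shows "numel cl \<le> ennreal ((real_of_int (cc j - cc i) + 2) / d)"
proof -
  have "xr i \<le> xr j" using xr_le[of i j] assms by simp
  then have "numel cl \<le> ennreal ((xr j + Z) - (xr i - Z) + 1)" using Z_ge by (intro numel_le assms(4)) auto
  also have "\<dots> \<le> ennreal ((real_of_int (cc j - cc i) + 2) / d)"
  proof (rule ennreal_leI)
    have "((xr j + Z) - (xr i - Z) + 1) * d = xr j * d - xr i * d + 2 * (Z * d) + d" by (simp add: algebra_simps)
    also have "\<dots> \<le> real_of_int (cc j - cc i) + 2" using xrd[OF assms(1)] xrd[OF assms(2)] Zd by simp
    finally show "(xr j + Z) - (xr i - Z) + 1 \<le> (of_int (cc j - cc i) + 2) / d"
      using d_pos by (simp add: pos_le_divide_eq)
  qed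
  finally show ?thesis .
qed

lemma size_ge:
  assumes "lf P \<le> i" "i < j" "j \<le> rg P" "\<And>g. i \<le> g \<Longrightarrow> g < j \<Longrightarrow> b v g"
  shows "ennreal ((real_of_int (cc j - cc i) - 2) / d) \<le> numel cl"
proof -
  have ij: "i \<le> M" "j \<le> M" using assms lfP by auto
  have "ennreal ((of_int (cc j - cc i) - 2) / d) \<le> ennreal ((xr j - Z) - (xr i + Z) - 1)"
  proof (rule ennreal_leI)
    have "of_int (cc j - cc i) - 2 \<le> xr j * d - xr i * d - 2 * (Z * d) - d" using xrd[OF ij(1)] xrd[OF ij(2)] Zd by simp
    also have "\<dots> = ((xr j - Z) - (xr i + Z) - 1) * d" by (simp add: algebra_simps)
    finally show "(of_int (cc j - cc i) - 2) / d \<le> (xr j - Z) - (xr i + Z) - 1"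
      using d_pos by (simp add: pos_divide_le_eq)
  qed
  also have "\<dots> \<le> numel cl" unfolding cl_eq by (rule numel_ge) (rule final_lower[OF assms])
  finally show ?thesis .
qed

lemma small_size:
  assumes "\<not> full b P v"
  shows "numel cl \<le> ennreal (R (P - last_burn b P v + 3))" "ennreal (R (P - last_burn b P v - 2)) \<le> numel cl"
proof -
  let ?z = "P - last_burn b P v"
  obtain z1 z2 where z: "0 < z1" "real_of_int z1 < R (?z + 2)" "e t z1 = 0" "z2 < 0" "real_of_int (- z2) < R (?z + 2)" "e t z2 = 0"
    using final_micro(1,2)[OF assms] by (auto simp: Xv tmv)
  have "z2 < y \<and> y < z1" if "y \<in> cl" for y
    using that z conn_mem[of "e t" 0 y z1] conn_mem[of "e t" 0 y z2] by (force simp: mem_cluster_iff)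
  then have i: "real_of_int z2 + 1 \<le> real_of_int y \<and> real_of_int y \<le> real_of_int z1 - 1" if "y \<in> cl" for y
    using that by force
  have "numel cl \<le> ennreal ((real_of_int z1 - 1) - (real_of_int z2 + 1) + 1)"
    by (rule numel_le[OF i]) (use z in auto)
  also have "\<dots> \<le> ennreal (R (?z + 3))"
  proof (rule ennreal_leI)
    \<comment> \<open>The factor 2 for the two sides of the origin costs one more row.\<close>
    have "2 \<le> exp \<iota>" using exp_ge_add_one_self[of \<iota>] \<iota>_pos by linarith
    then have "2 * R (?z + 2) \<le> exp \<iota> * R (?z + 2)" using R_pos[of "?z + 2"] by (intro mult_right_mono) auto
    also have "\<dots> = R (?z + 3)" by (simp add: R_def exp_add[symmetric] algebra_simps)
    finally show "(real_of_int z1 - 1) - (real_of_int z2 + 1) + 1 \<le> R (?z + 3)" using z by simp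
  qed
  finally show "numel cl \<le> ennreal (R (?z + 3))" .
  have "y \<in> cl" if "- R (?z - 2) \<le> real_of_int y" "real_of_int y \<le> R (?z - 2)" for y
    unfolding mem_cluster_iff conn_def
  proof (intro allI impI)
    fix x assume "min 0 y \<le> x \<and> x \<le> max 0 y"
    then have "real_of_int \<bar>x - X v\<bar> \<le> R (?z - 2)" using that Xv by linarith
    then show "e t x \<noteq> 0" using final_micro(3)[OF assms, of x] tmv by simp
  qed
  from numel_ge[of "- R (?z - 2)" "R (?z - 2)" cl, OF this] have "ennreal (R (?z - 2) - - R (?z - 2) - 1) \<le> numel cl" by simp
  moreover have "ennreal (R (?z - 2)) \<le> ennreal (R (?z - 2) - - R (?z - 2) - 1)" using R_pos[of "?z - 2"] by (intro ennreal_leI) auto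
  ultimately show "ennreal (R (?z - 2)) \<le> numel cl" by (rule order_trans[rotated])
qed

lemma R_le_3Z: "q + 1 \<le> N \<Longrightarrow> R q \<le> Z"
  using R_le_K[of q] Z_ge K_pos by linarith

text \<open>Columns give the length of the burnt run up to an error of 2, and no difference of
  marked columns comes within 3 of the threshold. An unfilled gap at the origin is excluded, as
  \<open>Z\<close> is less than a column.\<close>

lemma macro_iff:
  assumes \<theta>: "1 < \<theta> * real N"
    and tie: "\<And>c s c' s'. (c, s) \<in> cells Q P \<Longrightarrow> f (c, s) \<Longrightarrow> (c', s') \<in> cells Q P \<Longrightarrow> f (c', s') \<Longrightarrow> c < c' \<Longrightarrow>
       3 < \<bar>real_of_int (c' - c) - \<theta> * real N\<bar>"
  shows "ennreal (\<theta> * real N / d) \<le> numel cl \<longleftrightarrow> fin_macro N \<theta> P cc v lf rg b"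
proof
  assume E: "ennreal (\<theta> * real N / d) \<le> numel cl"
  have f: "full b P v"
  proof (rule ccontr)
    assume nf: "\<not> full b P v"
    have "numel cl \<le> ennreal (R (P - last_burn b P v + 3))" by (rule small_size(1)[OF nf])
    also have "\<dots> \<le> ennreal Z" using final_micro(4)[OF nf] by (intro ennreal_leI R_le_3Z) auto
    also have "\<dots> < ennreal (\<theta> * real N / d)"
    proof (rule ennreal_lessI)
      have "Z * d < \<theta> * real N" using Zd \<theta> by linarith
      then show "Z < \<theta> * real N / d" using d_pos by (simp add: pos_less_divide_eq)
    qed (use \<theta> d_pos in auto)
    finally show False using E by simp
  qed
  obtain i j where ij: "lf P \<le> i" "i < v" "v < j" "j \<le> rg P" "\<forall>g. i \<le> g \<and> g < j \<longrightarrow> b v g"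
    "\<forall>y\<in>B v. xr i - Z \<le> of_int y \<and> of_int y \<le> xr j + Z"
    using final_extent[OF f] by blast
  have M: "i \<le> M" "j \<le> M" using ij lfP v_window by auto
  have "numel cl \<le> ennreal ((real_of_int (cc j - cc i) + 2) / d)"
    by (rule size_le) (use ij M cl_eq in auto)
  with E have "ennreal (\<theta> * real N / d) \<le> ennreal ((real_of_int (cc j - cc i) + 2) / d)" by (rule order_trans)
  moreover have ccij: "cc i < cc j" using cc_less[of i j] ij M by auto
  ultimately have "\<theta> * real N / d \<le> (real_of_int (cc j - cc i) + 2) / d" using d_pos by (subst (asm) ennreal_le_iff) auto
  then have "\<theta> * real N \<le> real_of_int (cc j - cc i) + 2" using d_pos by (simp add: divide_le_cancel)
  moreover have "3 < \<bar>real_of_int (cc j - cc i) - \<theta> * real N\<bar>"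
    using tie[of "cc i" "S i" "cc j" "S j"] marked[of i] marked[of j] ij M ccij by auto
  ultimately have "\<theta> * real N \<le> real_of_int (cc j - cc i)" by linarith
  then show "fin_macro N \<theta> P cc v lf rg b" unfolding fin_macro_def using ij by blast
next
  assume "fin_macro N \<theta> P cc v lf rg b"
  then obtain i j where ij: "lf P \<le> i" "i < v" "v < j" "j \<le> rg P" "\<forall>g. i \<le> g \<and> g < j \<longrightarrow> b v g"
     "\<theta> * real N \<le> real_of_int (cc j - cc i)"
    unfolding fin_macro_def by blast
  have M: "i \<le> M" "j \<le> M" using ij lfP v_window by auto
  have ccij: "cc i < cc j" using cc_less[of i j] ij M by auto
  have "3 < \<bar>real_of_int (cc j - cc i) - \<theta> * real N\<bar>"
    using tie[of "cc i" "S i" "cc j" "S j"] marked[of i] marked[of j] ij M ccij by auto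
  then have "\<theta> * real N \<le> real_of_int (cc j - cc i) - 2" using ij by linarith
  then have "ennreal (\<theta> * real N / d) \<le> ennreal ((real_of_int (cc j - cc i) - 2) / d)"
    using d_pos by (intro ennreal_leI divide_right_mono) auto
  also have "\<dots> \<le> numel cl" by (rule size_ge) (use ij in auto)
  finally show "ennreal (\<theta> * real N / d) \<le> numel cl" .
qed

text \<open>A cluster in a full gap is at least \<open>Z\<close> long, beyond the range. Otherwise
  the exponent is the age up to 3 rows, and no marked row lies within 5 of a threshold.\<close>

lemma micro_iff:
  assumes ab: "0 \<le> \<alpha>" "\<alpha> < \<beta>" "\<beta> * real N + 1 < real N"
    and tie: "\<And>c s. (c, s) \<in> cells Q P \<Longrightarrow> f (c, s) \<Longrightarrow> 5 \<le> \<bar>real P - real s - \<beta> * real N\<bar> \<and> (0 < \<alpha> \<longrightarrow> 5 \<le> \<bar>real P - real s - \<alpha> * real N\<bar>)"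
  shows "numel cl \<in> {ennreal (exp (\<alpha> * real N * \<iota>))..ennreal (exp (\<beta> * real N * \<iota>))} \<longleftrightarrow> fin_micro N \<alpha> \<beta> P M v S lf rg b"
proof (cases "full b P v")
  case True
  obtain i j where ij: "lf P \<le> i" "i < v" "v < j" "j \<le> rg P" "\<forall>g. i \<le> g \<and> g < j \<longrightarrow> b v g"
    using final_extent[OF True] by blast
  have M: "i \<le> M" "j \<le> M" using ij lfP v_window by auto
  have "xr i + 3 * Z < xr v" "xr v + 3 * Z < xr j" using xr_less ij M v_window by auto
  then have "Z \<le> (xr j - Z) - (xr i + Z) - 1" using Z_ge by linarith
  then have "ennreal Z \<le> ennreal ((xr j - Z) - (xr i + Z) - 1)" by (rule ennreal_leI)
  also have "\<dots> \<le> numel cl" unfolding cl_eq by (rule numel_ge) (rule final_lower, use ij in auto)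
  finally have 1: "ennreal Z \<le> numel cl" .
  have "exp (\<beta> * real N * \<iota>) < R (N - 1)"
    unfolding R_def exp_less_cancel_iff using ab N_eq hN_ge \<iota>_nonneg by (intro mult_strict_right_mono) (auto simp: of_nat_diff)
  also have "\<dots> \<le> Z" using Z_ge K_pos by (simp add: K_def)
  finally have "ennreal (exp (\<beta> * real N * \<iota>)) < ennreal Z" by (intro ennreal_lessI) (use Z_ge in auto)
  with 1 have "\<not> numel cl \<le> ennreal (exp (\<beta> * real N * \<iota>))" by auto
  then show ?thesis using True by (simp add: fin_micro_def)
next
  case False
  let ?z = "P - last_burn b P v"
  note fm = final_micro(4,5)[OF False]
  have rz: "real ?z = real P - real (last_burn b P v)" using fm by (simp add: of_nat_diff)
  obtain l where l: "active l" "l \<noteq> v" "last_burn b P v = S l" using last_burn_by_connected[OF False] by blast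
  have t: "5 \<le> \<bar>real ?z - \<beta> * real N\<bar> \<and> (0 < \<alpha> \<longrightarrow> 5 \<le> \<bar>real ?z - \<alpha> * real N\<bar>)"
    using tie[of "cc l" "S l"] marked[OF active_le(1)[OF l(1)] l(2)] l(3) rz by auto
  have up: "numel cl \<le> ennreal (exp ((real ?z + 3) * \<iota>))" using small_size(1)[OF False] by (simp add: R_def algebra_simps)
  have lo: "ennreal (exp ((real ?z - 2) * \<iota>)) \<le> numel cl"
    using small_size(2)[OF False] fm by (simp add: R_def of_nat_diff algebra_simps)
  have i0: "0 < \<iota>" using \<iota>_nonneg by simp
  have exp_cmp: "x < y \<Longrightarrow> exp (x * \<iota>) < exp (y * \<iota>)" "x \<le> y \<Longrightarrow> exp (x * \<iota>) \<le> exp (y * \<iota>)" for x y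
    using i0 by auto
  have b_iff: "numel cl \<le> ennreal (exp (\<beta> * real N * \<iota>)) \<longleftrightarrow> real ?z \<le> \<beta> * real N"
  proof
    assume a: "numel cl \<le> ennreal (exp (\<beta> * real N * \<iota>))"
    show "real ?z \<le> \<beta> * real N"
    proof (rule ccontr)
      assume "\<not> real ?z \<le> \<beta> * real N"
      then have "\<beta> * real N < real ?z - 2" using t by linarith
      then have "ennreal (exp (\<beta> * real N * \<iota>)) < ennreal (exp ((real ?z - 2) * \<iota>))"
        by (intro ennreal_lessI exp_cmp) auto
      then show False using lo a by auto
    qed
  next
    assume "real ?z \<le> \<beta> * real N"
    then have "real ?z + 3 \<le> \<beta> * real N" using t by linarith
    then have "ennreal (exp ((real ?z + 3) * \<iota>)) \<le> ennreal (exp (\<beta> * real N * \<iota>))" by (intro ennreal_leI exp_cmp)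
    then show "numel cl \<le> ennreal (exp (\<beta> * real N * \<iota>))" using up by (rule order_trans[rotated])
  qed
  have a_iff: "ennreal (exp (\<alpha> * real N * \<iota>)) \<le> numel cl \<longleftrightarrow> \<alpha> * real N \<le> real ?z"
  proof
    assume a: "ennreal (exp (\<alpha> * real N * \<iota>)) \<le> numel cl"
    show "\<alpha> * real N \<le> real ?z"
    proof (rule ccontr)
      assume c: "\<not> \<alpha> * real N \<le> real ?z"
      then have "0 < \<alpha>" using ab by (cases "\<alpha> = 0") auto
      then have "real ?z + 3 < \<alpha> * real N" using t c by linarith
      then have "ennreal (exp ((real ?z + 3) * \<iota>)) < ennreal (exp (\<alpha> * real N * \<iota>))"
        by (intro ennreal_lessI exp_cmp) auto
      then show False using up a by auto
    qed
  next
    assume c: "\<alpha> * real N \<le> real ?z"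
    \<comment> \<open>For \<alpha> = 0 no tie is excluded, but an age is always at least 8
      rows.\<close>
    have "\<alpha> * real N \<le> real ?z - 2"
    proof (cases "\<alpha> = 0")
      case True
      have "8 \<le> ?z" using fm by auto
      then show ?thesis using True by simp
    next
      case False
      then show ?thesis using t c ab by linarith
    qed
    then have "ennreal (exp (\<alpha> * real N * \<iota>)) \<le> ennreal (exp ((real ?z - 2) * \<iota>))" by (intro ennreal_leI exp_cmp)
    then show "ennreal (exp (\<alpha> * real N * \<iota>)) \<le> numel cl" using lo by (rule order_trans)
  qed
  show ?thesis unfolding fin_micro_def atLeastAtMost_iff a_iff b_iff using False rz by auto
qed

text \<open>A fire of the last half time unit stops the cluster whatever it burnt, so one such fire
  on each side bounds the size.\<close>

lemma macro_upper:
  assumes "ennreal (\<theta> * real N / d) \<le> numel cl" "0 < \<theta>"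
    and r: "(c, s) \<in> cells Q P" "f (c, s)" "0 < c" "s < P" "P + 4 \<le> s + hN"
    and l: "(c', s') \<in> cells Q P" "f (c', s')" "c' < 0" "s' < P" "P + 4 \<le> s' + hN"
  shows "\<theta> * real N \<le> real_of_int (c - c') + 2"
proof -
  obtain j where j: "j \<le> M" "j \<noteq> v" "cc j = c" "S j = s" using all_marked[OF r(1,2)] by blast
  obtain i where i: "i \<le> M" "i \<noteq> v" "cc i = c'" "S i = s'" using all_marked[OF l(1,2)] by blast
  have ivj: "i < v" "v < j" using cc_iff[of i v] cc_iff[of v j] i j r l cc_v v_window by auto
  have "numel cl \<le> ennreal ((real_of_int (cc j - cc i) + 2) / d)"
  proof (rule size_le)
    fix y assume "y \<in> cl"
    then have "y \<in> B v" using cl_eq by simp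
    then show "xr i - Z \<le> of_int y \<and> of_int y \<le> xr j + Z"
      using final_fire_bound(1)[OF j(1,2) _ _ _ ivj(2)] final_fire_bound(2)[OF i(1,2) _ _ _ ivj(1)] i j r l by auto
  qed (use i j ivj in auto)
  with assms(1) have "ennreal (\<theta> * real N / d) \<le> ennreal ((real_of_int (cc j - cc i) + 2) / d)" by (rule order_trans)
  then have "\<theta> * real N / d \<le> (real_of_int (cc j - cc i) + 2) / d"
    using d_pos i j r l by (subst (asm) ennreal_le_iff) auto
  then show ?thesis using d_pos i j by (simp add: divide_le_cancel)
qed

lemma micro_upper_cells:
  assumes "fin_micro N \<alpha> \<beta> P M v S lf rg b"
  shows "\<exists>c s. (c, s) \<in> cells Q P \<and> f (c, s) \<and> c \<noteq> 0 \<and> \<alpha> * real N \<le> real P - real s \<and> real P - real s \<le> \<beta> * real N \<and>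
    (\<forall>c' s'. (c', s') \<in> cells Q P \<and> f (c', s') \<and> ((0 < c' \<and> c' < c) \<or> (c < c' \<and> c' < 0)) \<longrightarrow> \<not> (s' < s \<and> s + 4 \<le> s' + hN))"
proof -
  have nf: "\<not> full b P v" using assms by (simp add: fin_micro_def)
  obtain l where l: "active l" "l \<noteq> v" "last_burn b P v = S l"
    "\<forall>j\<le>M. j \<noteq> v \<longrightarrow> (l < j \<and> j < v) \<or> (v < j \<and> j < l) \<longrightarrow> \<not> (S j < S l \<and> S l + 4 \<le> S j + hN)"
    using last_burn_by_connected[OF nf] by blast
  have lM: "l \<le> M" using active_le(1)[OF l(1)] .
  show ?thesis
  proof (intro exI conjI allI impI)
    show "(cc l, S l) \<in> cells Q P" "f (cc l, S l)" using marked[OF lM l(2)] by auto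
    show "cc l \<noteq> 0" using cc_iff[of l v] cc_iff[of v l] lM l v_window cc_v by auto
    show "\<alpha> * real N \<le> real P - real (S l)" "real P - real (S l) \<le> \<beta> * real N"
      using assms l(3) by (auto simp: fin_micro_def)
    fix c' s' assume c: "(c', s') \<in> cells Q P \<and> f (c', s') \<and> ((0 < c' \<and> c' < cc l) \<or> (cc l < c' \<and> c' < 0))"
    then obtain j where j: "j \<le> M" "j \<noteq> v" "cc j = c'" "S j = s'" using all_marked by blast
    have "(l < j \<and> j < v) \<or> (v < j \<and> j < l)"
      using c j lM v_window cc_v cc_iff[of l j] cc_iff[of j v] cc_iff[of v j] cc_iff[of j l] by auto
    then show "\<not> (s' < S l \<and> S l + 4 \<le> s' + hN)" using l(4) j by blast
  qed
qed

lemma quiet_burns: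
  assumes k: "k \<le> M" "N + 8 \<le> S k" "lft < cc k" "cc k < rgt" "lft < 0" "0 < rgt"
    and lr: "cc (lf P) \<le> lft" "rgt \<le> cc (rg P)"
    and q: "\<And>c s. (c, s) \<in> cells Q P \<Longrightarrow> f (c, s) \<Longrightarrow> S k < s + N + 8 \<Longrightarrow> s < S k \<Longrightarrow>
      \<exists>c' s'. (c', s') \<in> cells Q P \<and> f (c', s') \<and> s' < s \<and> s + 4 \<le> s' + hN \<and> ((c < c' \<and> c' \<le> lft) \<or> (rgt \<le> c' \<and> c' < c))"
  shows "\<exists>i j. lf P \<le> i \<and> i < v \<and> v < j \<and> j \<le> rg P \<and> cc i \<le> lft \<and> rgt \<le> cc j \<and> i < k \<and> k < j \<and> (\<forall>g. i \<le> g \<and> g < j \<longrightarrow> b k g)"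
proof -
  \<comment> \<open>The outermost needed positions: the last one at or left of \<open>lft\<close>
    and the first one at or right of \<open>rgt\<close>.\<close>
  define i where "i = (GREATEST i. i \<le> M \<and> cc i \<le> lft)"
  have i: "i \<le> M" "cc i \<le> lft" "\<And>p. p \<le> M \<Longrightarrow> cc p \<le> lft \<Longrightarrow> p \<le> i"
    using GreatestI_nat[of "\<lambda>i. i \<le> M \<and> cc i \<le> lft" "lf P" M] Greatest_le_nat[of "\<lambda>i. i \<le> M \<and> cc i \<le> lft" _ M] lr lfP
    unfolding i_def by auto
  define j where "j = (LEAST j. j \<le> M \<and> rgt \<le> cc j)"
  have j: "j \<le> M" "rgt \<le> cc j" "\<And>p. p \<le> M \<Longrightarrow> rgt \<le> cc p \<Longrightarrow> j \<le> p"
    using LeastI[of "\<lambda>j. j \<le> M \<and> rgt \<le> cc j" "rg P"] Least_le[of "\<lambda>j. j \<le> M \<and> rgt \<le> cc j"] lr lfP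
    unfolding j_def by auto
  have ik: "i < k" "k < j" "i < v" "v < j"
    using cc_iff[of i k] cc_iff[of k j] cc_iff[of i v] cc_iff[of v j] i j k cc_v v_window by auto
  have win: "lf (S k) \<le> i" "j \<le> rg (S k)" "lf P \<le> i" "j \<le> rg P"
    using i(3)[of "lf P"] j(3)[of "rg P"] lr lfP lf_mono[of "S k" P] rg_mono[of "S k" P] S_le[OF k(1)] by auto
  have ak: "active k" using ik win k by (auto simp: active_def)
  have "b k g" if g: "i \<le> g" "g < j" for g
  proof (rule quiet_span(2)[OF ak win(1,2) k(2) _ g ik(1,2)])
    fix l assume l: "active l" "l \<noteq> v" "S k < S l + N + 8" "S l < S k"
    have lM: "l \<le> M" using active_le(1)[OF l(1)] .
    obtain c' s' where c': "(c', s') \<in> cells Q P" "f (c', s')" "s' < S l" "S l + 4 \<le> s' + hN" "(cc l < c' \<and> c' \<le> lft) \<or> (rgt \<le> c' \<and> c' < cc l)"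
      using q[of "cc l" "S l"] marked[OF lM l(2)] l by blast
    obtain p where p: "p \<le> M" "p \<noteq> v" "cc p = c'" "S p = s'" using all_marked[OF c'(1,2)] by blast
    have "(l < p \<and> p \<le> i) \<or> (j \<le> p \<and> p < l)"
      using c'(5) p i(3)[of p] j(3)[of p] cc_iff[of l p] cc_iff[of p l] lM by auto
    then show "\<exists>p\<le>M. p \<noteq> v \<and> S p < S l \<and> S l + 4 \<le> S p + hN \<and> ((l < p \<and> p \<le> i) \<or> (j \<le> p \<and> p < l))"
      using p c' by blast
  qed
  then show ?thesis using i j ik win by blast
qed

lemma macro_lower:
  assumes "lft < 0" "0 < rgt" "cc (lf P) \<le> lft" "rgt \<le> cc (rg P)" "N + 8 \<le> P" "\<theta> * real N + 2 \<le> real_of_int (rgt - lft)"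
    and q: "\<And>c s. (c, s) \<in> cells Q P \<Longrightarrow> f (c, s) \<Longrightarrow> P < s + N + 8 \<Longrightarrow> s < P \<Longrightarrow>
      \<exists>c' s'. (c', s') \<in> cells Q P \<and> f (c', s') \<and> s' < s \<and> s + 4 \<le> s' + hN \<and> ((c < c' \<and> c' \<le> lft) \<or> (rgt \<le> c' \<and> c' < c))"
  shows "ennreal (\<theta> * real N / d) \<le> numel cl"
proof -
  obtain i j where ij: "lf P \<le> i" "i < v" "v < j" "j \<le> rg P" "cc i \<le> lft" "rgt \<le> cc j" "\<forall>g. i \<le> g \<and> g < j \<longrightarrow> b v g"
    using quiet_burns[of v lft rgt] assms v_window cc_v S_v by auto
  have "\<theta> * real N \<le> real_of_int (cc j - cc i) - 2" using ij assms(6) by linarith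
  then have "ennreal (\<theta> * real N / d) \<le> ennreal ((real_of_int (cc j - cc i) - 2) / d)"
    using d_pos by (intro ennreal_leI divide_right_mono) auto
  also have "\<dots> \<le> numel cl" by (rule size_ge) (use ij in auto)
  finally show ?thesis .
qed

text \<open>Fire \<open>(c0, s0)\<close> finds the surroundings of the origin full and burns them,
  and all later fires are shielded from the origin, so the age there is
  \<open>P - s0\<close>.\<close>

lemma micro_lower_cells:
  assumes lr: "lft < 0" "0 < rgt" "cc (lf P) \<le> lft" "rgt \<le> cc (rg P)"
    and c0: "(c0, s0) \<in> cells Q P" "f (c0, s0)" "lft < c0" "c0 < rgt" "N + 8 \<le> s0"
    and s0: "\<alpha> * real N \<le> real P - real s0" "real P - real s0 \<le> \<beta> * real N" "\<beta> < 1"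
    and q: "\<And>c s. (c, s) \<in> cells Q P \<Longrightarrow> f (c, s) \<Longrightarrow> s0 < s + N + 8 \<Longrightarrow> (c, s) \<noteq> (c0, s0) \<Longrightarrow>
      \<exists>c' s'. (c', s') \<in> cells Q P \<and> f (c', s') \<and> s' < s \<and> s + 4 \<le> s' + hN \<and> ((c < c' \<and> c' \<le> lft) \<or> (rgt \<le> c' \<and> c' < c))"
  shows "fin_micro N \<alpha> \<beta> P M v S lf rg b"
proof -
  obtain k where k: "k \<le> M" "k \<noteq> v" "cc k = c0" "S k = s0" using all_marked[OF c0(1,2)] by blast
  have vM: "v < M" using v_window rg_le[of P] by auto
  obtain i j where ij: "lf P \<le> i" "i < v" "v < j" "j \<le> rg P" "i < k" "k < j" "\<forall>g. i \<le> g \<and> g < j \<longrightarrow> b k g"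
    using quiet_burns[of k lft rgt] k c0 lr q by auto
  have kv: "b k v" using ij by auto
  have SkP: "S k < P" using S_inj[of k v] S_le[of k] k v_window S_v by force
  have ak: "active k" using ij k lf_mono[of "S k" P] rg_mono[of "S k" P] SkP by (auto simp: active_def)
  have "last_burn b P v = s0"
  proof -
    have "s0 \<le> last_burn b P v" using last_burn_ge[of k P b v] ak k(2) SkP kv k by simp
    moreover have "last_burn b P v \<le> s0"
    proof (rule ccontr)
      assume n: "\<not> last_burn b P v \<le> s0"
      then obtain l where l: "active l" "l \<noteq> v" "S l < P" "b l v" "last_burn b P v = S l"
        using last_burn_cases[of b P v] by (metis bot_nat_0.extremum)
      have lM: "l \<le> M" using active_le(1)[OF l(1)] .
      have "(cc l, S l) \<noteq> (c0, s0)" using n l by auto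
      then obtain c' s' where c': "(c', s') \<in> cells Q P" "f (c', s')" "s' < S l" "S l + 4 \<le> s' + hN" "(cc l < c' \<and> c' \<le> lft) \<or> (rgt \<le> c' \<and> c' < cc l)"
        using q[of "cc l" "S l"] marked[OF lM l(2)] l n by auto
      obtain p where p: "p \<le> M" "p \<noteq> v" "cc p = c'" "S p = s'" using all_marked[OF c'(1,2)] by blast
      have "(l < p \<and> p \<le> v) \<or> (v < p \<and> p < l)"
        using c'(5) p cc_iff[of l p] cc_iff[of p l] cc_iff[of p v] cc_iff[of v p] lM lr cc_v v_window by auto
      then show False using shielded[OF l(1) p(1,2) _ _ vM] p c' l by auto
    qed
    ultimately show ?thesis by simp
  qed
  moreover have "real P < real s0 + real N" using s0 N_eq hN_ge by (smt (verit) mult_less_cancel_right2 of_nat_0_less_iff gr0I not_numeral_le_zero mult_is_0 le_zero_eq)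
  ultimately show ?thesis using s0 unfolding fin_micro_def full_def by auto
qed

end

lemma (in realization) tracked_realization_exists:
  assumes "admissible N hN Q P (marks d \<iota> m) M cc v S lf rg"
  shows "\<exists>X tm bx. tracked_realization n m e \<iota> N hN P Q d t M v S lf rg X tm bx cc"
proof -
  obtain X tm bx where *: "ffp_track n m e \<iota> N hN M v S lf rg P (P + 1 + N) X tm bx" "X v = 0" "tm v = t"
    "\<forall>l\<le>M. column_of d (X l) = cc l"
    using track[OF assms] by blast
  have "tracked_realization n m e \<iota> N hN P Q d t M v S lf rg X tm bx cc"
    unfolding tracked_realization_def tracked_realization_axioms_def
    using * assms realization_axioms by auto
  then show ?thesis by blast
qed

section \<open>The law of the marked cells\<close>

text \<open>Across sites independence is given for whole paths, along one site for increments. A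
  finite set of increments is grouped by sites, so that each group is an event of one path.\<close>

lemma (in prob_space) indep_vars_increments:
  fixes X :: "real \<Rightarrow> int \<Rightarrow> 'a \<Rightarrow> nat" and u :: "nat \<Rightarrow> real"
  assumes paths: "indep_vars (\<lambda>_. PiM {0..} (\<lambda>_. count_space UNIV)) (\<lambda>i \<omega>. \<lambda>t\<in>{0..}. X t i \<omega>) UNIV"
    and inc: "\<And>i. indep_vars (\<lambda>_. count_space UNIV) (\<lambda>k \<omega>. X (u (Suc k)) i \<omega> - X (u k) i \<omega>) {..<n}"
    and u: "\<And>k. 0 \<le> u k"
  shows "indep_vars (\<lambda>_. count_space UNIV) (\<lambda>j \<omega>. X (u (Suc (snd j))) (fst j) \<omega> - X (u (snd j)) (fst j) \<omega>) (UNIV \<times> {..<n})"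
    (is "indep_vars _ ?inc _")
  unfolding indep_vars_def2
proof (intro conjI ballI)
  fix j :: "int \<times> nat" assume "j \<in> UNIV \<times> {..<n}"
  then show "random_variable (count_space UNIV) (?inc j)"
    using inc[of "fst j"] by (auto simp: indep_vars_def2)
next
  show "indep_sets (\<lambda>j. {?inc j -` A \<inter> space M |A. A \<in> sets (count_space UNIV)}) (UNIV \<times> {..<n})"
  proof (rule indep_setsI)
    fix j :: "int \<times> nat" assume "j \<in> UNIV \<times> {..<n}"
    then have "random_variable (count_space UNIV) (?inc j)"
      using inc[of "fst j"] by (auto simp: indep_vars_def2)
    then show "{?inc j -` A \<inter> space M |A. A \<in> sets (count_space UNIV)} \<subseteq> events"
      by (auto dest: measurable_sets)
  next
    fix A :: "int \<times> nat \<Rightarrow> 'a set" and J :: "(int \<times> nat) set"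
    assume J: "J \<noteq> {}" "J \<subseteq> UNIV \<times> {..<n}" "finite J"
      and A: "\<forall>j\<in>J. A j \<in> {?inc j -` B \<inter> space M |B. B \<in> sets (count_space UNIV)}"
    then have "\<forall>j\<in>J. \<exists>B. A j = ?inc j -` B \<inter> space M" by blast
    then obtain B where B: "\<And>j. j \<in> J \<Longrightarrow> A j = ?inc j -` B j \<inter> space M" by metis
    define I where "I = fst ` J"
    define K where "K x = {k. (x, k) \<in> J}" for x
    have JS: "J = Sigma I K" by (force simp: I_def K_def)
    have fin: "finite I" "finite (K x)" "I \<noteq> {}" "x \<in> I \<Longrightarrow> K x \<noteq> {}" "K x \<subseteq> {..<n}" for x
    proof -
      show "finite (K x)" by (rule finite_subset[of _ "snd ` J"]) (use J in \<open>force simp: K_def\<close>)+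
    qed (use J in \<open>auto simp: I_def K_def\<close>)
    define T where "T x = {g \<in> space (PiM {0..} (\<lambda>_::real. count_space (UNIV::nat set))). \<forall>k\<in>K x. g (u (Suc k)) - g (u k) \<in> B (x, k)}" for x
    have Tm: "T x \<in> sets (PiM {0..} (\<lambda>_. count_space UNIV))" for x
    proof -
      have "(\<lambda>g. g (u k)) \<in> measurable (PiM {0..} (\<lambda>_::real. count_space (UNIV::nat set))) (count_space UNIV)" for k
        by (rule measurable_component_singleton) (use u in simp)
      then show ?thesis unfolding T_def using fin(2)[of x] by measurable
    qed
    have E: "(\<Inter>k\<in>K x. ?inc (x, k) -` B (x, k) \<inter> space M) = (\<lambda>\<omega>. \<lambda>t\<in>{0..}. X t x \<omega>) -` T x \<inter> space M" if "x \<in> I" for x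
      using fin(4)[OF that] u by (auto simp: T_def space_PiM PiE_def extensional_def)
    have "(\<Inter>j\<in>J. A j) = (\<Inter>x\<in>I. (\<lambda>\<omega>. \<lambda>t\<in>{0..}. X t x \<omega>) -` T x \<inter> space M)"
    proof -
      have "(\<Inter>j\<in>J. A j) = (\<Inter>x\<in>I. \<Inter>k\<in>K x. A (x, k))" unfolding JS by auto
      also have "\<dots> = (\<Inter>x\<in>I. \<Inter>k\<in>K x. ?inc (x, k) -` B (x, k) \<inter> space M)"
        by (intro INF_cong refl) (auto simp: B JS)
      also have "\<dots> = (\<Inter>x\<in>I. (\<lambda>\<omega>. \<lambda>t\<in>{0..}. X t x \<omega>) -` T x \<inter> space M)"
        by (intro INF_cong refl E)
      finally show ?thesis .
    qed
    then have "prob (\<Inter>j\<in>J. A j) = (\<Prod>x\<in>I. prob ((\<lambda>\<omega>. \<lambda>t\<in>{0..}. X t x \<omega>) -` T x \<inter> space M))"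
      using indep_varsD[OF paths fin(3,1), of T] Tm by simp
    also have "\<dots> = (\<Prod>x\<in>I. \<Prod>k\<in>K x. prob (A (x, k)))"
    proof (rule prod.cong[OF refl])
      fix x assume x: "x \<in> I"
      have "prob ((\<lambda>\<omega>. \<lambda>t\<in>{0..}. X t x \<omega>) -` T x \<inter> space M) = prob (\<Inter>k\<in>K x. ?inc (x, k) -` B (x, k) \<inter> space M)"
        using E[OF x] by simp
      also have "\<dots> = (\<Prod>k\<in>K x. prob (?inc (x, k) -` B (x, k) \<inter> space M))"
        using indep_varsD[OF inc[of x] fin(4)[OF x] fin(2) fin(5), of "\<lambda>k. B (x, k)"] by simp
      also have "\<dots> = (\<Prod>k\<in>K x. prob (A (x, k)))"
        using x by (intro prod.cong refl) (simp add: B JS)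
      finally show "prob ((\<lambda>\<omega>. \<lambda>t\<in>{0..}. X t x \<omega>) -` T x \<inter> space M) = (\<Prod>k\<in>K x. prob (A (x, k)))" .
    qed
    also have "\<dots> = (\<Prod>j\<in>J. prob (A j))"
      unfolding JS by (subst prod.Sigma) (use fin in auto)
    finally show "prob (\<Inter>j\<in>J. A j) = (\<Prod>j\<in>J. prob (A j))" .
  qed
qed

text \<open>On finitely many countable coordinates every set is measurable, so arbitrary predicates
  of disjoint blocks inherit independence.\<close>

lemma (in prob_space) indep_vars_blocks:
  fixes X :: "'i \<Rightarrow> 'a \<Rightarrow> 'c::countable"
  assumes ind: "indep_vars (\<lambda>_. count_space UNIV) X I" and J: "finite J"
    and K: "\<And>j. j \<in> J \<Longrightarrow> K j \<subseteq> I \<and> finite (K j)" "disjoint_family_on K J"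
    and \<Phi>: "\<And>j f g. j \<in> J \<Longrightarrow> (\<And>x. x \<in> K j \<Longrightarrow> f x = g x) \<Longrightarrow> \<Phi> j f = \<Phi> j g"
  shows "prob {\<omega> \<in> space M. \<forall>j\<in>J. \<Phi> j (\<lambda>i. X i \<omega>)} = (\<Prod>j\<in>J. prob {\<omega> \<in> space M. \<Phi> j (\<lambda>i. X i \<omega>)})"
proof (cases "J = {}")
  case False
  have 1: "indep_vars (\<lambda>j. PiM (K j) (\<lambda>_. count_space UNIV)) (\<lambda>j \<omega>. restrict (\<lambda>i. X i \<omega>) (K j)) J"
    by (rule indep_vars_restrict[OF ind]) (use K in auto)
  have 2: "indep_vars (\<lambda>_. count_space UNIV) (\<lambda>j \<omega>. \<Phi> j (restrict (\<lambda>i. X i \<omega>) (K j))) J"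
  proof (rule indep_vars_compose2[OF 1])
    fix j assume "j \<in> J"
    then have "finite (K j)" using K(1) by blast
    then have "PiM (K j) (\<lambda>_. count_space (UNIV :: 'c set)) = count_space (PiE (K j) (\<lambda>_. UNIV))"
      by (rule count_space_PiM_finite) simp
    then show "\<Phi> j \<in> measurable (PiM (K j) (\<lambda>_. count_space UNIV)) (count_space UNIV)" by simp
  qed
  have eq: "\<Phi> j (restrict (\<lambda>i. X i \<omega>) (K j)) = \<Phi> j (\<lambda>i. X i \<omega>)" if "j \<in> J" for j \<omega> by (rule \<Phi>[OF that]) simp
  have "prob (\<Inter>j\<in>J. (\<lambda>\<omega>. \<Phi> j (restrict (\<lambda>i. X i \<omega>) (K j))) -` {True} \<inter> space M) =
      (\<Prod>j\<in>J. prob ((\<lambda>\<omega>. \<Phi> j (restrict (\<lambda>i. X i \<omega>) (K j))) -` {True} \<inter> space M))"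
    by (rule indep_varsD_finite[OF 2 False J]) auto
  moreover have "(\<Inter>j\<in>J. (\<lambda>\<omega>. \<Phi> j (restrict (\<lambda>i. X i \<omega>) (K j))) -` {True} \<inter> space M) = {\<omega> \<in> space M. \<forall>j\<in>J. \<Phi> j (\<lambda>i. X i \<omega>)}"
    using False eq by auto
  moreover have "((\<lambda>\<omega>. \<Phi> j (restrict (\<lambda>i. X i \<omega>) (K j))) -` {True} \<inter> space M) = {\<omega> \<in> space M. \<Phi> j (\<lambda>i. X i \<omega>)}" if "j \<in> J" for j
    using eq[OF that] by auto
  ultimately show ?thesis by simp
qed (simp add: prob_space)

lemma (in prob_space) indep_vars_indicators_prob:
  assumes ind: "indep_vars (\<lambda>_. count_space UNIV) X I" and J: "finite J"
    and K: "\<And>j. j \<in> J \<Longrightarrow> K j \<subseteq> I \<and> finite (K j)" "disjoint_family_on K J"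
  shows "prob {\<omega> \<in> space M. \<forall>j\<in>J. (\<exists>i\<in>K j. X i \<omega> \<noteq> (0::nat)) = f j} =
    (\<Prod>j\<in>J. if f j then 1 - (\<Prod>i\<in>K j. prob {\<omega> \<in> space M. X i \<omega> = 0}) else (\<Prod>i\<in>K j. prob {\<omega> \<in> space M. X i \<omega> = 0}))"
proof -
  have Xm: "X i \<in> measurable M (count_space UNIV)" if "i \<in> I" for i using ind that by (simp add: indep_vars_def2)
  have "prob {\<omega> \<in> space M. \<forall>j\<in>J. (\<exists>i\<in>K j. X i \<omega> \<noteq> 0) = f j} = (\<Prod>j\<in>J. prob {\<omega> \<in> space M. (\<exists>i\<in>K j. X i \<omega> \<noteq> 0) = f j})"
    by (rule indep_vars_blocks[OF ind J K, where \<Phi>="\<lambda>j g. (\<exists>i\<in>K j. g i \<noteq> 0) = f j"]) auto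
  also have "\<dots> = (\<Prod>j\<in>J. if f j then 1 - (\<Prod>i\<in>K j. prob {\<omega> \<in> space M. X i \<omega> = 0}) else (\<Prod>i\<in>K j. prob {\<omega> \<in> space M. X i \<omega> = 0}))"
  proof (rule prod.cong[OF refl])
    fix j assume j: "j \<in> J"
    let ?Z = "{\<omega> \<in> space M. \<forall>i\<in>K j. X i \<omega> = 0}"
    have Z: "prob ?Z = (\<Prod>i\<in>K j. prob {\<omega> \<in> space M. X i \<omega> = 0})"
      by (rule indep_vars_blocks[OF ind, where K="\<lambda>i. {i}" and \<Phi>="\<lambda>i g. g i = 0"]) (use K(1)[OF j] in \<open>auto simp: disjoint_family_on_def\<close>)
    have "{\<omega> \<in> space M. X i \<omega> = 0} \<in> events" if "i \<in> K j" for i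
      using measurable_sets[OF Xm[of i], of "{0}"] K(1)[OF j] that by (auto simp: vimage_def Int_def conj_commute)
    then have m: "?Z \<in> events" using K(1)[OF j] by (intro sets.sets_Collect_finite_All) auto
    have "{\<omega> \<in> space M. \<exists>i\<in>K j. X i \<omega> \<noteq> 0} = space M - ?Z" by auto
    then show "prob {\<omega> \<in> space M. (\<exists>i\<in>K j. X i \<omega> \<noteq> 0) = f j} =
       (if f j then 1 - (\<Prod>i\<in>K j. prob {\<omega> \<in> space M. X i \<omega> = 0}) else (\<Prod>i\<in>K j. prob {\<omega> \<in> space M. X i \<omega> = 0}))"
      using Z prob_compl[OF m] by (cases "f j") simp_all
  qed
  finally show ?thesis .
qed

lemma poisson_ge_2:
  assumes "0 < \<mu>" shows "measure (measure_pmf (poisson_pmf \<mu>)) {2..} \<le> \<mu>\<^sup>2"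
proof -
  have "{2..} = space (measure_pmf (poisson_pmf \<mu>)) - {0, 1::nat}" by auto
  then have "measure (measure_pmf (poisson_pmf \<mu>)) {2..} = 1 - measure (measure_pmf (poisson_pmf \<mu>)) {0, 1}"
    by (simp only: measure_pmf.prob_compl sets_measure_pmf UNIV_I)
  also have "measure (measure_pmf (poisson_pmf \<mu>)) {0, 1} = (1 + \<mu>) * exp (- \<mu>)"
    using assms by (subst measure_measure_pmf_finite) (auto simp: algebra_simps)
  also have "1 - (1 + \<mu>) * exp (- \<mu>) \<le> 1 - (1 + \<mu>) * (1 - \<mu>)"
    using exp_ge_add_one_self[of "- \<mu>"] assms by (intro diff_left_mono mult_left_mono) auto
  finally show ?thesis by (simp add: power2_eq_square algebra_simps)
qed

section \<open>Probability estimates for seeds and fires\<close>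

locale ffp_space = prob_space Pr for Pr :: "'a measure" +
  fixes lam :: real and N M \<eta> :: "real \<Rightarrow> int \<Rightarrow> 'a \<Rightarrow> nat"
  assumes ffp: "forest_fire_process lam Pr N M \<eta>" and lam: "0 < lam" "lam < 1"
begin

lemma poisson_N: "poisson_process Pr 1 (\<lambda>t. N t i)" and poisson_M: "poisson_process Pr lam (\<lambda>t. M t i)"
  and indep_N: "indep_vars (\<lambda>_. PiM {0..} (\<lambda>_. count_space UNIV)) (\<lambda>i \<omega>. \<lambda>t\<in>{0..}. N t i \<omega>) UNIV"
  and indep_M: "indep_vars (\<lambda>_. PiM {0..} (\<lambda>_. count_space UNIV)) (\<lambda>i \<omega>. \<lambda>t\<in>{0..}. M t i \<omega>) UNIV"
  and indep_NM: "indep_families Pr N M"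
  using ffp by (auto simp: forest_fire_process_def indep_poisson_family_def)

lemma N_meas: "0 \<le> t \<Longrightarrow> N t i \<in> measurable Pr (count_space UNIV)"
  and M_meas: "0 \<le> t \<Longrightarrow> M t i \<in> measurable Pr (count_space UNIV)"
  using poisson_N[of i] poisson_M[of i] by (auto simp: poisson_process_def)

lemma \<eta>_meas: "0 \<le> t \<Longrightarrow> \<eta> t i \<in> measurable Pr (count_space UNIV)"
proof -
  assume t: "0 \<le> t"
  have "\<eta> t i \<in> measurable (generated_filtration Pr N M t) (count_space UNIV)"
    using ffp t by (auto simp: forest_fire_process_def)
  moreover have "sets (generated_filtration Pr N M t) \<subseteq> events"
  proof -
    have "{N s i -` A \<inter> space Pr | s i A. 0 \<le> s \<and> s \<le> t} \<union> {M s i -` A \<inter> space Pr | s i A. 0 \<le> s \<and> s \<le> t} \<subseteq> events"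
      using measurable_sets[OF N_meas] measurable_sets[OF M_meas] by auto
    from sets.sigma_sets_subset[OF this] show ?thesis unfolding generated_filtration_def
      by (subst sets_measure_of) auto
  qed
  moreover have "space (generated_filtration Pr N M t) = space Pr"
    unfolding generated_filtration_def by (rule space_measure_of) auto
  ultimately show ?thesis unfolding measurable_def by auto
qed

lemma AE_paths: "AE \<omega> in Pr. ffp_dynamics (\<lambda>t i. N t i \<omega>) (\<lambda>t i. M t i \<omega>) (\<lambda>t i. \<eta> t i \<omega>) \<and>
   (\<forall>i. counting_path (\<lambda>t. M t i \<omega>)) \<and> (\<forall>i. M 0 i \<omega> = 0)"
proof -
  have cN: "AE \<omega> in Pr. \<forall>i. counting_path (\<lambda>t. N t i \<omega>)"
    unfolding AE_all_countable counting_path_def using poisson_N by (auto simp: poisson_process_def)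
  have cM: "AE \<omega> in Pr. \<forall>i. counting_path (\<lambda>t. M t i \<omega>)"
    unfolding AE_all_countable counting_path_def using poisson_M by (auto simp: poisson_process_def)
  have M0: "AE \<omega> in Pr. \<forall>i. M 0 i \<omega> = 0"
    unfolding AE_all_countable using poisson_M by (auto simp: poisson_process_def)
  have ce: "AE \<omega> in Pr. \<forall>i. cadlag (\<lambda>t. \<eta> t i \<omega>)"
    unfolding AE_all_countable using ffp by (auto simp: forest_fire_process_def)
  have eq: "AE \<omega> in Pr. ffp_equation (\<lambda>t i. N t i \<omega>) (\<lambda>t i. M t i \<omega>) (\<lambda>t i. \<eta> t i \<omega>)"
    using ffp by (auto simp: forest_fire_process_def)
  have v: "\<eta> t i \<omega> \<in> {0, 1}" if "0 \<le> t" "\<omega> \<in> space Pr" for t i \<omega>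
    using ffp that unfolding forest_fire_process_def by blast
  show ?thesis
    using cN cM M0 ce eq AE_space
  proof eventually_elim
    case (elim \<omega>)
    then show ?case using v by (intro conjI ffp_dynamicsI) auto
  qed
qed

lemma N_incr:
  assumes "0 \<le> s" "s < u"
  shows "prob {\<omega> \<in> space Pr. N u i \<omega> - N s i \<omega> = 0} = exp (- (u - s))"
    "prob {\<omega> \<in> space Pr. N u i \<omega> - N s i \<omega> \<noteq> 0} = 1 - exp (- (u - s))"
proof -
  have m: "(\<lambda>\<omega>. N u i \<omega> - N s i \<omega>) \<in> measurable Pr (count_space UNIV)"
  proof -
    have "N s i \<in> measurable Pr (count_space UNIV)" "N u i \<in> measurable Pr (count_space UNIV)"
      using N_meas assms by auto
    then show ?thesis by measurable
  qed
  have d: "distr Pr (count_space UNIV) (\<lambda>\<omega>. N u i \<omega> - N s i \<omega>) = measure_pmf (poisson_pmf (1 * (u - s)))"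
    using poisson_N[of i] assms by (auto simp: poisson_process_def)
  have "prob {\<omega> \<in> space Pr. N u i \<omega> - N s i \<omega> = 0} = measure (distr Pr (count_space UNIV) (\<lambda>\<omega>. N u i \<omega> - N s i \<omega>)) {0}"
    by (subst measure_distr[OF m]) (auto intro!: arg_cong[where f=prob])
  also have "\<dots> = exp (- (u - s))" unfolding d using assms by (simp add: measure_pmf_single)
  finally show 1: "prob {\<omega> \<in> space Pr. N u i \<omega> - N s i \<omega> = 0} = exp (- (u - s))" .
  have "{\<omega> \<in> space Pr. N u i \<omega> - N s i \<omega> = 0} \<in> events" using m by measurable
  from prob_compl[OF this] show "prob {\<omega> \<in> space Pr. N u i \<omega> - N s i \<omega> \<noteq> 0} = 1 - exp (- (u - s))"
    using 1 by (simp add: set_diff_eq conj_commute cong: conj_cong) 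
qed

lemma M_incr:
  assumes "0 \<le> s" "s < u"
  shows "prob {\<omega> \<in> space Pr. M u i \<omega> - M s i \<omega> = 0} = exp (- (lam * (u - s)))"
    "prob {\<omega> \<in> space Pr. M u i \<omega> - M s i \<omega> \<noteq> 0} \<le> lam * (u - s)"
    "prob {\<omega> \<in> space Pr. 2 \<le> M u i \<omega> - M s i \<omega>} \<le> (lam * (u - s))\<^sup>2"
proof -
  have m: "(\<lambda>\<omega>. M u i \<omega> - M s i \<omega>) \<in> measurable Pr (count_space UNIV)"
  proof -
    have "M s i \<in> measurable Pr (count_space UNIV)" "M u i \<in> measurable Pr (count_space UNIV)"
      using M_meas assms by auto
    then show ?thesis by measurable
  qed
  have d: "distr Pr (count_space UNIV) (\<lambda>\<omega>. M u i \<omega> - M s i \<omega>) = measure_pmf (poisson_pmf (lam * (u - s)))"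
    using poisson_M[of i] assms by (auto simp: poisson_process_def)
  have pos: "0 < lam * (u - s)" using assms lam by simp
  have "prob {\<omega> \<in> space Pr. M u i \<omega> - M s i \<omega> = 0} = measure (distr Pr (count_space UNIV) (\<lambda>\<omega>. M u i \<omega> - M s i \<omega>)) {0}"
    by (subst measure_distr[OF m]) (auto intro!: arg_cong[where f=prob])
  also have "\<dots> = exp (- (lam * (u - s)))" unfolding d using pos by (simp add: measure_pmf_single)
  finally show 1: "prob {\<omega> \<in> space Pr. M u i \<omega> - M s i \<omega> = 0} = exp (- (lam * (u - s)))" .
  have "{\<omega> \<in> space Pr. M u i \<omega> - M s i \<omega> = 0} \<in> events" using m by measurable
  from prob_compl[OF this] have "prob {\<omega> \<in> space Pr. M u i \<omega> - M s i \<omega> \<noteq> 0} = 1 - exp (- (lam * (u - s)))"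
    using 1 by (simp add: set_diff_eq conj_commute cong: conj_cong) 
  then show "prob {\<omega> \<in> space Pr. M u i \<omega> - M s i \<omega> \<noteq> 0} \<le> lam * (u - s)"
    using exp_ge_add_one_self[of "- (lam * (u - s))"] by simp
  have "prob {\<omega> \<in> space Pr. 2 \<le> M u i \<omega> - M s i \<omega>} = measure (distr Pr (count_space UNIV) (\<lambda>\<omega>. M u i \<omega> - M s i \<omega>)) {2..}"
    by (subst measure_distr[OF m]) (auto intro!: arg_cong[where f=prob])
  also have "\<dots> \<le> (lam * (u - s))\<^sup>2" unfolding d by (rule poisson_ge_2[OF pos])
  finally show "prob {\<omega> \<in> space Pr. 2 \<le> M u i \<omega> - M s i \<omega>} \<le> (lam * (u - s))\<^sup>2" .
qed

lemma indep_M_grid: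
  assumes "mono u" "0 \<le> u (0::nat)"
  shows "indep_vars (\<lambda>_. count_space UNIV) (\<lambda>j \<omega>. M (u (Suc (snd j))) (fst j) \<omega> - M (u (snd j)) (fst j) \<omega>) (UNIV \<times> {..<n})"
proof (rule indep_vars_increments[OF indep_M])
  show "indep_vars (\<lambda>_. count_space UNIV) (\<lambda>k \<omega>. M (u (Suc k)) i \<omega> - M (u k) i \<omega>) {..<n}" for i
    using poisson_M[of i] assms unfolding poisson_process_def by blast
  show "0 \<le> u k" for k using monoD[OF assms(1), of 0 k] assms by simp
qed

lemma indep_N_grid:
  assumes "mono u" "0 \<le> u (0::nat)"
  shows "indep_vars (\<lambda>_. count_space UNIV) (\<lambda>j \<omega>. N (u (Suc (snd j))) (fst j) \<omega> - N (u (snd j)) (fst j) \<omega>) (UNIV \<times> {..<n})"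
proof (rule indep_vars_increments[OF indep_N])
  show "indep_vars (\<lambda>_. count_space UNIV) (\<lambda>k \<omega>. N (u (Suc k)) i \<omega> - N (u k) i \<omega>) {..<n}" for i
    using poisson_N[of i] assms unfolding poisson_process_def by blast
  show "0 \<le> u k" for k using monoD[OF assms(1), of 0 k] assms by simp
qed

lemma N_all_incr:
  assumes "0 \<le> s" "s < u" "finite A"
  shows "prob {\<omega> \<in> space Pr. \<forall>y\<in>A. N u y \<omega> - N s y \<omega> \<noteq> 0} = (1 - exp (- (u - s))) ^ card A"
proof -
  \<comment> \<open>A time grid with the single step from \<open>s\<close> to \<open>u\<close>, to
    which the joint independence of grid increments applies.\<close>
  define w where "w k = (if k = 0 then s else u)" for k :: nat
  have "mono w" "0 \<le> w 0" using assms by (auto simp: mono_def w_def)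
  from indep_N_grid[OF this, of 1]
  have ind: "indep_vars (\<lambda>_. count_space UNIV) (\<lambda>j \<omega>. N (w (Suc (snd j))) (fst j) \<omega> - N (w (snd j)) (fst j) \<omega>) (UNIV \<times> {..<1})" .
  have "prob {\<omega> \<in> space Pr. \<forall>y\<in>A. (\<exists>i\<in>{(y, 0::nat)}. N (w (Suc (snd i))) (fst i) \<omega> - N (w (snd i)) (fst i) \<omega> \<noteq> 0) = True} =
     (\<Prod>y\<in>A. if True then 1 - (\<Prod>i\<in>{(y, 0::nat)}. prob {\<omega> \<in> space Pr. N (w (Suc (snd i))) (fst i) \<omega> - N (w (snd i)) (fst i) \<omega> = 0}) else (\<Prod>i\<in>{(y, 0::nat)}. prob {\<omega> \<in> space Pr. N (w (Suc (snd i))) (fst i) \<omega> - N (w (snd i)) (fst i) \<omega> = 0}))"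
    by (rule indep_vars_indicators_prob[OF ind assms(3)]) (auto simp: disjoint_family_on_def)
  also have "\<dots> = (\<Prod>y\<in>A. 1 - exp (- (u - s)))"
    using N_incr(1)[OF assms(1,2)] by (simp add: w_def)
  finally show ?thesis by (simp add: w_def)
qed

lemma M_pair_incr:
  assumes "0 \<le> s" "s < u" "x \<noteq> y"
  shows "prob {\<omega> \<in> space Pr. M u x \<omega> - M s x \<omega> \<noteq> 0 \<and> M u y \<omega> - M s y \<omega> \<noteq> 0} \<le> (lam * (u - s))\<^sup>2"
proof -
  define w where "w k = (if k = 0 then s else u)" for k :: nat
  have "mono w" "0 \<le> w 0" using assms by (auto simp: mono_def w_def)
  from indep_M_grid[OF this, of 1]
  have ind: "indep_vars (\<lambda>_. count_space UNIV) (\<lambda>j \<omega>. M (w (Suc (snd j))) (fst j) \<omega> - M (w (snd j)) (fst j) \<omega>) (UNIV \<times> {..<1})" .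
  have "prob {\<omega> \<in> space Pr. \<forall>y\<in>{x, y}. (\<exists>i\<in>{(y, 0::nat)}. M (w (Suc (snd i))) (fst i) \<omega> - M (w (snd i)) (fst i) \<omega> \<noteq> 0) = True} =
     (\<Prod>y\<in>{x, y}. if True then 1 - (\<Prod>i\<in>{(y, 0::nat)}. prob {\<omega> \<in> space Pr. M (w (Suc (snd i))) (fst i) \<omega> - M (w (snd i)) (fst i) \<omega> = 0}) else (\<Prod>i\<in>{(y, 0::nat)}. prob {\<omega> \<in> space Pr. M (w (Suc (snd i))) (fst i) \<omega> - M (w (snd i)) (fst i) \<omega> = 0}))"
    by (rule indep_vars_indicators_prob[OF ind]) (auto simp: disjoint_family_on_def)
  also have "\<dots> = (1 - exp (- (lam * (u - s))))\<^sup>2"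
    using M_incr(1)[OF assms(1,2)] assms(3) by (simp add: w_def power2_eq_square)
  also have "\<dots> \<le> (lam * (u - s))\<^sup>2"
    using exp_ge_add_one_self[of "- (lam * (u - s))"] lam assms by (intro power_mono) auto
  finally show ?thesis by (simp add: w_def)
qed


lemma prob_UN_le:
  assumes "finite I" "\<And>i. i \<in> I \<Longrightarrow> A i \<in> events" "\<And>i. i \<in> I \<Longrightarrow> prob (A i) \<le> c"
  shows "prob (\<Union>i\<in>I. A i) \<le> real (card I) * c"
proof -
  have "prob (\<Union>i\<in>I. A i) \<le> (\<Sum>i\<in>I. prob (A i))"
    using assms by (intro finite_measure_subadditive_finite) auto
  also have "\<dots> \<le> real (card I) * c" using assms(3) by (rule sum_bounded_above)
  finally show ?thesis .
qed

lemma good_pred: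
  assumes "0 \<le> \<iota>"
  shows "Measurable.pred (PiM ({0..} \<times> UNIV) (\<lambda>_. count_space UNIV)) (\<lambda>g. grid_events.good (\<lambda>t i. g (t, i)) \<iota> H x)"
proof -
  have [measurable]: "(\<lambda>g. g (real p * \<iota>, y)) \<in> borel_measurable (PiM ({0..} \<times> UNIV) (\<lambda>_. count_space (UNIV :: nat set)))" for p y
    by (rule measurable_compose[OF measurable_component_singleton]) (use assms in auto)
  have ev: "Measurable.pred (PiM ({0..} \<times> UNIV) (\<lambda>_. count_space (UNIV :: nat set))) (\<lambda>g. g (real p * \<iota>, y) < g (real q * \<iota>, y))" for p q y
    by measurable
  show ?thesis unfolding grid_events.good_def grid_events.ev_def
    by (intro pred_intros_countable pred_intros_imp' pred_intros_conj1' pred_intros_logic ev)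
qed

abbreviation good_at :: "real \<Rightarrow> nat \<Rightarrow> int \<Rightarrow> 'a \<Rightarrow> bool" where
  "good_at \<iota> H x \<omega> \<equiv> grid_events.good (\<lambda>t i. N t i \<omega>) \<iota> H x"

lemma N_path_meas: "(\<lambda>\<omega>. \<lambda>(t, i)\<in>{0..} \<times> UNIV. N t i \<omega>) \<in> measurable Pr (PiM ({0..} \<times> UNIV) (\<lambda>_. count_space UNIV))"
  and M_path_meas: "(\<lambda>\<omega>. \<lambda>(t, i)\<in>{0..} \<times> UNIV. M t i \<omega>) \<in> measurable Pr (PiM ({0..} \<times> UNIV) (\<lambda>_. count_space UNIV))"
  by (rule measurable_restrict, auto simp: N_meas M_meas)+

lemma good_at_path:
  assumes "0 \<le> \<iota>"
  shows "good_at \<iota> H x \<omega> = grid_events.good (\<lambda>t i. (\<lambda>(t, i)\<in>{0..} \<times> UNIV. N t i \<omega>) (t, i)) \<iota> H x"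
  unfolding grid_events.good_def grid_events.ev_def using assms by simp

lemma good_events: "0 \<le> \<iota> \<Longrightarrow> {\<omega> \<in> space Pr. \<not> good_at \<iota> H x \<omega>} \<in> events"
  using measurable_compose[OF N_path_meas good_pred, of \<iota> H x] by (subst good_at_path) auto

text \<open>A union bound over at most \<open>(H + 1) ^ 2\<close> pairs of rows, with one term for
  the ball and one for the \<open>2 * H + 1\<close> slots.\<close>

definition good_error :: "real \<Rightarrow> nat \<Rightarrow> real" where
  "good_error \<iota> H = (real H + 1)\<^sup>2 * (3 * exp (- \<iota>) + (2 * real H + 1) * exp (1 - exp \<iota>))"

lemma card_int_ball: "finite {y::int. \<bar>real_of_int (y - x)\<bar> \<le> r}" "0 \<le> r \<Longrightarrow> real (card {y::int. \<bar>real_of_int (y - x)\<bar> \<le> r}) \<le> 2 * r + 1"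
proof -
  have eq: "{y::int. \<bar>real_of_int (y - x)\<bar> \<le> r} = {\<lceil>real_of_int x - r\<rceil>..\<lfloor>real_of_int x + r\<rfloor>}"
    unfolding set_eq_iff mem_Collect_eq atLeastAtMost_iff ceiling_le_iff le_floor_iff abs_le_iff of_int_diff
    by (simp add: algebra_simps conj_commute)
  show "finite {y::int. \<bar>real_of_int (y - x)\<bar> \<le> r}" unfolding eq by simp
  show "0 \<le> r \<Longrightarrow> real (card {y::int. \<bar>real_of_int (y - x)\<bar> \<le> r}) \<le> 2 * r + 1" unfolding eq by simp linarith
qed

lemma card_int_open: "finite {y::int. a < real_of_int y \<and> real_of_int y < b}" "b - a - 1 \<le> real (card {y::int. a < real_of_int y \<and> real_of_int y < b})"
proof -
  have eq: "{y::int. a < real_of_int y \<and> real_of_int y < b} = {\<lfloor>a\<rfloor> + 1..\<lceil>b\<rceil> - 1}"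
  proof (rule set_eqI)
    fix y :: int
    have "y \<in> {\<lfloor>a\<rfloor> + 1..\<lceil>b\<rceil> - 1} \<longleftrightarrow> \<lfloor>a\<rfloor> < y \<and> y < \<lceil>b\<rceil>" by auto
    then show "y \<in> {y. a < real_of_int y \<and> real_of_int y < b} \<longleftrightarrow> y \<in> {\<lfloor>a\<rfloor> + 1..\<lceil>b\<rceil> - 1}"
      by (simp add: floor_less_iff less_ceiling_iff)
  qed
  show "finite {y::int. a < real_of_int y \<and> real_of_int y < b}" unfolding eq by simp
  show "b - a - 1 \<le> real (card {y::int. a < real_of_int y \<and> real_of_int y < b})" unfolding eq by simp linarith
qed

text \<open>A ball has at most \<open>3 * R (q - p - 1)\<close> sites, each unseeded with
  probability 1 / \<open>R (q - p)\<close>, which leaves \<open>3 * exp (- \<iota>)\<close>. In a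
  slot about \<open>exp \<iota>\<close> unseeded sites are expected, so having none is doubly
  exponentially unlikely.\<close>

lemma not_good_prob:
  assumes \<iota>: "1 \<le> \<iota>"
  shows "prob {\<omega> \<in> space Pr. \<not> good_at \<iota> H x \<omega>} \<le> good_error \<iota> H"
proof -
  let ?R = "grid_events.R \<iota>"
  let ?inc = "\<lambda>p q y \<omega>. N (real q * \<iota>) y \<omega> - N (real p * \<iota>) y \<omega>"
  define I where "I = {(p, q). p < q \<and> q \<le> H}"
  define ball where "ball p q = {y. \<bar>real_of_int (y - x)\<bar> \<le> ?R (q - p - 1)}" for p q
  define slot where "slot p q i = {y. real_of_int x + real_of_int i * ?R (q - p + 1) < real_of_int y \<and>
        real_of_int y < real_of_int x + (real_of_int i + 1) * ?R (q - p + 1)}" for p q and i :: int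
  define A1 where "A1 p q = (\<Union>y\<in>ball p q. {\<omega> \<in> space Pr. ?inc p q y \<omega> = 0})" for p q
  define A2 where "A2 p q = (\<Union>i\<in>{- int H..int H}. {\<omega> \<in> space Pr. \<forall>y\<in>slot p q i. ?inc p q y \<omega> \<noteq> 0})" for p q
  have Im: "I \<subseteq> {..H} \<times> {..H}" by (auto simp: I_def)
  then have fI: "finite I" by (rule finite_subset) auto
  have cI: "real (card I) \<le> (real H + 1)\<^sup>2"
    using card_mono[OF _ Im] by (simp add: power2_eq_square card_cartesian_product algebra_simps flip: of_nat_mult of_nat_add)
  have i0: "0 \<le> real p * \<iota>" for p :: nat using \<iota> by simp
  have incm: "?inc p q y \<in> measurable Pr (count_space UNIV)" for p q y
  proof -
    have [measurable]: "N (real p * \<iota>) y \<in> measurable Pr (count_space UNIV)" "N (real q * \<iota>) y \<in> measurable Pr (count_space UNIV)"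
      using N_meas i0 by auto
    show ?thesis by measurable
  qed
  have e1: "{\<omega> \<in> space Pr. ?inc p q y \<omega> = 0} \<in> events" for p q y
    using incm[of q y p] by measurable
  have e2: "{\<omega> \<in> space Pr. \<forall>y\<in>slot p q i. ?inc p q y \<omega> \<noteq> 0} \<in> events" for p q i
  proof (rule sets.sets_Collect_finite_All)
    show "finite (slot p q i)" unfolding slot_def by (rule card_int_open)
    show "{\<omega> \<in> space Pr. ?inc p q y \<omega> \<noteq> 0} \<in> events" for y using incm[of q y p] by measurable
  qed
  have fb: "finite (ball p q)" for p q unfolding ball_def by (rule card_int_ball)
  have A1e: "A1 p q \<in> events" and A2e: "A2 p q \<in> events" for p q
    unfolding A1_def A2_def using fb e1 e2 by (auto intro!: sets.finite_UN)
  have A1: "prob (A1 p q) \<le> 3 * exp (- \<iota>)" if "(p, q) \<in> I" for p q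
  proof -
    have pq: "p < q" using that by (simp add: I_def)
    have "prob (A1 p q) \<le> real (card (ball p q)) * exp (- (real q * \<iota> - real p * \<iota>))"
      unfolding A1_def by (rule prob_UN_le[OF fb e1]) (use N_incr(1)[OF i0] pq \<iota> in simp)
    also have "\<dots> \<le> 3 * ?R (q - p - 1) * exp (- (real q * \<iota> - real p * \<iota>))"
    proof (rule mult_right_mono)
      have "1 \<le> ?R (q - p - 1)" using \<iota> by (simp add: grid_events.R_def)
      then show "real (card (ball p q)) \<le> 3 * ?R (q - p - 1)"
        using card_int_ball(2)[of "?R (q - p - 1)" x] by (simp add: ball_def)
    qed simp
    also have "\<dots> = 3 * exp (- \<iota>)"
      using pq by (simp add: grid_events.R_def exp_add[symmetric] of_nat_diff algebra_simps)
    finally show ?thesis .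
  qed
  have A2: "prob (A2 p q) \<le> (2 * real H + 1) * exp (1 - exp \<iota>)" if "(p, q) \<in> I" for p q
  proof -
    have pq: "p < q" using that by (simp add: I_def)
    define \<delta> where "\<delta> = exp (- (real q * \<iota> - real p * \<iota>))"
    have \<delta>: "0 \<le> \<delta>" "\<delta> \<le> 1" using pq \<iota> by (auto simp: \<delta>_def)
    have "prob (A2 p q) \<le> real (card {- int H..int H}) * exp (1 - exp \<iota>)"
      unfolding A2_def
    proof (rule prob_UN_le)
      show "finite {- int H..int H}" by (rule finite_atLeastAtMost_int)
      show "{\<omega> \<in> space Pr. \<forall>y\<in>slot p q i. ?inc p q y \<omega> \<noteq> 0} \<in> events" for i by (rule e2)
      fix i assume "i \<in> {- int H..int H}"
      have fs: "finite (slot p q i)" unfolding slot_def by (rule card_int_open)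
      have c: "?R (q - p + 1) - 1 \<le> real (card (slot p q i))"
        using card_int_open(2)[of "real_of_int x + (real_of_int i + 1) * ?R (q - p + 1)" "real_of_int x + real_of_int i * ?R (q - p + 1)"]
        by (simp add: slot_def algebra_simps)
      have "prob {\<omega> \<in> space Pr. \<forall>y\<in>slot p q i. ?inc p q y \<omega> \<noteq> 0} = (1 - \<delta>) ^ card (slot p q i)"
        using N_all_incr[OF i0 _ fs, of p "real q * \<iota>"] pq \<iota> by (simp add: \<delta>_def)
      also have "\<dots> \<le> exp (- \<delta>) ^ card (slot p q i)"
        using exp_ge_add_one_self[of "- \<delta>"] \<delta> by (intro power_mono) auto
      also have "\<dots> = exp (- (\<delta> * real (card (slot p q i))))" by (simp add: exp_of_nat_mult[symmetric] mult.commute)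
      also have "\<dots> \<le> exp (1 - exp \<iota>)"
      proof -
        \<comment> \<open>The 1 pays for rounding the ends of the slot to integers.\<close>
        have "exp \<iota> - 1 \<le> \<delta> * ?R (q - p + 1) - \<delta>"
          using \<delta> pq by (simp add: \<delta>_def grid_events.R_def exp_add[symmetric] of_nat_diff algebra_simps)
        also have "\<dots> \<le> \<delta> * real (card (slot p q i))" using mult_left_mono[OF c \<delta>(1)] by (simp add: algebra_simps)
        finally show ?thesis by simp
      qed
      finally show "prob {\<omega> \<in> space Pr. \<forall>y\<in>slot p q i. ?inc p q y \<omega> \<noteq> 0} \<le> exp (1 - exp \<iota>)" .
    qed
    also have "real (card {- int H..int H}) = 2 * real H + 1" by simp
    finally show ?thesis .
  qed
  have "{\<omega> \<in> space Pr. \<not> good_at \<iota> H x \<omega>} \<subseteq> (\<Union>j\<in>I. A1 (fst j) (snd j) \<union> A2 (fst j) (snd j))"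
  proof
    fix \<omega> assume \<omega>: "\<omega> \<in> {\<omega> \<in> space Pr. \<not> good_at \<iota> H x \<omega>}"
    have ev: "grid_events.ev (\<lambda>t i. N t i \<omega>) \<iota> y p q \<longleftrightarrow> ?inc p q y \<omega> \<noteq> 0" for y p q
      unfolding grid_events.ev_def by linarith
    define U V where "U p q \<longleftrightarrow> (\<forall>y\<in>ball p q. ?inc p q y \<omega> \<noteq> 0)"
      and "V p q \<longleftrightarrow> (\<forall>i. \<bar>i\<bar> \<le> int H \<longrightarrow> (\<exists>y\<in>slot p q i. \<not> ?inc p q y \<omega> \<noteq> 0))" for p q
    have "grid_events.good (\<lambda>t i. N t i \<omega>) \<iota> H x \<longleftrightarrow> (\<forall>p q. p < q \<and> q \<le> H \<longrightarrow> U p q \<and> V p q)"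
      unfolding U_def V_def grid_events.good_def ev ball_def slot_def Ball_def Bex_def mem_Collect_eq of_int_abs conj_assoc by (rule refl)
    moreover have "\<not> grid_events.good (\<lambda>t i. N t i \<omega>) \<iota> H x" using \<omega> by simp
    ultimately obtain p q where pq: "p < q" "q \<le> H" and "\<not> U p q \<or> \<not> V p q" by blast
    then have c: "(\<exists>y\<in>ball p q. ?inc p q y \<omega> = 0) \<or> (\<exists>i\<in>{- int H..int H}. \<forall>y\<in>slot p q i. ?inc p q y \<omega> \<noteq> 0)"
      unfolding U_def V_def by (auto simp: abs_le_iff)
    have "\<omega> \<in> A1 p q \<union> A2 p q" using c \<omega> unfolding A1_def A2_def by blast
    then show "\<omega> \<in> (\<Union>j\<in>I. A1 (fst j) (snd j) \<union> A2 (fst j) (snd j))" using pq by (auto simp: I_def intro!: bexI[of _ "(p, q)"])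
  qed
  then have "prob {\<omega> \<in> space Pr. \<not> good_at \<iota> H x \<omega>} \<le> prob (\<Union>j\<in>I. A1 (fst j) (snd j) \<union> A2 (fst j) (snd j))"
    using fI A1e A2e by (intro finite_measure_mono) (auto intro!: sets.finite_UN)
  also have "\<dots> \<le> real (card I) * (3 * exp (- \<iota>) + (2 * real H + 1) * exp (1 - exp \<iota>))"
  proof (rule prob_UN_le[OF fI])
    fix j assume j: "j \<in> I"
    show "A1 (fst j) (snd j) \<union> A2 (fst j) (snd j) \<in> events" using A1e A2e by auto
    have "prob (A1 (fst j) (snd j) \<union> A2 (fst j) (snd j)) \<le> prob (A1 (fst j) (snd j)) + prob (A2 (fst j) (snd j))"
      using A1e A2e by (rule measure_Un_le)
    then show "prob (A1 (fst j) (snd j) \<union> A2 (fst j) (snd j)) \<le> 3 * exp (- \<iota>) + (2 * real H + 1) * exp (1 - exp \<iota>)"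
      using A1[of "fst j" "snd j"] A2[of "fst j" "snd j"] j by simp
  qed
  also have "\<dots> \<le> good_error \<iota> H"
    unfolding good_error_def using cI by (intro mult_right_mono) auto
  finally show ?thesis .
qed

text \<open>Seeds and fires are independent. The factor \<open>lam\<close> gained from the presence
  of a fire compensates for the number of sites in the later union bound.\<close>

lemma fire_not_good_prob:
  fixes T :: real
  assumes \<iota>: "1 \<le> \<iota>" and T: "0 < T"
  shows "prob {\<omega> \<in> space Pr. M T x \<omega> - M 0 x \<omega> \<noteq> 0 \<and> \<not> good_at \<iota> H x \<omega>} \<le> lam * T * good_error \<iota> H"
proof -
  let ?S = "PiM ({0::real..} \<times> (UNIV :: int set)) (\<lambda>_. count_space (UNIV :: nat set))"
  let ?N = "\<lambda>\<omega>. \<lambda>(t, i)\<in>{0..} \<times> UNIV. N t i \<omega>" and ?M = "\<lambda>\<omega>. \<lambda>(t, i)\<in>{0..} \<times> UNIV. M t i \<omega>"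
  define A where "A = {g \<in> space ?S. \<not> grid_events.good (\<lambda>t i. g (t, i)) \<iota> H x}"
  define B where "B = {g \<in> space ?S. g (T, x) - g (0::real, x) \<noteq> 0}"
  have Am: "A \<in> sets ?S" unfolding A_def using good_pred[of \<iota> H x] \<iota> by simp
  have Bm: "B \<in> sets ?S"
  proof -
    have [measurable]: "(\<lambda>g. g (T, x)) \<in> measurable ?S (count_space UNIV)" "(\<lambda>g. g (0, x)) \<in> measurable ?S (count_space UNIV)"
      by (rule measurable_component_singleton; use T in simp)+
    show ?thesis unfolding B_def by measurable
  qed
  have A: "?N -` A \<inter> space Pr = {\<omega> \<in> space Pr. \<not> good_at \<iota> H x \<omega>}"
    using good_at_path[where \<iota> = \<iota> and H = H and x = x] \<iota> measurable_space[OF N_path_meas] unfolding A_def by auto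
  have B: "?M -` B \<inter> space Pr = {\<omega> \<in> space Pr. M T x \<omega> - M 0 x \<omega> \<noteq> 0}"
    using measurable_space[OF M_path_meas] T unfolding B_def by auto
  have "{\<omega> \<in> space Pr. M T x \<omega> - M 0 x \<omega> \<noteq> 0 \<and> \<not> good_at \<iota> H x \<omega>} = (\<lambda>\<omega>. (?N \<omega>, ?M \<omega>)) -` (A \<times> B) \<inter> space Pr"
    using A B by auto
  then have "prob {\<omega> \<in> space Pr. M T x \<omega> - M 0 x \<omega> \<noteq> 0 \<and> \<not> good_at \<iota> H x \<omega>} = prob (?N -` A \<inter> space Pr) * prob (?M -` B \<inter> space Pr)"
    using indep_varD[OF indep_NM[unfolded indep_families_def] Am Bm] by simp
  also have "\<dots> \<le> good_error \<iota> H * (lam * (T - 0))"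
    unfolding A B using not_good_prob[OF \<iota>, of H x] M_incr(2)[of 0 T x] T
    by (intro mult_mono) (auto simp: good_error_def)
  finally show ?thesis by (simp add: mult_ac)
qed

end

lemma column_sites:
  assumes "0 < d"
  shows "finite {x. column_of d x = c}" "real (card {x. column_of d x = c}) \<le> 1 / d + 1" "1 / d - 1 \<le> real (card {x. column_of d x = c})"
proof -
  have iff: "column_of d x = c \<longleftrightarrow> real_of_int c / d \<le> real_of_int x \<and> real_of_int x < (real_of_int c + 1) / d" for x
    unfolding column_of_def floor_eq_iff using assms by (simp add: pos_divide_le_eq pos_less_divide_eq)
  have eq: "{x. column_of d x = c} = {\<lceil>real_of_int c / d\<rceil>..\<lceil>(real_of_int c + 1) / d\<rceil> - 1}"
  proof (rule set_eqI)
    fix x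
    have "x \<in> {\<lceil>real_of_int c / d\<rceil>..\<lceil>(real_of_int c + 1) / d\<rceil> - 1} \<longleftrightarrow> \<lceil>real_of_int c / d\<rceil> \<le> x \<and> x < \<lceil>(real_of_int c + 1) / d\<rceil>" by auto
    then show "x \<in> {x. column_of d x = c} \<longleftrightarrow> x \<in> {\<lceil>real_of_int c / d\<rceil>..\<lceil>(real_of_int c + 1) / d\<rceil> - 1}"
      by (simp only: mem_Collect_eq iff ceiling_le_iff less_ceiling_iff)
  qed
  show "finite {x. column_of d x = c}" unfolding eq by simp
  have "(real_of_int c + 1) / d - real_of_int c / d = 1 / d" using assms by (simp add: diff_divide_distrib[symmetric])
  moreover have "0 < 1 / d" using assms by simp
  ultimately show "real (card {x. column_of d x = c}) \<le> 1 / d + 1" "1 / d - 1 \<le> real (card {x. column_of d x = c})"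
    unfolding eq by (simp; linarith)+
qed

lemma finite_cells: "finite (cells Q P)"
  by (simp add: cells_def)

lemma card_cells: "card (cells Q P) = 2 * Q * (P + 1)"
proof -
  have "nat (2 * int Q) = 2 * Q" by simp
  then show ?thesis by (simp add: cells_def card_cartesian_product)
qed

section \<open>The exceptional set and the law of the marks\<close>

locale ffp_scaled = ffp_space Pr lam N M \<eta>
  for Pr :: "'a measure" and lam :: real and N M \<eta> :: "real \<Rightarrow> int \<Rightarrow> 'a \<Rightarrow> nat" +
  fixes \<iota> d :: real and gN hN P Q :: nat
  assumes \<iota>1: "1 \<le> \<iota>" and d_pos: "0 < d"
begin

definition T :: real where "T = (real P + 1) * \<iota>"

text \<open>The spacing \<open>3 * ((P + 3) * K)\<close> demanded by
  \<open>realization\<close>.\<close>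

definition W :: real where "W = 3 * ((real P + 3) * exp (real (gN - 1) * \<iota>))"

definition inc :: "int \<Rightarrow> 'a \<Rightarrow> nat" where "inc x \<omega> = M T x \<omega> - M 0 x \<omega>"

definition row_inc :: "nat \<Rightarrow> int \<Rightarrow> 'a \<Rightarrow> nat" where
  "row_inc s x \<omega> = M ((real s + 1) * \<iota>) x \<omega> - M (real s * \<iota>) x \<omega>"

abbreviation "pair x y \<equiv> {\<omega> \<in> space Pr. inc x \<omega> \<noteq> 0 \<and> inc y \<omega> \<noteq> 0}"

abbreviation "row_pair j x y \<equiv> {\<omega> \<in> space Pr. row_inc (snd j) x \<omega> \<noteq> 0 \<and> row_inc (snd j) y \<omega> \<noteq> 0}"

definition near :: "int \<Rightarrow> real \<Rightarrow> int set" where "near x r = {y. \<bar>real_of_int (y - x)\<bar> \<le> r}"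

definition sites :: "int \<Rightarrow> int set" where "sites c = {x. column_of d x = c}"

abbreviation "H \<equiv> P + 1 + gN"

definition fail :: "'a set" where
  "fail = (\<Union>x\<in>near 0 (real Q / d). {\<omega> \<in> space Pr. 2 \<le> inc x \<omega>}) \<union>
     (\<Union>x\<in>near 0 (real Q / d). \<Union>y\<in>near x W - {x}. pair x y) \<union>
     (\<Union>x\<in>near 0 W. {\<omega> \<in> space Pr. inc x \<omega> \<noteq> 0}) \<union>
     (\<Union>x\<in>near 0 (real Q / d). {\<omega> \<in> space Pr. inc x \<omega> \<noteq> 0 \<and> \<not> good_at \<iota> H x \<omega>}) \<union>
     {\<omega> \<in> space Pr. \<not> good_at \<iota> H 0 \<omega>} \<union>
     (\<Union>j\<in>cells Q P. \<Union>x\<in>sites (fst j). \<Union>y\<in>sites (fst j) - {x}. row_pair j x y)"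

lemma \<iota>0: "0 \<le> \<iota>" "0 < \<iota>" using \<iota>1 by auto

lemma T_pos: "0 < T" using \<iota>0 by (simp add: T_def)

lemma inc_meas: "inc x \<in> measurable Pr (count_space UNIV)"
proof -
  have [measurable]: "M T x \<in> measurable Pr (count_space UNIV)" "M 0 x \<in> measurable Pr (count_space UNIV)"
    using M_meas T_pos by auto
  show ?thesis unfolding inc_def by measurable
qed

lemma row_inc_meas: "row_inc s x \<in> measurable Pr (count_space UNIV)"
proof -
  have [measurable]: "M ((real s + 1) * \<iota>) x \<in> measurable Pr (count_space UNIV)" "M (real s * \<iota>) x \<in> measurable Pr (count_space UNIV)"
    using M_meas \<iota>0 by auto
  show ?thesis unfolding row_inc_def by measurable
qed

lemma finite_near: "finite (near x r)" and card_near: "0 \<le> r \<Longrightarrow> real (card (near x r)) \<le> 2 * r + 1"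
  unfolding near_def using card_int_ball by auto

lemma finite_sites: "finite (sites c)" and card_sites: "real (card (sites c)) \<le> 1 / d + 1" "1 / d - 1 \<le> real (card (sites c))"
  unfolding sites_def using column_sites[OF d_pos] by auto

lemma fail_events_aux:
  "{\<omega> \<in> space Pr. 2 \<le> inc x \<omega>} \<in> events"
  "pair x y \<in> events"
  "{\<omega> \<in> space Pr. inc x \<omega> \<noteq> 0} \<in> events"
  "{\<omega> \<in> space Pr. inc x \<omega> \<noteq> 0 \<and> \<not> good_at \<iota> H z \<omega>} \<in> events"
  "{\<omega> \<in> space Pr. \<not> good_at \<iota> H z \<omega>} \<in> events"
  "{\<omega> \<in> space Pr. row_inc s x \<omega> \<noteq> 0 \<and> row_inc s y \<omega> \<noteq> 0} \<in> events"
proof -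
  have [measurable]: "\<And>x. inc x \<in> measurable Pr (count_space UNIV)" "\<And>s x. row_inc s x \<in> measurable Pr (count_space UNIV)"
    using inc_meas row_inc_meas by auto
  show "{\<omega> \<in> space Pr. 2 \<le> inc x \<omega>} \<in> events" by measurable
  show "pair x y \<in> events" by measurable
  show i: "{\<omega> \<in> space Pr. inc x \<omega> \<noteq> 0} \<in> events" by measurable
  show g: "{\<omega> \<in> space Pr. \<not> good_at \<iota> H z \<omega>} \<in> events" by (rule good_events[OF \<iota>0(1)])
  have "{\<omega> \<in> space Pr. inc x \<omega> \<noteq> 0 \<and> \<not> good_at \<iota> H z \<omega>} = {\<omega> \<in> space Pr. inc x \<omega> \<noteq> 0} \<inter> {\<omega> \<in> space Pr. \<not> good_at \<iota> H z \<omega>}" by auto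
  then show "{\<omega> \<in> space Pr. inc x \<omega> \<noteq> 0 \<and> \<not> good_at \<iota> H z \<omega>} \<in> events" using i g by simp
  show "{\<omega> \<in> space Pr. row_inc s x \<omega> \<noteq> 0 \<and> row_inc s y \<omega> \<noteq> 0} \<in> events" by measurable
qed

lemma fail_event: "fail \<in> events"
  unfolding fail_def
  by (intro sets.Un sets.finite_UN finite_near finite_Diff finite_cells finite_sites fail_events_aux)

text \<open>All terms but the last tend to 0 with \<lambda>. The last one is for two fires in the
  same cell; it tends to \<open>card (cells Q P) / gN ^ 4\<close> and becomes small only when the
  grid is refined.\<close>

definition fail_bound :: real where
  "fail_bound = (2 * (real Q / d) + 1) * (lam * T)\<^sup>2 + (2 * (real Q / d) + 1) * ((2 * W + 1) * (lam * T)\<^sup>2) + (2 * W + 1) * (lam * T) +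
     (2 * (real Q / d) + 1) * (lam * T * good_error \<iota> H) + good_error \<iota> H + real (card (cells Q P)) * (((1 / d + 1) * (lam * \<iota>))\<^sup>2)"

lemma fail_prob: "prob fail \<le> fail_bound"
proof -
  have W0: "0 \<le> W" by (simp add: W_def)
  have Q0: "0 \<le> real Q / d" using d_pos by simp
  note cQ = card_near[OF Q0, of 0]
  have lT: "0 \<le> lam * T" using lam T_pos by simp
  have ge: "0 \<le> good_error \<iota> H" by (simp add: good_error_def)
  have 1: "prob (\<Union>x\<in>near 0 (real Q / d). {\<omega> \<in> space Pr. 2 \<le> inc x \<omega>}) \<le> (2 * (real Q / d) + 1) * (lam * T)\<^sup>2"
    (is "prob ?F1 \<le> _")
  proof -
    have "prob ?F1 \<le> real (card (near 0 (real Q / d))) * (lam * T)\<^sup>2"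
      by (rule prob_UN_le[OF finite_near fail_events_aux(1)]) (use M_incr(3)[of 0 T] T_pos in \<open>simp add: inc_def\<close>)
    also have "\<dots> \<le> (2 * (real Q / d) + 1) * (lam * T)\<^sup>2" using cQ by (rule mult_right_mono) simp
    finally show ?thesis .
  qed
  have 2: "prob (\<Union>x\<in>near 0 (real Q / d). \<Union>y\<in>near x W - {x}. pair x y) \<le>
      (2 * (real Q / d) + 1) * ((2 * W + 1) * (lam * T)\<^sup>2)" (is "prob ?F2 \<le> _")
  proof -
    have "prob ?F2 \<le> real (card (near 0 (real Q / d))) * ((2 * W + 1) * (lam * T)\<^sup>2)"
    proof (rule prob_UN_le[OF finite_near])
      fix x
      show "(\<Union>y\<in>near x W - {x}. pair x y) \<in> events"
        by (intro sets.finite_UN finite_Diff finite_near fail_events_aux)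
      have "prob (\<Union>y\<in>near x W - {x}. pair x y) \<le> real (card (near x W - {x})) * (lam * T)\<^sup>2"
        by (rule prob_UN_le[OF finite_Diff[OF finite_near] fail_events_aux(2)])
           (use M_pair_incr[of 0 T x] T_pos in \<open>auto simp: inc_def\<close>)
      also have "\<dots> \<le> (2 * W + 1) * (lam * T)\<^sup>2"
      proof (rule mult_right_mono)
        have "card (near x W - {x}) \<le> card (near x W)" by (rule card_mono[OF finite_near]) auto
        then show "real (card (near x W - {x})) \<le> 2 * W + 1" using card_near[OF W0, of x] by linarith
      qed simp
      finally show "prob (\<Union>y\<in>near x W - {x}. pair x y) \<le> (2 * W + 1) * (lam * T)\<^sup>2" .
    qed
    also have "\<dots> \<le> (2 * (real Q / d) + 1) * ((2 * W + 1) * (lam * T)\<^sup>2)" using cQ by (rule mult_right_mono) (use W0 in simp)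
    finally show ?thesis .
  qed
  have 3: "prob (\<Union>x\<in>near 0 W. {\<omega> \<in> space Pr. inc x \<omega> \<noteq> 0}) \<le> (2 * W + 1) * (lam * T)" (is "prob ?F3 \<le> _")
  proof -
    have "prob ?F3 \<le> real (card (near 0 W)) * (lam * T)"
      by (rule prob_UN_le[OF finite_near fail_events_aux(3)]) (use M_incr(2)[of 0 T] T_pos in \<open>auto simp: inc_def\<close>)
    also have "\<dots> \<le> (2 * W + 1) * (lam * T)" using card_near[OF W0, of 0] by (rule mult_right_mono) (rule lT)
    finally show ?thesis .
  qed
  have 4: "prob (\<Union>x\<in>near 0 (real Q / d). {\<omega> \<in> space Pr. inc x \<omega> \<noteq> 0 \<and> \<not> good_at \<iota> H x \<omega>}) \<le>
      (2 * (real Q / d) + 1) * (lam * T * good_error \<iota> H)" (is "prob ?F4 \<le> _")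
  proof -
    have "prob ?F4 \<le> real (card (near 0 (real Q / d))) * (lam * T * good_error \<iota> H)"
      by (rule prob_UN_le[OF finite_near fail_events_aux(4)]) (use fire_not_good_prob[OF \<iota>1 T_pos] in \<open>auto simp: inc_def\<close>)
    also have "\<dots> \<le> (2 * (real Q / d) + 1) * (lam * T * good_error \<iota> H)" using cQ by (rule mult_right_mono) (use lT ge in simp)
    finally show ?thesis .
  qed
  have 5: "prob {\<omega> \<in> space Pr. \<not> good_at \<iota> H 0 \<omega>} \<le> good_error \<iota> H" (is "prob ?F5 \<le> _") by (rule not_good_prob[OF \<iota>1])
  have 6: "prob (\<Union>j\<in>cells Q P. \<Union>x\<in>sites (fst j). \<Union>y\<in>sites (fst j) - {x}. row_pair j x y)
     \<le> real (card (cells Q P)) * (((1 / d + 1) * (lam * \<iota>))\<^sup>2)" (is "prob ?F6 \<le> _")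
  proof (rule prob_UN_le[OF finite_cells])
    fix j :: "int \<times> nat"
    show "(\<Union>x\<in>sites (fst j). \<Union>y\<in>sites (fst j) - {x}. row_pair j x y) \<in> events"
      by (intro sets.finite_UN finite_Diff finite_sites fail_events_aux)
    have "prob (\<Union>x\<in>sites (fst j). \<Union>y\<in>sites (fst j) - {x}. row_pair j x y)
       \<le> real (card (sites (fst j))) * ((1 / d + 1) * (lam * \<iota>)\<^sup>2)"
    proof (rule prob_UN_le[OF finite_sites])
      fix x
      show "(\<Union>y\<in>sites (fst j) - {x}. row_pair j x y) \<in> events"
        by (intro sets.finite_UN finite_Diff finite_sites fail_events_aux)
      have "prob (\<Union>y\<in>sites (fst j) - {x}. row_pair j x y)
        \<le> real (card (sites (fst j) - {x})) * (lam * \<iota>)\<^sup>2"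
      proof (rule prob_UN_le[OF finite_Diff[OF finite_sites] fail_events_aux(6)])
        fix y assume "y \<in> sites (fst j) - {x}"
        moreover have "(real (snd j) + 1) * \<iota> - real (snd j) * \<iota> = \<iota>" by (simp add: algebra_simps)
        ultimately show "prob (row_pair j x y) \<le> (lam * \<iota>)\<^sup>2"
          using M_pair_incr[of "real (snd j) * \<iota>" "(real (snd j) + 1) * \<iota>" x y] \<iota>0 by (auto simp: row_inc_def)
      qed
      also have "\<dots> \<le> (1 / d + 1) * (lam * \<iota>)\<^sup>2"
      proof (rule mult_right_mono)
        have "card (sites (fst j) - {x}) \<le> card (sites (fst j))" by (rule card_mono[OF finite_sites]) auto
        then show "real (card (sites (fst j) - {x})) \<le> 1 / d + 1" using card_sites(1)[of "fst j"] by linarith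
      qed simp
      finally show "prob (\<Union>y\<in>sites (fst j) - {x}. row_pair j x y) \<le> (1 / d + 1) * (lam * \<iota>)\<^sup>2" .
    qed
    also have "\<dots> \<le> (1 / d + 1) * ((1 / d + 1) * (lam * \<iota>)\<^sup>2)" using card_sites(1) by (rule mult_right_mono) (use d_pos in simp)
    also have "\<dots> = ((1 / d + 1) * (lam * \<iota>))\<^sup>2" by (simp add: power2_eq_square)
    finally show "prob (\<Union>x\<in>sites (fst j). \<Union>y\<in>sites (fst j) - {x}. row_pair j x y)
       \<le> ((1 / d + 1) * (lam * \<iota>))\<^sup>2" .
  qed
  have e: "?F1 \<in> events" "?F2 \<in> events" "?F3 \<in> events" "?F4 \<in> events" "?F5 \<in> events" "?F6 \<in> events"
    by (intro sets.finite_UN finite_near finite_Diff finite_cells finite_sites fail_events_aux)+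
  have "prob fail \<le> prob ?F1 + prob ?F2 + prob ?F3 + prob ?F4 + prob ?F5 + prob ?F6"
    unfolding fail_def using e
    by (intro order_trans[OF measure_Un_le] add_mono order_refl sets.Un)
  then show ?thesis using 1 2 3 4 5 6 unfolding fail_bound_def by linarith
qed

lemma not_failD:
  assumes "\<omega> \<in> space Pr" "\<omega> \<notin> fail"
  shows "\<And>x. x \<in> near 0 (real Q / d) \<Longrightarrow> \<not> 2 \<le> inc x \<omega>"
    "\<And>x y. x \<in> near 0 (real Q / d) \<Longrightarrow> y \<in> near x W - {x} \<Longrightarrow> inc x \<omega> = 0 \<or> inc y \<omega> = 0"
    "\<And>x. x \<in> near 0 W \<Longrightarrow> inc x \<omega> = 0"
    "\<And>x. x \<in> near 0 (real Q / d) \<Longrightarrow> inc x \<omega> = 0 \<or> good_at \<iota> H x \<omega>"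
    "good_at \<iota> H 0 \<omega>"
    "\<And>j x y. j \<in> cells Q P \<Longrightarrow> x \<in> sites (fst j) \<Longrightarrow> y \<in> sites (fst j) - {x} \<Longrightarrow> row_inc (snd j) x \<omega> = 0 \<or> row_inc (snd j) y \<omega> = 0"
proof -
  note nf = assms(2)[unfolded fail_def Un_iff de_Morgan_disj]
  show "\<And>x. x \<in> near 0 (real Q / d) \<Longrightarrow> \<not> 2 \<le> inc x \<omega>"
    using nf[THEN conjunct1, THEN conjunct1, THEN conjunct1, THEN conjunct1, THEN conjunct1] assms(1) by blast
  show "\<And>x y. x \<in> near 0 (real Q / d) \<Longrightarrow> y \<in> near x W - {x} \<Longrightarrow> inc x \<omega> = 0 \<or> inc y \<omega> = 0"
    using nf[THEN conjunct1, THEN conjunct1, THEN conjunct1, THEN conjunct1, THEN conjunct2] assms(1) by blast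
  show "\<And>x. x \<in> near 0 W \<Longrightarrow> inc x \<omega> = 0"
    using nf[THEN conjunct1, THEN conjunct1, THEN conjunct1, THEN conjunct2] assms(1) by blast
  show "\<And>x. x \<in> near 0 (real Q / d) \<Longrightarrow> inc x \<omega> = 0 \<or> good_at \<iota> H x \<omega>"
    using nf[THEN conjunct1, THEN conjunct1, THEN conjunct2] assms(1) by blast
  show "good_at \<iota> H 0 \<omega>"
    using nf[THEN conjunct1, THEN conjunct2] assms(1) by blast
  show "\<And>j x y. j \<in> cells Q P \<Longrightarrow> x \<in> sites (fst j) \<Longrightarrow> y \<in> sites (fst j) - {x} \<Longrightarrow> row_inc (snd j) x \<omega> = 0 \<or> row_inc (snd j) y \<omega> = 0"
    using nf[THEN conjunct2] assms(1) by blast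
qed

lemma AE_realization:
  assumes N: "gN = 2 * hN" "20 \<le> hN" "gN \<le> P"
    and t: "real P * \<iota> < t" "t \<le> (real P + 1) * \<iota>"
    and small: "(2 * W + 1) * d \<le> 1 / 2" "real Q / d \<le> exp (real gN * \<iota>)"
  shows "AE \<omega> in Pr. \<omega> \<notin> fail \<longrightarrow> realization (\<lambda>t i. N t i \<omega>) (\<lambda>t i. M t i \<omega>) (\<lambda>t i. \<eta> t i \<omega>) \<iota> gN hN P Q d t"
  using AE_paths AE_space
proof eventually_elim
  case (elim \<omega>)
  show ?case
  proof
    assume nf: "\<omega> \<notin> fail"
    note D = not_failD[OF elim(2) nf]
    have M0: "M 0 i \<omega> = 0" for i using elim by auto
    interpret ffp_dynamics "\<lambda>t i. N t i \<omega>" "\<lambda>t i. M t i \<omega>" "\<lambda>t i. \<eta> t i \<omega>" using elim by auto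
    interpret ffp_grid "\<lambda>t i. N t i \<omega>" "\<lambda>t i. M t i \<omega>" "\<lambda>t i. \<eta> t i \<omega>" \<iota> gN hN
      by unfold_locales (use N \<iota>1 in auto)
    have W: "3 * ((real P + 3) * K) = W" by (simp add: K_def R_def W_def)
    have incM: "inc x \<omega> = M ((real P + 1) * \<iota>) x \<omega>" for x using M0 by (simp add: inc_def T_def)
    have nearQ: "x \<in> near 0 (real Q / d)" if "\<bar>real_of_int x\<bar> * d \<le> real Q" for x
      using that d_pos by (simp add: near_def pos_le_divide_eq)
    show "realization (\<lambda>t i. N t i \<omega>) (\<lambda>t i. M t i \<omega>) (\<lambda>t i. \<eta> t i \<omega>) \<iota> gN hN P Q d t"
    proof (intro realization.intro realization_axioms.intro ffp_grid_axioms)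
      show "counting_path (\<lambda>t. M t i \<omega>)" "M 0 i \<omega> = 0" for i using elim by auto
      show "0 < d" "real P * \<iota> < t" "t \<le> (real P + 1) * \<iota>" "gN \<le> P" using d_pos t N by auto
      show "(6 * ((real P + 3) * K) + 1) * d \<le> 1 / 2" using small(1) unfolding W[symmetric] by simp
      show "real Q / d \<le> R gN" using small(2) by (simp add: R_def)
      show "M ((real P + 1) * \<iota>) x \<omega> \<le> 1" if "\<bar>real_of_int x\<bar> * d \<le> real Q" for x
        using D(1)[OF nearQ[OF that]] unfolding incM[symmetric] by simp
      show "3 * ((real P + 3) * K) < \<bar>real_of_int x - real_of_int x'\<bar>"
        if x: "\<bar>real_of_int x\<bar> * d \<le> real Q" "\<bar>real_of_int x'\<bar> * d \<le> real Q" "x \<noteq> x'"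
          "0 < M ((real P + 1) * \<iota>) x \<omega>" "0 < M ((real P + 1) * \<iota>) x' \<omega>" for x x'
      proof (rule ccontr)
        assume "\<not> 3 * ((real P + 3) * K) < \<bar>real_of_int x - real_of_int x'\<bar>"
        then have "x' \<in> near x W - {x}" using x(3) W by (auto simp: near_def)
        then show False using D(2)[OF nearQ[OF x(1)]] x(4,5) unfolding incM[symmetric] by auto
      qed
      show "M ((real P + 1) * \<iota>) x \<omega> = 0" if "\<bar>real_of_int x\<bar> \<le> 3 * ((real P + 3) * K)" for x
      proof (rule ccontr)
        assume "M ((real P + 1) * \<iota>) x \<omega> \<noteq> 0"
        moreover have "x \<in> near 0 W" using that W by (simp add: near_def)
        ultimately show False using D(3)[of x] unfolding incM[symmetric] by simp
      qed
      show False if x: "x \<noteq> x'" "column_of d x = column_of d x'" "(column_of d x, s) \<in> cells Q P"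
        "M (real s * \<iota>) x \<omega> < M ((real s + 1) * \<iota>) x \<omega>" "M (real s * \<iota>) x' \<omega> < M ((real s + 1) * \<iota>) x' \<omega>" for x x' s
      proof -
        have s: "x \<in> sites (fst (column_of d x, s))" "x' \<in> sites (fst (column_of d x, s)) - {x}" using x by (auto simp: sites_def)
        have "row_inc (snd (column_of d x, s)) x \<omega> \<noteq> 0" "row_inc (snd (column_of d x, s)) x' \<omega> \<noteq> 0" using x by (auto simp: row_inc_def)
        with D(6)[OF x(3) s] show False by simp
      qed
      show "good (P + 1 + gN) x" if "\<bar>real_of_int x\<bar> * d \<le> real Q" "0 < M ((real P + 1) * \<iota>) x \<omega>" for x
        using D(4)[OF nearQ[OF that(1)]] that(2) unfolding incM[symmetric] by simp
      show "good (P + 1 + gN) 0" by (rule D(5))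
    qed
  qed
qed

text \<open>The marks outside the box are irrelevant and set to \<^const>\<open>False\<close>, so that the
  configurations form a finite set.\<close>

definition mk :: "'a \<Rightarrow> int \<times> nat \<Rightarrow> bool" where
  "mk \<omega> j \<longleftrightarrow> j \<in> cells Q P \<and> marks d \<iota> (\<lambda>t i. M t i \<omega>) j"

definition weight :: "config \<Rightarrow> real" where
  "weight f = (\<Prod>j\<in>cells Q P. if f j then 1 - exp (- (lam * \<iota> * real (card (sites (fst j))))) else exp (- (lam * \<iota> * real (card (sites (fst j))))))"

lemma marks_iff: "marks d \<iota> (\<lambda>t i. M t i \<omega>) j \<longleftrightarrow>
   (\<exists>i\<in>sites (fst j) \<times> {snd j}. M (real (Suc (snd i)) * \<iota>) (fst i) \<omega> - M (real (snd i) * \<iota>) (fst i) \<omega> \<noteq> 0)"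
  by (cases j) (auto simp: marks_def sites_def algebra_simps)

text \<open>Different cells use disjoint sets of increments, hence the product; a cell is unmarked
  exactly if none of its sites has a fire in its row.\<close>

lemma mk_prob:
  assumes "\<And>j. j \<notin> cells Q P \<Longrightarrow> \<not> f j"
  shows "prob {\<omega> \<in> space Pr. mk \<omega> = f} = weight f"
    and "{\<omega> \<in> space Pr. mk \<omega> = f} \<in> events"
proof -
  have mono: "mono (\<lambda>k::nat. real k * \<iota>)" by (intro monoI mult_right_mono) (use \<iota>0 in auto)
  have eq: "{\<omega> \<in> space Pr. mk \<omega> = f} = {\<omega> \<in> space Pr. \<forall>j\<in>cells Q P. marks d \<iota> (\<lambda>t i. M t i \<omega>) j = f j}"
  proof -
    have "mk \<omega> = f \<longleftrightarrow> (\<forall>j\<in>cells Q P. marks d \<iota> (\<lambda>t i. M t i \<omega>) j = f j)" for \<omega>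
      unfolding fun_eq_iff mk_def using assms by metis
    then show ?thesis by simp
  qed
  note ind = indep_M_grid[OF mono, of "P + 1"]
  have "prob {\<omega> \<in> space Pr. mk \<omega> = f} = (\<Prod>j\<in>cells Q P. if f j then 1 - (\<Prod>i\<in>sites (fst j) \<times> {snd j}. prob {\<omega> \<in> space Pr. M (real (Suc (snd i)) * \<iota>) (fst i) \<omega> - M (real (snd i) * \<iota>) (fst i) \<omega> = 0})
      else (\<Prod>i\<in>sites (fst j) \<times> {snd j}. prob {\<omega> \<in> space Pr. M (real (Suc (snd i)) * \<iota>) (fst i) \<omega> - M (real (snd i) * \<iota>) (fst i) \<omega> = 0}))"
    unfolding eq marks_iff
  proof (rule indep_vars_indicators_prob[OF ind finite_cells])
    show "disjoint_family_on (\<lambda>j. sites (fst j) \<times> {snd j}) (cells Q P)"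
      by (auto simp: disjoint_family_on_def sites_def prod_eq_iff)
  qed (use finite_sites in \<open>auto simp: cells_def\<close>)
  also have "\<dots> = weight f"
  proof -
    have "prob {\<omega> \<in> space Pr. M (real (Suc s) * \<iota>) x \<omega> - M (real s * \<iota>) x \<omega> = 0} = exp (- (lam * \<iota>))" for s x
      using M_incr(1)[of "real s * \<iota>" "real (Suc s) * \<iota>" x] \<iota>0 by (simp add: algebra_simps)
    then show ?thesis unfolding weight_def
      by (intro prod.cong refl) (simp add: card_cartesian_product exp_of_nat_mult[symmetric] mult_ac)
  qed
  finally show "prob {\<omega> \<in> space Pr. mk \<omega> = f} = weight f" .
  have "{\<omega> \<in> space Pr. marks d \<iota> (\<lambda>t i. M t i \<omega>) j = f j} \<in> events" for j
  proof -
    have "{\<omega> \<in> space Pr. marks d \<iota> (\<lambda>t i. M t i \<omega>) j} = (\<Union>x\<in>sites (fst j). {\<omega> \<in> space Pr. row_inc (snd j) x \<omega> \<noteq> 0})"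
      unfolding marks_iff row_inc_def by (auto simp: algebra_simps)
    also have "\<dots> \<in> events" using fail_events_aux(6)[of "snd j" x x for x] by (intro sets.finite_UN finite_sites) simp
    finally have m: "{\<omega> \<in> space Pr. marks d \<iota> (\<lambda>t i. M t i \<omega>) j} \<in> events" .
    show ?thesis
    proof (cases "f j")
      case True then show ?thesis using m by simp
    next
      case False
      then have "{\<omega> \<in> space Pr. marks d \<iota> (\<lambda>t i. M t i \<omega>) j = f j} = space Pr - {\<omega> \<in> space Pr. marks d \<iota> (\<lambda>t i. M t i \<omega>) j}" by auto
      then show ?thesis using m by auto
    qed
  qed
  then show "{\<omega> \<in> space Pr. mk \<omega> = f} \<in> events"
    unfolding eq by (intro sets.sets_Collect_finite_All finite_cells)
qed

lemma mk_prob_pred: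
  shows "prob {\<omega> \<in> space Pr. \<Psi> (mk \<omega>)} = (\<Sum>f\<in>{f \<in> PiE_dflt (cells Q P) False (\<lambda>_. UNIV). \<Psi> f}. weight f)"
    and "{\<omega> \<in> space Pr. \<Psi> (mk \<omega>)} \<in> events"
proof -
  let ?F = "{f \<in> PiE_dflt (cells Q P) False (\<lambda>_. UNIV). \<Psi> f}"
  have fin: "finite ?F" using finite_PiE_dflt[OF finite_cells, of Q P "\<lambda>_. UNIV" False] by auto
  have f0: "\<not> f j" if "f \<in> ?F" "j \<notin> cells Q P" for f j 
  proof -
    have "f j = False" using that unfolding PiE_dflt_def by blast
    then show ?thesis by simp
  qed
  have eq: "{\<omega> \<in> space Pr. \<Psi> (mk \<omega>)} = (\<Union>f\<in>?F. {\<omega> \<in> space Pr. mk \<omega> = f})"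
  proof -
    have "mk \<omega> \<in> PiE_dflt (cells Q P) False (\<lambda>_. UNIV)" for \<omega> by (simp add: PiE_dflt_def mk_def)
    then show ?thesis by auto
  qed
  show "{\<omega> \<in> space Pr. \<Psi> (mk \<omega>)} \<in> events"
    unfolding eq using mk_prob(2)[OF f0] fin by (intro sets.finite_UN)
  have "prob (\<Union>f\<in>?F. {\<omega> \<in> space Pr. mk \<omega> = f}) = (\<Sum>f\<in>?F. prob {\<omega> \<in> space Pr. mk \<omega> = f})"
    using fin mk_prob(2)[OF f0] by (intro finite_measure_finite_Union) (auto simp: disjoint_family_on_def)
  also have "\<dots> = (\<Sum>f\<in>?F. weight f)" by (intro sum.cong refl mk_prob(1)[OF f0])
  finally show "prob {\<omega> \<in> space Pr. \<Psi> (mk \<omega>)} = (\<Sum>f\<in>?F. weight f)" unfolding eq .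
qed

end

section \<open>The limit of small ignition rate\<close>

definition grid_step :: "nat \<Rightarrow> real \<Rightarrow> real" where "grid_step gN lam = ln (1 / lam) / real gN"

text \<open>With these steps \<open>exp (gN * grid_step gN lam)\<close> is 1 / \<lambda>, and a
  cell, having about 1 / \<open>site_step\<close> sites and duration \<open>grid_step\<close>,
  expects about \<open>1 / gN ^ 2\<close> fires.\<close>

definition site_step :: "nat \<Rightarrow> real \<Rightarrow> real" where "site_step gN lam = real gN * lam * ln (1 / lam)"

definition marked_cells :: "nat \<Rightarrow> nat \<Rightarrow> nat \<Rightarrow> real \<Rightarrow> (real \<Rightarrow> int \<Rightarrow> nat) \<Rightarrow> int \<times> nat \<Rightarrow> bool" where
  "marked_cells gN Q P lam m j \<longleftrightarrow> j \<in> cells Q P \<and> marks (site_step gN lam) (grid_step gN lam) m j"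

text \<open>The limit law: a cell is unmarked with the probability that a Poisson variable of mean
  \<open>1 / gN ^ 2\<close> vanishes.\<close>

definition cell_pmf :: "nat \<Rightarrow> nat \<Rightarrow> nat \<Rightarrow> config pmf" where
  "cell_pmf gN Q P = Pi_pmf (cells Q P) False (\<lambda>_. bernoulli_pmf (1 - exp (- 1 / (real gN)\<^sup>2)))"

abbreviation cell_prob :: "nat \<Rightarrow> nat \<Rightarrow> nat \<Rightarrow> config set \<Rightarrow> real" where
  "cell_prob gN Q P \<equiv> measure_pmf.prob (cell_pmf gN Q P)"

lemma eventually_small_rate: "eventually (\<lambda>lam::real. 0 < lam \<and> lam < 1) (at_right 0)"
  unfolding eventually_at_right_field by (rule exI[of _ 1]) auto

lemma grid_step_at_top: "0 < gN \<Longrightarrow> filterlim (grid_step gN) at_top (at_right 0)"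
proof -
  assume "0 < gN"
  have "filterlim (\<lambda>lam::real. ln (1 / lam)) at_top (at_right 0)" by real_asymp
  then show ?thesis unfolding grid_step_def
    using \<open>0 < gN\<close> by (intro filterlim_at_top_mult_tendsto_pos[OF tendsto_const[of "1 / real gN"], unfolded times_divide_eq_right mult_1_right]) auto
qed

lemma rate_eq: "0 < lam \<Longrightarrow> 0 < gN \<Longrightarrow> lam = exp (- (real gN * grid_step gN lam))"
  by (simp add: grid_step_def ln_div)

lemma site_step_eq: "0 < gN \<Longrightarrow> site_step gN lam = (real gN)\<^sup>2 * (grid_step gN lam * lam)"
  by (simp add: site_step_def grid_step_def power2_eq_square)

lemma lim_of_step:
  assumes "0 < gN" "(f \<longlongrightarrow> (l::real)) at_top" "\<And>lam. 0 < lam \<Longrightarrow> lam < 1 \<Longrightarrow> g lam = f (grid_step gN lam)"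
  shows "(g \<longlongrightarrow> l) (at_right 0)"
proof (rule Lim_transform_eventually)
  show "((\<lambda>lam. f (grid_step gN lam)) \<longlongrightarrow> l) (at_right 0)"
    by (rule filterlim_compose[OF assms(2) grid_step_at_top[OF assms(1)]])
  show "\<forall>\<^sub>F lam in at_right 0. f (grid_step gN lam) = g lam"
    using eventually_small_rate by eventually_elim (simp add: assms(3))
qed

lemma exp_decay: "0 < gN \<Longrightarrow> ((\<lambda>x. x * exp (- (real gN * x))) \<longlongrightarrow> 0) at_top"
proof -
  assume "0 < gN"
  have l: "((\<lambda>x::real. x * exp (- x)) \<longlongrightarrow> 0) at_top" by real_asymp
  show ?thesis
  proof (rule tendsto_sandwich[OF _ _ tendsto_const l])
    show "\<forall>\<^sub>F x in at_top. 0 \<le> x * exp (- (real gN * x))"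
      using eventually_ge_at_top[of 0] by eventually_elim simp
    show "\<forall>\<^sub>F x in at_top. x * exp (- (real gN * x)) \<le> x * exp (- x)"
      using eventually_ge_at_top[of 0]
    proof eventually_elim
      case (elim x)
      have "x \<le> real gN * x" using elim \<open>0 < gN\<close> by (cases gN) (auto simp: algebra_simps)
      then show ?case using elim by (intro mult_left_mono) auto
    qed
  qed
qed

locale ffp_family =
  fixes Pr :: "real \<Rightarrow> 'a measure" and N M \<eta> :: "real \<Rightarrow> real \<Rightarrow> int \<Rightarrow> 'a \<Rightarrow> nat"
  assumes ffp: "\<And>lam. 0 < lam \<Longrightarrow> lam < 1 \<Longrightarrow> forest_fire_process lam (Pr lam) (N lam) (M lam) (\<eta> lam)"

locale ffp_family_grid = ffp_family Pr N M \<eta> for Pr :: "real \<Rightarrow> 'a measure" and N M \<eta> :: "real \<Rightarrow> real \<Rightarrow> int \<Rightarrow> 'a \<Rightarrow> nat" +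
  fixes gN hN P Q :: nat and t :: real
  assumes gN: "gN = 2 * hN" "20 \<le> hN" "gN \<le> P" and t: "real P < t * real gN" "t * real gN \<le> real P + 1"
begin

abbreviation "cfg lam \<omega> \<equiv> marked_cells gN Q P lam (\<lambda>t i. M lam t i \<omega>)"

abbreviation "realized lam \<omega> \<equiv> realization (\<lambda>t i. N lam t i \<omega>) (\<lambda>t i. M lam t i \<omega>) (\<lambda>t i. \<eta> lam t i \<omega>)
  (grid_step gN lam) gN hN P Q (site_step gN lam) (t * ln (1 / lam))"

lemma gN0: "0 < gN" using gN by auto

lemma scaled:
  assumes "0 < lam" "lam < 1" "1 \<le> grid_step gN lam"
  shows "ffp_scaled (Pr lam) lam (N lam) (M lam) (\<eta> lam) (grid_step gN lam) (site_step gN lam)"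
proof -
  interpret prob_space "Pr lam" using ffp[OF assms(1,2)] by (simp add: forest_fire_process_def)
  show ?thesis
  proof
    show "forest_fire_process lam (Pr lam) (N lam) (M lam) (\<eta> lam)" by (rule ffp[OF assms(1,2)])
    show "0 < site_step gN lam" using assms gN0 by (simp add: site_step_eq)
  qed (use assms in auto)
qed

lemma eventually_scaled:
  "eventually (\<lambda>lam. 0 < lam \<and> lam < 1 \<and> 1 \<le> grid_step gN lam) (at_right 0)"
  using eventually_small_rate filterlim_at_top[THEN iffD1, OF grid_step_at_top[OF gN0], rule_format, of 1]
  by eventually_elim auto

lemma step_rate: "((\<lambda>lam. grid_step gN lam * lam) \<longlongrightarrow> 0) (at_right 0)"
  by (rule lim_of_step[OF gN0 exp_decay[OF gN0]]) (use rate_eq gN0 in auto)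

text \<open>There are finitely many configurations and each weight is a finite product, so only the
  number of sites per column matters. Rounding changes it by at most 1, which is negligible by
  \<open>step_rate\<close>.\<close>

lemma cfg_limit:
  "((\<lambda>lam. measure (Pr lam) {\<omega> \<in> space (Pr lam). \<Psi> (cfg lam \<omega>)}) \<longlongrightarrow> cell_prob gN Q P {f. \<Psi> f}) (at_right 0)"
proof -
  let ?F = "{f \<in> PiE_dflt (cells Q P) False (\<lambda>_. UNIV). \<Psi> f}"
  define w where "w lam c = lam * grid_step gN lam * real (card {x. column_of (site_step gN lam) x = c})" for lam c
  define wt where "wt lam f = (\<Prod>j\<in>cells Q P. if f j then 1 - exp (- w lam (fst j)) else exp (- w lam (fst j)))" for lam and f :: config
  have wlim: "((\<lambda>lam. w lam c) \<longlongrightarrow> 1 / (real gN)\<^sup>2) (at_right 0)" for c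
  proof (rule tendsto_sandwich)
    let ?u = "\<lambda>lam. grid_step gN lam * lam"
    show "((\<lambda>lam. 1 / (real gN)\<^sup>2 - ?u lam) \<longlongrightarrow> 1 / (real gN)\<^sup>2) (at_right 0)"
      "((\<lambda>lam. 1 / (real gN)\<^sup>2 + ?u lam) \<longlongrightarrow> 1 / (real gN)\<^sup>2) (at_right 0)"
      using tendsto_diff[OF tendsto_const[of "1 / (real gN)\<^sup>2"] step_rate] tendsto_add[OF tendsto_const[of "1 / (real gN)\<^sup>2"] step_rate] by auto
    have b: "1 / (real gN)\<^sup>2 - ?u lam \<le> w lam c \<and> w lam c \<le> 1 / (real gN)\<^sup>2 + ?u lam"
      if l: "0 < lam \<and> lam < 1 \<and> 1 \<le> grid_step gN lam" for lam
    proof -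
      have d0: "0 < site_step gN lam" using l gN0 by (simp add: site_step_eq)
      have u0: "0 < ?u lam" using l by simp
      have "?u lam * (1 / site_step gN lam) = 1 / (real gN)\<^sup>2" using u0 gN0 l by (simp add: site_step_eq)
      moreover have "?u lam * (1 / site_step gN lam - 1) \<le> w lam c" "w lam c \<le> ?u lam * (1 / site_step gN lam + 1)"
        using mult_left_mono[OF column_sites(3)[OF d0, of c] less_imp_le[OF u0]]
          mult_left_mono[OF column_sites(2)[OF d0, of c] less_imp_le[OF u0]]
        by (simp_all add: w_def mult_ac)
      ultimately show ?thesis by (simp add: algebra_simps)
    qed
    show "\<forall>\<^sub>F lam in at_right 0. 1 / (real gN)\<^sup>2 - ?u lam \<le> w lam c" "\<forall>\<^sub>F lam in at_right 0. w lam c \<le> 1 / (real gN)\<^sup>2 + ?u lam"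
      using eventually_scaled by (eventually_elim, use b in auto)+
  qed
  have pmf: "pmf (cell_pmf gN Q P) f = (\<Prod>j\<in>cells Q P. if f j then 1 - exp (- (1 / (real gN)\<^sup>2)) else exp (- (1 / (real gN)\<^sup>2)))" if "f \<in> ?F" for f
  proof -
    have "pmf (cell_pmf gN Q P) f = (\<Prod>j\<in>cells Q P. pmf (bernoulli_pmf (1 - exp (- 1 / (real gN)\<^sup>2))) (f j))"
      unfolding cell_pmf_def by (rule pmf_Pi') (use that finite_cells in \<open>auto simp: PiE_dflt_def\<close>)
    also have "\<dots> = (\<Prod>j\<in>cells Q P. if f j then 1 - exp (- (1 / (real gN)\<^sup>2)) else exp (- (1 / (real gN)\<^sup>2)))"
      by (intro prod.cong refl) simp
    finally show ?thesis .
  qed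
  have fin: "finite ?F" using finite_PiE_dflt[OF finite_cells, of Q P "\<lambda>_. UNIV" False] by auto
  have "((\<lambda>lam. \<Sum>f\<in>?F. wt lam f) \<longlongrightarrow> (\<Sum>f\<in>?F. pmf (cell_pmf gN Q P) f)) (at_right 0)"
  proof (rule tendsto_sum)
    fix f assume f: "f \<in> ?F"
    show "((\<lambda>lam. wt lam f) \<longlongrightarrow> pmf (cell_pmf gN Q P) f) (at_right 0)"
      unfolding wt_def pmf[OF f]
    proof (rule tendsto_prod)
      fix j :: "int \<times> nat"
      have "((\<lambda>lam. exp (- w lam (fst j))) \<longlongrightarrow> exp (- (1 / (real gN)\<^sup>2))) (at_right 0)"
        by (intro tendsto_exp tendsto_minus wlim)
      then show "((\<lambda>lam. if f j then 1 - exp (- w lam (fst j)) else exp (- w lam (fst j))) \<longlongrightarrow>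
         (if f j then 1 - exp (- (1 / (real gN)\<^sup>2)) else exp (- (1 / (real gN)\<^sup>2)))) (at_right 0)"
        by (cases "f j") (auto intro: tendsto_diff)
    qed
  qed
  moreover have "(\<Sum>f\<in>?F. pmf (cell_pmf gN Q P) f) = cell_prob gN Q P {f. \<Psi> f}"
  proof -
    have "cell_prob gN Q P {f. \<Psi> f} = cell_prob gN Q P ({f. \<Psi> f} \<inter> set_pmf (cell_pmf gN Q P))"
      by (simp add: measure_Int_set_pmf)
    also have "\<dots> = cell_prob gN Q P (?F \<inter> set_pmf (cell_pmf gN Q P))"
    proof -
      have "set_pmf (cell_pmf gN Q P) \<subseteq> PiE_dflt (cells Q P) False (\<lambda>_. UNIV)"
        unfolding cell_pmf_def using set_Pi_pmf_subset[OF finite_cells] by (fastforce simp: PiE_dflt_def)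
      then show ?thesis by (intro arg_cong[where f="measure_pmf.prob _"]) auto
    qed
    also have "\<dots> = cell_prob gN Q P ?F" by (simp add: measure_Int_set_pmf)
    also have "\<dots> = (\<Sum>f\<in>?F. pmf (cell_pmf gN Q P) f)" by (rule measure_measure_pmf_finite[OF fin])
    finally show ?thesis by simp
  qed
  moreover have "\<forall>\<^sub>F lam in at_right 0. (\<Sum>f\<in>?F. wt lam f) = measure (Pr lam) {\<omega> \<in> space (Pr lam). \<Psi> (cfg lam \<omega>)}"
    using eventually_scaled
  proof eventually_elim
    case (elim lam)
    interpret ffp_scaled "Pr lam" lam "N lam" "M lam" "\<eta> lam" "grid_step gN lam" "site_step gN lam" gN hN P Q
      using scaled elim by auto
    have "mk \<omega> = cfg lam \<omega>" for \<omega> by (auto simp: mk_def marked_cells_def fun_eq_iff)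
    then show ?case using mk_prob_pred(1)[of \<Psi>] unfolding weight_def wt_def w_def sites_def by simp
  qed
  ultimately show ?thesis using Lim_transform_eventually by force
qed


definition radius :: "real \<Rightarrow> real" where
  "radius lam = 3 * ((real P + 3) * exp (real (gN - 1) * grid_step gN lam))"

text \<open>\<open>K\<close> is smaller than 1 / \<lambda> by the factor
  \<open>exp (- grid_step)\<close>, and this beats the additional logarithm.\<close>

lemma radius_rate: "((\<lambda>lam. radius lam * (grid_step gN lam * lam)) \<longlongrightarrow> 0) (at_right 0)"
proof (rule lim_of_step[OF gN0])
  have l: "((\<lambda>x::real. x * exp (- x)) \<longlongrightarrow> 0) at_top" by real_asymp
  show "((\<lambda>x. 3 * (real P + 3) * (x * exp (- x))) \<longlongrightarrow> 0) at_top"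
    using tendsto_mult[OF tendsto_const[of "3 * (real P + 3)"] l] by simp
  fix lam :: real assume lam: "0 < lam" "lam < 1"
  let ?x = "grid_step gN lam"
  have "exp (real (gN - 1) * ?x) * lam = exp (real (gN - 1) * ?x) * exp (- (real gN * ?x))" using rate_eq[OF lam(1) gN0] by simp
  also have "\<dots> = exp (- ?x)" using gN0 by (simp add: exp_add[symmetric] of_nat_diff algebra_simps)
  finally have e: "exp (real (gN - 1) * ?x) * lam = exp (- ?x)" .
  have "radius lam * (?x * lam) = 3 * (real P + 3) * (?x * (exp (real (gN - 1) * ?x) * lam))"
    by (simp add: radius_def mult_ac)
  then show "radius lam * (?x * lam) = 3 * (real P + 3) * (?x * exp (- ?x))" unfolding e .
qed

lemma eventually_small:
  "eventually (\<lambda>lam. (2 * radius lam + 1) * site_step gN lam \<le> 1 / 2 \<and> real Q / site_step gN lam \<le> exp (real gN * grid_step gN lam)) (at_right 0)"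
proof -
  have "((\<lambda>lam. (2 * (radius lam * (grid_step gN lam * lam)) + (grid_step gN lam * lam)) * (real gN)\<^sup>2) \<longlongrightarrow> (2 * 0 + 0) * (real gN)\<^sup>2) (at_right 0)"
    by (intro tendsto_intros radius_rate step_rate)
  then have "eventually (\<lambda>lam. (2 * (radius lam * (grid_step gN lam * lam)) + (grid_step gN lam * lam)) * (real gN)\<^sup>2 < 1 / 2) (at_right 0)"
    by (rule order_tendstoD) simp
  moreover have "eventually (\<lambda>lam. real Q \<le> grid_step gN lam) (at_right 0)"
    using filterlim_at_top[THEN iffD1, OF grid_step_at_top[OF gN0]] by blast
  ultimately show ?thesis using eventually_scaled
  proof eventually_elim
    case (elim lam)
    have d: "site_step gN lam = (real gN)\<^sup>2 * (grid_step gN lam * lam)" using gN0 by (rule site_step_eq)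
    have 1: "(2 * radius lam + 1) * site_step gN lam \<le> 1 / 2" using elim unfolding d by (simp add: algebra_simps)
    have "real Q \<le> (real gN)\<^sup>2 * grid_step gN lam"
    proof -
      have "grid_step gN lam \<le> (real gN)\<^sup>2 * grid_step gN lam" using elim gN0 by (simp add: mult_le_cancel_right1)
      then show ?thesis using elim by linarith
    qed
    then have "real Q * lam \<le> site_step gN lam" using elim unfolding d by (simp add: mult_ac)
    moreover have "0 < site_step gN lam" using elim gN0 unfolding d by simp
    ultimately have "real Q / site_step gN lam \<le> 1 / lam" using elim by (simp add: field_simps)
    also have "1 / lam = exp (real gN * grid_step gN lam)"
      using elim gN0 by (simp add: grid_step_def)
    finally show ?case using 1 by simp
  qed
qed

definition fail_set :: "real \<Rightarrow> 'a set" where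
  "fail_set lam = ffp_scaled.fail (Pr lam) (N lam) (M lam) (grid_step gN lam) (site_step gN lam) gN P Q"

lemma good_error_rate: "((\<lambda>lam. (real H + 1)\<^sup>2 * (3 * exp (- grid_step gN lam) + (2 * real H + 1) * exp (1 - exp (grid_step gN lam)))) \<longlongrightarrow> 0) (at_right 0)"
proof (rule lim_of_step[OF gN0 _ refl])
  have 1: "((\<lambda>x::real. exp (- x)) \<longlongrightarrow> 0) at_top" by real_asymp
  have 2: "((\<lambda>x::real. exp (1 - exp x)) \<longlongrightarrow> 0) at_top" by real_asymp
  have "((\<lambda>x. (real H + 1)\<^sup>2 * (3 * exp (- x) + (2 * real H + 1) * exp (1 - exp x))) \<longlongrightarrow> (real H + 1)\<^sup>2 * (3 * 0 + (2 * real H + 1) * 0)) at_top"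
    by (intro tendsto_intros 1 2)
  then show "((\<lambda>x. (real H + 1)\<^sup>2 * (3 * exp (- x) + (2 * real H + 1) * exp (1 - exp x))) \<longlongrightarrow> 0) at_top" by simp
qed

lemma eventually_fail_prob:
  assumes "0 < \<epsilon>"
  shows "eventually (\<lambda>lam. measure (Pr lam) (fail_set lam) \<le> real (card (cells Q P)) / real gN ^ 4 + \<epsilon>) (at_right 0)"
proof -
  let ?u = "\<lambda>lam. grid_step gN lam * lam"
  let ?H = "P + 1 + gN"
  define ge where "ge lam = (real ?H + 1)\<^sup>2 * (3 * exp (- grid_step gN lam) + (2 * real ?H + 1) * exp (1 - exp (grid_step gN lam)))" for lam
  \<comment> \<open>The limit of \<open>(2 * (Q / d) + 1) * (lam * T)\<close>, which bounds the
    expected number of fires in the box.\<close>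
  define c where "c = (real P + 1) / (real gN)\<^sup>2 * 2 * real Q"
  define v where "v lam = (2 * (radius lam * ?u lam) + ?u lam) * (real P + 1)" for lam
  define bd where "bd lam = (c + (real P + 1) * ?u lam) * ((real P + 1) * ?u lam) + (c + (real P + 1) * ?u lam) * v lam + v lam +
     (c + (real P + 1) * ?u lam) * ge lam + ge lam + real (card (cells Q P)) * (1 / (real gN)\<^sup>2 + ?u lam)\<^sup>2" for lam
  have ge: "(ge \<longlongrightarrow> 0) (at_right 0)" unfolding ge_def by (rule good_error_rate)
  have "(v \<longlongrightarrow> (2 * 0 + 0) * (real P + 1)) (at_right 0)"
    unfolding v_def by (intro tendsto_intros radius_rate step_rate)
  then have v: "(v \<longlongrightarrow> 0) (at_right 0)" by simp
  have "(bd \<longlongrightarrow> (c + (real P + 1) * 0) * ((real P + 1) * 0) + (c + (real P + 1) * 0) * 0 + 0 +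
     (c + (real P + 1) * 0) * 0 + 0 + real (card (cells Q P)) * (1 / (real gN)\<^sup>2 + 0)\<^sup>2) (at_right 0)"
    unfolding bd_def by (intro tendsto_intros step_rate ge v)
  then have "(bd \<longlongrightarrow> real (card (cells Q P)) / real gN ^ 4) (at_right 0)"
    by (simp add: power_divide flip: power_mult)
  then have "eventually (\<lambda>lam. bd lam < real (card (cells Q P)) / real gN ^ 4 + \<epsilon>) (at_right 0)"
    by (rule order_tendstoD) (use assms in simp)
  then show ?thesis using eventually_scaled
  proof eventually_elim
    case (elim lam)
    interpret ffp_scaled "Pr lam" lam "N lam" "M lam" "\<eta> lam" "grid_step gN lam" "site_step gN lam" gN hN P Q
      using scaled elim by auto
    let ?d = "site_step gN lam" and ?x = "grid_step gN lam"
    have W: "W = radius lam" by (simp add: W_def radius_def)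
    have d: "?d = (real gN)\<^sup>2 * ?u lam" using gN0 by (rule site_step_eq)
    have ud: "?u lam / ?d = 1 / (real gN)\<^sup>2" using elim gN0 unfolding d by simp
    have lT: "lam * T = (real P + 1) * ?u lam" by (simp add: T_def mult_ac)
    have Ad: "(2 * (real Q / ?d) + 1) * (lam * T) = c + (real P + 1) * ?u lam"
    proof -
      have "(2 * (real Q / ?d) + 1) * (lam * T) = (real P + 1) * (?u lam / ?d) * 2 * real Q + (real P + 1) * ?u lam"
        unfolding lT by (simp add: algebra_simps add_divide_distrib)
      then show ?thesis unfolding ud c_def by simp
    qed
    have Wd: "(2 * W + 1) * (lam * T) = v lam" unfolding lT W v_def by (simp add: algebra_simps)
    have Cd: "(1 / ?d + 1) * (lam * ?x) = 1 / (real gN)\<^sup>2 + ?u lam"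
      using ud by (simp add: algebra_simps)
    have g: "good_error ?x (P + 1 + gN) = ge lam" by (simp add: good_error_def ge_def)
    have "fail_bound = ((2 * (real Q / ?d) + 1) * (lam * T)) * (lam * T) + ((2 * (real Q / ?d) + 1) * (lam * T)) * ((2 * W + 1) * (lam * T)) + (2 * W + 1) * (lam * T) +
      ((2 * (real Q / ?d) + 1) * (lam * T)) * good_error ?x (P + 1 + gN) + good_error ?x (P + 1 + gN) + real (card (cells Q P)) * ((1 / ?d + 1) * (lam * ?x))\<^sup>2"
      unfolding fail_bound_def by (simp add: power2_eq_square mult_ac)
    also have "\<dots> = bd lam" unfolding Ad Wd Cd g unfolding lT bd_def ..
    finally have "fail_bound = bd lam" .
    then show ?case using fail_prob elim unfolding fail_set_def by linarith
  qed
qed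

lemma final_time: "0 < lam \<Longrightarrow> lam < 1 \<Longrightarrow> t * ln (1 / lam) = t * real gN * grid_step gN lam"
  using gN0 by (simp add: grid_step_def)

lemma eventually_realized:
  "eventually (\<lambda>lam. 0 < lam \<and> lam < 1 \<and> prob_space (Pr lam) \<and> fail_set lam \<in> sets (Pr lam) \<and>
     (\<forall>\<Psi>. {\<omega> \<in> space (Pr lam). \<Psi> (cfg lam \<omega>)} \<in> sets (Pr lam)) \<and>
     (AE \<omega> in Pr lam. \<omega> \<notin> fail_set lam \<longrightarrow> realized lam \<omega>)) (at_right 0)"
  using eventually_scaled eventually_small
proof eventually_elim
  case (elim lam)
  interpret ffp_scaled "Pr lam" lam "N lam" "M lam" "\<eta> lam" "grid_step gN lam" "site_step gN lam" gN hN P Q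
    using scaled elim by auto
  have x0: "0 < grid_step gN lam" using elim by auto
  have tt: "real P * grid_step gN lam < t * ln (1 / lam)" "t * ln (1 / lam) \<le> (real P + 1) * grid_step gN lam"
    using final_time[of lam] elim mult_strict_right_mono[OF t(1) x0] mult_right_mono[OF t(2) less_imp_le[OF x0]] by auto
  have W: "W = radius lam" by (simp add: W_def radius_def)
  have "mk \<omega> = cfg lam \<omega>" for \<omega> by (auto simp: mk_def marked_cells_def fun_eq_iff)
  then have "{\<omega> \<in> space (Pr lam). \<Psi> (cfg lam \<omega>)} \<in> events" for \<Psi> using mk_prob_pred(2)[of \<Psi>] by simp
  moreover have "AE \<omega> in Pr lam. \<omega> \<notin> fail_set lam \<longrightarrow> realized lam \<omega>"
    unfolding fail_set_def by (rule AE_realization[OF gN tt]) (use elim W in auto)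
  moreover have "fail_set lam \<in> events" unfolding fail_set_def by (rule fail_event)
  ultimately show ?case using elim prob_space_axioms by blast
qed

section \<open>Transfer between the process and the marked cells\<close>

lemma transfer_upper:
  assumes E: "\<And>lam. 0 < lam \<Longrightarrow> lam < 1 \<Longrightarrow> E lam \<in> sets (Pr lam)"
    and rel: "\<And>lam \<omega>. 0 < lam \<Longrightarrow> lam < 1 \<Longrightarrow> realized lam \<omega> \<Longrightarrow> \<omega> \<in> E lam \<Longrightarrow> ok (cfg lam \<omega>) \<Longrightarrow> U (cfg lam \<omega>)"
    and \<epsilon>: "0 < \<epsilon>"
  shows "eventually (\<lambda>lam. measure (Pr lam) (E lam) \<le> cell_prob gN Q P {f. U f} +
      cell_prob gN Q P {f. \<not> ok f} + real (card (cells Q P)) / real gN ^ 4 + \<epsilon>) (at_right 0)"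
proof -
  have e3: "0 < \<epsilon> / 3" using \<epsilon> by simp
  have 1: "eventually (\<lambda>lam. measure (Pr lam) {\<omega> \<in> space (Pr lam). U (cfg lam \<omega>)} < cell_prob gN Q P {f. U f} + \<epsilon> / 3) (at_right 0)"
    by (rule order_tendstoD(2)[OF cfg_limit]) (use e3 in simp)
  have 2: "eventually (\<lambda>lam. measure (Pr lam) {\<omega> \<in> space (Pr lam). \<not> ok (cfg lam \<omega>)} < cell_prob gN Q P {f. \<not> ok f} + \<epsilon> / 3) (at_right 0)"
    by (rule order_tendstoD(2)[OF cfg_limit]) (use e3 in simp)
  show ?thesis using 1 2 eventually_fail_prob[OF e3] eventually_realized
  proof eventually_elim
    case (elim lam)
    interpret prob_space "Pr lam" using elim by auto
    let ?U = "{\<omega> \<in> space (Pr lam). U (cfg lam \<omega>)}" and ?ok = "{\<omega> \<in> space (Pr lam). \<not> ok (cfg lam \<omega>)}"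
    have ev: "?U \<in> events" "?ok \<in> events" "fail_set lam \<in> events" using elim by auto
    have "AE \<omega> in Pr lam. \<omega> \<notin> fail_set lam \<longrightarrow> realized lam \<omega>" using elim by blast
    moreover have l: "0 < lam" "lam < 1" using elim by auto
    ultimately have "AE \<omega> in Pr lam. \<omega> \<in> E lam \<longrightarrow> \<omega> \<in> ?U \<union> ?ok \<union> fail_set lam"
      using AE_space
    proof (elim eventually_elim2)
      fix \<omega> assume "\<omega> \<notin> fail_set lam \<longrightarrow> realized lam \<omega>" "\<omega> \<in> space (Pr lam)"
      then show "\<omega> \<in> E lam \<longrightarrow> \<omega> \<in> ?U \<union> ?ok \<union> fail_set lam" using rel[OF l, of \<omega>] by auto
    qed
    then have "prob (E lam) \<le> prob (?U \<union> ?ok \<union> fail_set lam)"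
      using ev by (intro finite_measure_mono_AE) auto
    also have "\<dots> \<le> prob ?U + prob ?ok + prob (fail_set lam)"
      using ev by (intro order_trans[OF measure_Un_le] add_mono order_refl) auto
    finally show ?case using elim by linarith
  qed
qed

text \<open>The upper estimate applied to the complementary event.\<close>

lemma transfer_lower:
  assumes E: "\<And>lam. 0 < lam \<Longrightarrow> lam < 1 \<Longrightarrow> E lam \<in> sets (Pr lam)"
    and rel: "\<And>lam \<omega>. 0 < lam \<Longrightarrow> lam < 1 \<Longrightarrow> realized lam \<omega> \<Longrightarrow> \<omega> \<in> space (Pr lam) \<Longrightarrow> ok (cfg lam \<omega>) \<Longrightarrow> U (cfg lam \<omega>) \<Longrightarrow> \<omega> \<in> E lam"
    and \<epsilon>: "0 < \<epsilon>"
  shows "eventually (\<lambda>lam. cell_prob gN Q P {f. U f} -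
      cell_prob gN Q P {f. \<not> ok f} - real (card (cells Q P)) / real gN ^ 4 - \<epsilon> \<le> measure (Pr lam) (E lam)) (at_right 0)"
proof -
  have E': "space (Pr lam) - E lam \<in> sets (Pr lam)" if "0 < lam" "lam < 1" for lam using E[OF that] by auto
  have *: "eventually (\<lambda>lam. measure (Pr lam) (space (Pr lam) - E lam) \<le> cell_prob gN Q P {f. \<not> U f} +
      cell_prob gN Q P {f. \<not> ok f} + real (card (cells Q P)) / real gN ^ 4 + \<epsilon>) (at_right 0)"
    by (rule transfer_upper[OF E' _ \<epsilon>]) (use rel in auto)
  have c: "cell_prob gN Q P {f. \<not> U f} = 1 - cell_prob gN Q P {f. U f}"
    using measure_pmf.prob_compl[of "{f. U f}" "cell_pmf gN Q P"] by (simp add: Compl_eq_Diff_UNIV[symmetric] Collect_neg_eq)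
  show ?thesis using * eventually_realized
  proof eventually_elim
    case (elim lam)
    interpret prob_space "Pr lam" using elim by auto
    show ?case using elim prob_compl[OF E[of lam]] c by auto
  qed
qed

end

section \<open>Generic configurations of marked cells\<close>

definition fire_cells :: "nat \<Rightarrow> nat \<Rightarrow> config \<Rightarrow> (int \<times> nat) set" where
  "fire_cells Q P f = {x \<in> cells Q P. f x}"

text \<open>The fixed rows are those where one fire alone makes a tie: with the initial row 0, with
  the final row \<open>P\<close>, or, for \<open>P / 2\<close>, with both. The fixed columns are the
  origin and the rim of the box.\<close>

definition bad1 :: "nat \<Rightarrow> nat \<Rightarrow> nat \<Rightarrow> real set \<Rightarrow> int \<times> nat \<Rightarrow> bool" where
  "bad1 N Q P A y \<longleftrightarrow> fst y \<in> {0, - int Q, int Q - 1} \<or>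
     (\<exists>r\<in>{0, real P, real N, real P - real N, real P / 2} \<union> A. \<bar>real (snd y) - r\<bar> < 8)"

text \<open>Ties between two fires. The rows \<open>2 * snd x\<close> and
  \<open>(P + snd x) / 2\<close> come from the healing rule with the initial state as last burning
  and with the observed site as passing fire, respectively. Since 0 is always among the column
  differences, fires get distinct columns.\<close>

definition bad2 :: "nat \<Rightarrow> nat \<Rightarrow> real set \<Rightarrow> int \<times> nat \<Rightarrow> int \<times> nat \<Rightarrow> bool" where
  "bad2 N P D x y \<longleftrightarrow> (\<exists>r\<in>insert 0 D. \<bar>real_of_int (fst y) - (real_of_int (fst x) + r)\<bar> \<le> 3) \<or>
     (\<exists>r\<in>{real (snd x), real (snd x) + real N, 2 * real (snd x), (real P + real (snd x)) / 2}. \<bar>real (snd y) - r\<bar> < 8)"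

text \<open>The healing rule with three fires: last burning, hole, and passing fire.\<close>

definition bad3 :: "int \<times> nat \<Rightarrow> int \<times> nat \<Rightarrow> int \<times> nat \<Rightarrow> bool" where
  "bad3 x y z \<longleftrightarrow> \<bar>real (snd z) - (2 * real (snd y) - real (snd x))\<bar> < 8"

text \<open>The sets \<open>A\<close> and \<open>D\<close> contain further rows and column differences to be avoided.\<close>

definition generic :: "nat \<Rightarrow> nat \<Rightarrow> nat \<Rightarrow> real set \<Rightarrow> real set \<Rightarrow> config \<Rightarrow> bool" where
  "generic N Q P A D f \<longleftrightarrow> (\<forall>y\<in>fire_cells Q P f. \<not> bad1 N Q P A y) \<and>
     (\<forall>x\<in>fire_cells Q P f. \<forall>y\<in>fire_cells Q P f. x \<noteq> y \<longrightarrow> \<not> bad2 N P D x y) \<and>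
     (\<forall>x\<in>fire_cells Q P f. \<forall>y\<in>fire_cells Q P f. \<forall>z\<in>fire_cells Q P f.
        x \<noteq> y \<longrightarrow> x \<noteq> z \<longrightarrow> y \<noteq> z \<longrightarrow> \<not> bad3 x y z)"

text \<open>A chain of fires whose shielding periods cover all rows; along the chain the fires approach
  the origin.\<close>

definition chain_rows :: "nat \<Rightarrow> nat \<Rightarrow> nat set" where
  "chain_rows w i = (if i = 0 then {7 * w..<8 * w} else {2 * w * i + 4 * w..<2 * w * i + 5 * w})"

text \<open>Approaching the origin makes the windows shrink with time, as \<open>lf_mono\<close> and
  \<open>rg_mono\<close> demand.\<close>

definition left_group :: "nat \<Rightarrow> nat \<Rightarrow> int \<Rightarrow> nat \<Rightarrow> (int \<times> nat) set" where
  "left_group N w base i = {base + int (i * N)..<base + int (Suc i * N)} \<times> chain_rows w i"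

definition right_group :: "nat \<Rightarrow> nat \<Rightarrow> int \<Rightarrow> nat \<Rightarrow> (int \<times> nat) set" where
  "right_group N w base i = {base - int (Suc i * N)..<base - int (i * N)} \<times> chain_rows w i"

lemma chain_rows_bound: "s \<in> chain_rows w i \<Longrightarrow> i \<le> (P - 5 * w) div (2 * w) \<Longrightarrow> 8 * w \<le> P \<Longrightarrow> s < P"
proof -
  assume a: "s \<in> chain_rows w i" "i \<le> (P - 5 * w) div (2 * w)" "8 * w \<le> P"
  have "2 * w * i \<le> P - 5 * w" using mult_le_mono2[OF a(2), of "2 * w"] times_div_less_eq_dividend[of "2 * w" "P - 5 * w"] by linarith
  then show ?thesis using a by (auto simp: chain_rows_def split: if_splits)
qed

text \<open>The link in charge of row \<open>u\<close> has fired less than \<open>3 * w\<close> rows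
  ago, within the half unit of \<open>4 * w\<close> rows. Link 0 is in charge only below row
  \<open>7 * w\<close>, where the initial state still shields.\<close>

lemma chain_row_valid:
  assumes "5 \<le> w" "s \<in> chain_rows w ((u - 5 * w) div (2 * w))"
  shows "u + 3 \<le> 8 * w \<or> s < u \<and> u + 4 \<le> s + 4 * w"
proof -
  let ?i = "(u - 5 * w) div (2 * w)"
  show ?thesis
  proof (cases "?i = 0")
    case True
    then have "u - 5 * w < 2 * w" using assms(1) by (simp add: div_eq_0_iff)
    then show ?thesis using assms(1) by linarith
  next
    case False
    have 1: "2 * w * ?i \<le> u - 5 * w" by (rule times_div_less_eq_dividend)
    have "u - 5 * w < 2 * w * ?i + 2 * w" using dividend_less_times_div[of "2 * w" "u - 5 * w"] assms(1) by linarith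
    moreover have "2 * w \<le> 2 * w * ?i" using False by simp
    moreover have "2 * w * ?i + 4 * w \<le> s" "s < 2 * w * ?i + 5 * w" using assms(2) False by (auto simp: chain_rows_def)
    ultimately show ?thesis using 1 assms(1) by linarith
  qed
qed

text \<open>The positions are the marked columns and the origin in increasing order. Genericity puts
  at most one mark into a column and turns each assumption on ties into a case of
  \<open>bad1\<close>, \<open>bad2\<close> or \<open>bad3\<close>.\<close>

lemma admissible_exists:
  assumes g: "generic N Q P A D f" and N: "N = 8 * w" "5 \<le> w" "N + 8 \<le> P" and D0: "0 < D0"
    and l: "\<And>i. i \<le> (P - 5 * w) div (2 * w) \<Longrightarrow> \<exists>x\<in>fire_cells Q P f. x \<in> left_group N w bl i"
    and r: "\<And>i. i \<le> (P - 5 * w) div (2 * w) \<Longrightarrow> \<exists>x\<in>fire_cells Q P f. x \<in> right_group N w br i"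
    and bl: "bl + int (Suc ((P - 5 * w) div (2 * w)) * N) \<le> - D0" and br: "D0 \<le> br - int (Suc ((P - 5 * w) div (2 * w)) * N)"
  shows "\<exists>M cc v S lf rg. admissible N (4 * w) Q P f M cc v S lf rg \<and> cc (lf P) \<le> - D0 \<and> D0 \<le> cc (rg P)"
proof -
  define T where "T = fire_cells Q P f"
  define I0 where "I0 = (P - 5 * w) div (2 * w)"
  have T_cells: "x \<in> T \<Longrightarrow> x \<in> cells Q P \<and> f x" for x by (auto simp: T_def fire_cells_def)
  note gg = g[unfolded generic_def T_def[symmetric]]
  note gA = conjunct1[OF gg] and gB = conjunct1[OF conjunct2[OF gg]] and gC = conjunct2[OF conjunct2[OF gg]]
  have g1: "c \<noteq> 0 \<and> c \<noteq> - int Q \<and> c \<noteq> int Q - 1 \<and> 8 \<le> s \<and> s + 8 \<le> P \<and> 8 \<le> \<bar>real s - real N\<bar> \<and> 8 \<le> \<bar>real s - (real P - real N)\<bar> \<and> 8 \<le> \<bar>real s - real P / 2\<bar>"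
    if "(c, s) \<in> T" for c s
  proof -
    have h: "\<not> bad1 N Q P A (c, s)" using gA that by simp
    have "s \<le> P" using T_cells[OF that] by (auto simp: cells_def)
    then show ?thesis using h by (auto simp: bad1_def)
  qed
  have g2: "c \<noteq> c' \<and> 8 \<le> \<bar>real s' - real s\<bar> \<and> 8 \<le> \<bar>real s' - (real s + real N)\<bar> \<and> 8 \<le> \<bar>real s' - 2 * real s\<bar> \<and> 8 \<le> \<bar>real s' - (real P + real s) / 2\<bar>"
    if "(c, s) \<in> T" "(c', s') \<in> T" "(c, s) \<noteq> (c', s')" for c s c' s'
  proof -
    have "\<not> bad2 N P D (c, s) (c', s')" using gB that by simp
    then show ?thesis by (auto simp: bad2_def)
  qed
  have g3: "8 \<le> \<bar>real s - (2 * real (snd y) - real (snd x))\<bar>"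
    if "x \<in> T" "y \<in> T" "(c, s) \<in> T" "x \<noteq> y" "x \<noteq> (c, s)" "y \<noteq> (c, s)" for x y c s
  proof -
    have "\<not> bad3 x y (c, s)" using gC that by simp
    then show ?thesis by (simp add: bad3_def)
  qed
  define Pos where "Pos = insert 0 (fst ` T)"
  have finT: "finite T" unfolding T_def fire_cells_def using finite_cells[of Q P] by simp
  then have finP: "finite Pos" by (simp add: Pos_def)
  define xs where "xs = sorted_list_of_set Pos"
  have xs: "set xs = Pos" "sorted_wrt (<) xs"
    unfolding xs_def by (use finP in simp) (rule strict_sorted_list_of_set)
  then have xs0: "xs \<noteq> []" by (auto simp: Pos_def)
  define M where "M = length xs - 1"
  have len: "length xs = Suc M" using xs0 by (simp add: M_def)
  define cc where "cc i = xs ! i" for i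
  have cc_less: "cc i < cc j" if "i < j" "j \<le> M" for i j
    using sorted_wrt_nth_less[OF xs(2), of i j] that len by (simp add: cc_def)
  have cc_Pos: "cc i \<in> Pos" if "i \<le> M" for i using nth_mem[of i xs] that len xs(1) by (simp add: cc_def)
  have "\<forall>c\<in>Pos. \<exists>i\<le>M. cc i = c" using xs(1) len by (metis cc_def in_set_conv_nth less_Suc_eq_le)
  then obtain idx where idx: "\<And>c. c \<in> Pos \<Longrightarrow> idx c \<le> M \<and> cc (idx c) = c" by metis
  have idx_less: "c \<in> Pos \<Longrightarrow> c' \<in> Pos \<Longrightarrow> c < c' \<Longrightarrow> idx c < idx c'" for c c'
    using idx[of c] idx[of c'] cc_less[of "idx c'" "idx c"] by (metis less_asym linorder_neqE_nat order_less_irrefl)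
  have idx_le: "c \<in> Pos \<Longrightarrow> c' \<in> Pos \<Longrightarrow> c \<le> c' \<Longrightarrow> idx c \<le> idx c'" for c c'
    using idx_less[of c c'] by (cases "c = c'") auto
  have idx_cc: "idx (cc i) = i" if "i \<le> M" for i
    using idx[OF cc_Pos[OF that]] cc_less[of i "idx (cc i)"] cc_less[of "idx (cc i)" i] that by (metis less_irrefl linorder_neqE_nat)
  have "\<forall>c\<in>fst ` T. \<exists>s. (c, s) \<in> T" by auto
  then obtain row where row: "\<And>c. c \<in> fst ` T \<Longrightarrow> (c, row c) \<in> T" by metis
  have row_eq: "row c = s" if "(c, s) \<in> T" for c s
  proof -
    have "(c, row c) \<in> T" using row[of c] that by (force simp: image_iff)
    then show ?thesis using g2[of c s c "row c"] that by auto
  qed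
  define S where "S i = (if cc i = 0 then P else row (cc i))" for i
  define v where "v = idx 0"
  have v: "v \<le> M" "cc v = 0" using idx[of 0] by (auto simp: v_def Pos_def)
  have S_v: "S v = P" using v by (simp add: S_def)
  have cc0: "cc i = 0 \<longleftrightarrow> i = v" if "i \<le> M" for i using idx_cc[OF that] v v_def by auto
  have ST: "(cc i, S i) \<in> T" if "i \<le> M" "i \<noteq> v" for i
  proof -
    have "cc i \<noteq> 0" using cc0 that by simp
    then show ?thesis using cc_Pos[OF that(1)] row by (auto simp: Pos_def S_def)
  qed
  have TS: "\<exists>i\<le>M. i \<noteq> v \<and> cc i = c \<and> S i = s" if "(c, s) \<in> T" for c s
  proof -
    have cP: "c \<in> Pos" using that by (force simp: Pos_def image_iff)
    have "c \<noteq> 0" using g1[OF that] by simp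
    then show ?thesis using idx[OF cP] row_eq[OF that] v by (intro exI[of _ "idx c"]) (auto simp: S_def)
  qed
  have Srange: "8 \<le> S i \<and> S i \<le> P \<and> (i \<noteq> v \<longrightarrow> S i + 8 \<le> P)" if "i \<le> M" for i
    using g1[OF ST[OF that]] S_v N by (cases "i = v") auto
  have inj: "j = k" if "j \<le> M" "k \<le> M" "S j = S k" for j k
  proof (rule ccontr)
    assume "j \<noteq> k"
    then have ne: "(cc j, S j) \<noteq> (cc k, S k)" using idx_cc that by (metis prod.inject)
    have "j \<noteq> v" using Srange[OF that(2)] that(3) S_v \<open>j \<noteq> k\<close> by (cases "k = v") auto
    moreover have "k \<noteq> v" using Srange[OF that(1)] that(3) S_v \<open>j \<noteq> k\<close> by (cases "j = v") auto
    ultimately show False using g2[OF ST[OF that(1)] ST[OF that(2)] ne] that(3) by simp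
  qed
  have diff: "(cc j, S j) \<noteq> (cc k, S k)" if "j \<le> M" "k \<le> M" "j \<noteq> k" for j k using idx_cc that by (metis prod.inject)
  have "\<forall>i. \<exists>x. i \<le> I0 \<longrightarrow> x \<in> T \<and> x \<in> left_group N w bl i" using l unfolding T_def I0_def by blast
  then obtain lx where lx: "\<And>i. i \<le> I0 \<Longrightarrow> lx i \<in> T \<and> lx i \<in> left_group N w bl i" by metis
  have "\<forall>i. \<exists>x. i \<le> I0 \<longrightarrow> x \<in> T \<and> x \<in> right_group N w br i" using r unfolding T_def I0_def by blast
  then obtain rx where rx: "\<And>i. i \<le> I0 \<Longrightarrow> rx i \<in> T \<and> rx i \<in> right_group N w br i" by metis
  \<comment> \<open>The link in charge of row \<open>u\<close>.\<close>
  define st where "st u = (u - 5 * w) div (2 * w)" for u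
  have st: "st u \<le> I0" if "u \<le> P" for u unfolding st_def I0_def using that by (intro div_le_mono) auto
  have st_mono: "st u \<le> st u'" if "u \<le> u'" for u u' unfolding st_def using that by (intro div_le_mono) auto
  define lf where "lf u = idx (fst (lx (st u)))" for u
  define rg where "rg u = idx (fst (rx (st u)))" for u
  have lP: "fst (lx i) \<in> Pos" "fst (rx i) \<in> Pos" if "i \<le> I0" for i using lx[OF that] rx[OF that] by (auto simp: Pos_def)
  have mono_cols: "fst (lx i) \<le> fst (lx j) \<and> fst (rx j) \<le> fst (rx i)" if "i \<le> j" "j \<le> I0" for i j
  proof (cases "i = j")
    case False
    then have "Suc i * N \<le> j * N" using that by (intro mult_le_mono1) auto
    then have "int (Suc i * N) \<le> int (j * N)" by linarith
    moreover have "lx i \<in> left_group N w bl i" "lx j \<in> left_group N w bl j" "rx i \<in> right_group N w br i" "rx j \<in> right_group N w br j"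
      using lx rx that by auto
    ultimately show ?thesis unfolding left_group_def right_group_def mem_Times_iff atLeastLessThan_iff by linarith
  qed simp
  have outer: "fst (lx i) < - D0 \<and> D0 \<le> fst (rx i)" if "i \<le> I0" for i
  proof -
    have "lx i \<in> left_group N w bl i" "rx i \<in> right_group N w br i" using lx rx that by auto
    moreover have "int (Suc i * N) \<le> int (Suc I0 * N)" using that by (simp only: of_nat_le_iff mult_le_mono1 Suc_le_mono)
    ultimately show ?thesis using bl br unfolding I0_def[symmetric] left_group_def right_group_def mem_Times_iff atLeastLessThan_iff by linarith
  qed
  have sched: "tie_free_schedule N M v S lf rg P"
  proof
    fix s s' :: nat assume s: "s \<le> s'" "s' \<le> P"
    show "lf s \<le> lf s'" "rg s' \<le> rg s"
      unfolding lf_def rg_def using mono_cols[OF st_mono[OF s(1)] st[OF s(2)]] lP st s by (auto intro!: idx_le)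
  next
    fix s assume "s \<le> P" then show "rg s \<le> M" unfolding rg_def using lP st idx by auto
  next
    show "v \<le> M" by (rule v)
    have zP: "0 \<in> Pos" by (simp add: Pos_def)
    have sP: "st P \<le> I0" using st by simp
    show "lf P < v" unfolding lf_def v_def by (rule idx_less[OF lP(1)[OF sP] zP]) (use outer[OF sP] D0 in simp)
    show "v < rg P" unfolding rg_def v_def by (rule idx_less[OF zP lP(2)[OF sP]]) (use outer[OF sP] D0 in simp)
    show "S v = P" by (rule S_v)
  next
    fix k assume "k \<le> M" then show "S k \<le> P" using Srange by blast
  next
    fix j k assume "j \<le> M" "k \<le> M" "S j = S k" then show "j = k" by (rule inj)
  next
    fix L k assume L: "L \<in> insert 0 (S ` {..M})" and k: "k \<le> M" and lt: "L < S k"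
    have main: "(L + 8 \<le> S k) \<and> (S k + 8 \<le> L + N \<or> L + N + 8 \<le> S k)"
    proof (cases "L = 0")
      case True
      then show ?thesis using Srange[OF k] g1[OF ST[OF k]] S_v N by (cases "k = v") (auto simp: abs_if split: if_splits)
    next
      case False
      then obtain i where i: "i \<le> M" "L = S i" using L by auto
      have iv: "i \<noteq> v" using i lt S_v Srange[OF k] by auto
      have ik: "i \<noteq> k" using i lt by auto
      show ?thesis
      proof (cases "k = v")
        case True
        then show ?thesis using g1[OF ST[OF i(1) iv]] S_v i N by (auto simp: abs_if split: if_splits)
      next
        case False
        show ?thesis using g2[OF ST[OF i(1) iv] ST[OF k False] diff[OF i(1) k ik]] lt i by (auto simp: abs_if split: if_splits)
      qed
    qed
    show "L + 8 \<le> S k" "S k + 8 \<le> L + N \<or> L + N + 8 \<le> S k" using main by auto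
  next
    fix L j k assume L: "L \<in> insert 0 (S ` {..M})" and j: "j \<le> M" and k: "k \<le> M" and lt: "L < S j" "S j < S k"
    have jv: "j \<noteq> v" using lt S_v Srange[OF k] by auto
    have jk: "j \<noteq> k" using lt by auto
    show "S k + L + 8 \<le> 2 * S j \<or> 2 * S j + 8 \<le> S k + L"
    proof (cases "L = 0")
      case True
      show ?thesis
      proof (cases "k = v")
        case kv: True
        then show ?thesis using g1[OF ST[OF j jv]] S_v True by (auto simp: abs_if split: if_splits)
      next
        case False
        then show ?thesis using g2[OF ST[OF j jv] ST[OF k False] diff[OF j k jk]] True by (auto simp: abs_if split: if_splits)
      qed
    next
      case False
      then obtain i where i: "i \<le> M" "L = S i" using L by auto
      have iv: "i \<noteq> v" using i lt S_v Srange[OF j] by auto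
      have ij: "i \<noteq> j" "i \<noteq> k" using i lt by auto
      show ?thesis
      proof (cases "k = v")
        case kv: True
        have "8 \<le> \<bar>real (S j) - (real P + real (S i)) / 2\<bar>"
          using g2[OF ST[OF i(1) iv] ST[OF j jv] diff[OF i(1) j ij(1)]] by blast
        then have "real (P + S i + 8) \<le> real (2 * S j) \<or> real (2 * S j + 8) \<le> real (P + S i)"
          unfolding of_nat_add of_nat_mult of_nat_numeral
          by (auto simp: abs_if field_simps split: if_splits)
        then have "P + S i + 8 \<le> 2 * S j \<or> 2 * S j + 8 \<le> P + S i" by (simp only: of_nat_le_iff)
        then show ?thesis using kv S_v i by simp
      next
        case kv: False
        show ?thesis
          using g3[OF ST[OF i(1) iv] ST[OF j jv] ST[OF k kv] diff[OF i(1) j ij(1)] diff[OF i(1) k ij(2)] diff[OF j k jk]] i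
          by (auto simp: abs_if split: if_splits)
      qed
    qed
  qed
  have valid: "j \<noteq> v \<and> (s + 3 \<le> N \<or> S j < s \<and> s + 4 \<le> S j + 4 * w)" if s: "s \<le> P" "j \<in> {lf s, rg s}" for s j
  proof -
    have "\<exists>x\<in>T. snd x \<in> chain_rows w (st s) \<and> j = idx (fst x)"
      using s lx[OF st[OF s(1)]] rx[OF st[OF s(1)]] by (auto simp: lf_def rg_def left_group_def right_group_def mem_Times_iff)
    then obtain x where x: "x \<in> T" "snd x \<in> chain_rows w (st s)" "j = idx (fst x)" by blast
    have xP: "fst x \<in> Pos" using x by (auto simp: Pos_def)
    have ccj: "cc j = fst x" using idx[OF xP] x by simp
    have "fst x \<noteq> 0" using g1[of "fst x" "snd x"] x by simp
    then have "S j = snd x" "j \<noteq> v" using row_eq[of "fst x" "snd x"] x ccj v by (auto simp: S_def)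
    then show ?thesis using chain_row_valid[OF N(2), of "S j" s] x N by (auto simp: st_def)
  qed
  have "admissible N (4 * w) Q P f M cc v S lf rg"
    unfolding admissible_def
  proof (intro conjI allI impI)
    fix i j assume "i < j \<and> j \<le> M" then show "cc i < cc j" using cc_less by blast
  next
    fix i assume i: "i \<le> M"
    show "(cc i, S i) \<in> cells Q P" "f (cc i, S i)" if "i \<noteq> v" using T_cells[OF ST[OF i that]] by auto
    have "i = v \<or> (- int Q \<le> cc i \<and> cc i < int Q \<and> cc i \<noteq> - int Q \<and> cc i \<noteq> int Q - 1)"
      using T_cells[OF ST[OF i]] g1[OF ST[OF i]] by (auto simp: cells_def)
    moreover have "- int Q < 0" "0 < int Q - 1"
    proof -
      have "lx 0 \<in> T" "rx 0 \<in> T" using lx rx by auto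
      then have "lx 0 \<in> cells Q P" "rx 0 \<in> cells Q P" using T_cells by auto
      then show "- int Q < 0" "0 < int Q - 1" using outer[of 0] D0 g1[of "fst (rx 0)" "snd (rx 0)"] \<open>rx 0 \<in> T\<close> by (auto simp: cells_def mem_Times_iff)
    qed
    ultimately show "- int Q < cc i" "cc i < int Q - 1" using v by auto
    show "8 \<le> S i" using Srange[OF i] by simp
  next
    fix c s assume "(c, s) \<in> cells Q P \<and> f (c, s)"
    then have "(c, s) \<in> T" by (simp add: T_def fire_cells_def)
    then show "\<exists>l\<le>M. l \<noteq> v \<and> cc l = c \<and> S l = s" by (rule TS)
  next
    fix s j assume "s \<le> P \<and> j \<in> {lf s, rg s}"
    then show "j \<noteq> v" "s + 3 \<le> N \<or> S j < s \<and> s + 4 \<le> S j + 4 * w" using valid by auto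
  qed (use v sched in auto)
  moreover have "cc (lf P) \<le> - D0 \<and> D0 \<le> cc (rg P)"
    using outer[OF st[of P]] idx lP[OF st[of P]] by (simp add: lf_def rg_def less_imp_le)
  ultimately show ?thesis by blast
qed

section \<open>Probabilities of configurations of marked cells\<close>

lemma cell_independent_blocks:
  assumes J: "finite J" and K: "\<And>j. j \<in> J \<Longrightarrow> K j \<subseteq> cells Q P" "disjoint_family_on K J"
    and \<Phi>: "\<And>j f g. j \<in> J \<Longrightarrow> (\<And>x. x \<in> K j \<Longrightarrow> f x = g x) \<Longrightarrow> \<Phi> j f = \<Phi> j g"
  shows "cell_prob N Q P {f. \<forall>j\<in>J. \<Phi> j f} = (\<Prod>j\<in>J. cell_prob N Q P {f. \<Phi> j f})"
proof -
  have ind: "prob_space.indep_vars (cell_pmf N Q P) (\<lambda>_. count_space UNIV) (\<lambda>x f. f x) (cells Q P)"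
    unfolding cell_pmf_def by (rule indep_vars_Pi_pmf) (rule finite_cells)
  have fin: "K j \<subseteq> cells Q P \<and> finite (K j)" if "j \<in> J" for j using K(1)[OF that] finite_cells finite_subset by blast
  have "measure_pmf.prob (cell_pmf N Q P) {f \<in> space (cell_pmf N Q P). \<forall>j\<in>J. \<Phi> j (\<lambda>i. f i)} =
      (\<Prod>j\<in>J. measure_pmf.prob (cell_pmf N Q P) {f \<in> space (cell_pmf N Q P). \<Phi> j (\<lambda>i. f i)})"
    by (rule prob_space.indep_vars_blocks[OF measure_pmf.prob_space_axioms ind J fin K(2)]) (assumption, rule \<Phi>)
  then show ?thesis by (simp only: space_measure_pmf UNIV_I simp_thms)
qed

lemma cell_independent_pair:
  assumes "K \<subseteq> cells Q P" "L \<subseteq> cells Q P" "K \<inter> L = {}"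
    and "\<And>f g. (\<And>x. x \<in> K \<Longrightarrow> f x = g x) \<Longrightarrow> \<Phi> f = \<Phi> g" "\<And>f g. (\<And>x. x \<in> L \<Longrightarrow> f x = g x) \<Longrightarrow> \<Psi> f = \<Psi> g"
  shows "cell_prob N Q P {f. \<Phi> f \<and> \<Psi> f} =
    cell_prob N Q P {f. \<Phi> f} * cell_prob N Q P {f. \<Psi> f}"
proof -
  have "cell_prob N Q P {f. \<forall>j\<in>UNIV. (if j then \<Phi> else \<Psi>) f} =
      (\<Prod>j\<in>UNIV. cell_prob N Q P {f. (if j then \<Phi> else \<Psi>) f})"
  proof (rule cell_independent_blocks[where K="\<lambda>j. if j then K else L"])
    show "(if j then K else L) \<subseteq> cells Q P" for j using assms(1,2) by simp
    show "disjoint_family_on (\<lambda>j. if j then K else L) UNIV" using assms(3) by (auto simp: disjoint_family_on_def)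
    show "(if j then \<Phi> else \<Psi>) f = (if j then \<Phi> else \<Psi>) g" if "\<And>x. x \<in> (if j then K else L) \<Longrightarrow> f x = g x" for j f g
      using that assms(4)[of f g] assms(5)[of f g] by (cases j) (simp_all only: if_True if_False)
  qed simp
  moreover have "{f. \<forall>j\<in>UNIV. (if j then \<Phi> else \<Psi>) f} = {f. \<Phi> f \<and> \<Psi> f}"
    unfolding UNIV_bool by auto
  ultimately show ?thesis unfolding UNIV_bool by simp
qed

abbreviation mark_prob :: "nat \<Rightarrow> real" where
  "mark_prob N \<equiv> 1 - exp (- 1 / (real N)\<^sup>2)"

lemma mark_prob_bounds: "0 \<le> mark_prob N" "mark_prob N \<le> 1 / (real N)\<^sup>2"
  using exp_ge_add_one_self[of "- 1 / (real N)\<^sup>2"] by simp_all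

lemma one_minus_exp_ge:
  fixes x :: real
  assumes x: "0 \<le> x" "x \<le> 1"
  shows "x / 2 \<le> 1 - exp (- x)"
proof -
  have "exp (- x) = inverse (exp x)" by (simp add: exp_minus)
  also have "\<dots> \<le> inverse (1 + x)" using exp_ge_add_one_self[of x] x by (intro le_imp_inverse_le) linarith+
  also have "\<dots> \<le> 1 - x / 2"
  proof -
    have "0 \<le> x * (1 - x)" using x by (intro mult_nonneg_nonneg) auto
    then have "1 \<le> (1 - x / 2) * (1 + x)" by (simp add: algebra_simps)
    moreover have "0 < 1 + x" using x by linarith
    ultimately show ?thesis by (simp only: inverse_eq_divide pos_divide_le_eq)
  qed
  finally show ?thesis by simp
qed

lemma mark_prob_ge: assumes "0 < N" shows "1 / (2 * (real N)\<^sup>2) \<le> mark_prob N"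
proof -
  have "1 \<le> (real N)\<^sup>2" using assms by simp
  then have "1 / (real N)\<^sup>2 \<le> 1" using assms by (auto simp: divide_le_eq_1)
  then show ?thesis using one_minus_exp_ge[of "1 / (real N)\<^sup>2"] by simp
qed

lemma cell_marked:
  assumes "x \<in> cells Q P"
  shows "cell_prob N Q P {f. f x} = mark_prob N"
    "cell_prob N Q P {f. \<not> f x} = exp (- 1 / (real N)\<^sup>2)"
proof -
  have c: "map_pmf (\<lambda>f. f x) (cell_pmf N Q P) = bernoulli_pmf (mark_prob N)"
    unfolding cell_pmf_def using assms by (simp add: Pi_pmf_component[OF finite_cells])
  have "cell_prob N Q P {f. f x} = measure_pmf.prob (map_pmf (\<lambda>f. f x) (cell_pmf N Q P)) {True}"
    by (simp add: measure_map_pmf vimage_def)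
  then show 1: "cell_prob N Q P {f. f x} = mark_prob N"
    unfolding c using mark_prob_bounds(1)[of N] by (simp add: measure_pmf_single)
  have "cell_prob N Q P {f. \<not> f x} = measure_pmf.prob (map_pmf (\<lambda>f. f x) (cell_pmf N Q P)) {False}"
    by (simp add: measure_map_pmf vimage_def)
  then show "cell_prob N Q P {f. \<not> f x} = exp (- 1 / (real N)\<^sup>2)"
    unfolding c using mark_prob_bounds(1)[of N] by (simp add: measure_pmf_single)
qed

lemma cells_all_marked:
  assumes "J \<subseteq> cells Q P"
  shows "cell_prob N Q P {f. \<forall>x\<in>J. f x} = mark_prob N ^ card J"
proof -
  have "cell_prob N Q P {f. \<forall>x\<in>J. f x} = (\<Prod>x\<in>J. cell_prob N Q P {f. f x})"
    by (rule cell_independent_blocks[where K="\<lambda>x. {x}"])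
       (use assms finite_subset[OF assms finite_cells] in \<open>auto simp: disjoint_family_on_def\<close>)
  also have "\<dots> = (\<Prod>x\<in>J. mark_prob N)" by (intro prod.cong refl cell_marked) (use assms in auto)
  finally show ?thesis by simp
qed

lemma cells_none_marked:
  assumes "J \<subseteq> cells Q P"
  shows "cell_prob N Q P {f. \<forall>x\<in>J. \<not> f x} = exp (- (real (card J) / (real N)\<^sup>2))"
proof -
  have "cell_prob N Q P {f. \<forall>x\<in>J. \<not> f x} = (\<Prod>x\<in>J. cell_prob N Q P {f. \<not> f x})"
    by (rule cell_independent_blocks[where K="\<lambda>x. {x}"])
       (use assms finite_subset[OF assms finite_cells] in \<open>auto simp: disjoint_family_on_def\<close>)
  also have "\<dots> = (\<Prod>x\<in>J. exp (- 1 / (real N)\<^sup>2))" by (intro prod.cong refl cell_marked) (use assms in auto)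
  also have "\<dots> = exp (- (real (card J) / (real N)\<^sup>2))" by (simp flip: exp_of_nat_mult)
  finally show ?thesis .
qed

lemma cells_some_marked:
  assumes "J \<subseteq> cells Q P"
  shows "cell_prob N Q P {f. \<exists>x\<in>J. f x} = 1 - exp (- (real (card J) / (real N)\<^sup>2))"
proof -
  have "{f. \<exists>x\<in>J. f x} = UNIV - {f. \<forall>x\<in>J. \<not> f x}" by auto
  then show ?thesis using measure_pmf.prob_compl[of "{f. \<forall>x\<in>J. \<not> f x}" "cell_pmf N Q P"] cells_none_marked[OF assms] by simp
qed

lemma cells_groups_marked:
  assumes "finite J" "\<And>j. j \<in> J \<Longrightarrow> K j \<subseteq> cells Q P" "disjoint_family_on K J"
    and "\<And>j. j \<in> J \<Longrightarrow> real (card (K j)) / (real N)\<^sup>2 = k"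
  shows "cell_prob N Q P {f. \<forall>j\<in>J. \<exists>x\<in>K j. f x} = (1 - exp (- k)) ^ card J"
proof -
  have "cell_prob N Q P {f. \<forall>j\<in>J. \<exists>x\<in>K j. f x} = (\<Prod>j\<in>J. cell_prob N Q P {f. \<exists>x\<in>K j. f x})"
    by (rule cell_independent_blocks[where K=K]) (use assms in auto)
  also have "\<dots> = (\<Prod>j\<in>J. 1 - exp (- k))" using assms by (intro prod.cong refl) (simp add: cells_some_marked)
  finally show ?thesis by simp
qed

lemma pmf_prob_UN_le:
  assumes "finite I" "\<And>i. i \<in> I \<Longrightarrow> measure_pmf.prob p (A i) \<le> c"
  shows "measure_pmf.prob p (\<Union>i\<in>I. A i) \<le> real (card I) * c"
proof -
  have "measure_pmf.prob p (\<Union>i\<in>I. A i) \<le> (\<Sum>i\<in>I. measure_pmf.prob p (A i))"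
    using assms by (intro measure_pmf.finite_measure_subadditive_finite) auto
  also have "\<dots> \<le> real (card I) * c" using assms(2) by (rule sum_bounded_above)
  finally show ?thesis .
qed

subsection \<open>Ties\<close>

lemma card_near_rows: "card {s::nat. \<bar>real s - r\<bar> < 8} \<le> 16" "finite {s::nat. \<bar>real s - r\<bar> < 8}"
proof -
  have s: "{s::nat. \<bar>real s - r\<bar> < 8} \<subseteq> nat ` {\<lfloor>r\<rfloor> - 7..\<lfloor>r\<rfloor> + 8}"
  proof
    fix s :: nat assume "s \<in> {s::nat. \<bar>real s - r\<bar> < 8}"
    then have "\<bar>real s - r\<bar> < 8" by simp
    then have "int s \<in> {\<lfloor>r\<rfloor> - 7..\<lfloor>r\<rfloor> + 8}" unfolding atLeastAtMost_iff by linarith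
    then show "s \<in> nat ` {\<lfloor>r\<rfloor> - 7..\<lfloor>r\<rfloor> + 8}" by (metis image_eqI nat_int)
  qed
  show "finite {s::nat. \<bar>real s - r\<bar> < 8}" by (rule finite_subset[OF s]) simp
  have "card {s::nat. \<bar>real s - r\<bar> < 8} \<le> card (nat ` {\<lfloor>r\<rfloor> - 7..\<lfloor>r\<rfloor> + 8})" by (rule card_mono[OF _ s]) simp
  also have "\<dots> \<le> card {\<lfloor>r\<rfloor> - 7..\<lfloor>r\<rfloor> + 8}" by (rule card_image_le) simp
  finally show "card {s::nat. \<bar>real s - r\<bar> < 8} \<le> 16" by simp
qed

lemma card_cells_near_row: "card {y \<in> cells Q P. \<bar>real (snd y) - r\<bar> < 8} \<le> 32 * Q"
proof -
  have "card {y \<in> cells Q P. \<bar>real (snd y) - r\<bar> < 8} \<le> card ({- int Q..<int Q} \<times> {s::nat. \<bar>real s - r\<bar> < 8})"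
    by (rule card_mono) (auto simp: cells_def card_near_rows(2))
  also have "\<dots> = (2 * Q) * card {s::nat. \<bar>real s - r\<bar> < 8}" by (simp add: card_cartesian_product nat_mult_distrib)
  also have "\<dots> \<le> (2 * Q) * 16" using card_near_rows(1) by (rule mult_le_mono2)
  finally show ?thesis by simp
qed

lemma card_cells_columns:
  assumes "finite C" "real (card C) \<le> k"
  shows "real (card {y \<in> cells Q P. fst y \<in> C}) \<le> k * (real P + 1)"
proof -
  have "card {y \<in> cells Q P. fst y \<in> C} \<le> card (C \<times> {..P})"
    by (rule card_mono) (use assms in \<open>auto simp: cells_def\<close>)
  also have "\<dots> = card C * (P + 1)" by (simp add: card_cartesian_product)
  finally have "card {y \<in> cells Q P. fst y \<in> C} \<le> card C * (P + 1)" .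
  then have "real (card {y \<in> cells Q P. fst y \<in> C}) \<le> real (card C * (P + 1))" by (simp only: of_nat_le_iff)
  also have "\<dots> = real (card C) * (real P + 1)" by (simp add: algebra_simps)
  also have "\<dots> \<le> k * (real P + 1)" using assms(2) by (intro mult_right_mono) auto
  finally show ?thesis .
qed

lemma card_cells_near_rows:
  assumes "finite A"
  shows "real (card {y \<in> cells Q P. \<exists>r\<in>A. \<bar>real (snd y) - r\<bar> < 8}) \<le> real (card A) * (32 * real Q)"
proof -
  have "{y \<in> cells Q P. \<exists>r\<in>A. \<bar>real (snd y) - r\<bar> < 8} = (\<Union>r\<in>A. {y \<in> cells Q P. \<bar>real (snd y) - r\<bar> < 8})" by auto
  then have "card {y \<in> cells Q P. \<exists>r\<in>A. \<bar>real (snd y) - r\<bar> < 8} \<le> (\<Sum>r\<in>A. card {y \<in> cells Q P. \<bar>real (snd y) - r\<bar> < 8})"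
    using card_UN_le[OF assms] by simp
  also have "\<dots> \<le> (\<Sum>r\<in>A. 32 * Q)" by (intro sum_mono card_cells_near_row)
  finally have "card {y \<in> cells Q P. \<exists>r\<in>A. \<bar>real (snd y) - r\<bar> < 8} \<le> card A * (32 * Q)" by simp
  then have "real (card {y \<in> cells Q P. \<exists>r\<in>A. \<bar>real (snd y) - r\<bar> < 8}) \<le> real (card A * (32 * Q))" by (simp only: of_nat_le_iff)
  then show ?thesis by simp
qed

lemma card_Un_le_real:
  assumes "S \<subseteq> A \<union> B" "finite A" "finite B" "real (card A) \<le> x" "real (card B) \<le> y"
  shows "real (card S) \<le> x + y"
proof -
  have "card S \<le> card (A \<union> B)" using assms by (intro card_mono) auto
  also have "\<dots> \<le> card A + card B" by (rule card_Un_le)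
  finally show ?thesis using assms by linarith
qed

text \<open>224 = 7 * 32: at most seven forbidden values, each excluding up to 16 rows of
  \<open>2 * Q\<close> cells.\<close>

lemma card_bad1:
  assumes "finite A" "card A \<le> 2"
  shows "real (card {y \<in> cells Q P. bad1 N Q P A y}) \<le> 3 * (real P + 1) + 224 * real Q"
proof -
  let ?A = "{0, real P, real N, real P - real N, real P / 2} \<union> A"
  have fA: "finite ?A" using assms by simp
  have "card ?A \<le> card {0, real P, real N, real P - real N, real P / 2} + card A" by (rule card_Un_le)
  also have "\<dots> \<le> 5 + 2" using assms by (intro add_mono) (auto simp: card_insert_if)
  finally have "real (card ?A) * (32 * real Q) \<le> 7 * (32 * real Q)" by (intro mult_right_mono) auto
  then have 2: "real (card {y \<in> cells Q P. \<exists>r\<in>?A. \<bar>real (snd y) - r\<bar> < 8}) \<le> 224 * real Q"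
    using card_cells_near_rows[OF fA, of Q P] by linarith
  have 1: "real (card {y \<in> cells Q P. fst y \<in> {0, - int Q, int Q - 1}}) \<le> 3 * (real P + 1)"
    by (rule card_cells_columns) (auto simp: card_insert_if)
  show ?thesis
    by (rule card_Un_le_real[OF _ _ _ 1 2]) (auto simp: bad1_def finite_cells)
qed

lemma card_bad2:
  assumes "finite D" "card D \<le> 1"
  shows "real (card {y \<in> cells Q P. bad2 N P D x y}) \<le> 14 * (real P + 1) + 128 * real Q"
proof -
  let ?A = "{real (snd x), real (snd x) + real N, 2 * real (snd x), (real P + real (snd x)) / 2}"
  have fA: "finite ?A" by simp
  have "card ?A \<le> 4" by (simp add: card_insert_if)
  then have "real (card ?A) * (32 * real Q) \<le> 4 * (32 * real Q)" by (intro mult_right_mono) auto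
  then have 2: "real (card {y \<in> cells Q P. \<exists>r\<in>?A. \<bar>real (snd y) - r\<bar> < 8}) \<le> 128 * real Q"
    using card_cells_near_rows[OF fA, of Q P] by linarith
  let ?C = "\<Union>r\<in>insert 0 D. {c::int. \<bar>real_of_int c - (real_of_int (fst x) + r)\<bar> \<le> 3}"
  have c: "{c::int. \<bar>real_of_int c - a\<bar> \<le> 3} = {\<lceil>a\<rceil> - 3..\<lfloor>a\<rfloor> + 3}" for a
    unfolding set_eq_iff mem_Collect_eq atLeastAtMost_iff by (intro allI) linarith
  have c7: "card {c::int. \<bar>real_of_int c - a\<bar> \<le> 3} \<le> 7" for a unfolding c by simp linarith
  have fC: "finite ?C" using assms(1) unfolding c by auto
  have "card ?C \<le> (\<Sum>r\<in>insert 0 D. card {c::int. \<bar>real_of_int c - (real_of_int (fst x) + r)\<bar> \<le> 3})"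
    by (rule card_UN_le) (use assms in auto)
  also have "\<dots> \<le> (\<Sum>r\<in>insert 0 D. 7)" by (intro sum_mono c7)
  also have "\<dots> \<le> 14" using card_insert_le_m1[of 2 D 0] assms by (simp add: card_insert_if)
  finally have 1: "real (card {y \<in> cells Q P. fst y \<in> ?C}) \<le> 14 * (real P + 1)"
    using fC by (intro card_cells_columns) auto
  show ?thesis
    by (rule card_Un_le_real[OF _ _ _ 1 2]) (auto simp: bad2_def finite_cells)
qed

lemma card_bad3: "real (card {z \<in> cells Q P. bad3 x y z}) \<le> 32 * real Q"
  using card_cells_near_row[of Q P "2 * real (snd y) - real (snd x)"] unfolding bad3_def
  by (metis (no_types, lifting) of_nat_le_iff of_nat_mult of_nat_numeral)

text \<open>A union bound over one, two or three marked cells, the last of which is confined to at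
  most \<open>m\<close> cells by the others. For \<open>n\<close> of order \<open>N ^ 2\<close>,
  \<open>m\<close> of order \<open>N\<close> and a mark probability of order
  \<open>1 / N ^ 2\<close>, every term is of order \<open>1 / N\<close>.\<close>

lemma not_generic_prob:
  assumes A: "finite A" "card A \<le> 2" and D: "finite D" "card D \<le> 1"
    and m: "3 * (real P + 1) + 224 * real Q \<le> m" "14 * (real P + 1) + 128 * real Q \<le> m"
    and n: "real (card (cells Q P)) \<le> n"
  shows "cell_prob N Q P {f. \<not> generic N Q P A D f} \<le>
    m * mark_prob N + n * (m * (mark_prob N)\<^sup>2) + n * (n * (m * mark_prob N ^ 3))"
proof -
  let ?C = "cells Q P" and ?p = "mark_prob N"
  let ?pr = "cell_prob N Q P"
  note p0 = mark_prob_bounds(1)[of N]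
  have m0: "0 \<le> m" using m(1) by (rule order_trans[rotated]) simp
  have n0: "0 \<le> n" using n by (rule order_trans[rotated]) simp
  define F1 where "F1 = (\<Union>y\<in>{y \<in> ?C. bad1 N Q P A y}. {f::int \<times> nat \<Rightarrow> bool. f y})"
  define F2 where "F2 = (\<Union>x\<in>?C. \<Union>y\<in>{y \<in> ?C. bad2 N P D x y} - {x}. {f::int \<times> nat \<Rightarrow> bool. f x \<and> f y})"
  define F3 where "F3 = (\<Union>x\<in>?C. \<Union>y\<in>?C - {x}. \<Union>z\<in>{z \<in> ?C. bad3 x y z} - {x, y}. {f::int \<times> nat \<Rightarrow> bool. f x \<and> f y \<and> f z})"
  have fin: "finite {y \<in> ?C. R y}" for R using finite_cells by simp
  have c: "real (card (S - U)) \<le> x" if "finite S" "real (card S) \<le> x" for S U :: "(int \<times> nat) set" and x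
    using card_mono[of S "S - U"] that by (meson Diff_subset of_nat_le_iff order_trans)
  have 1: "?pr F1 \<le> m * ?p"
  proof -
    have "?pr F1 \<le> real (card {y \<in> ?C. bad1 N Q P A y}) * ?p"
      unfolding F1_def by (rule pmf_prob_UN_le[OF fin]) (simp add: cell_marked)
    also have "\<dots> \<le> m * ?p" using card_bad1[OF A, of Q P N] m p0 by (intro mult_right_mono) auto
    finally show ?thesis .
  qed
  have 2: "?pr F2 \<le> n * (m * ?p\<^sup>2)"
  proof -
    have "?pr F2 \<le> real (card ?C) * (m * ?p\<^sup>2)" unfolding F2_def
    proof (rule pmf_prob_UN_le[OF finite_cells])
      fix x assume x: "x \<in> ?C"
      have "?pr (\<Union>y\<in>{y \<in> ?C. bad2 N P D x y} - {x}. {f. f x \<and> f y}) \<le> real (card ({y \<in> ?C. bad2 N P D x y} - {x})) * ?p\<^sup>2"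
      proof (rule pmf_prob_UN_le)
        fix y assume "y \<in> {y \<in> ?C. bad2 N P D x y} - {x}"
        then show "?pr {f. f x \<and> f y} \<le> ?p\<^sup>2" using cells_all_marked[of "{x, y}" Q P N] x by (auto simp: card_insert_if power2_eq_square)
      qed (use fin in auto)
      also have "\<dots> \<le> m * ?p\<^sup>2" using order_trans[OF card_bad2[OF D, of Q P N x] m(2)] by (intro mult_right_mono c fin) auto
      finally show "?pr (\<Union>y\<in>{y \<in> ?C. bad2 N P D x y} - {x}. {f. f x \<and> f y}) \<le> m * ?p\<^sup>2" .
    qed
    also have "\<dots> \<le> n * (m * ?p\<^sup>2)" using n m0 by (intro mult_right_mono) auto
    finally show ?thesis .
  qed
  have 3: "?pr F3 \<le> n * (n * (m * ?p ^ 3))"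
  proof -
    have mp: "0 \<le> m * ?p ^ 3" using m0 p0 by simp
    have "?pr F3 \<le> real (card ?C) * (n * (m * ?p ^ 3))" unfolding F3_def
    proof (rule pmf_prob_UN_le[OF finite_cells])
      fix x assume x: "x \<in> ?C"
      have "?pr (\<Union>y\<in>?C - {x}. \<Union>z\<in>{z \<in> ?C. bad3 x y z} - {x, y}. {f. f x \<and> f y \<and> f z}) \<le> real (card (?C - {x})) * (m * ?p ^ 3)"
      proof (rule pmf_prob_UN_le)
        fix y assume y: "y \<in> ?C - {x}"
        have "?pr (\<Union>z\<in>{z \<in> ?C. bad3 x y z} - {x, y}. {f. f x \<and> f y \<and> f z}) \<le> real (card ({z \<in> ?C. bad3 x y z} - {x, y})) * ?p ^ 3"
        proof (rule pmf_prob_UN_le)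
          fix z assume z: "z \<in> {z \<in> ?C. bad3 x y z} - {x, y}"
          have "card {x, y, z} = 3" using y z by (auto simp: card_insert_if)
          then show "?pr {f. f x \<and> f y \<and> f z} \<le> ?p ^ 3" using cells_all_marked[of "{x, y, z}" Q P N] x y z by auto
        qed (use fin in auto)
        also have "\<dots> \<le> m * ?p ^ 3"
        proof (intro mult_right_mono c fin)
          have "32 * real Q \<le> m" using m(2) by (rule order_trans[rotated]) simp
          then show "real (card {z \<in> ?C. bad3 x y z}) \<le> m" using card_bad3[of Q P x y] by linarith
        qed (use p0 in auto)
        finally show "?pr (\<Union>z\<in>{z \<in> ?C. bad3 x y z} - {x, y}. {f. f x \<and> f y \<and> f z}) \<le> m * ?p ^ 3" .
      qed (use finite_cells in auto)
      also have "\<dots> \<le> n * (m * ?p ^ 3)" using n by (intro mult_right_mono[OF _ mp] c finite_cells) auto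
      finally show "?pr (\<Union>y\<in>?C - {x}. \<Union>z\<in>{z \<in> ?C. bad3 x y z} - {x, y}. {f. f x \<and> f y \<and> f z}) \<le> n * (m * ?p ^ 3)" .
    qed
    also have "\<dots> \<le> n * (n * (m * ?p ^ 3))" using n by (rule mult_right_mono) (use n0 mp in auto)
    finally show ?thesis .
  qed
  have "{f. \<not> generic N Q P A D f} \<subseteq> F1 \<union> F2 \<union> F3"
  proof
    fix f assume "f \<in> {f. \<not> generic N Q P A D f}"
    then consider y where "y \<in> ?C" "f y" "bad1 N Q P A y"
      | x y where "x \<in> ?C" "f x" "y \<in> ?C" "f y" "x \<noteq> y" "bad2 N P D x y"
      | x y z where "x \<in> ?C" "f x" "y \<in> ?C" "f y" "z \<in> ?C" "f z" "x \<noteq> y" "x \<noteq> z" "y \<noteq> z" "bad3 x y z"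
      unfolding generic_def fire_cells_def by blast
    then show "f \<in> F1 \<union> F2 \<union> F3"
    proof cases
      case 1 then have "f \<in> F1" unfolding F1_def by blast
      then show ?thesis by blast
    next
      case 2 then have "f \<in> F2" unfolding F2_def by blast
      then show ?thesis by blast
    next
      case 3
      then have "f \<in> F3" unfolding F3_def
        by (intro UN_I[of x] UN_I[of y] UN_I[of z]) auto
      then show ?thesis by blast
    qed
  qed
  then have "?pr {f. \<not> generic N Q P A D f} \<le> ?pr (F1 \<union> F2 \<union> F3)" by (rule measure_pmf.finite_measure_mono) simp
  also have "\<dots> \<le> ?pr F1 + ?pr F2 + ?pr F3"
    by (intro order_trans[OF measure_Un_le] add_mono order_refl) auto
  finally show ?thesis using 1 2 3 by linarith
qed

subsection \<open>Chains of marked cells\<close>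

definition strip :: "nat \<Rightarrow> int \<Rightarrow> int set" where
  "strip N k = {k * int N..<(k + 1) * int N}"

lemma strip_disjoint: assumes "k \<noteq> k'" shows "strip N k \<inter> strip N k' = {}"
proof -
  have *: "strip N k \<inter> strip N k' = {}" if "k < k'" for k k'
  proof -
    have "(k + 1) * int N \<le> k' * int N" using that by (intro mult_right_mono) auto
    then show ?thesis by (auto simp: strip_def)
  qed
  show ?thesis using assms *[of k k'] *[of k' k] by (cases k k' rule: linorder_cases) auto
qed

lemma card_strip: "card (strip N k) = N" "finite (strip N k)"
  by (auto simp: strip_def algebra_simps)

lemma card_chain_rows: "card (chain_rows w i) = w" "finite (chain_rows w i)"
  by (auto simp: chain_rows_def)

lemma left_group_strip: "left_group N w (k * int N) i = strip N (k + int i) \<times> chain_rows w i"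
  by (simp add: left_group_def strip_def algebra_simps)

lemma right_group_strip: "right_group N w (k * int N) i = strip N (k - int i - 1) \<times> chain_rows w i"
  by (simp add: right_group_def strip_def algebra_simps)

text \<open>A strip of \<open>N\<close> columns and \<open>w\<close> rows has
  \<open>N ^ 2 / 8\<close> cells, so it is hit with probability \<open>1 - exp (- 1 / 8)\<close> on
  every grid. A block of at most \<open>R\<close> links thus succeeds with a probability bounded
  below independently of \<open>N\<close>, and disjoint blocks are independent.\<close>

lemma chain_blocks_fail:
  fixes k :: "nat \<Rightarrow> nat \<Rightarrow> int"
  assumes N: "N = 8 * w" "0 < w" and I: "Suc I \<le> R"
    and sub: "\<And>a i. a < A \<Longrightarrow> i \<le> I \<Longrightarrow> strip N (k a i) \<times> chain_rows w i \<subseteq> cells Q P"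
    and inj: "\<And>a i a' i'. i \<le> I \<Longrightarrow> i' \<le> I \<Longrightarrow> k a i = k a' i' \<Longrightarrow> a = a' \<and> i = i'"
  shows "cell_prob N Q P {f. \<forall>a\<in>{..<A}. \<not> (\<forall>i\<in>{..I}. \<exists>x\<in>strip N (k a i) \<times> chain_rows w i. f x)} \<le>
    (1 - (1 - exp (- 1 / 8)) ^ R) ^ A"
proof -
  let ?G = "\<lambda>a i. strip N (k a i) \<times> chain_rows w i"
  let ?pr = "cell_prob N Q P"
  have disj: "?G a i \<inter> ?G a' i' = {}" if "i \<le> I" "i' \<le> I" "(a, i) \<noteq> (a', i')" for a i a' i'
  proof -
    have "k a i \<noteq> k a' i'" using inj[OF that(1,2)] that(3) by auto
    then show ?thesis using strip_disjoint[of "k a i" "k a' i'" N] by auto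
  qed
  have one: "?pr {f. \<not> (\<forall>i\<in>{..I}. \<exists>x\<in>?G a i. f x)} \<le> 1 - (1 - exp (- 1 / 8)) ^ R" if "a < A" for a
  proof -
    have "?pr {f. \<forall>i\<in>{..I}. \<exists>x\<in>?G a i. f x} = (1 - exp (- (1 / 8))) ^ card {..I}"
    proof (rule cells_groups_marked)
      show "?G a i \<subseteq> cells Q P" if "i \<in> {..I}" for i using sub[OF \<open>a < A\<close>] that by simp
      show "disjoint_family_on (?G a) {..I}" unfolding disjoint_family_on_def using disj by auto
      show "real (card (?G a i)) / (real N)\<^sup>2 = 1 / 8" for i
        using N by (simp add: card_cartesian_product card_strip card_chain_rows power2_eq_square)
    qed simp
    also have "\<dots> = (1 - exp (- 1 / 8)) ^ Suc I" by simp
    also have "\<dots> \<ge> (1 - exp (- 1 / 8)) ^ R" by (rule power_decreasing[OF I]) auto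
    finally have "(1 - exp (- 1 / 8)) ^ R \<le> ?pr {f. \<forall>i\<in>{..I}. \<exists>x\<in>?G a i. f x}" .
    moreover have "{f. \<not> (\<forall>i\<in>{..I}. \<exists>x\<in>?G a i. f x)} = UNIV - {f. \<forall>i\<in>{..I}. \<exists>x\<in>?G a i. f x}"
      by (rule set_eqI) (simp only: mem_Collect_eq Diff_iff UNIV_I simp_thms)
    ultimately show ?thesis using measure_pmf.prob_compl[of "{f. \<forall>i\<in>{..I}. \<exists>x\<in>?G a i. f x}" "cell_pmf N Q P"] by simp
  qed
  have "?pr {f. \<forall>a\<in>{..<A}. \<not> (\<forall>i\<in>{..I}. \<exists>x\<in>?G a i. f x)} = (\<Prod>a\<in>{..<A}. ?pr {f. \<not> (\<forall>i\<in>{..I}. \<exists>x\<in>?G a i. f x)})"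
  proof (rule cell_independent_blocks[where K="\<lambda>a. \<Union>i\<in>{..I}. ?G a i"])
    show "(\<Union>i\<in>{..I}. ?G a i) \<subseteq> cells Q P" if "a \<in> {..<A}" for a using sub that by fastforce
    show "disjoint_family_on (\<lambda>a. \<Union>i\<in>{..I}. ?G a i) {..<A}"
      unfolding disjoint_family_on_def
    proof (intro ballI impI)
      fix a a' :: nat assume "a \<noteq> a'"
      then have "?G a i \<inter> ?G a' i' = {}" if "i \<le> I" "i' \<le> I" for i i' using disj[OF that, of a a'] by simp
      then show "(\<Union>i\<in>{..I}. ?G a i) \<inter> (\<Union>i\<in>{..I}. ?G a' i) = {}"
        by (simp only: Int_UN_distrib2 atMost_iff SUP_bot_conv(1) ball_simps) blast
    qed
    show "(\<not> (\<forall>i\<in>{..I}. \<exists>x\<in>?G a i. f x)) = (\<not> (\<forall>i\<in>{..I}. \<exists>x\<in>?G a i. g x))"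
      if "\<And>x. x \<in> (\<Union>i\<in>{..I}. ?G a i) \<Longrightarrow> f x = g x" for a and f g :: config
    proof -
      have "(\<exists>x\<in>?G a i. f x) = (\<exists>x\<in>?G a i. g x)" if "i \<in> {..I}" for i
        by (rule bex_cong[OF refl]) (use that \<open>\<And>x. x \<in> (\<Union>i\<in>{..I}. ?G a i) \<Longrightarrow> f x = g x\<close> in blast)
      then show ?thesis by simp
    qed
  qed simp
  also have "\<dots> \<le> (\<Prod>a\<in>{..<A}. 1 - (1 - exp (- 1 / 8)) ^ R)"
    by (intro prod_mono conjI measure_nonneg one) auto
  finally show ?thesis by simp
qed

lemma mixed_radix_inj:
  fixes a a' R i i' :: nat
  assumes "i < R" "i' < R" "int a * int R + int i = int a' * int R + int i'"
  shows "a = a' \<and> i = i'"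
proof -
  have e: "a * R + i = a' * R + i'" using assms(3) by (metis of_nat_add of_nat_eq_iff of_nat_mult)
  have "a = (a * R + i) div R" "a' = (a' * R + i') div R" using assms by simp_all
  then have "a = a'" using e by simp
  then show ?thesis using e by simp
qed

text \<open>The \<open>\<delta> * N\<close> columns left free on each side of the origin are room
  for the explicit chains of the lower bounds.\<close>

definition chained :: "nat \<Rightarrow> nat \<Rightarrow> nat \<Rightarrow> nat \<Rightarrow> nat \<Rightarrow> config \<Rightarrow> bool" where
  "chained N w Q P \<delta> f \<longleftrightarrow>
     (\<exists>bl. bl + int (Suc ((P - 5 * w) div (2 * w)) * N) \<le> - int (\<delta> * N) \<and>
        (\<forall>i\<le>(P - 5 * w) div (2 * w). \<exists>x\<in>fire_cells Q P f. x \<in> left_group N w bl i)) \<and>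
     (\<exists>br. int (\<delta> * N) \<le> br - int (Suc ((P - 5 * w) div (2 * w)) * N) \<and>
        (\<forall>i\<le>(P - 5 * w) div (2 * w). \<exists>x\<in>fire_cells Q P f. x \<in> right_group N w br i))"

text \<open>On either side of the origin, the chain is searched for in \<open>A\<close> independent blocks of \<open>R * N\<close> columns.\<close>

lemma not_chained_prob:
  assumes N: "N = 8 * w" "0 < w" "N \<le> P" and R: "Suc ((P - 5 * w) div (2 * w)) \<le> R"
  shows "cell_prob N ((\<delta> + A * R) * N) P {f. \<not> chained N w ((\<delta> + A * R) * N) P \<delta> f} \<le>
    2 * (1 - (1 - exp (- 1 / 8)) ^ R) ^ A"
proof -
  define Q where "Q = (\<delta> + A * R) * N"
  define I where "I = (P - 5 * w) div (2 * w)"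
  let ?pr = "cell_prob N Q P"
  define kl where "kl a i = - int (\<delta> + (a + 1) * R) + int i" for a i
  define kr where "kr a i = int (\<delta> + (a + 1) * R) - int i - 1" for a i
  have RI: "Suc I \<le> R" using R by (simp add: I_def)
  have strip_sub: "strip N k \<times> chain_rows w i \<subseteq> cells Q P" if "- int (\<delta> + A * R) \<le> k" "k < int (\<delta> + A * R)" "i \<le> I" for k i
  proof -
    have "strip N k \<subseteq> {- int Q..<int Q}"
    proof -
      have "- int (\<delta> + A * R) * int N \<le> k * int N" "(k + 1) * int N \<le> int (\<delta> + A * R) * int N"
        using that by (intro mult_right_mono; simp)+
      then show ?thesis unfolding strip_def Q_def of_nat_mult by (auto simp: algebra_simps)
    qed
    moreover have "chain_rows w i \<subseteq> {..P}" using chain_rows_bound[of _ w i P] that N by (auto simp: I_def less_imp_le)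
    ultimately show ?thesis unfolding cells_def by (rule Sigma_mono)
  qed
  have aR: "int (\<delta> + (a + 1) * R) \<le> int (\<delta> + A * R)" if "a < A" for a
  proof -
    have "(a + 1) * R \<le> A * R" using that by (intro mult_le_mono1) auto
    then show ?thesis by (simp only: of_nat_le_iff add_le_cancel_left)
  qed
  have 1: "?pr {f. \<forall>a\<in>{..<A}. \<not> (\<forall>i\<in>{..I}. \<exists>x\<in>strip N (kl a i) \<times> chain_rows w i. f x)} \<le> (1 - (1 - exp (- 1 / 8)) ^ R) ^ A"
  proof (rule chain_blocks_fail[OF N(1,2) RI])
    fix a i assume "a < A" "i \<le> I"
    moreover have "int R \<le> int (\<delta> + (a + 1) * R)" by (simp add: algebra_simps)
    ultimately show "strip N (kl a i) \<times> chain_rows w i \<subseteq> cells Q P"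
      using aR[of a] RI by (intro strip_sub) (auto simp: kl_def simp del: of_nat_add of_nat_mult)
  next
    fix a i a' i' assume i: "i \<le> I" "i' \<le> I" and e: "kl a i = kl a' i'"
    \<comment> \<open>Up to sign and an additive constant, \<open>kl a i\<close> has the digits
      \<open>a\<close> and \<open>R - 1 - i\<close> to base \<open>R\<close>.\<close>
    have "int a * int R + int (R - 1 - i) = int a' * int R + int (R - 1 - i')"
      using e i RI unfolding kl_def by (simp add: algebra_simps of_nat_diff)
    from mixed_radix_inj[OF _ _ this] show "a = a' \<and> i = i'" using i RI by auto
  qed
  have 2: "?pr {f. \<forall>a\<in>{..<A}. \<not> (\<forall>i\<in>{..I}. \<exists>x\<in>strip N (kr a i) \<times> chain_rows w i. f x)} \<le> (1 - (1 - exp (- 1 / 8)) ^ R) ^ A"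
  proof (rule chain_blocks_fail[OF N(1,2) RI])
    fix a i assume "a < A" "i \<le> I"
    moreover have "int R \<le> int (\<delta> + (a + 1) * R)" by (simp add: algebra_simps)
    ultimately show "strip N (kr a i) \<times> chain_rows w i \<subseteq> cells Q P"
      using aR[of a] RI by (intro strip_sub) (auto simp: kr_def simp del: of_nat_add of_nat_mult)
  next
    fix a i a' i' assume i: "i \<le> I" "i' \<le> I" and e: "kr a i = kr a' i'"
    have "int a * int R + int (R - 1 - i) = int a' * int R + int (R - 1 - i')"
      using e i RI unfolding kr_def by (simp add: algebra_simps of_nat_diff)
    from mixed_radix_inj[OF _ _ this] show "a = a' \<and> i = i'" using i RI by auto
  qed
  have RN: "int (Suc I * N) \<le> int (R * N)" using mult_le_mono1[OF RI, of N] by (simp only: of_nat_le_iff)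
  have "{f. \<not> chained N w Q P \<delta> f} \<subseteq>
      {f. \<forall>a\<in>{..<A}. \<not> (\<forall>i\<in>{..I}. \<exists>x\<in>strip N (kl a i) \<times> chain_rows w i. f x)} \<union>
      {f. \<forall>a\<in>{..<A}. \<not> (\<forall>i\<in>{..I}. \<exists>x\<in>strip N (kr a i) \<times> chain_rows w i. f x)}" (is "_ \<subseteq> ?L \<union> ?R")
  proof (rule subsetI, rule ccontr)
    fix f assume f: "f \<in> {f. \<not> chained N w Q P \<delta> f}" "f \<notin> ?L \<union> ?R"
    then obtain a where a: "a < A" "\<forall>i\<in>{..I}. \<exists>x\<in>strip N (kl a i) \<times> chain_rows w i. f x" by blast
    obtain a' where a': "a' < A" "\<forall>i\<in>{..I}. \<exists>x\<in>strip N (kr a' i) \<times> chain_rows w i. f x" using f by blast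
    have "\<exists>x\<in>fire_cells Q P f. x \<in> left_group N w (- int (\<delta> + (a + 1) * R) * int N) i" if "i \<le> I" for i
    proof -
      have "int R \<le> int (\<delta> + (a + 1) * R)" by (simp add: algebra_simps)
      then have "strip N (kl a i) \<times> chain_rows w i \<subseteq> cells Q P"
        using aR[OF a(1)] RI that by (intro strip_sub) (auto simp: kl_def simp del: of_nat_add of_nat_mult)
      then show ?thesis using a(2) that unfolding left_group_strip fire_cells_def kl_def by blast
    qed
    moreover have "\<exists>x\<in>fire_cells Q P f. x \<in> right_group N w (int (\<delta> + (a' + 1) * R) * int N) i" if "i \<le> I" for i
    proof -
      have "int R \<le> int (\<delta> + (a' + 1) * R)" by (simp add: algebra_simps)
      then have "strip N (kr a' i) \<times> chain_rows w i \<subseteq> cells Q P"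
        using aR[OF a'(1)] RI that by (intro strip_sub) (auto simp: kr_def simp del: of_nat_add of_nat_mult)
      then show ?thesis using a'(2) that unfolding right_group_strip fire_cells_def kr_def by blast
    qed
    moreover have "int (\<delta> * N) + int (Suc I * N) \<le> int (\<delta> + (b + 1) * R) * int N" for b
    proof -
      have "int (\<delta> * N) + int (R * N) \<le> int (\<delta> + (b + 1) * R) * int N" by (simp add: algebra_simps)
      then show ?thesis using RN by linarith
    qed
    note this[of a] this[of a']
    ultimately have "chained N w Q P \<delta> f"
      unfolding chained_def I_def[symmetric]
      by (intro conjI exI[of _ "- int (\<delta> + (a + 1) * R) * int N"] exI[of _ "int (\<delta> + (a' + 1) * R) * int N"])
         (auto simp del: of_nat_add of_nat_mult)
    then show False using f by simp
  qed
  then have "?pr {f. \<not> chained N w Q P \<delta> f} \<le> ?pr (?L \<union> ?R)" by (rule measure_pmf.finite_measure_mono) simp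
  also have "\<dots> \<le> ?pr ?L + ?pr ?R" by (rule measure_Un_le) auto
  finally show ?thesis using 1 2 unfolding Q_def by linarith
qed

lemma not_generic_prob_scaled:
  assumes A: "finite A" "card A \<le> 2" and D: "finite D" "card D \<le> 1" and N: "0 < N"
    and P: "real P + 1 \<le> \<tau> * real N" and \<mu>: "\<mu> = 14 * \<tau> + 224 * real q" and \<nu>: "\<nu> = 2 * real q * \<tau>"
  shows "cell_prob N (q * N) P {f. \<not> generic N (q * N) P A D f} \<le> \<mu> * (1 + \<nu> + \<nu>\<^sup>2) / real N"
    "real (card (cells (q * N) P)) / real N ^ 4 \<le> \<nu> / (real N)\<^sup>2"
proof -
  let ?p = "mark_prob N" and ?N = "real N"
  have N0: "0 < ?N" using N by simp
  have "0 < \<tau> * ?N" using P by linarith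
  then have \<tau>: "0 \<le> \<tau>" using N0 by (simp add: zero_less_mult_iff)
  have card: "real (card (cells (q * N) P)) \<le> \<nu> * ?N\<^sup>2"
  proof -
    have "real (card (cells (q * N) P)) = 2 * real q * ?N * (real P + 1)" by (simp add: card_cells algebra_simps)
    also have "\<dots> \<le> 2 * real q * ?N * (\<tau> * ?N)" using P by (intro mult_left_mono) auto
    finally show ?thesis by (simp add: \<nu> power2_eq_square algebra_simps)
  qed
  have "real (card (cells (q * N) P)) / ?N ^ 4 \<le> \<nu> * ?N\<^sup>2 / ?N ^ 4" using card by (intro divide_right_mono) auto
  also have "\<dots> = \<nu> / ?N\<^sup>2" using N0 by (simp add: power2_eq_square power4_eq_xxxx)
  finally show "real (card (cells (q * N) P)) / real N ^ 4 \<le> \<nu> / (real N)\<^sup>2" .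
  have \<mu>0: "0 \<le> \<mu>" "0 \<le> \<nu>" using \<tau> unfolding \<mu> \<nu> by auto
  have p: "0 \<le> ?p" "?p \<le> 1 / ?N\<^sup>2" by (rule mark_prob_bounds)+
  have "cell_prob N (q * N) P {f. \<not> generic N (q * N) P A D f} \<le>
      \<mu> * ?N * ?p + \<nu> * ?N\<^sup>2 * (\<mu> * ?N * ?p\<^sup>2) + \<nu> * ?N\<^sup>2 * (\<nu> * ?N\<^sup>2 * (\<mu> * ?N * ?p ^ 3))"
  proof (rule not_generic_prob[OF A D _ _ card])
    have "14 * (real P + 1) \<le> 14 * (\<tau> * ?N)" using P by (intro mult_left_mono) auto
    moreover have "3 * (real P + 1) \<le> 14 * (real P + 1)" by simp
    moreover have "\<mu> * ?N = 14 * (\<tau> * ?N) + 224 * real (q * N)" by (simp add: \<mu> algebra_simps)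
    moreover have "0 \<le> real (q * N)" by simp
    ultimately show "3 * (real P + 1) + 224 * real (q * N) \<le> \<mu> * ?N" "14 * (real P + 1) + 128 * real (q * N) \<le> \<mu> * ?N"
      by linarith+
  qed
  also have "\<dots> \<le> \<mu> * ?N * (1 / ?N\<^sup>2) + \<nu> * ?N\<^sup>2 * (\<mu> * ?N * (1 / ?N\<^sup>2)\<^sup>2) + \<nu> * ?N\<^sup>2 * (\<nu> * ?N\<^sup>2 * (\<mu> * ?N * (1 / ?N\<^sup>2) ^ 3))"
    using p \<mu>0 by (intro add_mono mult_left_mono power_mono) auto
  also have "\<dots> = \<mu> * (1 + \<nu> + \<nu>\<^sup>2) / ?N"
    using N0 by (simp add: field_simps power2_eq_square power3_eq_cube)
  finally show "cell_prob N (q * N) P {f. \<not> generic N (q * N) P A D f} \<le> \<mu> * (1 + \<nu> + \<nu>\<^sup>2) / real N" .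
qed

text \<open>Row \<open>P\<close> comprises the times after \<open>P\<close> and up to
  \<open>P + 1\<close> steps, hence a ceiling minus one.\<close>

definition last_row :: "real \<Rightarrow> nat \<Rightarrow> nat" where
  "last_row t N = nat \<lceil>t * real N\<rceil> - 1"

lemma last_row_bounds:
  assumes "0 < t" "0 < N"
  shows "real (last_row t N) < t * real N" "t * real N \<le> real (last_row t N) + 1"
proof -
  have "0 < t * real N" using assms by simp
  then have "1 \<le> \<lceil>t * real N\<rceil>" by linarith
  then have "int (last_row t N) = \<lceil>t * real N\<rceil> - 1" unfolding last_row_def by linarith
  then show "real (last_row t N) < t * real N" "t * real N \<le> real (last_row t N) + 1" by linarith+
qed

text \<open>The good configurations, on which the cluster of the origin is determined by the marked cells.\<close>

definition tame :: "nat \<Rightarrow> nat \<Rightarrow> nat \<Rightarrow> nat \<Rightarrow> real set \<Rightarrow> real set \<Rightarrow> config \<Rightarrow> bool" where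
  "tame w Q P \<delta> A D f \<longleftrightarrow> generic (8 * w) Q P A D f \<and> chained (8 * w) w Q P \<delta> f"

text \<open>The relative width \<open>q\<close> depends on \<epsilon>, \<delta> and \<open>t\<close>
  but not on the grid: it makes chains likely uniformly in \<open>w\<close>. Ties and doubly hit
  cells disappear as \<open>w\<close> grows with \<open>q\<close> fixed.\<close>

lemma eventually_tame:
  assumes t: "3 / 2 \<le> t" and \<epsilon>: "0 < \<epsilon>"
  shows "\<exists>q\<ge>\<delta>. \<forall>\<^sub>F w in sequentially. \<forall>A D. finite A \<and> card A \<le> 2 \<and> finite D \<and> card D \<le> 1 \<longrightarrow>
    cell_prob (8 * w) (q * (8 * w)) (last_row t (8 * w)) {f. \<not> tame w (q * (8 * w)) (last_row t (8 * w)) \<delta> A D f} +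
    real (card (cells (q * (8 * w)) (last_row t (8 * w)))) / real (8 * w) ^ 4 \<le> \<epsilon>"
proof -
  \<comment> \<open>A link serves \<open>2 * w\<close> rows, a quarter of a time unit, so about
    \<open>4 * t\<close> links cover all rows.\<close>
  define R where "R = nat \<lceil>4 * t\<rceil> + 1"
  define z where "z = 1 - (1 - exp (- 1 / 8 :: real)) ^ R"
  have "(0::real) < (1 - exp (- 1 / 8)) ^ R" "(1 - exp (- 1 / 8 :: real)) ^ R \<le> 1"
    by (auto intro: power_le_one)
  then have "0 \<le> z" "z < 1" by (auto simp: z_def)
  then have "(\<lambda>A. z ^ A) \<longlonglongrightarrow> 0" by (intro LIMSEQ_realpow_zero) auto
  then have "\<forall>\<^sub>F A in sequentially. z ^ A < \<epsilon> / 6" by (rule order_tendstoD) (use \<epsilon> in simp)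
  then obtain B where B: "z ^ B < \<epsilon> / 6" unfolding eventually_sequentially by auto
  define q where "q = \<delta> + B * R"
  define \<tau> where "\<tau> = t + 1"
  define \<mu> where "\<mu> = 14 * \<tau> + 224 * real q"
  define \<nu> where "\<nu> = 2 * real q * \<tau>"
  have l: "(\<lambda>w. \<mu> * (1 + \<nu> + \<nu>\<^sup>2) / real (8 * w) + \<nu> / (real (8 * w))\<^sup>2) \<longlonglongrightarrow> 0"
    by real_asymp
  have "\<forall>\<^sub>F w in sequentially. \<mu> * (1 + \<nu> + \<nu>\<^sup>2) / real (8 * w) + \<nu> / (real (8 * w))\<^sup>2 < \<epsilon> / 2"
    by (rule order_tendstoD(2)[OF l]) (use \<epsilon> in simp)
  then have "\<forall>\<^sub>F w in sequentially. \<forall>A D. finite A \<and> card A \<le> 2 \<and> finite D \<and> card D \<le> 1 \<longrightarrow>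
    cell_prob (8 * w) (q * (8 * w)) (last_row t (8 * w)) {f. \<not> tame w (q * (8 * w)) (last_row t (8 * w)) \<delta> A D f} +
    real (card (cells (q * (8 * w)) (last_row t (8 * w)))) / real (8 * w) ^ 4 \<le> \<epsilon>"
    using eventually_gt_at_top[of 0]
  proof eventually_elim
    case (elim w)
    define N where "N = 8 * w"
    define P where "P = last_row t N"
    have N: "0 < N" "0 < real N" using elim by (auto simp: N_def)
    have t0: "0 < t" using t by simp
    have P: "real P < t * real N" "t * real N \<le> real P + 1" unfolding P_def by (rule last_row_bounds[OF t0 N(1)])+
    have "1 * real N \<le> real N" "8 \<le> real N" using elim by (auto simp: N_def)
    moreover have "3 / 2 * real N \<le> t * real N" using t by (intro mult_right_mono) auto
    ultimately have "real N \<le> real P" using P by linarith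
    then have NP: "N \<le> P" by simp
    have P\<tau>: "real P + 1 \<le> \<tau> * real N" using P \<open>8 \<le> real N\<close> by (simp add: \<tau>_def algebra_simps)
    have R: "Suc ((P - 5 * w) div (2 * w)) \<le> R"
    proof -
      have "real ((P - 5 * w) div (2 * w)) \<le> real (P - 5 * w) / real (2 * w)" by (rule of_nat_div_le_of_nat)
      also have "\<dots> \<le> real P / real (2 * w)" by (intro divide_right_mono) auto
      also have "\<dots> \<le> 4 * t" using P(1) elim by (simp add: N_def field_simps)
      finally have "real ((P - 5 * w) div (2 * w)) \<le> 4 * t" .
      then have "int ((P - 5 * w) div (2 * w)) \<le> \<lceil>4 * t\<rceil>" by linarith
      then show ?thesis by (simp add: R_def)
    qed
    show ?case
    proof (intro allI impI)
      fix A D :: "real set" assume AD: "finite A \<and> card A \<le> 2 \<and> finite D \<and> card D \<le> 1"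
      let ?pr = "cell_prob N (q * N) P"
      have 1: "?pr {f. \<not> generic N (q * N) P A D f} \<le> \<mu> * (1 + \<nu> + \<nu>\<^sup>2) / real N"
        "real (card (cells (q * N) P)) / real N ^ 4 \<le> \<nu> / (real N)\<^sup>2"
        using not_generic_prob_scaled[OF _ _ _ _ N(1) P\<tau> \<mu>_def \<nu>_def] AD by blast+
      have 2: "?pr {f. \<not> chained N w (q * N) P \<delta> f} \<le> 2 * z ^ B"
        unfolding q_def z_def by (rule not_chained_prob[OF N_def elim(2) NP R])
      have "?pr {f. \<not> tame w (q * N) P \<delta> A D f} \<le> ?pr ({f. \<not> generic N (q * N) P A D f} \<union> {f. \<not> chained N w (q * N) P \<delta> f})"
        by (rule measure_pmf.finite_measure_mono) (auto simp: tame_def N_def)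
      also have "\<dots> \<le> ?pr {f. \<not> generic N (q * N) P A D f} + ?pr {f. \<not> chained N w (q * N) P \<delta> f}"
        by (rule measure_Un_le) auto
      finally have "?pr {f. \<not> tame w (q * N) P \<delta> A D f} + real (card (cells (q * N) P)) / real N ^ 4 \<le> \<epsilon>"
        using 1 2 B elim(1) unfolding N_def[symmetric] using \<epsilon> by linarith
      then show "cell_prob (8 * w) (q * (8 * w)) (last_row t (8 * w)) {f. \<not> tame w (q * (8 * w)) (last_row t (8 * w)) \<delta> A D f} +
        real (card (cells (q * (8 * w)) (last_row t (8 * w)))) / real (8 * w) ^ 4 \<le> \<epsilon>"
        unfolding P_def N_def .
    qed
  qed
  moreover have "\<delta> \<le> q" by (simp add: q_def)
  ultimately show ?thesis by blast
qed

section \<open>The cluster of the origin and the marked cells\<close>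

lemma admissible_cong:
  assumes "\<And>x. x \<in> cells Q P \<Longrightarrow> f x = g x"
  shows "admissible N hN Q P f M cc v S lf rg \<longleftrightarrow> admissible N hN Q P g M cc v S lf rg"
proof -
  have e: "((c, s) \<in> cells Q P \<and> f (c, s)) = ((c, s) \<in> cells Q P \<and> g (c, s))" for c s using assms by blast
  show ?thesis unfolding admissible_def e ..
qed

text \<open>The final events consult \<open>b\<close> only inside the windows of active positions,
  where \<open>burns_unique\<close> applies; so they may be evaluated with any solution of the
  equation.\<close>

lemma (in tracked_realization) fin_unique:
  assumes "burns b'"
  shows "fin_macro N \<theta> P cc v lf rg b' = fin_macro N \<theta> P cc v lf rg b"
    and "fin_micro N \<alpha> \<beta> P M v S lf rg b' = fin_micro N \<alpha> \<beta> P M v S lf rg b"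
proof -
  have bv: "b' v g = b v g" if "lf P \<le> g" "g < rg P" for g
    using burns_unique[OF assms burns_b active_v, of g] that S_v by simp
  show "fin_macro N \<theta> P cc v lf rg b' = fin_macro N \<theta> P cc v lf rg b"
  proof -
    have "(\<forall>g. i \<le> g \<and> g < j \<longrightarrow> b' v g) = (\<forall>g. i \<le> g \<and> g < j \<longrightarrow> b v g)" if "lf P \<le> i" "j \<le> rg P" for i j
      by (intro all_cong imp_cong refl bv) (use that in auto)
    then have "(lf P \<le> i \<and> i < v \<and> v < j \<and> j \<le> rg P \<and> (\<forall>g. i \<le> g \<and> g < j \<longrightarrow> b' v g) \<and> \<theta> * real N \<le> real_of_int (cc j - cc i)) \<longleftrightarrow>
        (lf P \<le> i \<and> i < v \<and> v < j \<and> j \<le> rg P \<and> (\<forall>g. i \<le> g \<and> g < j \<longrightarrow> b v g) \<and> \<theta> * real N \<le> real_of_int (cc j - cc i))" for i j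
      by (intro conj_cong refl) simp
    then show ?thesis unfolding fin_macro_def by (simp only:)
  qed
  have "last_burn b' P v = last_burn b P v"
  proof (rule last_burn_cong)
    fix l assume l: "active l"
    have "lf (S l) \<le> v" "v < rg (S l)"
      using lf_mono[OF active_le(2)[OF l]] rg_mono[OF active_le(2)[OF l]] v_window by auto
    then show "b' l v = b l v" by (rule burns_unique[OF assms burns_b l])
  qed
  then show "fin_micro N \<alpha> \<beta> P M v S lf rg b' = fin_micro N \<alpha> \<beta> P M v S lf rg b"
    by (simp add: fin_micro_def full_def)
qed

text \<open>Existential in form, but for a tame realization every admissible labelling and every
  solution give the same answer, namely the event itself; see \<open>macro_fin_iff\<close>.\<close>

definition macro_config :: "nat \<Rightarrow> nat \<Rightarrow> nat \<Rightarrow> real \<Rightarrow> config \<Rightarrow> bool" where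
  "macro_config w Q P \<theta> f \<longleftrightarrow> (\<exists>M cc v S lf rg b. admissible (8 * w) (4 * w) Q P f M cc v S lf rg \<and>
     schedule.burns (8 * w) M v S lf rg b \<and> fin_macro (8 * w) \<theta> P cc v lf rg b)"

definition micro_config :: "nat \<Rightarrow> nat \<Rightarrow> nat \<Rightarrow> real \<Rightarrow> real \<Rightarrow> config \<Rightarrow> bool" where
  "micro_config w Q P \<alpha> \<beta> f \<longleftrightarrow> (\<exists>M cc v S lf rg b. admissible (8 * w) (4 * w) Q P f M cc v S lf rg \<and>
     schedule.burns (8 * w) M v S lf rg b \<and> fin_micro (8 * w) \<alpha> \<beta> P M v S lf rg b)"

subsection \<open>Chains closing in on the origin\<close>

text \<open>Bands of \<open>w\<close> rows, one every \<open>2 * w\<close> rows; the last of the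
  \<open>J\<close> bands starts \<open>2 * w\<close> rows before \<open>P\<close>.\<close>

definition inner_rows :: "nat \<Rightarrow> nat \<Rightarrow> nat \<Rightarrow> nat \<Rightarrow> nat set" where
  "inner_rows w P J i = {P + 2 * w * i - 2 * w * J..<P + 2 * w * i - 2 * w * J + w}"

text \<open>Unlike in the chains of \<open>chained\<close>, later fires are farther away from the origin, so that every
  fire of the chain is shielded by its predecessor.\<close>

definition inner_group :: "nat \<Rightarrow> nat \<Rightarrow> int \<Rightarrow> nat \<Rightarrow> bool \<times> nat \<Rightarrow> (int \<times> nat) set" where
  "inner_group w P m J = (\<lambda>(r, i).
     (if r then {m + int (i * (8 * w))..<m + int (Suc i * (8 * w))}
      else {- m - int (Suc i * (8 * w))..<- m - int (i * (8 * w))}) \<times> inner_rows w P J i)"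

text \<open>Its first row, \<open>P - 2 * w * J + w\<close>, is the one right after the band of link
  0, from which on the chain shields.\<close>

definition inner_zone :: "nat \<Rightarrow> nat \<Rightarrow> int \<Rightarrow> nat \<Rightarrow> (int \<times> nat) set" where
  "inner_zone w P m J = {- m - int (J * (8 * w))..<m + int (J * (8 * w))} \<times> {P - (2 * J - 1) * w..P}"

definition inner_rest :: "nat \<Rightarrow> nat \<Rightarrow> int \<Rightarrow> nat \<Rightarrow> (int \<times> nat) set" where
  "inner_rest w P m J = inner_zone w P m J - (\<Union>j\<in>UNIV \<times> {..<J}. inner_group w P m J j)"

text \<open>\<open>X\<close> holds the cells about which nothing is prescribed: none for large
  clusters, the one fire that is to burn the origin last for intermediate ones.\<close>

definition enclosed :: "nat \<Rightarrow> nat \<Rightarrow> int \<Rightarrow> nat \<Rightarrow> (int \<times> nat) set \<Rightarrow> config \<Rightarrow> bool" where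
  "enclosed w P m J X f \<longleftrightarrow> (\<forall>j\<in>UNIV \<times> {..<J}. \<exists>x\<in>inner_group w P m J j. f x) \<and> (\<forall>x\<in>inner_rest w P m J - X. \<not> f x)"

lemma inner_group_cells:
  assumes "m + int (J * (8 * w)) \<le> int Q" "0 < m" "2 * w * J \<le> P" "j \<in> UNIV \<times> {..<J}"
  shows "inner_group w P m J j \<subseteq> cells Q P"
proof -
  obtain r i where j: "j = (r, i)" "i < J" using assms by auto
  have "Suc i * (8 * w) \<le> J * (8 * w)" using j by (intro mult_le_mono1) auto
  then have c: "int (Suc i * (8 * w)) \<le> int (J * (8 * w))" "0 \<le> int (i * (8 * w))" by linarith+
  have "2 * w * i + 2 * w \<le> 2 * w * J" using mult_le_mono2[of "Suc i" J "2 * w"] j by simp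
  then have "inner_rows w P J i \<subseteq> {..P}" using assms by (auto simp: inner_rows_def)
  moreover have "(if r then {m + int (i * (8 * w))..<m + int (Suc i * (8 * w))}
      else {- m - int (Suc i * (8 * w))..<- m - int (i * (8 * w))}) \<subseteq> {- int Q..<int Q}"
  proof
    fix x assume "x \<in> (if r then {m + int (i * (8 * w))..<m + int (Suc i * (8 * w))}
      else {- m - int (Suc i * (8 * w))..<- m - int (i * (8 * w))})"
    then show "x \<in> {- int Q..<int Q}" using c assms(1,2)
      by (cases r) (simp_all only: if_True if_False atLeastLessThan_iff; linarith)+
  qed
  ultimately show ?thesis unfolding inner_group_def j cells_def prod.case by (rule Sigma_mono[rotated])
qed

text \<open>Link \<open>u div (2 * w)\<close> has fired within the last \<open>3 * w\<close> rows
  and shields everything farther out. Farther in, the only marks of the zone outside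
  \<open>X\<close> belong to this or earlier links, and their bands are already over.\<close>

lemma enclosed_shielded:
  assumes f: "enclosed w P m J X f" and w: "7 \<le> w" and P: "2 * w * J \<le> P" and J: "0 < J" and m: "0 < m"
    and Q: "m + int (J * (8 * w)) \<le> int Q"
    and x: "f (c, s)" "(c, s) \<notin> X" "P \<le> s + (2 * J - 1) * w" "s \<le> P"
  shows "\<exists>c' s'. (c', s') \<in> cells Q P \<and> f (c', s') \<and> s' < s \<and> s + 4 \<le> s' + 4 * w \<and> ((c < c' \<and> c' \<le> - m) \<or> (m \<le> c' \<and> c' < c))"
proof -
  define u where "u = s + (2 * J - 1) * w - P"
  define i where "i = u div (2 * w)"
  have J2: "(2 * J - 1) * w + w = 2 * w * J" using J by (cases J) (auto simp: algebra_simps)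
  have u: "u + P + w = s + 2 * w * J" using x J2 by (simp add: u_def)
  have i1: "2 * w * i \<le> u" "u < 2 * w * i + 2 * w"
    using times_div_less_eq_dividend[of "2 * w" u] dividend_less_times_div[of "2 * w" u] w by (auto simp: i_def)
  have iJ: "i < J"
  proof (rule ccontr)
    assume "\<not> i < J"
    then have "2 * w * J \<le> 2 * w * i" by simp
    then show False using i1(1) u x w by linarith
  qed
  have rows: "s' < s \<and> s + 4 \<le> s' + 4 * w" if "s' \<in> inner_rows w P J i" for s'
    using that i1 u P w unfolding inner_rows_def atLeastLessThan_iff by linarith
  have g: "\<exists>y\<in>inner_group w P m J (r, i). f y" for r using f iJ by (auto simp: enclosed_def)
  have cells: "inner_group w P m J (r, i) \<subseteq> cells Q P" for r using inner_group_cells[OF Q m P, of "(r, i)"] iJ by simp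
  have ii: "0 \<le> int (i * (8 * w))" by simp
  consider "m + int (Suc i * (8 * w)) \<le> c" | "c < - m - int (Suc i * (8 * w))"
    | "- m - int (Suc i * (8 * w)) \<le> c" "c < m + int (Suc i * (8 * w))" by linarith
  then show ?thesis
  proof cases
    case 1
    obtain c' s' where y: "(c', s') \<in> inner_group w P m J (True, i)" "f (c', s')" using g[of True] by fastforce
    then have "s' \<in> inner_rows w P J i" "m + int (i * (8 * w)) \<le> c'" "c' < m + int (Suc i * (8 * w))"
      unfolding inner_group_def by (simp_all only: prod.case if_True mem_Times_iff atLeastLessThan_iff fst_conv snd_conv)
    moreover from this have "m \<le> c'" "c' < c" using 1 ii by linarith+
    ultimately show ?thesis using rows[of s'] y cells[of True] by blast
  next
    case 2
    obtain c' s' where y: "(c', s') \<in> inner_group w P m J (False, i)" "f (c', s')" using g[of False] by fastforce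
    then have "s' \<in> inner_rows w P J i" "- m - int (Suc i * (8 * w)) \<le> c'" "c' < - m - int (i * (8 * w))"
      unfolding inner_group_def by (simp_all only: prod.case if_False mem_Times_iff atLeastLessThan_iff fst_conv snd_conv)
    moreover from this have "c' \<le> - m" "c < c'" using 2 ii by linarith+
    ultimately show ?thesis using rows[of s'] y cells[of False] by blast
  next
    case 3
    have "Suc i * (8 * w) \<le> J * (8 * w)" using iJ by (intro mult_le_mono1) auto
    then have "int (Suc i * (8 * w)) \<le> int (J * (8 * w))" by linarith
    then have "(c, s) \<in> inner_zone w P m J" using 3 x by (auto simp: inner_zone_def)
    moreover have "(c, s) \<notin> inner_rest w P m J" using f x by (auto simp: enclosed_def)
    ultimately obtain r k where k: "k < J" "(c, s) \<in> inner_group w P m J (r, k)" by (auto simp: inner_rest_def)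
    have "int (k * (8 * w)) < int (Suc i * (8 * w))"
      using k 3 unfolding inner_group_def by (cases r) (simp_all only: prod.case if_True if_False mem_Times_iff atLeastLessThan_iff fst_conv snd_conv; linarith)+
    then have "k * (8 * w) < Suc i * (8 * w)" by linarith
    then have "k \<le> i" by (simp only: mult_less_cancel2) simp
    then have "2 * w * k \<le> 2 * w * i" by simp
    moreover have "s < P + 2 * w * k - 2 * w * J + w"
      using k(2) unfolding inner_group_def inner_rows_def by (simp only: prod.case mem_Times_iff atLeastLessThan_iff snd_conv)
    ultimately have False using i1 u P w by linarith
    then show ?thesis ..
  qed
qed

subsection \<open>Realizations with tame marked cells\<close>

text \<open>If it fails, a fire of the last half time unit shields the origin within
  \<open>m\<close> columns on each side.\<close>

definition empty_half :: "nat \<Rightarrow> nat \<Rightarrow> int \<Rightarrow> config \<Rightarrow> bool" where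
  "empty_half w P m f \<longleftrightarrow> (\<forall>x\<in>{1..m} \<times> {P + 4 - 4 * w..<P}. \<not> f x) \<or> (\<forall>x\<in>{- m..- 1} \<times> {P + 4 - 4 * w..<P}. \<not> f x)"

definition window_rows :: "nat \<Rightarrow> nat \<Rightarrow> real \<Rightarrow> real \<Rightarrow> nat set" where
  "window_rows w P \<alpha> \<beta> = {s. real P - \<beta> * real (8 * w) \<le> real s \<and> real s \<le> real P - \<alpha> * real (8 * w)}"

text \<open>A fire nearer to the origin in the half unit before row \<open>s\<close> would have
  shielded the origin from the fire in column \<open>k + 1\<close>, or from its mirror
  image.\<close>

definition exposed :: "nat \<Rightarrow> nat \<Rightarrow> nat \<Rightarrow> config \<Rightarrow> nat \<Rightarrow> nat \<Rightarrow> bool" where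
  "exposed w Q P f k s \<longleftrightarrow>
     (int k + 1, s) \<in> cells Q P \<and> f (int k + 1, s) \<and> (\<forall>x\<in>{1..int k} \<times> {s + 4 - 4 * w..<s}. \<not> f x) \<or>
     (- int k - 1, s) \<in> cells Q P \<and> f (- int k - 1, s) \<and> (\<forall>x\<in>{- int k..- 1} \<times> {s + 4 - 4 * w..<s}. \<not> f x)"

locale tame_realization = realization n m e \<iota> "8 * w" "4 * w" P Q d t
  for n m e :: "real \<Rightarrow> int \<Rightarrow> nat" and \<iota> :: real and w P Q :: nat and d t :: real +
  fixes f :: config and \<delta> :: nat and A D :: "real set"
  assumes f: "x \<in> cells Q P \<Longrightarrow> f x = marks d \<iota> m x"
    and w: "8 \<le> w" "8 * w + 8 \<le> P" and \<delta>: "0 < \<delta>"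
    and tame: "tame w Q P \<delta> A D f"
begin

abbreviation "size0 \<equiv> numel (cluster (e t) 0)"

abbreviation "micro_range \<alpha> \<beta> \<equiv> {ennreal (exp (\<alpha> * real (8 * w) * \<iota>))..ennreal (exp (\<beta> * real (8 * w) * \<iota>))}"

lemma tracked: "admissible (8 * w) (4 * w) Q P f M cc v S lf rg \<Longrightarrow>
   \<exists>X tm bx. tracked_realization n m e \<iota> (8 * w) (4 * w) P Q d t M v S lf rg X tm bx cc"
  by (rule tracked_realization_exists) (use admissible_cong[of Q P f "marks d \<iota> m"] f in blast)

lemma tracked_wide: "\<exists>M cc v S lf rg X tm bx. tracked_realization n m e \<iota> (8 * w) (4 * w) P Q d t M v S lf rg X tm bx cc \<and>
   cc (lf P) \<le> - int (\<delta> * (8 * w)) \<and> int (\<delta> * (8 * w)) \<le> cc (rg P)"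
proof -
  have D0: "0 < int (\<delta> * (8 * w))" using \<delta> w by simp
  have g: "generic (8 * w) Q P A D f" and c: "chained (8 * w) w Q P \<delta> f" using tame by (auto simp: tame_def)
  obtain bl br where
    b: "bl + int (Suc ((P - 5 * w) div (2 * w)) * (8 * w)) \<le> - int (\<delta> * (8 * w))"
      "int (\<delta> * (8 * w)) \<le> br - int (Suc ((P - 5 * w) div (2 * w)) * (8 * w))"
    and l: "\<And>i. i \<le> (P - 5 * w) div (2 * w) \<Longrightarrow> \<exists>x\<in>fire_cells Q P f. x \<in> left_group (8 * w) w bl i"
    and r: "\<And>i. i \<le> (P - 5 * w) div (2 * w) \<Longrightarrow> \<exists>x\<in>fire_cells Q P f. x \<in> right_group (8 * w) w br i"
    using c unfolding chained_def by blast
  have "5 \<le> w" using w by simp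
  then have "\<exists>M cc v S lf rg. admissible (8 * w) (4 * w) Q P f M cc v S lf rg \<and> cc (lf P) \<le> - int (\<delta> * (8 * w)) \<and> int (\<delta> * (8 * w)) \<le> cc (rg P)"
    using l r by (intro admissible_exists[OF g refl _ w(2) D0 _ _ b]) auto
  then obtain M cc v S lf rg where a: "admissible (8 * w) (4 * w) Q P f M cc v S lf rg"
      "cc (lf P) \<le> - int (\<delta> * (8 * w)) \<and> int (\<delta> * (8 * w)) \<le> cc (rg P)" by (elim exE conjE) (rule that, assumption, rule conjI)
  obtain X tm bx where "tracked_realization n m e \<iota> (8 * w) (4 * w) P Q d t M v S lf rg X tm bx cc"
    using tracked[OF a(1)] by (elim exE)
  with a(2) show ?thesis by (intro exI conjI) (assumption, simp_all)
qed

lemma generic_column_gap: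
  assumes "(c, s) \<in> cells Q P" "f (c, s)" "(c', s') \<in> cells Q P" "f (c', s')" "c < c'" "r \<in> D"
  shows "3 < \<bar>real_of_int (c' - c) - r\<bar>"
proof -
  have "\<not> bad2 (8 * w) P D (c, s) (c', s')"
  proof -
    have "\<forall>x\<in>fire_cells Q P f. \<forall>y\<in>fire_cells Q P f. x \<noteq> y \<longrightarrow> \<not> bad2 (8 * w) P D x y"
      using tame unfolding tame_def generic_def by (elim conjE)
    moreover have "(c, s) \<in> fire_cells Q P f" "(c', s') \<in> fire_cells Q P f" "(c, s) \<noteq> (c', s')"
      using assms by (auto simp: fire_cells_def)
    ultimately show ?thesis by blast
  qed
  then have "\<not> \<bar>real_of_int c' - (real_of_int c + r)\<bar> \<le> 3" using assms(6) by (auto simp: bad2_def)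
  then show ?thesis by linarith
qed

lemma generic_row_gap:
  assumes "(c, s) \<in> cells Q P" "f (c, s)" "r \<in> A"
  shows "8 \<le> \<bar>real s - r\<bar>"
proof -
  have "\<forall>y\<in>fire_cells Q P f. \<not> bad1 (8 * w) Q P A y" using tame unfolding tame_def generic_def by (elim conjE)
  moreover have "(c, s) \<in> fire_cells Q P f" using assms by (simp add: fire_cells_def)
  ultimately have "\<not> bad1 (8 * w) Q P A (c, s)" by blast
  then show ?thesis using assms(3) by (auto simp: bad1_def)
qed

lemma admissible_burns: "\<exists>M cc v S lf rg b. admissible (8 * w) (4 * w) Q P f M cc v S lf rg \<and> schedule.burns (8 * w) M v S lf rg b"
proof -
  obtain M cc v S lf rg X tm bx where "tracked_realization n m e \<iota> (8 * w) (4 * w) P Q d t M v S lf rg X tm bx cc"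
    using tracked_wide by blast
  then interpret T: tracked_realization n m e \<iota> "8 * w" "4 * w" P Q d t M v S lf rg X tm bx cc .
  show ?thesis using T.burns_b T.adm admissible_cong[of Q P f "marks d \<iota> m"] f by blast
qed

lemma macro_fin_iff:
  assumes \<theta>: "1 < \<theta> * real (8 * w)" "\<theta> * real (8 * w) \<in> D"
    and a: "admissible (8 * w) (4 * w) Q P f M cc v S lf rg" "schedule.burns (8 * w) M v S lf rg b"
  shows "ennreal (\<theta> * real (8 * w) / d) \<le> size0 \<longleftrightarrow> fin_macro (8 * w) \<theta> P cc v lf rg b"
proof -
  have tie: "3 < \<bar>real_of_int (c' - c) - \<theta> * real (8 * w)\<bar>"
    if "(c, s) \<in> cells Q P" "marks d \<iota> m (c, s)" "(c', s') \<in> cells Q P" "marks d \<iota> m (c', s')" "c < c'" for c s c' s'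
    using generic_column_gap[of c s c' s'] that f \<theta>(2) by blast
  obtain X tm bx where "tracked_realization n m e \<iota> (8 * w) (4 * w) P Q d t M v S lf rg X tm bx cc"
    using tracked[OF a(1)] by blast
  then interpret T: tracked_realization n m e \<iota> "8 * w" "4 * w" P Q d t M v S lf rg X tm bx cc .
  show ?thesis unfolding T.fin_unique(1)[OF a(2)] by (rule T.macro_iff[OF \<theta>(1)]) (rule tie; assumption)
qed

lemma macro_event_iff:
  assumes \<theta>: "1 < \<theta> * real (8 * w)" "\<theta> * real (8 * w) \<in> D"
  shows "ennreal (\<theta> * real (8 * w) / d) \<le> size0 \<longleftrightarrow> macro_config w Q P \<theta> f"
  unfolding macro_config_def using macro_fin_iff[OF \<theta>] admissible_burns by blast

lemma micro_fin_iff: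
  assumes ab: "0 \<le> \<alpha>" "\<alpha> < \<beta>" "\<beta> * real (8 * w) + 1 < real (8 * w)"
    and A: "real P - \<alpha> * real (8 * w) \<in> A" "real P - \<beta> * real (8 * w) \<in> A"
    and a: "admissible (8 * w) (4 * w) Q P f M cc v S lf rg" "schedule.burns (8 * w) M v S lf rg b"
  shows "size0 \<in> micro_range \<alpha> \<beta> \<longleftrightarrow> fin_micro (8 * w) \<alpha> \<beta> P M v S lf rg b"
proof -
  have tie: "5 \<le> \<bar>real P - real s - \<beta> * real (8 * w)\<bar> \<and> (0 < \<alpha> \<longrightarrow> 5 \<le> \<bar>real P - real s - \<alpha> * real (8 * w)\<bar>)"
    if "(c, s) \<in> cells Q P" "marks d \<iota> m (c, s)" for c s
  proof -
    have "f (c, s)" using that f by blast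
    from generic_row_gap[OF that(1) this A(1)] generic_row_gap[OF that(1) this A(2)] show ?thesis by linarith
  qed
  obtain X tm bx where "tracked_realization n m e \<iota> (8 * w) (4 * w) P Q d t M v S lf rg X tm bx cc"
    using tracked[OF a(1)] by blast
  then interpret T: tracked_realization n m e \<iota> "8 * w" "4 * w" P Q d t M v S lf rg X tm bx cc .
  show ?thesis unfolding T.fin_unique(2)[OF a(2)] by (rule T.micro_iff[OF ab]) (rule tie; assumption)
qed

lemma micro_event_iff:
  assumes ab: "0 \<le> \<alpha>" "\<alpha> < \<beta>" "\<beta> * real (8 * w) + 1 < real (8 * w)"
    and A: "real P - \<alpha> * real (8 * w) \<in> A" "real P - \<beta> * real (8 * w) \<in> A"
  shows "size0 \<in> micro_range \<alpha> \<beta> \<longleftrightarrow> micro_config w Q P \<alpha> \<beta> f"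
  unfolding micro_config_def using micro_fin_iff[OF ab A] admissible_burns by blast

lemma macro_event_upper:
  assumes E: "ennreal (\<theta> * real (8 * w) / d) \<le> size0" and k: "real_of_int (2 * k + 2) < \<theta> * real (8 * w)" "0 \<le> k" "k < int Q"
  shows "empty_half w P k f"
proof (rule ccontr)
  assume "\<not> empty_half w P k f"
  then obtain x y where xy: "x \<in> {1..k} \<times> {P + 4 - 4 * w..<P}" "f x" "y \<in> {- k..- 1} \<times> {P + 4 - 4 * w..<P}" "f y"
    unfolding empty_half_def by blast
  obtain c s c' s' where "x = (c, s)" "y = (c', s')" by (cases x, cases y)
  with xy have r: "1 \<le> c" "c \<le> k" "P + 4 \<le> s + 4 * w" "s < P" "f (c, s)"
    and l: "- k \<le> c'" "c' \<le> - 1" "P + 4 \<le> s' + 4 * w" "s' < P" "f (c', s')" by auto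
  have cells: "(c, s) \<in> cells Q P" "(c', s') \<in> cells Q P" using r l k by (auto simp: cells_def)
  obtain M cc v S lf rg X tm bx where "tracked_realization n m e \<iota> (8 * w) (4 * w) P Q d t M v S lf rg X tm bx cc"
    using tracked_wide by blast
  then interpret T: tracked_realization n m e \<iota> "8 * w" "4 * w" P Q d t M v S lf rg X tm bx cc .
  have "0 < \<theta>" using k(1,2) by (smt (verit) of_int_0_le_iff of_nat_0_le_iff mult_nonneg_nonneg zero_less_mult_iff)
  then have "\<theta> * real (8 * w) \<le> real_of_int (c - c') + 2"
    by (rule T.macro_upper[OF E, of c s c' s']) (use r l cells f in auto)
  moreover have "real_of_int (c - c') \<le> real_of_int (2 * k)" using r l by (simp only: of_int_le_iff)
  ultimately show False using k(1) by simp
qed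

lemma macro_event_lower:
  assumes f': "enclosed w P k 5 {} f" and k: "0 < k" "k + int (5 * (8 * w)) \<le> int Q" "k \<le> int (\<delta> * (8 * w))"
    and P: "2 * w * 5 \<le> P" and \<theta>: "\<theta> * real (8 * w) + 2 \<le> real_of_int (2 * k)"
  shows "ennreal (\<theta> * real (8 * w) / d) \<le> size0"
proof -
  obtain M cc v S lf rg X tm bx where T: "tracked_realization n m e \<iota> (8 * w) (4 * w) P Q d t M v S lf rg X tm bx cc"
    and cc: "cc (lf P) \<le> - int (\<delta> * (8 * w))" "int (\<delta> * (8 * w)) \<le> cc (rg P)"
    using tracked_wide by blast
  interpret T: tracked_realization n m e \<iota> "8 * w" "4 * w" P Q d t M v S lf rg X tm bx cc by (rule T)
  show ?thesis
  proof (rule T.macro_lower[of "- k" k])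
    show "- k < 0" "0 < k" "cc (lf P) \<le> - k" "k \<le> cc (rg P)" "8 * w + 8 \<le> P" "\<theta> * real (8 * w) + 2 \<le> real_of_int (k - - k)"
      using k cc w \<theta> by auto
    fix c s assume c: "(c, s) \<in> cells Q P" "marks d \<iota> m (c, s)" "P < s + 8 * w + 8" "s < P"
    have "f (c, s)" using c f by blast
    \<comment> \<open>Five links reach back \<open>9 * w\<close> rows, which covers the last
      \<open>8 * w + 8\<close> rows because \<open>w\<close> is at least 8.\<close>
    moreover have "P \<le> s + (2 * 5 - 1) * w" using c w by simp
    ultimately have "\<exists>c' s'. (c', s') \<in> cells Q P \<and> f (c', s') \<and> s' < s \<and> s + 4 \<le> s' + 4 * w \<and> ((c < c' \<and> c' \<le> - k) \<or> (k \<le> c' \<and> c' < c))"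
      using w c by (intro enclosed_shielded[OF f' _ P _ k(1,2)]) auto
    then show "\<exists>c' s'. (c', s') \<in> cells Q P \<and> marks d \<iota> m (c', s') \<and> s' < s \<and> s + 4 \<le> s' + 4 * w \<and> ((c < c' \<and> c' \<le> - k) \<or> (k \<le> c' \<and> c' < c))"
      using f by blast
  qed
qed

lemma micro_event_upper:
  assumes E: "size0 \<in> micro_range \<alpha> \<beta>"
    and ab: "0 \<le> \<alpha>" "\<alpha> < \<beta>" "\<beta> * real (8 * w) + 1 < real (8 * w)"
    and A: "real P - \<alpha> * real (8 * w) \<in> A" "real P - \<beta> * real (8 * w) \<in> A"
  shows "\<exists>s\<in>window_rows w P \<alpha> \<beta>. \<exists>k<Q. exposed w Q P f k s"
proof -
  obtain M cc v S lf rg X tm bx where "tracked_realization n m e \<iota> (8 * w) (4 * w) P Q d t M v S lf rg X tm bx cc"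
    using tracked_wide by blast
  then interpret T: tracked_realization n m e \<iota> "8 * w" "4 * w" P Q d t M v S lf rg X tm bx cc .
  have "admissible (8 * w) (4 * w) Q P f M cc v S lf rg" using T.adm admissible_cong[of Q P f "marks d \<iota> m"] f by blast
  then have "fin_micro (8 * w) \<alpha> \<beta> P M v S lf rg T.b" using micro_fin_iff[OF ab A _ T.burns_b] E by blast
  from T.micro_upper_cells[OF this] obtain c s where c: "(c, s) \<in> cells Q P" "f (c, s)" "c \<noteq> 0"
    and s: "\<alpha> * real (8 * w) \<le> real P - real s" "real P - real s \<le> \<beta> * real (8 * w)"
    and q: "\<And>c' s'. (c', s') \<in> cells Q P \<Longrightarrow> f (c', s') \<Longrightarrow> (0 < c' \<and> c' < c) \<or> (c < c' \<and> c' < 0) \<Longrightarrow> \<not> (s' < s \<and> s + 4 \<le> s' + 4 * w)"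
    using f by blast
  have cQ: "- int Q \<le> c" "c < int Q" "s \<le> P" using c by (auto simp: cells_def)
  define k where "k = nat (\<bar>c\<bar> - 1)"
  have q': "\<not> f (c', s')" if "(0 < c' \<and> c' < c) \<or> (c < c' \<and> c' < 0)" "s + 4 - 4 * w \<le> s'" "s' < s" for c' s'
  proof
    assume "f (c', s')"
    moreover have "(c', s') \<in> cells Q P" using that cQ by (auto simp: cells_def)
    ultimately show False using q[of c' s'] that by auto
  qed
  have "exposed w Q P f k s"
  proof (cases "0 < c")
    case True
    then have k: "int k + 1 = c" by (simp add: k_def)
    have "\<not> f x" if "x \<in> {1..int k} \<times> {s + 4 - 4 * w..<s}" for x
    proof -
      obtain c' s' where x: "x = (c', s')" by (cases x)
      then show ?thesis using q'[of c' s'] that k by auto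
    qed
    then show ?thesis unfolding exposed_def k using c by blast
  next
    case False
    then have k: "- int k - 1 = c" using c(3) by (simp add: k_def)
    have "\<not> f x" if "x \<in> {- int k..- 1} \<times> {s + 4 - 4 * w..<s}" for x
    proof -
      obtain c' s' where x: "x = (c', s')" by (cases x)
      then show ?thesis using q'[of c' s'] that k by auto
    qed
    then show ?thesis unfolding exposed_def k using c by blast
  qed
  moreover have "k < Q" using cQ c(3) unfolding k_def by linarith
  moreover have "s \<in> window_rows w P \<alpha> \<beta>" using s by (auto simp: window_rows_def)
  ultimately show ?thesis by blast
qed

lemma micro_event_lower:
  assumes f': "enclosed w P k 9 {(c, s)} f" and c: "f (c, s)" "- k < c" "c < k" "s \<in> window_rows w P \<alpha> \<beta>"
    and k: "0 < k" "k + int (9 * (8 * w)) \<le> int Q" "k \<le> int (\<delta> * (8 * w))" and P: "2 * w * 9 \<le> P"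
    and ab: "0 \<le> \<alpha>" "\<alpha> < \<beta>" "\<beta> * real (8 * w) + 1 < real (8 * w)"
    and A: "real P - \<alpha> * real (8 * w) \<in> A" "real P - \<beta> * real (8 * w) \<in> A"
  shows "size0 \<in> micro_range \<alpha> \<beta>"
proof -
  have w0: "0 < real (8 * w)" using w by simp
  have \<beta>: "\<beta> < 1" using ab(3) w0 by (smt (verit) mult_less_cancel_right2 mult_right_mono mult_1)
  have \<alpha>w: "0 \<le> \<alpha> * real (8 * w)" using ab by simp
  have s: "\<alpha> * real (8 * w) \<le> real P - real s" "real P - real s \<le> \<beta> * real (8 * w)" using c(4) by (auto simp: window_rows_def)
  then have "real s \<le> real P" "real P < real s + real (8 * w)" using \<alpha>w ab(3) by linarith+
  then have sP: "s \<le> P" "P < s + 8 * w" by linarith+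
  have cs: "(c, s) \<in> cells Q P" using c k sP by (auto simp: cells_def)
  obtain M cc v S lf rg X tm bx where T: "tracked_realization n m e \<iota> (8 * w) (4 * w) P Q d t M v S lf rg X tm bx cc"
    and cc: "cc (lf P) \<le> - int (\<delta> * (8 * w))" "int (\<delta> * (8 * w)) \<le> cc (rg P)"
    using tracked_wide by blast
  interpret T: tracked_realization n m e \<iota> "8 * w" "4 * w" P Q d t M v S lf rg X tm bx cc by (rule T)
  have "fin_micro (8 * w) \<alpha> \<beta> P M v S lf rg T.b"
  proof (rule T.micro_lower_cells[of "- k" k c s])
    show "- k < 0" "0 < k" "cc (lf P) \<le> - k" "k \<le> cc (rg P)" "8 * w + 8 \<le> s" "(c, s) \<in> cells Q P" "marks d \<iota> m (c, s)" "- k < c" "c < k"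
      "\<alpha> * real (8 * w) \<le> real P - real s" "real P - real s \<le> \<beta> * real (8 * w)" "\<beta> < 1"
      using k cc w cs c P sP f s \<beta> by auto
    fix c' s' assume c': "(c', s') \<in> cells Q P" "marks d \<iota> m (c', s')" "s < s' + 8 * w + 8" "(c', s') \<noteq> (c, s)"
    have "f (c', s')" using c' f by blast
    \<comment> \<open>Nine links reach back \<open>17 * w\<close> rows: up to \<open>8 * w\<close>
      for the chosen fire and \<open>8 * w + 8\<close> before it.\<close>
    moreover have "P \<le> s' + (2 * 9 - 1) * w" using c' w sP by simp
    moreover have "s' \<le> P" using c' by (auto simp: cells_def)
    ultimately have "\<exists>c'' s''. (c'', s'') \<in> cells Q P \<and> f (c'', s'') \<and> s'' < s' \<and> s' + 4 \<le> s'' + 4 * w \<and> ((c' < c'' \<and> c'' \<le> - k) \<or> (k \<le> c'' \<and> c'' < c'))"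
      using w c' by (intro enclosed_shielded[OF f' _ P _ k(1,2)]) auto
    then show "\<exists>c'' s''. (c'', s'') \<in> cells Q P \<and> marks d \<iota> m (c'', s'') \<and> s'' < s' \<and> s' + 4 \<le> s'' + 4 * w \<and> ((c' < c'' \<and> c'' \<le> - k) \<or> (k \<le> c'' \<and> c'' < c'))"
      using f by blast
  qed
  then have "micro_config w Q P \<alpha> \<beta> f"
    unfolding micro_config_def using T.burns_b T.adm admissible_cong[of Q P f "marks d \<iota> m"] f by blast
  then show ?thesis using micro_event_iff[OF ab A] by blast
qed

end

subsection \<open>Probabilities of the comparison events\<close>

abbreviation hit_prob :: real where
  "hit_prob \<equiv> 1 - exp (- (1 / 8))"

lemma inner_rows_card: "card (inner_rows w P J i) = w" "finite (inner_rows w P J i)"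
  by (auto simp: inner_rows_def)

lemma inner_group_card: "card (inner_group w P m J j) = 8 * w * w"
proof -
  obtain r i where j: "j = (r, i)" by (cases j)
  have ab: "card {a..<b} = 8 * w" if "b = a + int (8 * w)" for a b :: int using that by simp
  have "card (if r then {m + int (i * (8 * w))..<m + int (Suc i * (8 * w))}
      else {- m - int (Suc i * (8 * w))..<- m - int (i * (8 * w))}) = 8 * w"
    by (cases r) (simp_all only: if_True if_False, (rule ab; simp)+)
  then show ?thesis by (simp add: inner_group_def j card_cartesian_product inner_rows_card)
qed

lemma inner_group_disjoint:
  assumes "0 < m" "j \<noteq> j'"
  shows "inner_group w P m J j \<inter> inner_group w P m J j' = {}"
proof -
  obtain r i r' i' where j: "j = (r, i)" "j' = (r', i')" by (cases j, cases j')
  have le: "i < i' \<Longrightarrow> int (Suc i * (8 * w)) \<le> int (i' * (8 * w))" for i i'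
    using mult_le_mono1[of "Suc i" i' "8 * w"] by linarith
  have False if "x \<in> inner_group w P m J (r, i)" "x \<in> inner_group w P m J (r', i')" for x
  proof -
    have p: "0 \<le> int (i * (8 * w))" "0 \<le> int (i' * (8 * w))" by simp_all
    consider "r \<noteq> r'" | "r = r'" "i < i'" | "r = r'" "i' < i" using assms(2) j by (cases i i' rule: linorder_cases) auto
    then show False
    proof cases
      case 1
      then show ?thesis using that p assms(1) unfolding inner_group_def
        by (cases r; cases r') (simp_all only: prod.case if_True if_False mem_Times_iff atLeastLessThan_iff simp_thms; linarith)+
    next
      case 2
      then show ?thesis using that le[OF 2(2)] unfolding inner_group_def
        by (cases r') (simp_all only: prod.case if_True if_False mem_Times_iff atLeastLessThan_iff; linarith)+
    next
      case 3
      then show ?thesis using that le[OF 3(2)] unfolding inner_group_def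
        by (cases r') (simp_all only: prod.case if_True if_False mem_Times_iff atLeastLessThan_iff; linarith)+
    qed
  qed
  then show ?thesis unfolding j by blast
qed

lemma inner_zone_cells: "m + int (J * (8 * w)) \<le> int Q \<Longrightarrow> inner_zone w P m J \<subseteq> cells Q P"
  unfolding inner_zone_def cells_def by auto

lemma inner_zone_card:
  assumes "0 < m" "(2 * J - 1) * w \<le> P"
  shows "real (card (inner_zone w P m J)) = 2 * (real_of_int m + real J * real (8 * w)) * (real ((2 * J - 1) * w) + 1)"
proof -
  have 1: "card {- m - int (J * (8 * w))..<m + int (J * (8 * w))} = nat (2 * (m + int (J * (8 * w))))" by simp
  have "0 \<le> int (J * (8 * w))" by simp
  then have 2: "real (nat (2 * (m + int (J * (8 * w))))) = 2 * (real_of_int m + real (J * (8 * w)))"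
    using assms by (simp del: of_nat_mult)
  have 3: "card {P - (2 * J - 1) * w..P} = (2 * J - 1) * w + 1" using assms by simp
  show ?thesis unfolding inner_zone_def card_cartesian_product 1 3
      of_nat_mult[of "nat (2 * (m + int (J * (8 * w))))"] 2 by simp
qed

text \<open>The groups, the empty rest and the cells of \<open>X\<close> are disjoint, so the
  conditions are independent. Each of the \<open>2 * J\<close> groups has one eighth of
  \<open>(8 * w) ^ 2\<close> cells.\<close>

lemma enclosed_prob:
  assumes Q: "m + int (J * (8 * w)) \<le> int Q" and m: "0 < m" and P: "2 * w * J \<le> P" and w: "0 < w"
    and X: "X \<subseteq> cells Q P" "X \<inter> (\<Union>j\<in>UNIV \<times> {..<J}. inner_group w P m J j) = {}"
  shows "hit_prob ^ (2 * J) * exp (- (real (card (inner_zone w P m J)) / (real (8 * w))\<^sup>2)) * mark_prob (8 * w) ^ card X \<le>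
    cell_prob (8 * w) Q P {f. enclosed w P m J X f \<and> (\<forall>x\<in>X. f x)}"
proof -
  let ?G = "inner_group w P m J" and ?I = "UNIV \<times> {..<J} :: (bool \<times> nat) set"
  let ?pr = "cell_prob (8 * w) Q P"
  let ?R = "inner_rest w P m J - X"
  have sub: "?G j \<subseteq> cells Q P" if "j \<in> ?I" for j by (rule inner_group_cells[OF Q m P that])
  have R: "?R \<subseteq> cells Q P" "?R \<subseteq> inner_zone w P m J" using inner_zone_cells[OF Q, of P] by (auto simp: inner_rest_def)
  have G: "?pr {f. \<forall>j\<in>?I. \<exists>x\<in>?G j. f x} = hit_prob ^ card ?I"
  proof (rule cells_groups_marked)
    show "disjoint_family_on ?G ?I" unfolding disjoint_family_on_def using inner_group_disjoint[OF m] by blast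
    show "real (card (?G j)) / (real (8 * w))\<^sup>2 = 1 / 8" for j
      using w by (simp add: inner_group_card power2_eq_square)
  qed (use sub in auto)
  have cI: "card ?I = 2 * J" by (simp add: card_cartesian_product)
  have "?pr {f. (\<forall>x\<in>?R. \<not> f x) \<and> (\<forall>x\<in>X. f x)} = ?pr {f. \<forall>x\<in>?R. \<not> f x} * ?pr {f. \<forall>x\<in>X. f x}"
    by (rule cell_independent_pair[OF R(1) X(1)]) auto
  also have "\<dots> = exp (- (real (card ?R) / (real (8 * w))\<^sup>2)) * mark_prob (8 * w) ^ card X"
    unfolding cells_none_marked[OF R(1)] cells_all_marked[OF X(1)] ..
  finally have RX: "?pr {f. (\<forall>x\<in>?R. \<not> f x) \<and> (\<forall>x\<in>X. f x)} = exp (- (real (card ?R) / (real (8 * w))\<^sup>2)) * mark_prob (8 * w) ^ card X" .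
  have "?pr {f. enclosed w P m J X f \<and> (\<forall>x\<in>X. f x)} = ?pr {f. (\<forall>j\<in>?I. \<exists>x\<in>?G j. f x) \<and> ((\<forall>x\<in>?R. \<not> f x) \<and> (\<forall>x\<in>X. f x))}"
    by (simp only: enclosed_def conj_assoc)
  also have "\<dots> = ?pr {f. \<forall>j\<in>?I. \<exists>x\<in>?G j. f x} * ?pr {f. (\<forall>x\<in>?R. \<not> f x) \<and> (\<forall>x\<in>X. f x)}"
  proof (rule cell_independent_pair)
    show "(\<Union>j\<in>?I. ?G j) \<subseteq> cells Q P" using sub by (rule UN_least)
    show "?R \<union> X \<subseteq> cells Q P" using R X by blast
    show "(\<Union>j\<in>?I. ?G j) \<inter> (?R \<union> X) = {}" using X(2) unfolding inner_rest_def by blast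
    show "(\<forall>j\<in>?I. \<exists>x\<in>?G j. f x) = (\<forall>j\<in>?I. \<exists>x\<in>?G j. g x)" if "\<And>x. x \<in> (\<Union>j\<in>?I. ?G j) \<Longrightarrow> f x = g x" for f g :: config
      by (intro ball_cong bex_cong refl that) blast
    show "((\<forall>x\<in>?R. \<not> f x) \<and> (\<forall>x\<in>X. f x)) = ((\<forall>x\<in>?R. \<not> g x) \<and> (\<forall>x\<in>X. g x))" if "\<And>x. x \<in> ?R \<union> X \<Longrightarrow> f x = g x" for f g :: config
      using that by (intro conj_cong ball_cong refl arg_cong[where f=Not]) blast+
  qed
  finally have eq: "?pr {f. enclosed w P m J X f \<and> (\<forall>x\<in>X. f x)} =
      hit_prob ^ (2 * J) * exp (- (real (card ?R) / (real (8 * w))\<^sup>2)) * mark_prob (8 * w) ^ card X"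
    unfolding G RX cI by (simp only: mult.assoc)
  have "finite (inner_zone w P m J)" by (simp add: inner_zone_def)
  then have "card ?R \<le> card (inner_zone w P m J)" using R(2) by (rule card_mono)
  then have "exp (- (real (card (inner_zone w P m J)) / (real (8 * w))\<^sup>2)) \<le> exp (- (real (card ?R) / (real (8 * w))\<^sup>2))"
    by (simp add: divide_right_mono)
  then show ?thesis unfolding eq using mark_prob_bounds(1)[of "8 * w"] by (intro mult_right_mono mult_left_mono) auto
qed

lemma empty_half_prob:
  assumes "0 \<le> m" "m < int Q" "4 * w \<le> P" "0 < w"
  shows "cell_prob (8 * w) Q P {f. empty_half w P m f} \<le>
    2 * exp (- (real_of_int m * (4 * real w - 4) / (real (8 * w))\<^sup>2))"
proof -
  let ?L = "{- m..- 1} \<times> {P + 4 - 4 * w..<P}" and ?R = "{1..m} \<times> {P + 4 - 4 * w..<P}"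
  let ?pr = "cell_prob (8 * w) Q P"
  have c: "P - (P + 4 - 4 * w) = 4 * w - 4" using assms by linarith
  have "real (card ?L) = real_of_int m * (4 * real w - 4)" "real (card ?R) = real_of_int m * (4 * real w - 4)"
    using assms by (simp_all add: card_cartesian_product c of_nat_diff)
  moreover have "?L \<subseteq> cells Q P" "?R \<subseteq> cells Q P" using assms by (auto simp: cells_def)
  ultimately have p: "?pr {f. \<forall>x\<in>?L. \<not> f x} = exp (- (real_of_int m * (4 * real w - 4) / (real (8 * w))\<^sup>2))"
      "?pr {f. \<forall>x\<in>?R. \<not> f x} = exp (- (real_of_int m * (4 * real w - 4) / (real (8 * w))\<^sup>2))"
    by (simp_all only: cells_none_marked)
  have "{f. empty_half w P m f} = {f. \<forall>x\<in>?R. \<not> f x} \<union> {f. \<forall>x\<in>?L. \<not> f x}"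
    unfolding set_eq_iff Un_iff mem_Collect_eq empty_half_def by blast
  then have "?pr {f. empty_half w P m f} \<le> ?pr {f. \<forall>x\<in>?R. \<not> f x} + ?pr {f. \<forall>x\<in>?L. \<not> f x}"
    by (simp only:) (rule measure_Un_le; simp)
  then show ?thesis unfolding p by simp
qed

lemma unshielded_prob:
  assumes "x \<notin> K" "x \<in> cells Q P \<Longrightarrow> K \<subseteq> cells Q P"
  shows "cell_prob N Q P {f. x \<in> cells Q P \<and> f x \<and> (\<forall>y\<in>K. \<not> f y)} \<le>
    mark_prob N * exp (- (real (card K) / (real N)\<^sup>2))"
proof (cases "x \<in> cells Q P")
  case True
  have "cell_prob N Q P {f. f x \<and> (\<forall>y\<in>K. \<not> f y)} =
      cell_prob N Q P {f. f x} * cell_prob N Q P {f. \<forall>y\<in>K. \<not> f y}"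
    by (rule cell_independent_pair[of "{x}" Q P K]) (use True assms in auto)
  then show ?thesis using True cell_marked(1)[OF True] cells_none_marked[OF assms(2)[OF True]] by simp
next
  case False
  then show ?thesis using mark_prob_bounds(1)[of N] by simp
qed

lemma exposed_prob:
  assumes "4 * w \<le> s" "0 < w"
  shows "cell_prob (8 * w) Q P {f. exposed w Q P f k s} \<le>
    2 * mark_prob (8 * w) * exp (- ((4 * real w - 4) / (real (8 * w))\<^sup>2)) ^ k"
proof -
  let ?R = "{1..int k} \<times> {s + 4 - 4 * w..<s}" and ?L = "{- int k..- 1} \<times> {s + 4 - 4 * w..<s}"
  let ?pr = "cell_prob (8 * w) Q P"
  let ?x = "(int k + 1, s)" and ?y = "(- int k - 1, s)"
  have c: "s - (s + 4 - 4 * w) = 4 * w - 4" using assms by linarith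
  have e: "exp (- (real k * (4 * real w - 4) / (real (8 * w))\<^sup>2)) = exp (- ((4 * real w - 4) / (real (8 * w))\<^sup>2)) ^ k"
    by (simp flip: exp_of_nat_mult)
  have card: "real (card ?L) = real k * (4 * real w - 4)" "real (card ?R) = real k * (4 * real w - 4)"
    using assms by (simp_all add: card_cartesian_product c of_nat_diff)
  have 1: "?pr {f. ?x \<in> cells Q P \<and> f ?x \<and> (\<forall>y\<in>?R. \<not> f y)} \<le> mark_prob (8 * w) * exp (- (real (card ?R) / (real (8 * w))\<^sup>2))"
    by (rule unshielded_prob) (auto simp: cells_def)
  have 2: "?pr {f. ?y \<in> cells Q P \<and> f ?y \<and> (\<forall>y\<in>?L. \<not> f y)} \<le> mark_prob (8 * w) * exp (- (real (card ?L) / (real (8 * w))\<^sup>2))"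
    by (rule unshielded_prob) (auto simp: cells_def)
  have "{f. exposed w Q P f k s} = {f. ?x \<in> cells Q P \<and> f ?x \<and> (\<forall>y\<in>?R. \<not> f y)} \<union> {f. ?y \<in> cells Q P \<and> f ?y \<and> (\<forall>y\<in>?L. \<not> f y)}"
    unfolding set_eq_iff Un_iff mem_Collect_eq exposed_def by blast
  then have "?pr {f. exposed w Q P f k s} \<le> ?pr {f. ?x \<in> cells Q P \<and> f ?x \<and> (\<forall>y\<in>?R. \<not> f y)} + ?pr {f. ?y \<in> cells Q P \<and> f ?y \<and> (\<forall>y\<in>?L. \<not> f y)}"
    by (simp only:) (rule measure_Un_le; simp)
  then show ?thesis using 1 2 unfolding card e by linarith
qed

lemma window_rows_card:
  assumes "\<alpha> \<le> \<beta>" "\<beta> * real (8 * w) \<le> real P"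
  shows "finite (window_rows w P \<alpha> \<beta>)" "real (card (window_rows w P \<alpha> \<beta>)) \<le> (\<beta> - \<alpha>) * real (8 * w) + 1"
    "(\<beta> - \<alpha>) * real (8 * w) - 1 \<le> real (card (window_rows w P \<alpha> \<beta>))"
proof -
  let ?a = "real P - \<beta> * real (8 * w)" and ?b = "real P - \<alpha> * real (8 * w)"
  have ab: "0 \<le> ?a" "?a \<le> ?b" using assms by (auto intro: mult_right_mono)
  have "window_rows w P \<alpha> \<beta> = {nat \<lceil>?a\<rceil>..nat \<lfloor>?b\<rfloor>}"
  proof (rule set_eqI)
    fix s :: nat
    have "?a \<le> real s \<longleftrightarrow> nat \<lceil>?a\<rceil> \<le> s" by linarith
    moreover have "real s \<le> ?b \<longleftrightarrow> s \<le> nat \<lfloor>?b\<rfloor>" using ab by linarith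
    ultimately show "s \<in> window_rows w P \<alpha> \<beta> \<longleftrightarrow> s \<in> {nat \<lceil>?a\<rceil>..nat \<lfloor>?b\<rfloor>}" by (simp add: window_rows_def)
  qed
  moreover have "?b - ?a = (\<beta> - \<alpha>) * real (8 * w)" by (simp add: algebra_simps)
  ultimately show "finite (window_rows w P \<alpha> \<beta>)" "real (card (window_rows w P \<alpha> \<beta>)) \<le> (\<beta> - \<alpha>) * real (8 * w) + 1"
    "(\<beta> - \<alpha>) * real (8 * w) - 1 \<le> real (card (window_rows w P \<alpha> \<beta>))"
    using ab by (simp_all del: of_nat_mult) linarith+
qed

text \<open>Shielding makes the sum over columns geometric, of order \<open>w\<close>. Together with
  the mark probability of order \<open>1 / w ^ 2\<close> this leaves order \<open>1 / w\<close> per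
  row, so the total is proportional to the number of rows in the window.\<close>

lemma window_exposed_prob:
  assumes ab: "0 \<le> \<alpha>" "\<alpha> < \<beta>" "\<beta> \<le> 1" and w: "2 \<le> w" and P: "12 * w \<le> P"
  shows "cell_prob (8 * w) Q P {f. \<exists>s\<in>window_rows w P \<alpha> \<beta>. \<exists>k<Q. exposed w Q P f k s} \<le>
    16 * (\<beta> - \<alpha>) + 2 / real w"
proof -
  let ?pr = "cell_prob (8 * w) Q P"
  define y where "y = (4 * real w - 4) / (real (8 * w))\<^sup>2"
  define z where "z = exp (- y)"
  have w2: "2 \<le> real w" using w by simp
  have y: "1 / (32 * real w) \<le> y" "y \<le> 1"
  proof -
    have "64 * (real w)\<^sup>2 \<le> 32 * real w * (4 * real w - 4)"
      using mult_left_mono[OF w2, of "64 * real w"] by (simp add: power2_eq_square algebra_simps)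
    then show "1 / (32 * real w) \<le> y" using w2 unfolding y_def by (simp add: field_simps power2_eq_square)
    have "4 * real w - 4 \<le> 64 * (real w)\<^sup>2" using mult_left_mono[OF w2, of "32 * real w"] by (simp add: power2_eq_square)
    then show "y \<le> 1" using w2 unfolding y_def by (simp add: power2_eq_square)
  qed
  have y0: "0 < y" using y(1) w2 by (smt (verit) divide_pos_pos)
  have z: "0 < z" "z < 1" using y0 by (auto simp: z_def)
  have z1: "1 / (64 * real w) \<le> 1 - z"
  proof -
    have "1 / (64 * real w) = 1 / (32 * real w) / 2" by simp
    then show ?thesis using one_minus_exp_ge[of y] y y0 unfolding z_def by linarith
  qed
  have geo: "(\<Sum>k<Q. z ^ k) \<le> 64 * real w"
  proof -
    have "(\<Sum>k<Q. z ^ k) = (1 - z ^ Q) / (1 - z)" using z by (simp add: sum_gp_strict)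
    also have "\<dots> \<le> 1 / (1 - z)" using z by (intro divide_right_mono) auto
    also have "\<dots> \<le> 64 * real w" using z z1 w2 by (simp add: field_simps)
    finally show ?thesis .
  qed
  have \<beta>w: "\<beta> * real (8 * w) \<le> real (8 * w)" using ab by (simp add: mult_left_le_one_le)
  have bP: "\<beta> * real (8 * w) \<le> real P" using \<beta>w P by linarith
  have rows: "finite (window_rows w P \<alpha> \<beta>)" "real (card (window_rows w P \<alpha> \<beta>)) \<le> (\<beta> - \<alpha>) * real (8 * w) + 1"
    using window_rows_card[OF less_imp_le[OF ab(2)] bP] by auto
  have "{f. \<exists>s\<in>window_rows w P \<alpha> \<beta>. \<exists>k<Q. exposed w Q P f k s} = (\<Union>s\<in>window_rows w P \<alpha> \<beta>. \<Union>k<Q. {f. exposed w Q P f k s})" by auto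
  also have "?pr \<dots> \<le> real (card (window_rows w P \<alpha> \<beta>)) * (2 * mark_prob (8 * w) * (64 * real w))"
  proof (rule pmf_prob_UN_le[OF rows(1)])
    fix s assume "s \<in> window_rows w P \<alpha> \<beta>"
    then have "real P - \<beta> * real (8 * w) \<le> real s" by (simp add: window_rows_def)
    then have "real (12 * w) - real (8 * w) \<le> real s" using \<beta>w P by linarith
    then have s: "4 * w \<le> s" by simp
    have "?pr (\<Union>k<Q. {f. exposed w Q P f k s}) \<le> (\<Sum>k<Q. ?pr {f. exposed w Q P f k s})"
      by (intro measure_pmf.finite_measure_subadditive_finite) auto
    also have "\<dots> \<le> (\<Sum>k<Q. 2 * mark_prob (8 * w) * z ^ k)"
      unfolding z_def y_def by (intro sum_mono exposed_prob[OF s]) (use w in simp)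
    also have "\<dots> = 2 * mark_prob (8 * w) * (\<Sum>k<Q. z ^ k)" by (simp add: sum_distrib_left)
    also have "\<dots> \<le> 2 * mark_prob (8 * w) * (64 * real w)"
      using mark_prob_bounds(1)[of "8 * w"] by (intro mult_left_mono[OF geo]) auto
    finally show "?pr (\<Union>k<Q. {f. exposed w Q P f k s}) \<le> 2 * mark_prob (8 * w) * (64 * real w)" .
  qed
  also have "\<dots> \<le> ((\<beta> - \<alpha>) * real (8 * w) + 1) * (2 * (1 / (real (8 * w))\<^sup>2) * (64 * real w))"
    by (intro mult_mono rows(2) mark_prob_bounds mult_right_mono mult_left_mono mult_nonneg_nonneg) (use ab in auto)
  also have "\<dots> = 16 * (\<beta> - \<alpha>) + 2 / real w" using w2 by (simp add: field_simps power2_eq_square)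
  finally show ?thesis .
qed

text \<open>The events \<open>V x\<close> are disjoint, so their probabilities add: about
  \<open>128 * w ^ 2 * (\<beta> - \<alpha>)\<close> cells, each contributing a constant times
  \<open>1 / (128 * w ^ 2)\<close>. Half of \<beta> - \<alpha> is kept to absorb rounding.\<close>

lemma window_enclosed_prob:
  assumes ab: "0 \<le> \<alpha>" "\<alpha> < \<beta>" "\<beta> \<le> 1" and w: "8 \<le> w" and P: "20 * w \<le> P + w" and Q: "10 * (8 * w) \<le> Q"
  shows "hit_prob ^ 18 * exp (- 45) * ((\<beta> - \<alpha>) / 2 - 1 / real w) \<le>
    cell_prob (8 * w) Q P {f. \<exists>s\<in>window_rows w P \<alpha> \<beta>. \<exists>c\<in>{- int (8 * w)<..<int (8 * w)}.
      enclosed w P (int (8 * w)) 9 {(c, s)} f \<and> f (c, s)}"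
proof -
  let ?pr = "cell_prob (8 * w) Q P"
  let ?k = "int (8 * w)"
  define W where "W = {- ?k<..<?k} \<times> window_rows w P \<alpha> \<beta>"
  define V where "V x = {f. enclosed w P ?k 9 {x} f \<and> (\<forall>y\<in>{x}. f y)}" for x
  have w0: "8 \<le> real w" using w by simp
  have k: "0 < ?k" "?k + int (9 * (8 * w)) \<le> int Q" "2 * w * 9 \<le> P" "0 < w" using w P Q by auto
  have \<beta>w: "\<beta> * real (8 * w) \<le> real (8 * w)" using ab by (simp add: mult_left_le_one_le)
  have bP: "\<beta> * real (8 * w) \<le> real P" using \<beta>w P by linarith
  note rows = window_rows_card[OF less_imp_le[OF ab(2)] bP]
  have W: "x \<in> cells Q P \<and> x \<in> inner_zone w P ?k 9 \<and> x \<notin> (\<Union>j\<in>UNIV \<times> {..<9}. inner_group w P ?k 9 j)" if x: "x \<in> W" for x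
  proof -
    obtain c s where cs: "x = (c, s)" by (cases x)
    have c: "- ?k < c" "c < ?k" and s: "s \<in> window_rows w P \<alpha> \<beta>" using x by (auto simp: W_def cs)
    have "0 \<le> \<alpha> * real (8 * w)" using ab by simp
    then have "real s \<le> real P" "real P - real (8 * w) \<le> real s" using s \<beta>w unfolding window_rows_def by auto
    then have sP: "s \<le> P" "P \<le> s + 8 * w" by linarith+
    have 1: "x \<in> inner_zone w P ?k 9" using c sP by (auto simp: cs inner_zone_def)
    have "x \<notin> inner_group w P ?k 9 (r, i)" for r i
    proof -
      have "0 \<le> int (i * (8 * w))" by simp
      then show ?thesis using c unfolding cs inner_group_def
        by (cases r) (simp_all only: prod.case if_True if_False mem_Times_iff atLeastLessThan_iff fst_conv; linarith)+
    qed
    then have 2: "x \<notin> (\<Union>j\<in>UNIV \<times> {..<9}. inner_group w P ?k 9 j)" by auto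
    show ?thesis using 1 2 inner_zone_cells[OF k(2), of P] by blast
  qed
  have finW: "finite W" using rows by (simp add: W_def)
  have card: "(2 * real (8 * w) - 1) * ((\<beta> - \<alpha>) * real (8 * w) - 1) \<le> real (card W)"
  proof -
    have c: "real (card {- ?k<..<?k}) = 2 * real (8 * w) - 1" using w by simp
    show ?thesis unfolding W_def card_cartesian_product of_nat_mult[of "card _"] c using rows(3) w0 by (intro mult_left_mono) auto
  qed
  \<comment> \<open>The zone has \<open>160 * w\<close> columns and at most \<open>18 * w\<close>
    rows, and 160 * 18 / 64 = 45.\<close>
  have zone: "real (card (inner_zone w P ?k 9)) / (real (8 * w))\<^sup>2 \<le> 45"
  proof -
    have "(2 * 9 - 1) * w \<le> P" using k(3) by simp
    then have "real (card (inner_zone w P ?k 9)) = 2 * (real_of_int ?k + real 9 * real (8 * w)) * (real ((2 * 9 - 1) * w) + 1)"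
      by (rule inner_zone_card[OF k(1)])
    also have "\<dots> = 160 * real w * (17 * real w + 1)" by simp
    also have "\<dots> \<le> 160 * real w * (18 * real w)" using w0 by (intro mult_left_mono) auto
    finally show ?thesis using w0 by (simp add: power2_eq_square field_simps)
  qed
  have V: "hit_prob ^ 18 * exp (- 45) * (1 / (2 * (real (8 * w))\<^sup>2)) \<le> ?pr (V x)" if x: "x \<in> W" for x
  proof -
    have "hit_prob ^ 18 * exp (- 45) * (1 / (2 * (real (8 * w))\<^sup>2)) \<le>
        hit_prob ^ (2 * 9) * exp (- (real (card (inner_zone w P ?k 9)) / (real (8 * w))\<^sup>2)) * mark_prob (8 * w) ^ card {x}"
      using zone mark_prob_ge[of "8 * w"] w by (intro mult_mono) auto
    also have "\<dots> \<le> ?pr (V x)"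
      unfolding V_def by (rule enclosed_prob[OF k(2,1,3,4)]) (use W[OF x] in auto)
    finally show ?thesis .
  qed
  \<comment> \<open>Under \<open>V x\<close> the cell \<open>y\<close> belongs to the part of the
    zone that must be unmarked.\<close>
  have disj: "V x \<inter> V y = {}" if "x \<in> W" "y \<in> W" "x \<noteq> y" for x y
  proof -
    have "y \<in> inner_rest w P ?k 9 - {x}" using W[OF that(2)] that(3) by (simp add: inner_rest_def)
    then show ?thesis unfolding V_def enclosed_def by blast
  qed
  have u: "0 \<le> hit_prob ^ 18 * exp (- 45)" by simp
  have "hit_prob ^ 18 * exp (- 45) * ((\<beta> - \<alpha>) / 2 - 1 / real w) \<le>
      hit_prob ^ 18 * exp (- 45) * (real (card W) * (1 / (2 * (real (8 * w))\<^sup>2)))"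
  proof (rule mult_left_mono[OF _ u])
    define D where "D = \<beta> - \<alpha>"
    have D: "0 \<le> D" "D \<le> 1" using ab by (auto simp: D_def)
    have D': "real w * D \<le> real w" "0 \<le> real w * (real w * D)" using D w0 mult_left_mono[OF D(2), of "real w"] by auto
    have "(D / 2 - 1 / real w) * (2 * (real (8 * w))\<^sup>2) = 64 * (real w * (real w * D)) - 128 * real w"
      using w0 by (simp add: field_simps power2_eq_square)
    moreover have "(2 * real (8 * w) - 1) * (D * real (8 * w) - 1) = 128 * (real w * (real w * D)) - 16 * real w - 8 * (real w * D) + 1"
      by (simp add: algebra_simps)
    ultimately have "((\<beta> - \<alpha>) / 2 - 1 / real w) * (2 * (real (8 * w))\<^sup>2) \<le> (2 * real (8 * w) - 1) * ((\<beta> - \<alpha>) * real (8 * w) - 1)"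
      using D' w0 unfolding D_def[symmetric] by linarith
    then have "((\<beta> - \<alpha>) / 2 - 1 / real w) * (2 * (real (8 * w))\<^sup>2) \<le> real (card W)" using card by linarith
    then show "(\<beta> - \<alpha>) / 2 - 1 / real w \<le> real (card W) * (1 / (2 * (real (8 * w))\<^sup>2))"
      using w0 by (simp add: pos_le_divide_eq)
  qed
  also have "\<dots> = (\<Sum>x\<in>W. hit_prob ^ 18 * exp (- 45) * (1 / (2 * (real (8 * w))\<^sup>2)))" by simp
  also have "\<dots> \<le> (\<Sum>x\<in>W. ?pr (V x))" by (rule sum_mono[OF V])
  also have "\<dots> = ?pr (\<Union>x\<in>W. V x)"
    by (rule measure_pmf.finite_measure_finite_Union[symmetric, OF finW]) (use disj in \<open>auto simp: disjoint_family_on_def\<close>)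
  also have "\<dots> \<le> ?pr {f. \<exists>s\<in>window_rows w P \<alpha> \<beta>. \<exists>c\<in>{- int (8 * w)<..<int (8 * w)}. enclosed w P (int (8 * w)) 9 {(c, s)} f \<and> f (c, s)}"
  proof (rule measure_pmf.finite_measure_mono)
    show "(\<Union>x\<in>W. V x) \<subseteq> {f. \<exists>s\<in>window_rows w P \<alpha> \<beta>. \<exists>c\<in>{- int (8 * w)<..<int (8 * w)}. enclosed w P (int (8 * w)) 9 {(c, s)} f \<and> f (c, s)}"
      unfolding W_def V_def by blast
  qed simp
  finally show ?thesis .
qed

section \<open>Limits of the cluster size probabilities\<close>

text \<open>The number of elements is a series of indicators along an enumeration of the integers,
  which includes infinite clusters.\<close>

lemma numel_cluster_measurable:
  assumes X: "\<And>i. X i \<in> measurable M (count_space (UNIV :: nat set))"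
  shows "(\<lambda>\<omega>. numel (cluster (\<lambda>i. X i \<omega>) j)) \<in> borel_measurable M"
proof -
  have m: "{\<omega> \<in> space M. k \<in> cluster (\<lambda>i. X i \<omega>) j} \<in> sets M" for k
  proof -
    have "{\<omega> \<in> space M. k \<in> cluster (\<lambda>i. X i \<omega>) j} = {\<omega> \<in> space M. \<forall>z\<in>{min j k..max j k}. X z \<omega> \<noteq> 0}"
      by (auto simp: mem_cluster_iff conn_def)
    also have "\<dots> \<in> sets M" using X by measurable
    finally show ?thesis .
  qed
  have "numel A = (\<Sum>n. indicator A (int_decode n))" for A :: "int set"
  proof -
    have "numel A = (\<integral>\<^sup>+x. indicator A x \<partial>count_space UNIV)" by (simp add: numel_def)
    also have "\<dots> = (\<integral>\<^sup>+n. indicator A (int_decode n) \<partial>count_space UNIV)"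
      by (rule nn_integral_bij_count_space[OF bij_int_decode, symmetric])
    finally show ?thesis by (simp add: nn_integral_count_space_nat)
  qed
  moreover have "(\<lambda>\<omega>. \<Sum>n. indicator (cluster (\<lambda>i. X i \<omega>) j) (int_decode n) :: ennreal) \<in> borel_measurable M"
  proof (rule borel_measurable_suminf_order)
    fix n
    have "indicator {\<omega> \<in> space M. int_decode n \<in> cluster (\<lambda>i. X i \<omega>) j} \<in> borel_measurable M"
      using m by (rule borel_measurable_indicator)
    then show "(\<lambda>\<omega>. indicator (cluster (\<lambda>i. X i \<omega>) j) (int_decode n) :: ennreal) \<in> borel_measurable M"
      by (rule measurable_cong[THEN iffD1, rotated]) (auto simp: indicator_def)
  qed
  ultimately show ?thesis by simp
qed

text \<open>The approximating constants for smaller and smaller errors form a Cauchy sequence; the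
  limit exists without being identified.\<close>

lemma limit_if_nearly_constant:
  fixes g :: "'b \<Rightarrow> real"
  assumes F: "F \<noteq> bot" and near: "\<And>\<epsilon>. 0 < \<epsilon> \<Longrightarrow> \<exists>c. \<forall>\<^sub>F x in F. \<bar>g x - c\<bar> \<le> \<epsilon>"
  shows "\<exists>L. (g \<longlongrightarrow> L) F"
proof -
  have "\<exists>c. \<forall>\<^sub>F x in F. \<bar>g x - c\<bar> \<le> inverse (real (Suc n))" for n by (rule near) simp
  then obtain c where c: "\<And>n. \<forall>\<^sub>F x in F. \<bar>g x - c n\<bar> \<le> inverse (real (Suc n))" by metis
  have cc: "\<bar>c k - c l\<bar> \<le> inverse (real (Suc k)) + inverse (real (Suc l))" for k l
  proof -
    have "\<forall>\<^sub>F x in F. \<bar>c k - c l\<bar> \<le> inverse (real (Suc k)) + inverse (real (Suc l))"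
      using c[of k] c[of l] by eventually_elim linarith
    then show ?thesis using F by (simp add: eventually_const_iff)
  qed
  have inv: "\<exists>n. inverse (real (Suc n)) < e" if "0 < e" for e :: real
    using reals_Archimedean[OF that] by auto
  have "Cauchy c"
  proof (rule metric_CauchyI)
    fix e :: real assume "0 < e"
    then obtain n where n: "inverse (real (Suc n)) < e / 2" using inv[of "e / 2"] by auto
    have "dist (c k) (c l) < e" if "n \<le> k" "n \<le> l" for k l
    proof -
      have "inverse (real (Suc k)) \<le> inverse (real (Suc n))" "inverse (real (Suc l)) \<le> inverse (real (Suc n))"
        using that by (auto intro!: le_imp_inverse_le)
      then show ?thesis using cc[of k l] n by (simp only: dist_real_def)
    qed
    then show "\<exists>M. \<forall>k\<ge>M. \<forall>l\<ge>M. dist (c k) (c l) < e" by blast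
  qed
  then obtain L where L: "c \<longlonglongrightarrow> L" using Cauchy_convergent convergent_def by blast
  have "(g \<longlongrightarrow> L) F"
  proof (rule tendstoI)
    fix e :: real assume e: "0 < e"
    then have "\<forall>\<^sub>F n in sequentially. dist (c n) L < e / 2" by (intro tendstoD[OF L]) simp
    moreover have "\<forall>\<^sub>F n in sequentially. inverse (real (Suc n)) < e / 2"
      by (rule order_tendstoD(2)[OF LIMSEQ_inverse_real_of_nat]) (use e in simp)
    ultimately have "\<forall>\<^sub>F n in sequentially. dist (c n) L < e / 2 \<and> inverse (real (Suc n)) < e / 2" by (rule eventually_conj)
    then obtain n where n: "dist (c n) L < e / 2" "inverse (real (Suc n)) < e / 2"
      unfolding eventually_sequentially by auto
    show "\<forall>\<^sub>F x in F. dist (g x) L < e"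
      using c[of n] by eventually_elim (use n in \<open>simp only: dist_real_def; linarith\<close>)
  qed
  then show ?thesis ..
qed

text \<open>The origin of the bounds on \<open>t\<close>: a time unit is \<open>8 * w\<close> rows,
  the five links of the macroscopic chain take \<open>10 * w\<close> rows and the nine of the
  microscopic chain \<open>18 * w\<close>.\<close>

lemma last_row_ge: "3 / 2 \<le> t \<Longrightarrow> 0 < w \<Longrightarrow> 12 * w \<le> last_row t (8 * w) + 1"
  and last_row_ge': "5 / 2 \<le> t \<Longrightarrow> 0 < w \<Longrightarrow> 20 * w \<le> last_row t (8 * w) + 1"
proof -
  assume w: "0 < w"
  have *: "x * real (8 * w) \<le> real (last_row t (8 * w) + 1)" if "0 < x" "x \<le> t" for x
  proof -
    have "x * real (8 * w) \<le> t * real (8 * w)" using that by (intro mult_right_mono) auto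
    moreover have "t * real (8 * w) \<le> real (last_row t (8 * w)) + 1"
      by (rule last_row_bounds(2)) (use that w in auto)
    ultimately show ?thesis unfolding of_nat_add of_nat_1 by linarith
  qed
  show "3 / 2 \<le> t \<Longrightarrow> 12 * w \<le> last_row t (8 * w) + 1" using *[of "3 / 2"] by simp
  show "5 / 2 \<le> t \<Longrightarrow> 20 * w \<le> last_row t (8 * w) + 1" using *[of "5 / 2"] by simp
qed

section \<open>Existence of the limits and their bounds\<close>

context ffp_family
begin

definition tame_at :: "nat \<Rightarrow> real set \<Rightarrow> real set \<Rightarrow> real \<Rightarrow> nat \<Rightarrow> nat \<Rightarrow> real \<Rightarrow> 'a \<Rightarrow> config \<Rightarrow> bool" where
  "tame_at \<delta> A D t w q lam \<omega> f \<longleftrightarrow> tame_realization (\<lambda>t i. N lam t i \<omega>) (\<lambda>t i. M lam t i \<omega>) (\<lambda>t i. \<eta> lam t i \<omega>)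
     (grid_step (8 * w) lam) w (last_row t (8 * w)) (q * (8 * w)) (site_step (8 * w) lam) (t * ln (1 / lam)) f \<delta> A D"

definition on_tame :: "nat \<Rightarrow> real set \<Rightarrow> real set \<Rightarrow> real \<Rightarrow> nat \<Rightarrow> nat \<Rightarrow> (real \<Rightarrow> 'a \<Rightarrow> config \<Rightarrow> bool) \<Rightarrow> bool" where
  "on_tame \<delta> A D t w q \<Phi> \<longleftrightarrow> (\<forall>lam \<omega> f. 0 < lam \<longrightarrow> lam < 1 \<longrightarrow> \<omega> \<in> space (Pr lam) \<longrightarrow> tame_at \<delta> A D t w q lam \<omega> f \<longrightarrow> \<Phi> lam \<omega> f)"

abbreviation config_prob :: "real \<Rightarrow> nat \<Rightarrow> nat \<Rightarrow> (config \<Rightarrow> bool) \<Rightarrow> real" where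
  "config_prob t w q \<Phi> \<equiv> cell_prob (8 * w) (q * (8 * w)) (last_row t (8 * w)) {f. \<Phi> f}"

text \<open>Three limits are nested: the relative width \<open>q\<close> is fixed by \<epsilon>,
  then \<open>w\<close> goes to infinity, and for each large \<open>w\<close> the rate \<lambda>
  tends to 0. Half of \<epsilon> covers untame configurations and doubly hit cells, half the
  convergence of the probabilities.\<close>

lemma comparison:
  assumes t: "3 / 2 \<le> t" and \<delta>: "0 < \<delta>" and AD: "\<And>w. finite (A w) \<and> card (A w) \<le> 2 \<and> finite (D w) \<and> card (D w) \<le> 1"
    and E: "\<And>lam. 0 < lam \<Longrightarrow> lam < 1 \<Longrightarrow> E lam \<in> sets (Pr lam)"
    and up: "\<And>q. \<delta> \<le> q \<Longrightarrow> \<forall>\<^sub>F w in sequentially. on_tame \<delta> (A w) (D w) t w q (\<lambda>lam \<omega> f. \<omega> \<in> E lam \<longrightarrow> U w q f)"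
    and lo: "\<And>q. \<delta> \<le> q \<Longrightarrow> \<forall>\<^sub>F w in sequentially. on_tame \<delta> (A w) (D w) t w q (\<lambda>lam \<omega> f. V w q f \<longrightarrow> \<omega> \<in> E lam)"
    and \<epsilon>: "0 < \<epsilon>"
  shows "\<exists>q\<ge>\<delta>. \<forall>\<^sub>F w in sequentially. \<forall>\<^sub>F lam in at_right 0.
    measure (Pr lam) (E lam) \<le> config_prob t w q (U w q) + \<epsilon> \<and> config_prob t w q (V w q) - \<epsilon> \<le> measure (Pr lam) (E lam)"
proof -
  have \<epsilon>2: "0 < \<epsilon> / 2" using \<epsilon> by simp
  obtain q where q: "\<delta> \<le> q" and tame: "\<forall>\<^sub>F w in sequentially. \<forall>A D. finite A \<and> card A \<le> 2 \<and> finite D \<and> card D \<le> 1 \<longrightarrow>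
    config_prob t w q (\<lambda>f. \<not> tame w (q * (8 * w)) (last_row t (8 * w)) \<delta> A D f) +
    real (card (cells (q * (8 * w)) (last_row t (8 * w)))) / real (8 * w) ^ 4 \<le> \<epsilon> / 2"
    using eventually_tame[OF t \<epsilon>2, of \<delta>] by blast
  have "\<forall>\<^sub>F w in sequentially. \<forall>\<^sub>F lam in at_right 0.
    measure (Pr lam) (E lam) \<le> config_prob t w q (U w q) + \<epsilon> \<and> config_prob t w q (V w q) - \<epsilon> \<le> measure (Pr lam) (E lam)"
    using tame up[OF q] lo[OF q] eventually_ge_at_top[of 8]
  proof eventually_elim
    case (elim w)
    let ?P = "last_row t (8 * w)" and ?Q = "q * (8 * w)"
    have w: "8 \<le> w" "0 < w" using elim by auto
    have P: "8 * w + 8 \<le> ?P" using last_row_ge[OF t w(2)] w by linarith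
    interpret ffp_family_grid Pr N M \<eta> "8 * w" "4 * w" ?P ?Q t
    proof
      show "real ?P < t * real (8 * w)" "t * real (8 * w) \<le> real ?P + 1"
        by (rule last_row_bounds; use t w in linarith)+
    qed (use w P in auto)
    let ?ok = "tame w ?Q ?P \<delta> (A w) (D w)"
    have ok: "config_prob t w q (\<lambda>f. \<not> ?ok f) + real (card (cells ?Q ?P)) / real (8 * w) ^ 4 \<le> \<epsilon> / 2"
      using elim(1) AD by blast
    have at: "tame_at \<delta> (A w) (D w) t w q lam \<omega> (cfg lam \<omega>)" if "realized lam \<omega>" "?ok (cfg lam \<omega>)" for lam \<omega>
      unfolding tame_at_def tame_realization_def tame_realization_axioms_def
      using that \<delta> w P by (auto simp: marked_cells_def)
    have space: "\<omega> \<in> space (Pr lam)" if "0 < lam" "lam < 1" "\<omega> \<in> E lam" for lam \<omega>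
      using sets.sets_into_space[OF E[OF that(1,2)]] that(3) by auto
    have 1: "\<forall>\<^sub>F lam in at_right 0. measure (Pr lam) (E lam) \<le> config_prob t w q (U w q) +
      config_prob t w q (\<lambda>f. \<not> ?ok f) + real (card (cells ?Q ?P)) / real (8 * w) ^ 4 + \<epsilon> / 2"
      by (rule transfer_upper[OF E _ \<epsilon>2]) (use elim(2)[unfolded on_tame_def] at space in blast)+
    have 2: "\<forall>\<^sub>F lam in at_right 0. config_prob t w q (V w q) -
      config_prob t w q (\<lambda>f. \<not> ?ok f) - real (card (cells ?Q ?P)) / real (8 * w) ^ 4 - \<epsilon> / 2 \<le> measure (Pr lam) (E lam)"
      by (rule transfer_lower[OF E _ \<epsilon>2]) (use elim(3)[unfolded on_tame_def] at in blast)+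
    show ?case using 1 2 by eventually_elim (use ok in linarith)
  qed
  with q show ?thesis by blast
qed

text \<open>The exact description \<open>C\<close> makes the probabilities nearly constant, which
  gives existence of the limit; the cruder events \<open>U\<close> and \<open>V\<close>, whose
  probabilities are computable, enclose it.\<close>

lemma limit_between:
  assumes t: "3 / 2 \<le> t" and \<delta>: "0 < \<delta>" and AD: "\<And>w. finite (A w) \<and> card (A w) \<le> 2 \<and> finite (D w) \<and> card (D w) \<le> 1"
    and E: "\<And>lam. 0 < lam \<Longrightarrow> lam < 1 \<Longrightarrow> E lam \<in> sets (Pr lam)"
    and eq: "\<And>q. \<delta> \<le> q \<Longrightarrow> \<forall>\<^sub>F w in sequentially. on_tame \<delta> (A w) (D w) t w q (\<lambda>lam \<omega> f. \<omega> \<in> E lam \<longleftrightarrow> C w q f)"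
    and up: "\<And>q. \<delta> \<le> q \<Longrightarrow> \<forall>\<^sub>F w in sequentially. on_tame \<delta> (A w) (D w) t w q (\<lambda>lam \<omega> f. \<omega> \<in> E lam \<longrightarrow> U w q f)"
    and lo: "\<And>q. \<delta> \<le> q \<Longrightarrow> \<forall>\<^sub>F w in sequentially. on_tame \<delta> (A w) (D w) t w q (\<lambda>lam \<omega> f. V w q f \<longrightarrow> \<omega> \<in> E lam)"
    and U: "\<And>q. \<delta> \<le> q \<Longrightarrow> \<forall>\<^sub>F w in sequentially. config_prob t w q (U w q) \<le> g w" and g: "g \<longlonglongrightarrow> G"
    and V: "\<And>q. \<delta> \<le> q \<Longrightarrow> \<forall>\<^sub>F w in sequentially. h w \<le> config_prob t w q (V w q)" and h: "h \<longlonglongrightarrow> H"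
  shows "\<exists>L. ((\<lambda>lam. measure (Pr lam) (E lam)) \<longlongrightarrow> L) (at_right 0) \<and> H \<le> L \<and> L \<le> G"
proof -
  have nontriv: "at_right (0::real) \<noteq> bot" by (rule trivial_limit_at_right_real)
  have "\<exists>L. ((\<lambda>lam. measure (Pr lam) (E lam)) \<longlongrightarrow> L) (at_right 0)"
  proof (rule limit_if_nearly_constant[OF nontriv])
    fix \<epsilon> :: real assume \<epsilon>: "0 < \<epsilon>"
    have "\<forall>\<^sub>F w in sequentially. on_tame \<delta> (A w) (D w) t w q (\<lambda>lam \<omega> f. \<omega> \<in> E lam \<longrightarrow> C w q f)"
      "\<forall>\<^sub>F w in sequentially. on_tame \<delta> (A w) (D w) t w q (\<lambda>lam \<omega> f. C w q f \<longrightarrow> \<omega> \<in> E lam)" if "\<delta> \<le> q" for q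
      by (rule eventually_mono[OF eq[OF that]]; simp add: on_tame_def)+
    note up' = this(1) and lo' = this(2)
    obtain q where "\<forall>\<^sub>F w in sequentially. \<forall>\<^sub>F lam in at_right 0.
      measure (Pr lam) (E lam) \<le> config_prob t w q (C w q) + \<epsilon> \<and> config_prob t w q (C w q) - \<epsilon> \<le> measure (Pr lam) (E lam)"
      by (rule exE[OF comparison[where U=C and V=C, OF t \<delta> AD E up' lo' \<epsilon>]]) (assumption+, elim conjE, rule that)
    then obtain w where "\<forall>\<^sub>F lam in at_right 0.
      measure (Pr lam) (E lam) \<le> config_prob t w q (C w q) + \<epsilon> \<and> config_prob t w q (C w q) - \<epsilon> \<le> measure (Pr lam) (E lam)"
      by (rule eventually_happens'[OF sequentially_bot, THEN exE])
    then have "\<forall>\<^sub>F lam in at_right 0. \<bar>measure (Pr lam) (E lam) - config_prob t w q (C w q)\<bar> \<le> \<epsilon>"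
      by eventually_elim linarith
    then show "\<exists>c. \<forall>\<^sub>F lam in at_right 0. \<bar>measure (Pr lam) (E lam) - c\<bar> \<le> \<epsilon>" ..
  qed
  then obtain L where L: "((\<lambda>lam. measure (Pr lam) (E lam)) \<longlongrightarrow> L) (at_right 0)" ..
  have LG: "L \<le> G + \<epsilon> \<and> H \<le> L + \<epsilon>" if \<epsilon>: "0 < \<epsilon>" for \<epsilon>
  proof -
    obtain q where q: "\<delta> \<le> q" and c: "\<forall>\<^sub>F w in sequentially. \<forall>\<^sub>F lam in at_right 0.
      measure (Pr lam) (E lam) \<le> config_prob t w q (U w q) + \<epsilon> \<and> config_prob t w q (V w q) - \<epsilon> \<le> measure (Pr lam) (E lam)"
      by (rule exE[OF comparison[OF t \<delta> AD E up lo \<epsilon>]]) (assumption+, elim conjE, rule that)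
    have ev: "\<forall>\<^sub>F w in sequentially. L \<le> g w + \<epsilon> \<and> h w - \<epsilon> \<le> L"
      using c U[OF q] V[OF q]
    proof eventually_elim
      case (elim w)
      have "\<forall>\<^sub>F lam in at_right 0. measure (Pr lam) (E lam) \<le> g w + \<epsilon>"
        using elim(1) by eventually_elim (use elim(2) in linarith)
      moreover have "\<forall>\<^sub>F lam in at_right 0. h w - \<epsilon> \<le> measure (Pr lam) (E lam)"
        using elim(1) by eventually_elim (use elim(3) in linarith)
      ultimately show ?case using tendsto_upperbound[OF L _ nontriv] tendsto_lowerbound[OF L _ nontriv] by blast
    qed
    have ev': "\<forall>\<^sub>F w in sequentially. L \<le> g w + \<epsilon>" "\<forall>\<^sub>F w in sequentially. h w - \<epsilon> \<le> L"
      by (rule eventually_mono[OF ev]; simp)+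
    have "L \<le> G + \<epsilon>"
      by (rule tendsto_lowerbound[OF tendsto_add[OF g tendsto_const] ev'(1) sequentially_bot])
    moreover have "H - \<epsilon> \<le> L"
      by (rule tendsto_upperbound[OF tendsto_diff[OF h tendsto_const] ev'(2) sequentially_bot])
    ultimately show ?thesis by simp
  qed
  then have "L \<le> G" "H \<le> L" by (auto intro: field_le_epsilon)
  with L show ?thesis by blast
qed

lemma cluster_event:
  assumes "0 < lam" "lam < 1" "0 \<le> t" "S \<in> sets borel"
  shows "{\<omega> \<in> space (Pr lam). numel (cluster (\<lambda>i. \<eta> lam t i \<omega>) 0) \<in> S} \<in> sets (Pr lam)"
proof -
  interpret P: prob_space "Pr lam" using ffp[OF assms(1,2)] by (simp add: forest_fire_process_def)
  interpret ffp_space "Pr lam" lam "N lam" "M lam" "\<eta> lam"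
    by unfold_locales (use ffp assms in auto)
  have "(\<lambda>\<omega>. numel (cluster (\<lambda>i. \<eta> lam t i \<omega>) 0)) \<in> borel_measurable (Pr lam)"
    by (rule numel_cluster_measurable) (rule \<eta>_meas[OF assms(3)])
  from measurable_sets[OF this assms(4)] show ?thesis by (simp add: vimage_def Int_def conj_commute)
qed

lemma macro_threshold:
  assumes "0 < lam" "lam < 1" "0 < w"
  shows "B * real (8 * w) / site_step (8 * w) lam = B / (lam * ln (1 / lam))"
  using assms by (simp add: site_step_def)

lemma micro_threshold:
  assumes "0 < lam" "lam < 1" "0 < w"
  shows "exp (a * real (8 * w) * grid_step (8 * w) lam) = lam powr (- a)"
  using assms by (simp add: grid_step_def powr_def ln_div)

lemma macro_limit:
  assumes t32: "3 / 2 \<le> t" and B: "0 < B"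
  shows "\<exists>L. ((\<lambda>lam. measure (Pr lam) {\<omega> \<in> space (Pr lam).
      ennreal (B / (lam * ln (1 / lam))) \<le> numel (cluster (\<lambda>i. \<eta> lam (t * ln (1 / lam)) i \<omega>) 0)}) \<longlongrightarrow> L) (at_right 0) \<and>
    hit_prob ^ 10 * exp (- ((9 / 8) * (B + 10))) \<le> L \<and> L \<le> 2 * exp (- (B / 4))"
proof -
  \<comment> \<open>Room for the inner half width \<open>l w\<close>, about \<open>4 * B * w\<close>
    columns, followed by five links of \<open>8 * w\<close> columns.\<close>
  define \<delta> where "\<delta> = nat \<lceil>B\<rceil> + 6"
  \<comment> \<open>The threshold is \<open>8 * B * w\<close> columns. Twice \<open>k\<close> is
    slightly less and twice \<open>l\<close> slightly more, by enough to absorb the rounding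
    errors.\<close>
  define k where "k w = \<lfloor>B * (4 * real w)\<rfloor> - 2" for w :: nat
  define l where "l w = \<lceil>B * (4 * real w)\<rceil> + 1" for w :: nat
  define D where "D w = {B * real (8 * w)}" for w :: nat
  let ?S = "\<lambda>lam \<omega>. numel (cluster (\<lambda>i. \<eta> lam (t * ln (1 / lam)) i \<omega>) 0)"
  let ?E = "\<lambda>lam. {\<omega> \<in> space (Pr lam). ennreal (B / (lam * ln (1 / lam))) \<le> ?S lam \<omega>}"
  let ?P = "\<lambda>w. last_row t (8 * w)"
  have \<delta>: "0 < \<delta>" "B + 6 \<le> real \<delta>" unfolding \<delta>_def by linarith+
  have size: "B * real (8 * w) + 6 * real (8 * w) \<le> real (q * (8 * w))" if "\<delta> \<le> q" for q w
  proof -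
    have "B + 6 \<le> real q" using \<delta> that by linarith
    then have "(B + 6) * real (8 * w) \<le> real q * real (8 * w)" by (rule mult_right_mono) simp
    then show ?thesis by (simp add: algebra_simps)
  qed
  have k: "0 \<le> k w \<and> k w < int (q * (8 * w)) \<and> real_of_int (2 * k w + 2) < B * real (8 * w) \<and> B * (4 * real w) - 3 \<le> real_of_int (k w)"
    if "\<delta> \<le> q" "2 \<le> B * real (4 * w)" "1 \<le> w" for q w
  proof -
    define x where "x = B * (4 * real w)"
    have x: "B * real (8 * w) = 2 * x" "B * (4 * real w) = x" "2 \<le> x" "k w = \<lfloor>x\<rfloor> - 2"
      using that(2) by (simp_all add: x_def k_def)
    then have "real_of_int (k w) \<le> B * real (8 * w)" by linarith
    then have "real_of_int (k w) < real (q * (8 * w))" using size[OF that(1), of w] that(3) by simp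
    then have "k w < int (q * (8 * w))" by linarith
    moreover have "real_of_int (2 * k w + 2) = 2 * real_of_int \<lfloor>x\<rfloor> - 2" using x(4) by simp
    ultimately show ?thesis using x by (intro conjI; linarith)
  qed
  have l: "0 < l w \<and> l w + int (5 * (8 * w)) \<le> int (q * (8 * w)) \<and> l w \<le> int (\<delta> * (8 * w)) \<and>
      B * real (8 * w) + 2 \<le> real_of_int (2 * l w) \<and> real_of_int (l w) \<le> B * (4 * real w) + 2"
    if "\<delta> \<le> q" "8 \<le> w" for q w
  proof -
    define x where "x = B * (4 * real w)"
    have x: "B * real (8 * w) = 2 * x" "B * (4 * real w) = x" "0 \<le> x" using B by (simp_all add: x_def)
    have l1: "real_of_int (l w) \<le> x + 2" "x + 1 \<le> real_of_int (l w)" unfolding l_def x_def by linarith+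
    have l2: "l w + int (5 * (8 * w)) \<le> int (r * (8 * w))" if "\<delta> \<le> r" for r
    proof -
      have "real_of_int (l w) + real (5 * (8 * w)) \<le> real (r * (8 * w))"
        using size[OF that, of w] l1 x \<open>8 \<le> w\<close> by simp
      then have "real_of_int (l w + int (5 * (8 * w))) \<le> real_of_int (int (r * (8 * w)))" by simp
      then show ?thesis by (simp only: of_int_le_iff)
    qed
    have "0 \<le> int (5 * (8 * w))" by simp
    moreover have "real_of_int (2 * l w) = 2 * real_of_int (l w)" by simp
    ultimately show ?thesis using l2[OF that(1)] l2[of \<delta>] l1 x by (intro conjI; linarith)
  qed
  have wB: "\<forall>\<^sub>F w in sequentially. 2 \<le> B * real (4 * w)" using B by real_asymp
  have \<eta>E: "ennreal (B * real (8 * w) / site_step (8 * w) lam) = ennreal (B / (lam * ln (1 / lam)))" if "0 < lam" "lam < 1" "8 \<le> w" for lam w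
    using macro_threshold[of lam w B] that by simp
  show ?thesis
  proof (rule limit_between[OF t32 \<delta>(1), where A="\<lambda>_. {}" and D=D
        and E="?E" and C="\<lambda>w q. macro_config w (q * (8 * w)) (?P w) B"
        and U="\<lambda>w q. empty_half w (?P w) (k w)" and V="\<lambda>w q. enclosed w (?P w) (l w) 5 {}"
        and g="\<lambda>w. 2 * exp (- ((B * 4 - 3 / real w) * (4 - 4 / real w) / 64))"
        and h="\<lambda>w. hit_prob ^ 10 * exp (- (2 * (B * 4 + 2 / real w + 40) * (9 + 1 / real w) / 64))"])
    show "finite ({} :: real set) \<and> card ({} :: real set) \<le> 2 \<and> finite (D w) \<and> card (D w) \<le> 1" for w by (simp add: D_def)
    show "?E lam \<in> sets (Pr lam)"
      if "0 < lam" "lam < 1" for lam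
    proof -
      have "0 \<le> t * ln (1 / lam)" using that t32 by simp
      from cluster_event[OF that this, of "{ennreal (B / (lam * ln (1 / lam)))..}"] show ?thesis
        by (simp only: atLeast_iff closed_atLeast borel_closed simp_thms)
    qed
  next
    fix q assume q: "\<delta> \<le> q"
    show "\<forall>\<^sub>F w in sequentially. on_tame \<delta> {} (D w) t w q (\<lambda>lam \<omega> f. \<omega> \<in> ?E lam \<longleftrightarrow> macro_config w (q * (8 * w)) (?P w) B f)"
      using wB eventually_ge_at_top[of 8]
    proof eventually_elim
      case (elim w)
      show ?case unfolding on_tame_def
      proof (intro allI impI)
        fix lam \<omega> f assume x: "0 < lam" "lam < 1" "\<omega> \<in> space (Pr lam)" "tame_at \<delta> {} (D w) t w q lam \<omega> f"
        have "ennreal (B * real (8 * w) / site_step (8 * w) lam) \<le> ?S lam \<omega> \<longleftrightarrow> macro_config w (q * (8 * w)) (?P w) B f"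
          by (rule tame_realization.macro_event_iff[OF x(4)[unfolded tame_at_def]]) (use elim(1) in \<open>simp_all add: D_def\<close>)
        then show "\<omega> \<in> ?E lam \<longleftrightarrow> macro_config w (q * (8 * w)) (?P w) B f"
          using x(3) unfolding \<eta>E[OF x(1,2) elim(2)] by (simp only: mem_Collect_eq simp_thms)
      qed
    qed
    show "\<forall>\<^sub>F w in sequentially. on_tame \<delta> {} (D w) t w q (\<lambda>lam \<omega> f. \<omega> \<in> ?E lam \<longrightarrow> empty_half w (?P w) (k w) f)"
      using wB eventually_ge_at_top[of 8]
    proof eventually_elim
      case (elim w)
      show ?case unfolding on_tame_def
      proof (intro allI impI)
        fix lam \<omega> f assume x: "0 < lam" "lam < 1" "tame_at \<delta> {} (D w) t w q lam \<omega> f" "\<omega> \<in> ?E lam"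
        have "ennreal (B * real (8 * w) / site_step (8 * w) lam) \<le> ?S lam \<omega>"
          using x(4) unfolding \<eta>E[OF x(1,2) elim(2)] by (simp only: mem_Collect_eq)
        moreover have "1 \<le> w" using elim(2) by simp
        note k[OF q elim(1) this]
        ultimately show "empty_half w (?P w) (k w) f"
          by (intro tame_realization.macro_event_upper[OF x(3)[unfolded tame_at_def]]) blast+
      qed
    qed
    show "\<forall>\<^sub>F w in sequentially. on_tame \<delta> {} (D w) t w q (\<lambda>lam \<omega> f. enclosed w (?P w) (l w) 5 {} f \<longrightarrow> \<omega> \<in> ?E lam)"
      using eventually_ge_at_top[of 8]
    proof eventually_elim
      case (elim w)
      show ?case unfolding on_tame_def
      proof (intro allI impI)
        fix lam \<omega> f assume x: "0 < lam" "lam < 1" "\<omega> \<in> space (Pr lam)" "tame_at \<delta> {} (D w) t w q lam \<omega> f" "enclosed w (?P w) (l w) 5 {} f"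
        have "2 * w * 5 \<le> ?P w" using last_row_ge[OF t32, of w] elim by linarith
        then have "ennreal (B * real (8 * w) / site_step (8 * w) lam) \<le> ?S lam \<omega>"
          using l[OF q elim] by (intro tame_realization.macro_event_lower[OF x(4)[unfolded tame_at_def] x(5)]) blast+
        then show "\<omega> \<in> ?E lam" using x(3) unfolding \<eta>E[OF x(1,2) elim] by (simp only: mem_Collect_eq simp_thms)
      qed
    qed
    show "\<forall>\<^sub>F w in sequentially. config_prob t w q (empty_half w (?P w) (k w)) \<le> 2 * exp (- ((B * 4 - 3 / real w) * (4 - 4 / real w) / 64))"
      using wB eventually_ge_at_top[of 8]
    proof eventually_elim
      case (elim w)
      have w: "1 \<le> w" using elim by simp
      note kw = k[OF q elim(1) w]
      have "config_prob t w q (empty_half w (?P w) (k w)) \<le> 2 * exp (- (real_of_int (k w) * (4 * real w - 4) / (real (8 * w))\<^sup>2))"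
        by (rule empty_half_prob) (use kw last_row_ge[OF t32, of w] elim in auto)
      also have "\<dots> \<le> 2 * exp (- ((B * (4 * real w) - 3) * (4 * real w - 4) / (real (8 * w))\<^sup>2))"
        using kw elim by (simp add: divide_right_mono mult_right_mono)
      also have "(B * (4 * real w) - 3) * (4 * real w - 4) / (real (8 * w))\<^sup>2 = (B * 4 - 3 / real w) * (4 - 4 / real w) / 64"
        using elim by (simp add: field_simps power2_eq_square)
      finally show ?case .
    qed
    show "\<forall>\<^sub>F w in sequentially. hit_prob ^ 10 * exp (- (2 * (B * 4 + 2 / real w + 40) * (9 + 1 / real w) / 64)) \<le>
      config_prob t w q (enclosed w (?P w) (l w) 5 {})"
      using eventually_ge_at_top[of 8]
    proof eventually_elim
      case (elim w)
      note lw = l[OF q elim]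
      have P: "2 * w * 5 \<le> ?P w" "(2 * 5 - 1) * w \<le> ?P w" using last_row_ge[OF t32, of w] elim by simp_all
      have "real (card (inner_zone w (?P w) (l w) 5)) = 2 * (real_of_int (l w) + real 5 * real (8 * w)) * (real ((2 * 5 - 1) * w) + 1)"
        by (rule inner_zone_card[OF _ P(2)]) (use lw in blast)
      also have "\<dots> \<le> 2 * ((B * (4 * real w) + 2) + real 5 * real (8 * w)) * (real ((2 * 5 - 1) * w) + 1)"
        using lw by (intro mult_right_mono mult_left_mono add_right_mono) auto
      finally have "real (card (inner_zone w (?P w) (l w) 5)) / (real (8 * w))\<^sup>2 \<le>
          2 * ((B * (4 * real w) + 2) + real 5 * real (8 * w)) * (real ((2 * 5 - 1) * w) + 1) / (real (8 * w))\<^sup>2"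
        by (rule divide_right_mono) simp
      also have "\<dots> = 2 * (B * 4 + 2 / real w + 40) * (9 + 1 / real w) / 64"
        using elim by (simp add: field_simps power2_eq_square)
      finally have z: "real (card (inner_zone w (?P w) (l w) 5)) / (real (8 * w))\<^sup>2 \<le> 2 * (B * 4 + 2 / real w + 40) * (9 + 1 / real w) / 64" .
      have "hit_prob ^ 10 * exp (- (2 * (B * 4 + 2 / real w + 40) * (9 + 1 / real w) / 64)) \<le>
          hit_prob ^ (2 * 5) * exp (- (real (card (inner_zone w (?P w) (l w) 5)) / (real (8 * w))\<^sup>2)) * mark_prob (8 * w) ^ card ({} :: (int \<times> nat) set)"
        using z by simp
      also have "\<dots> \<le> cell_prob (8 * w) (q * (8 * w)) (?P w) {f. enclosed w (?P w) (l w) 5 {} f \<and> (\<forall>x\<in>{}. f x)}"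
        by (rule enclosed_prob) (use lw P elim in auto)
      finally show ?case by simp
    qed
  next
    have i: "(\<lambda>w. x / real w) \<longlonglongrightarrow> 0" for x by (rule lim_const_over_n)
    \<comment> \<open>About \<open>4 * B * w\<close> columns times \<open>4 * w\<close> rows,
      divided by \<open>(8 * w) ^ 2\<close>, give \<open>B / 4\<close>.\<close>
    have "(\<lambda>w. 2 * exp (- ((B * 4 - 3 / real w) * (4 - 4 / real w) / 64))) \<longlonglongrightarrow> 2 * exp (- ((B * 4 - 0) * (4 - 0) / 64))"
      by (intro tendsto_intros i) simp
    moreover have "(B * 4 - 0) * (4 - 0) / 64 = B / 4" by simp
    ultimately show "(\<lambda>w. 2 * exp (- ((B * 4 - 3 / real w) * (4 - 4 / real w) / 64))) \<longlonglongrightarrow> 2 * exp (- (B / 4))" by (simp only:)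
    \<comment> \<open>The zone has about \<open>2 * (4 * B + 40) * w\<close> columns and
      \<open>9 * w\<close> rows; divided by \<open>(8 * w) ^ 2\<close> this is
      \<open>9 / 8 * (B + 10)\<close>.\<close>
    have "(\<lambda>w. hit_prob ^ 10 * exp (- (2 * (B * 4 + 2 / real w + 40) * (9 + 1 / real w) / 64))) \<longlonglongrightarrow>
        hit_prob ^ 10 * exp (- (2 * (B * 4 + 0 + 40) * (9 + 0) / 64))"
      by (intro tendsto_intros i) simp
    moreover have "2 * (B * 4 + 0 + 40) * (9 + 0) / 64 = 9 / 8 * (B + 10)" by simp
    ultimately show "(\<lambda>w. hit_prob ^ 10 * exp (- (2 * (B * 4 + 2 / real w + 40) * (9 + 1 / real w) / 64))) \<longlonglongrightarrow>
        hit_prob ^ 10 * exp (- ((9 / 8) * (B + 10)))" by (simp only:)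
  qed
qed

lemma micro_limit:
  assumes t52: "5 / 2 \<le> t" and ab: "0 \<le> a" "a < b" "b < 1"
  shows "\<exists>L. ((\<lambda>lam. measure (Pr lam) {\<omega> \<in> space (Pr lam).
      numel (cluster (\<lambda>i. \<eta> lam (t * ln (1 / lam)) i \<omega>) 0) \<in> {ennreal (lam powr (- a))..ennreal (lam powr (- b))}}) \<longlongrightarrow> L) (at_right 0) \<and>
    hit_prob ^ 18 * exp (- 45) * ((b - a) / 2) \<le> L \<and> L \<le> 16 * (b - a)"
proof -
  define A where "A w = {real (last_row t (8 * w)) - a * real (8 * w), real (last_row t (8 * w)) - b * real (8 * w)}" for w :: nat
  let ?P = "\<lambda>w. last_row t (8 * w)"
  let ?S = "\<lambda>lam \<omega>. numel (cluster (\<lambda>i. \<eta> lam (t * ln (1 / lam)) i \<omega>) 0)"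
  let ?U = "\<lambda>w q f. \<exists>s\<in>window_rows w (?P w) a b. \<exists>k<q * (8 * w). exposed w (q * (8 * w)) (?P w) f k s"
  let ?V = "\<lambda>w q f. \<exists>s\<in>window_rows w (?P w) a b. \<exists>c\<in>{- int (8 * w)<..<int (8 * w)}. enclosed w (?P w) (int (8 * w)) 9 {(c, s)} f \<and> f (c, s)"
  let ?E = "\<lambda>lam. {\<omega> \<in> space (Pr lam). ?S lam \<omega> \<in> {ennreal (lam powr (- a))..ennreal (lam powr (- b))}}"
  have t32: "3 / 2 \<le> t" using t52 by simp
  have wb: "\<forall>\<^sub>F w in sequentially. b * real (8 * w) + 1 < real (8 * w)" using ab by real_asymp
  have AP: "real (?P w) - a * real (8 * w) \<in> A w" "real (?P w) - b * real (8 * w) \<in> A w" for w by (auto simp: A_def)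
  have th: "{ennreal (exp (a * real (8 * w) * grid_step (8 * w) lam))..ennreal (exp (b * real (8 * w) * grid_step (8 * w) lam))} =
      {ennreal (lam powr (- a))..ennreal (lam powr (- b))}" if "0 < lam" "lam < 1" "8 \<le> w" for lam w
    using micro_threshold[of lam w] that by simp
  show ?thesis
  \<comment> \<open>Ten strips of \<open>8 * w\<close> columns on each side: one for the fire that
    burns the origin and nine for the links.\<close>
  proof (rule limit_between[OF t32, where \<delta>=10 and A=A and D="\<lambda>_. {}"
        and E="?E" and C="\<lambda>w q. micro_config w (q * (8 * w)) (?P w) a b"
        and U="?U"
        and V="?V"
        and g="\<lambda>w. 16 * (b - a) + 2 / real w"
        and h="\<lambda>w. hit_prob ^ 18 * exp (- 45) * ((b - a) / 2 - 1 / real w)"])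
    show "finite (A w) \<and> card (A w) \<le> 2 \<and> finite ({} :: real set) \<and> card ({} :: real set) \<le> 1" for w by (simp add: A_def card_insert_if)
    show "?E lam \<in> sets (Pr lam)" if "0 < lam" "lam < 1" for lam
      using that t52 by (intro cluster_event) auto
  next
    fix q :: nat assume q: "10 \<le> q"
    have size: "?S lam \<omega> \<in> {ennreal (exp (a * real (8 * w) * grid_step (8 * w) lam))..ennreal (exp (b * real (8 * w) * grid_step (8 * w) lam))} \<longleftrightarrow> \<omega> \<in> ?E lam"
      if "0 < lam" "lam < 1" "\<omega> \<in> space (Pr lam)" "8 \<le> w" for lam \<omega> w
      unfolding th[OF that(1,2,4)] using that(3) by (simp only: mem_Collect_eq simp_thms)
    show "\<forall>\<^sub>F w in sequentially. on_tame 10 (A w) {} t w q (\<lambda>lam \<omega> f. \<omega> \<in> ?E lam \<longleftrightarrow> micro_config w (q * (8 * w)) (?P w) a b f)"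
      using wb eventually_ge_at_top[of 8]
    proof eventually_elim
      case (elim w)
      show ?case unfolding on_tame_def
      proof (intro allI impI)
        fix lam \<omega> f assume x: "0 < lam" "lam < 1" "\<omega> \<in> space (Pr lam)" "tame_at 10 (A w) {} t w q lam \<omega> f"
        show "\<omega> \<in> ?E lam \<longleftrightarrow> micro_config w (q * (8 * w)) (?P w) a b f"
          unfolding size[OF x(1-3) elim(2), symmetric]
          by (rule tame_realization.micro_event_iff[OF x(4)[unfolded tame_at_def] ab(1,2) elim(1) AP])
      qed
    qed
    show "\<forall>\<^sub>F w in sequentially. on_tame 10 (A w) {} t w q (\<lambda>lam \<omega> f. \<omega> \<in> ?E lam \<longrightarrow>
      ?U w q f)"
      using wb eventually_ge_at_top[of 8]
    proof eventually_elim
      case (elim w)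
      show ?case unfolding on_tame_def
      proof (intro allI impI)
        fix lam \<omega> f assume x: "0 < lam" "lam < 1" "\<omega> \<in> space (Pr lam)" "tame_at 10 (A w) {} t w q lam \<omega> f" "\<omega> \<in> ?E lam"
        show "?U w q f"
          by (rule tame_realization.micro_event_upper[OF x(4)[unfolded tame_at_def] x(5)[folded size[OF x(1-3) elim(2)]] ab(1,2) elim(1) AP])
      qed
    qed
    show "\<forall>\<^sub>F w in sequentially. on_tame 10 (A w) {} t w q (\<lambda>lam \<omega> f.
      ?V w q f \<longrightarrow> \<omega> \<in> ?E lam)"
      using wb eventually_ge_at_top[of 8]
    proof eventually_elim
      case (elim w)
      show ?case unfolding on_tame_def
      proof (intro allI impI, elim bexE conjE)
        fix lam \<omega> f s c assume x: "0 < lam" "lam < 1" "\<omega> \<in> space (Pr lam)" "tame_at 10 (A w) {} t w q lam \<omega> f"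
          and cs: "s \<in> window_rows w (?P w) a b" "c \<in> {- int (8 * w)<..<int (8 * w)}" "enclosed w (?P w) (int (8 * w)) 9 {(c, s)} f" "f (c, s)"
        have Q: "10 * (8 * w) \<le> q * (8 * w)" using q by (rule mult_le_mono1)
        show "\<omega> \<in> ?E lam" unfolding size[OF x(1-3) elim(2), symmetric]
        proof (rule tame_realization.micro_event_lower[OF x(4)[unfolded tame_at_def] cs(3,4) _ _ cs(1) _ _ _ _ ab(1,2) elim(1) AP])
          show "- int (8 * w) < c" "c < int (8 * w)" using cs(2) by auto
          show "0 < int (8 * w)" "int (8 * w) \<le> int (10 * (8 * w))" using elim(2) by auto
          show "int (8 * w) + int (9 * (8 * w)) \<le> int (q * (8 * w))" using Q by linarith
          show "2 * w * 9 \<le> ?P w" using last_row_ge'[OF t52, of w] elim(2) by linarith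
        qed
      qed
    qed
    show "\<forall>\<^sub>F w in sequentially. config_prob t w q (?U w q) \<le>
      16 * (b - a) + 2 / real w"
      using eventually_ge_at_top[of 8]
    proof eventually_elim
      case (elim w)
      show ?case
        by (rule window_exposed_prob) (use ab elim last_row_ge'[OF t52, of w] in auto)
    qed
    show "\<forall>\<^sub>F w in sequentially. hit_prob ^ 18 * exp (- 45) * ((b - a) / 2 - 1 / real w) \<le>
      config_prob t w q (?V w q)"
      using eventually_ge_at_top[of 8]
    proof eventually_elim
      case (elim w)
      show ?case
      proof (rule window_enclosed_prob)
        show "10 * (8 * w) \<le> q * (8 * w)" using q by (rule mult_le_mono1)
      qed (use ab elim last_row_ge'[OF t52, of w] in auto)
    qed
  next
    have i: "(\<lambda>w. 1 / real w) \<longlonglongrightarrow> 0" by (rule lim_1_over_n)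
    have "(\<lambda>w. 16 * (b - a) + 2 * (1 / real w)) \<longlonglongrightarrow> 16 * (b - a) + 2 * 0" by (intro tendsto_intros i)
    then show "(\<lambda>w. 16 * (b - a) + 2 / real w) \<longlonglongrightarrow> 16 * (b - a)" by simp
    have "(\<lambda>w. hit_prob ^ 18 * exp (- 45) * ((b - a) / 2 - 1 / real w)) \<longlonglongrightarrow> hit_prob ^ 18 * exp (- 45) * ((b - a) / 2 - 0)"
      by (intro tendsto_intros i) simp
    then show "(\<lambda>w. hit_prob ^ 18 * exp (- 45) * ((b - a) / 2 - 1 / real w)) \<longlonglongrightarrow> hit_prob ^ 18 * exp (- 45) * ((b - a) / 2)"
      by simp
  qed simp
qed

end

theorem corollary6:
  fixes P :: "real \<Rightarrow> 'a measure"
    and N M \<eta> :: "real \<Rightarrow> real \<Rightarrow> int \<Rightarrow> 'a \<Rightarrow> nat"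
  assumes ffp: "\<And>lam. 0 < lam \<Longrightarrow> lam < 1 \<Longrightarrow>
    forest_fire_process lam (P lam) (N lam) (M lam) (\<eta> lam)"
  shows
    "(\<exists>c C :: real. 0 < c \<and> c < C \<and>
       (\<forall>t a b :: real. 5 / 2 \<le> t \<and> 0 \<le> a \<and> a < b \<and> b < 1 \<longrightarrow>
         (\<exists>L. ((\<lambda>lam. measure (P lam) {\<omega> \<in> space (P lam).
                  numel (cluster (\<lambda>i. \<eta> lam (t * ln (1 / lam)) i \<omega>) 0)
                    \<in> {ennreal (lam powr (- a)) .. ennreal (lam powr (- b))}})
                \<longlongrightarrow> L) (at_right 0) \<and>
              c * (b - a) \<le> L \<and> L \<le> C * (b - a))))
     \<and>
     (\<exists>c C \<kappa>\<^sub>1 \<kappa>\<^sub>2 :: real. 0 < c \<and> c < C \<and> 0 < \<kappa>\<^sub>1 \<and> \<kappa>\<^sub>1 < \<kappa>\<^sub>2 \<and>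
       (\<forall>t B :: real. 3 / 2 \<le> t \<and> 0 < B \<longrightarrow>
         (\<exists>L. ((\<lambda>lam. measure (P lam) {\<omega> \<in> space (P lam).
                  ennreal (B / (lam * ln (1 / lam)))
                    \<le> numel (cluster (\<lambda>i. \<eta> lam (t * ln (1 / lam)) i \<omega>) 0)})
                \<longlongrightarrow> L) (at_right 0) \<and>
              c * exp (- \<kappa>\<^sub>2 * B) \<le> L \<and> L \<le> C * exp (- \<kappa>\<^sub>1 * B))))"
proof -
  interpret ffp_family P N M \<eta> by standard (rule ffp)
  have e: "0 < hit_prob" "hit_prob < 1" by auto
  define c where "c = hit_prob ^ 18 * exp (- 45) / 2"
  \<comment> \<open>45 / 4 is the part of \<open>9 / 8 * (B + 10)\<close> that does not depend on
    \<open>B\<close>.\<close>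
  define c' where "c' = hit_prob ^ 10 * exp (- (45 / 4))"
  have "hit_prob ^ 18 * exp (- 45) \<le> 1 * 1" "hit_prob ^ 10 * exp (- (45 / 4)) \<le> 1 * 1"
    using e by (intro mult_mono power_le_one; simp)+
  then have c: "0 < c" "c < 16" "0 < c'" "c' < 2" using e by (auto simp: c_def c'_def)
  show ?thesis
  proof (rule conjI;
      ((rule exI[of _ c], rule exI[of _ 16], rule conjI[OF c(1)], rule conjI[OF c(2)], intro allI impI) |
      (rule exI[of _ c'], rule exI[of _ 2], rule exI[of _ "1 / 4"], rule exI[of _ "9 / 8"], rule conjI[OF c(3)], rule conjI[OF c(4)])))
    fix t a b :: real assume tab: "5 / 2 \<le> t \<and> 0 \<le> a \<and> a < b \<and> b < 1"
    have "hit_prob ^ 18 * exp (- 45) * ((b - a) / 2) = c * (b - a)" by (simp add: c_def)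
    with micro_limit[of t a b] tab show "\<exists>L. ((\<lambda>lam. measure (P lam) {\<omega> \<in> space (P lam). numel (cluster (\<lambda>i. \<eta> lam (t * ln (1 / lam)) i \<omega>) 0)
        \<in> {ennreal (lam powr (- a)) .. ennreal (lam powr (- b))}}) \<longlongrightarrow> L) (at_right 0) \<and> c * (b - a) \<le> L \<and> L \<le> 16 * (b - a)"
      by (simp only: simp_thms)
  next
    have X: "\<exists>L. ((\<lambda>lam. measure (P lam) {\<omega> \<in> space (P lam). ennreal (B / (lam * ln (1 / lam)))
        \<le> numel (cluster (\<lambda>i. \<eta> lam (t * ln (1 / lam)) i \<omega>) 0)}) \<longlongrightarrow> L) (at_right 0) \<and> c' * exp (- (9 / 8) * B) \<le> L \<and> L \<le> 2 * exp (- (1 / 4) * B)"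
      if "3 / 2 \<le> t \<and> 0 < B" for t B :: real
    proof -
      have eq1: "hit_prob ^ 10 * exp (- ((9 / 8) * (B + 10))) = c' * exp (- (9 / 8) * B)"
        by (simp add: c'_def algebra_simps flip: exp_add)
      have eq2: "2 * exp (- (B / 4)) = 2 * exp (- (1 / 4) * B)" by simp
      show ?thesis using macro_limit[of t B] that unfolding eq1 eq2 by blast
    qed
    show "0 < (1 / 4 :: real) \<and> 1 / 4 < (9 / 8 :: real) \<and> (\<forall>t B :: real. 3 / 2 \<le> t \<and> 0 < B \<longrightarrow>
        (\<exists>L. ((\<lambda>lam. measure (P lam) {\<omega> \<in> space (P lam). ennreal (B / (lam * ln (1 / lam)))
        \<le> numel (cluster (\<lambda>i. \<eta> lam (t * ln (1 / lam)) i \<omega>) 0)}) \<longlongrightarrow> L) (at_right 0) \<and> c' * exp (- (9 / 8) * B) \<le> L \<and> L \<le> 2 * exp (- (1 / 4) * B)))"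
      by (intro conjI allI impI X) simp_all
  qed
qed

end
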